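(* Let $d\ge 3$. There exist a number $\eta(d)>0$ and a constant $C_d>0$, depending only on $d$, such that for every integer $n\ge 1$ and every choice of real coefficients $\alpha(R)$, indexed by the dyadic rectangles $R\subset[0,1]^d$ with $|R|\ge 2^{-n}$, $$ 2^{-n}\sum_{|R|=2^{-n}}|\alpha(R)|\;\le\; C_d\, n^{\frac{d-1}{2}-\eta(d)}\,\Bigl\|\sum_{|R|\ge 2^{-n}}\alpha(R)\,h_R\Bigr\|_{\infty},$$ where both sums range over dyadic rectangles $R\subset[0,1]^d$ and $\|\cdot\|_\infty$ is the $L^\infty([0,1]^d)$ norm.
   Context: Dyadic intervals are the intervals $[j2^k,(j+1)2^k)$, $j,k\in\mathbb Z$. For a dyadic interval $I$ with left and right halves $I_{\rm left}, I_{\rm right}$, the $L^\infty$-normalized Haar function is $h_I=-\mathbf 1_{I_{\rm left}}+\mathbf 1_{I_{\rm right}}$. A dyadic rectangle in dimension $d$ is a product $R=R_1\times\cdots\times R_d$ of dyadic intervals, $|R|$ is its volume, and $h_R(x_1,\dots,x_d)=\prod_{j=1}^d h_{R_j}(x_j)$. All rectangles considered are contained in the unit cube $[0,1]^d$ (half-open rectangles, contained in $[0,1)^d$). *)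

theory Defs
  imports "HOL-Probability.Essential_Supremum"
begin

definition dyadic_interval :: "real set \<Rightarrow> bool" where
  "dyadic_interval I \<longleftrightarrow>
     (\<exists>j k :: int. I = {real_of_int j * 2 powi k ..< (real_of_int j + 1) * 2 powi k})"

definition left_half :: "real set \<Rightarrow> real set" where
  "left_half I = {x \<in> I. x < (Inf I + Sup I) / 2}"

definition right_half :: "real set \<Rightarrow> real set" where
  "right_half I = {x \<in> I. (Inf I + Sup I) / 2 \<le> x}"

definition haar :: "real set \<Rightarrow> real \<Rightarrow> real" where
  "haar I x = - indicator (left_half I) x + indicator (right_half I) x"

text \<open>A point of \<open>d\<close>-dimensional space is a function on the coordinates \<open>{..<d}\<close>. A rectangle
  \<open>R 0 \<times> \<dots> \<times> R (d - 1)\<close> is represented by the tuple \<open>R\<close> of its sides; since the sides are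
  nonempty, they are determined by their product, so tuples and rectangles correspond one to one.\<close>

definition dyadic_rectangles :: "nat \<Rightarrow> (nat \<Rightarrow> real set) set" where
  "dyadic_rectangles d = {..<d} \<rightarrow>\<^sub>E {I. dyadic_interval I \<and> I \<subseteq> {0..<1}}"

definition rect_volume :: "nat \<Rightarrow> (nat \<Rightarrow> real set) \<Rightarrow> real" where
  "rect_volume d R = (\<Prod>j<d. measure lborel (R j))"

definition haar_rect :: "nat \<Rightarrow> (nat \<Rightarrow> real set) \<Rightarrow> (nat \<Rightarrow> real) \<Rightarrow> real" where
  "haar_rect d R x = (\<Prod>j<d. haar (R j) (x j))"

definition unit_cube :: "nat \<Rightarrow> (nat \<Rightarrow> real) measure" where
  "unit_cube d = (\<Pi>\<^sub>M j\<in>{..<d}. restrict_space lborel {0..1})"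

text \<open>Meaningful for essentially bounded measurable \<open>f\<close>; the essential supremum is
  \<open>\<infinity>\<close>, hence the value below 0, for all other \<open>f\<close>.\<close>

definition Linf_norm :: "'a measure \<Rightarrow> ('a \<Rightarrow> real) \<Rightarrow> real" where
  "Linf_norm M f = real_of_ereal (esssup M (\<lambda>x. ereal \<bar>f x\<bar>))"

end

theory Submission
  imports Defs
begin

text \<open>
  Through the binary digits of its coordinates, a point of the cube becomes a random set \<open>w\<close> of pairs
  (coordinate, digit). The part \<open>h v\<close> of the Haar sum \<open>H\<close> with side lengths \<open>2 powi - v j\<close> changes its sign
  when the digit \<open>v j\<close> of the coordinate \<open>j\<close> is flipped, and does not depend on later digits. The
  left-hand side is at most the sum of the means of \<open>\<bar>h r\<bar>\<close> over all \<open>r\<close> with \<open>\<Sum>j. r j = n\<close>. Put \<open>f r = sgn (h r)\<close>.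

  The duality argument tests \<open>H\<close> against a short Riesz product \<open>\<Prod>t. 1 + \<rho> * F t\<close>, where \<open>F t\<close> is the sum of \<open>f r\<close>
  over the \<open>r\<close> with \<open>r 0\<close> in the \<open>t\<close>-th slab of the first coordinate and \<open>\<rho>\<close> is
  \<open>n powr (- (d - 1) / 2 + \<eta>)\<close>. Each \<open>F t\<close> is stopped as a martingale in the first coordinate, so that the product is
  positive with mean exactly 1, and the test is bounded by the supremum of \<open>\<bar>H\<bar>\<close>. By the martingale tail bound
  the stopping matters only on a set of superpolynomially small probability, where crude bounds suffice.

  To evaluate the test from below, the other coordinates are cut into blocks and the product is
  telescoped over the blocks of one coordinate after the other. Terms in which two factors share a block are
  negligible by Beck's gain: the sum of \<open>f r * f s\<close> over pairs with a coincidence in one coordinate is smaller by a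
  power of \<open>n\<close> than square root cancellation predicts. In the end every coordinate has a top block owned by
  one factor, and orthogonality leaves exactly \<open>\<rho>\<close> times the sum of the means of \<open>\<bar>h r\<bar>\<close>.
\<close>

section \<open>Functions of random signs\<close>

text \<open>For \<open>d = 2\<close> a full Riesz product works: two different indices with the same
  sum differ in both coordinates, so the product of their r-functions is odd in a digit of each
  coordinate. From \<open>d = 3\<close> on, different indices may share a coordinate, and there the
  oddness is lost; these coincidences are the obstacle that shapes the proof. Since the factors live
  in disjoint slabs of the first coordinate, coincidences between factors can occur only in the
  other coordinates. The available gain is a small power of \<open>n\<close>, so every parameter is
  a power of one quantity \<open>z = (n + 1) powr \<eta>\<close>. With
  \<open>\<rho> = z / sqrt ((n + 1) ^ (d - 1))\<close> the test shows that \<open>\<rho>\<close>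
  times the mass is at most 2, and the factor \<open>z\<close> is the improvement over the exponent
  \<open>(d - 1) / 2\<close>. There are about \<open>z ^ 8\<close> slabs, so a scaled factor has
  typical size \<open>z / z ^ 4\<close>; deviations by the factor \<open>z\<^sup>2\<close> still
  leave \<open>1 / z\<close>, which makes positivity possible. Unstopped factors can be negative on
  rare events, and truncating the product there would spoil its mean and the orthogonality; stopping
  preserves both.\<close>

definition avg :: "'a set \<Rightarrow> ('a set \<Rightarrow> real) \<Rightarrow> real" where
  "avg D X = (\<Sum>w\<in>Pow D. X w) / 2 ^ card D"

definition flip :: "'a \<Rightarrow> 'a set \<Rightarrow> 'a set" where
  "flip a w = (if a \<in> w then w - {a} else insert a w)"

definition odd_at :: "'a \<Rightarrow> ('a set \<Rightarrow> real) \<Rightarrow> bool" where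
  "odd_at a X \<longleftrightarrow> (\<forall>w. X (flip a w) = - X w)"

definition inv_at :: "'a \<Rightarrow> ('a set \<Rightarrow> 'b) \<Rightarrow> bool" where
  "inv_at a X \<longleftrightarrow> (\<forall>w. X (flip a w) = X w)"

lemma flip_flip [simp]: "flip a (flip a w) = w"
  by (auto simp: flip_def)

lemma flip_Pow: "a \<in> D \<Longrightarrow> w \<subseteq> D \<Longrightarrow> flip a w \<subseteq> D"
  by (auto simp: flip_def)

lemma avg_add: "avg D (\<lambda>w. X w + Y w) = avg D X + avg D Y"
  by (simp add: avg_def sum.distrib add_divide_distrib)

lemma avg_diff: "avg D (\<lambda>w. X w - Y w) = avg D X - avg D Y"
  by (simp add: avg_def sum_subtractf diff_divide_distrib)

lemma avg_cmult: "avg D (\<lambda>w. c * X w) = c * avg D X"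
  by (simp add: avg_def sum_distrib_left)

lemma avg_cmult_right: "avg D (\<lambda>w. X w * c) = avg D X * c"
  by (simp add: avg_def sum_distrib_right)

lemma avg_sum: "avg D (\<lambda>w. \<Sum>i\<in>I. X i w) = (\<Sum>i\<in>I. avg D (X i))"
  unfolding avg_def by (subst sum.swap) (simp add: sum_divide_distrib)

lemma avg_mono: "(\<And>w. w \<subseteq> D \<Longrightarrow> X w \<le> Y w) \<Longrightarrow> avg D X \<le> avg D Y"
  unfolding avg_def by (intro divide_right_mono sum_mono) auto

lemma avg_cong: "(\<And>w. w \<subseteq> D \<Longrightarrow> X w = Y w) \<Longrightarrow> avg D X = avg D Y"
  unfolding avg_def by (intro arg_cong2[where f = "(/)"] sum.cong) auto

lemma avg_nonneg: "(\<And>w. w \<subseteq> D \<Longrightarrow> 0 \<le> X w) \<Longrightarrow> 0 \<le> avg D X"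
  unfolding avg_def by (intro divide_nonneg_nonneg sum_nonneg) auto

lemma avg_const: "finite D \<Longrightarrow> avg D (\<lambda>_. c) = c"
  by (simp add: avg_def card_Pow)

lemma avg_abs: "\<bar>avg D X\<bar> \<le> avg D (\<lambda>w. \<bar>X w\<bar>)"
  using divide_right_mono[OF sum_abs[of X "Pow D"], of "2 ^ card D"] by (simp add: avg_def abs_divide)

lemma avg_flip: "a \<in> D \<Longrightarrow> avg D (\<lambda>w. X (flip a w)) = avg D X"
  unfolding avg_def
  using sum.reindex_bij_witness[of "Pow D" "flip a" "flip a" "Pow D" X "\<lambda>w. X (flip a w)"] flip_Pow[of a D]
  by simp

lemma avg_odd: "a \<in> D \<Longrightarrow> odd_at a X \<Longrightarrow> avg D X = 0"
  using avg_flip[of a D X] avg_cmult[of D "-1" X] by (simp add: odd_at_def)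

lemma odd_mult_inv: "odd_at a X \<Longrightarrow> inv_at a Y \<Longrightarrow> odd_at a (\<lambda>w. X w * Y w)"
  and inv_mult_odd: "inv_at a Y \<Longrightarrow> odd_at a X \<Longrightarrow> odd_at a (\<lambda>w. Y w * X w)"
  by (auto simp: odd_at_def inv_at_def)

lemma odd_sum: "(\<And>i. i \<in> I \<Longrightarrow> odd_at a (X i)) \<Longrightarrow> odd_at a (\<lambda>w. \<Sum>i\<in>I. X i w)"
  by (auto simp: odd_at_def sum_negf)

lemma inv_sum: "(\<And>i. i \<in> I \<Longrightarrow> inv_at a (X i)) \<Longrightarrow> inv_at a (\<lambda>w. \<Sum>i\<in>I. X i w)"
  by (auto simp: inv_at_def intro!: sum.cong)

lemma inv_prod: "(\<And>i. i \<in> I \<Longrightarrow> inv_at a (X i)) \<Longrightarrow> inv_at a (\<lambda>w. \<Prod>i\<in>I. X i w :: real)"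
  by (auto simp: inv_at_def intro!: prod.cong)

lemma inv_comp1: "inv_at a X \<Longrightarrow> inv_at a (\<lambda>w. g (X w))"
  and inv_comp2: "inv_at a X \<Longrightarrow> inv_at a Y \<Longrightarrow> inv_at a (\<lambda>w. g2 (X w) (Y w))"
  and inv_const: "inv_at a (\<lambda>w. c)"
  by (auto simp: inv_at_def)

lemma inv_flip_set:
  assumes "finite S" "\<And>a. a \<in> S \<Longrightarrow> inv_at a Y"
  shows "Y ((w - S) \<union> (S - w)) = Y w"
  using assms
proof (induction S rule: finite_induct)
  case (insert a S)
  have "(w - insert a S) \<union> (insert a S - w) = flip a ((w - S) \<union> (S - w))"
    using insert.hyps by (auto simp: flip_def)
  then show ?case using insert by (simp add: inv_at_def)
qed auto

section \<open>Resampling and conditional expectation\<close>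

definition mix :: "'a set \<Rightarrow> 'a set \<Rightarrow> 'a set \<Rightarrow> 'a set" where
  "mix K w w' = (w \<inter> K) \<union> (w' - K)"

text \<open>The conditional expectation of \<open>X\<close> given the digits in \<open>K\<close>,
  realised by resampling all the others.\<close>

definition cex :: "'a set \<Rightarrow> 'a set \<Rightarrow> ('a set \<Rightarrow> real) \<Rightarrow> 'a set \<Rightarrow> real" where
  "cex D K X w = avg D (\<lambda>w'. X (mix K w w'))"

text \<open>Exchanging the parts outside \<open>K\<close> between two independent points is an
  involution of \<open>Pow D \<times> Pow D\<close>, so it preserves the mean.\<close>

lemma avg_mix:
  assumes "finite D"
  shows "avg D (\<lambda>w. avg D (\<lambda>w'. Z (mix K w w'))) = avg D Z"
proof -
  have "(\<Sum>w\<in>Pow D. \<Sum>w'\<in>Pow D. Z (mix K w w')) = (\<Sum>(w, w')\<in>Pow D \<times> Pow D. Z (mix K w w'))"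
    by (simp add: sum.cartesian_product)
  also have "\<dots> = (\<Sum>(w, w')\<in>Pow D \<times> Pow D. Z w)"
    by (rule sum.reindex_bij_witness[where i = "\<lambda>(w,w'). (mix K w w', mix K w' w)"
          and j = "\<lambda>(w,w'). (mix K w w', mix K w' w)"]) (auto simp: mix_def)
  also have "\<dots> = (\<Sum>w\<in>Pow D. \<Sum>w'\<in>Pow D. Z w)"
    unfolding sum.cartesian_product by simp
  also have "\<dots> = 2 ^ card D * (\<Sum>w\<in>Pow D. Z w)"
    using assms by (simp add: card_Pow sum_distrib_left[symmetric])
  finally show ?thesis
    by (simp add: avg_def flip: sum_divide_distrib)
qed

lemma inv_mix:
  assumes "finite D" "w \<subseteq> D" "w' \<subseteq> D" "\<And>a. a \<in> D - K \<Longrightarrow> inv_at a Y"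
  shows "Y (mix K w w') = Y w"
proof -
  define S where "S = (w - w' - K) \<union> (w' - w - K)"
  have "mix K w w' = (w - S) \<union> (S - w)" by (auto simp: S_def mix_def)
  moreover have "finite S" "S \<subseteq> D - K" using assms by (auto simp: S_def intro: finite_subset)
  ultimately show ?thesis using inv_flip_set[of S Y w] assms(4) by auto
qed

text \<open>The tower property: \<open>Y\<close> does not see the resampled digits, so it can be
  moved inside the resampling.\<close>

lemma avg_cex_mult:
  assumes "finite D" "\<And>a. a \<in> D - K \<Longrightarrow> inv_at a Y"
  shows "avg D (\<lambda>w. cex D K X w * Y w) = avg D (\<lambda>w. X w * Y w)"
proof -
  have "avg D (\<lambda>w. cex D K X w * Y w) = avg D (\<lambda>w. avg D (\<lambda>w'. X (mix K w w') * Y (mix K w w')))"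
    unfolding cex_def avg_cmult_right[symmetric]
    by (intro avg_cong arg_cong2[where f = "(*)"] refl inv_mix[OF assms(1), symmetric] assms(2)) auto
  also have "\<dots> = avg D (\<lambda>w. X w * Y w)"
    using avg_mix[OF assms(1), of "\<lambda>w. X w * Y w" K] by simp
  finally show ?thesis .
qed

lemma inv_cex: "a \<notin> K \<Longrightarrow> inv_at a (cex D K X)"
proof -
  assume "a \<notin> K"
  then have "mix K (flip a w) w' = mix K w w'" for w w' by (auto simp: mix_def flip_def)
  then show ?thesis by (simp add: inv_at_def cex_def)
qed

lemma cex_bound: "finite D \<Longrightarrow> (\<And>w. \<bar>X w\<bar> \<le> B) \<Longrightarrow> \<bar>cex D K X w\<bar> \<le> B"
  unfolding cex_def
  by (rule order_trans[OF avg_abs], rule order_trans[OF avg_mono[of _ _ "\<lambda>_. B"]])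
     (auto simp: avg_const)

section \<open>Gaussian tails for martingales of random signs\<close>

lemma cosh_le_exp_sq: "(exp x + exp (-x)) / 2 \<le> exp (x\<^sup>2 / 2)" for x :: real
proof -
  have s1: "(\<lambda>n. x ^ (2 * n) / fact (2 * n)) sums cosh x"
  proof -
    have "(\<lambda>n. if even n then x ^ n /\<^sub>R fact n else 0) sums cosh x" by (rule cosh_converges)
    then have "(\<lambda>n. (if even (2 * n) then x ^ (2 * n) /\<^sub>R fact (2 * n) else 0)) sums cosh x"
      by (subst sums_mono_reindex[of "\<lambda>n. 2 * n" "\<lambda>n. if even n then x ^ n /\<^sub>R fact n else 0"])
        (auto simp: strict_mono_def elim!: evenE)
    moreover have "y /\<^sub>R fact n = y / fact n" for y :: real and n by (simp add: field_simps)
    ultimately show ?thesis by simp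
  qed
  have s2: "(\<lambda>n. (x\<^sup>2 / 2) ^ n / fact n) sums exp (x\<^sup>2 / 2)"
  proof -
    have "y ^ n /\<^sub>R fact n = y ^ n / fact n" for y :: real and n by (simp add: field_simps)
    then show ?thesis using exp_converges[of "x\<^sup>2 / 2"] by simp
  qed
  \<comment> \<open>The two power series are compared term by term, by
    \<open>2 ^ n * fact n \<le> fact (2 * n)\<close>.\<close>
  have le: "x ^ (2 * n) / fact (2 * n) \<le> (x\<^sup>2 / 2) ^ n / fact n" for n
  proof -
    have "(2::nat) ^ n * fact n \<le> fact (2 * n)"
    proof (induction n)
      case (Suc n)
      have "(2::nat) ^ Suc n * fact (Suc n) = (2 * Suc n) * (2 ^ n * fact n)" by (simp add: algebra_simps)
      also have "\<dots> \<le> (2 * Suc n) * ((2 * n + 1) * fact (2 * n))"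
        by (intro mult_left_mono order_trans[OF Suc]) auto
      also have "\<dots> = fact (2 * Suc n)" by (simp add: algebra_simps)
      finally show ?case .
    qed simp
    then have "(2::real) ^ n * fact n \<le> fact (2 * n)"
      by (metis (mono_tags, lifting) of_nat_fact of_nat_le_iff of_nat_mult of_nat_numeral of_nat_power)
    then have "x ^ (2 * n) / fact (2 * n) \<le> x ^ (2 * n) / (2 ^ n * fact n)"
      by (intro divide_left_mono) auto
    also have "\<dots> = (x\<^sup>2 / 2) ^ n / fact n" by (simp add: power_divide power_mult)
    finally show ?thesis .
  qed
  have "cosh x \<le> exp (x\<^sup>2 / 2)" using sums_le[OF _ s1 s2] le by blast
  then show ?thesis by (simp add: cosh_def)
qed

text \<open>\<open>X y\<close> changes its sign with the digit \<open>a y\<close>, which all earlier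
  terms ignore, so the \<open>X y\<close> are conditionally symmetric martingale differences. The
  square of \<open>X y\<close> is even in that digit; therefore the actual squares can serve as
  compensator in place of conditional variances, and averaging over the flip leaves
  \<open>cosh u * exp (- u\<^sup>2 / 2) \<le> 1\<close>.\<close>

lemma exp_martingale:
  fixes X :: "nat \<Rightarrow> 'a set \<Rightarrow> real"
  assumes "finite D" "finite Y" "\<And>y. y \<in> Y \<Longrightarrow> a y \<in> D" "\<And>y. y \<in> Y \<Longrightarrow> odd_at (a y) (X y)"
    "\<And>y z. y \<in> Y \<Longrightarrow> z \<in> Y \<Longrightarrow> z < y \<Longrightarrow> inv_at (a y) (X z)"
  shows "avg D (\<lambda>w. exp (s * (\<Sum>y\<in>Y. X y w) - s\<^sup>2 / 2 * (\<Sum>y\<in>Y. (X y w)\<^sup>2))) \<le> 1"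
  using assms(2-)
proof (induction Y rule: finite_linorder_max_induct)
  case empty
  then show ?case using assms(1) by (simp add: avg_const)
next
  case (insert m Y)
  define Z where "Z w = exp (s * (\<Sum>y\<in>Y. X y w) - s\<^sup>2 / 2 * (\<Sum>y\<in>Y. (X y w)\<^sup>2))" for w
  define V where "V w = exp (s * X m w - s\<^sup>2 / 2 * (X m w)\<^sup>2)" for w
  have odd: "X m (flip (a m) w) = - X m w" for w
    using insert.prems(2)[of m] by (auto simp: odd_at_def)
  have inv: "Z (flip (a m) w) = Z w" for w
    using insert.prems(3)[of m] insert.hyps by (auto simp: Z_def inv_at_def)
  have "avg D (\<lambda>w. exp (s * (\<Sum>y\<in>insert m Y. X y w) - s\<^sup>2 / 2 * (\<Sum>y\<in>insert m Y. (X y w)\<^sup>2)))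
      = avg D (\<lambda>w. Z w * V w)"
    using insert.hyps
    by (intro avg_cong) (auto simp: Z_def V_def exp_add[symmetric] algebra_simps)
  also have "\<dots> = avg D (\<lambda>w. Z w * ((V w + V (flip (a m) w)) / 2))"
  proof -
    have "avg D (\<lambda>w. Z w * V (flip (a m) w)) = avg D (\<lambda>w. Z w * V w)"
      using avg_flip[of "a m" D "\<lambda>w. Z w * V w"] insert.prems(1)[of m] inv by simp
    then have "avg D (\<lambda>w. Z w * V w) = (avg D (\<lambda>w. Z w * V w) + avg D (\<lambda>w. Z w * V (flip (a m) w))) * (1/2)"
      by simp
    also have "\<dots> = avg D (\<lambda>w. Z w * ((V w + V (flip (a m) w)) / 2))"
      unfolding avg_add[symmetric] avg_cmult_right[symmetric]
      by (intro avg_cong) (auto simp: algebra_simps)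
    finally show ?thesis .
  qed
  also have "\<dots> \<le> avg D Z"
  proof (intro avg_mono)
    fix w
    have "(V w + V (flip (a m) w)) / 2 = (exp (s * X m w) + exp (- (s * X m w))) / 2 * exp (- ((s * X m w)\<^sup>2 / 2))"
    proof -
      have "V w = exp (s * X m w) * exp (- ((s * X m w)\<^sup>2 / 2))"
        "V (flip (a m) w) = exp (- (s * X m w)) * exp (- ((s * X m w)\<^sup>2 / 2))"
        by (simp_all add: V_def odd exp_add[symmetric] power_mult_distrib)
      then show ?thesis by (simp add: distrib_right add_divide_distrib)
    qed
    also have "\<dots> \<le> exp ((s * X m w)\<^sup>2 / 2) * exp (- ((s * X m w)\<^sup>2 / 2))"
      by (intro mult_right_mono cosh_le_exp_sq) auto
    also have "\<dots> = 1" by (simp add: exp_minus)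
    finally show "Z w * ((V w + V (flip (a m) w)) / 2) \<le> Z w"
      by (intro mult_left_le) (auto simp: Z_def)
  qed
  also have "\<dots> \<le> 1" unfolding Z_def using insert by (intro insert.IH) auto
  finally show ?case .
qed

text \<open>Exponential Markov inequality with the optimal \<open>s = l / b\<close>. The square
  function is itself random, so the bound on it is made part of the event.\<close>

lemma martingale_tail_one_sided:
  fixes X :: "nat \<Rightarrow> 'a set \<Rightarrow> real"
  assumes "finite D" "finite Y" "\<And>y. y \<in> Y \<Longrightarrow> a y \<in> D" "\<And>y. y \<in> Y \<Longrightarrow> odd_at (a y) (X y)"
    "\<And>y z. y \<in> Y \<Longrightarrow> z \<in> Y \<Longrightarrow> z < y \<Longrightarrow> inv_at (a y) (X z)" "b > 0" "l \<ge> 0"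
  shows "avg D (\<lambda>w. of_bool ((\<Sum>y\<in>Y. X y w) > l * b \<and> (\<Sum>y\<in>Y. (X y w)\<^sup>2) \<le> b\<^sup>2)) \<le> exp (- l\<^sup>2 / 2)"
proof -
  define s where "s = l / b"
  have "avg D (\<lambda>w. of_bool ((\<Sum>y\<in>Y. X y w) > l * b \<and> (\<Sum>y\<in>Y. (X y w)\<^sup>2) \<le> b\<^sup>2))
     \<le> avg D (\<lambda>w. exp (- l\<^sup>2 / 2) * exp (s * (\<Sum>y\<in>Y. X y w) - s\<^sup>2 / 2 * (\<Sum>y\<in>Y. (X y w)\<^sup>2)))"
  proof (intro avg_mono)
    fix w
    show "of_bool ((\<Sum>y\<in>Y. X y w) > l * b \<and> (\<Sum>y\<in>Y. (X y w)\<^sup>2) \<le> b\<^sup>2) \<le>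
      exp (- l\<^sup>2 / 2) * exp (s * (\<Sum>y\<in>Y. X y w) - s\<^sup>2 / 2 * (\<Sum>y\<in>Y. (X y w)\<^sup>2))"
    proof (cases "(\<Sum>y\<in>Y. X y w) > l * b \<and> (\<Sum>y\<in>Y. (X y w)\<^sup>2) \<le> b\<^sup>2")
      case True
      have "s * (l * b) \<le> s * (\<Sum>y\<in>Y. X y w)" using True assms by (intro mult_left_mono) (auto simp: s_def)
      moreover have "s\<^sup>2 / 2 * (\<Sum>y\<in>Y. (X y w)\<^sup>2) \<le> s\<^sup>2 / 2 * b\<^sup>2" using True by (intro mult_left_mono) auto
      moreover have "s * (l * b) = l\<^sup>2" "s\<^sup>2 / 2 * b\<^sup>2 = l\<^sup>2 / 2" using assms by (auto simp: s_def field_simps power2_eq_square)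
      ultimately show ?thesis using True by (simp add: exp_add[symmetric])
    qed auto
  qed
  also have "\<dots> \<le> exp (- l\<^sup>2 / 2) * 1"
    unfolding avg_cmult using assms by (intro mult_left_mono exp_martingale[where a = a]) auto
  finally show ?thesis by simp
qed

lemma martingale_tail:
  fixes X :: "nat \<Rightarrow> 'a set \<Rightarrow> real"
  assumes "finite D" "finite Y" "\<And>y. y \<in> Y \<Longrightarrow> a y \<in> D" "\<And>y. y \<in> Y \<Longrightarrow> odd_at (a y) (X y)"
    "\<And>y z. y \<in> Y \<Longrightarrow> z \<in> Y \<Longrightarrow> z < y \<Longrightarrow> inv_at (a y) (X z)" "b \<ge> 0" "l \<ge> 0"
  shows "avg D (\<lambda>w. of_bool (\<bar>\<Sum>y\<in>Y. X y w\<bar> > l * b \<and> (\<Sum>y\<in>Y. (X y w)\<^sup>2) \<le> b\<^sup>2)) \<le> 2 * exp (- l\<^sup>2 / 2)"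
proof (cases "b = 0")
  case True
  \<comment> \<open>The choice \<open>s = l / b\<close> degenerates for \<open>b = 0\<close>, but a
    vanishing square function makes the sum vanish.\<close>
  have "(\<Sum>y\<in>Y. X y w) = 0" if "(\<Sum>y\<in>Y. (X y w)\<^sup>2) \<le> 0" for w
  proof -
    have "(\<Sum>y\<in>Y. (X y w)\<^sup>2) = 0" using that by (intro antisym sum_nonneg) auto
    then show ?thesis using assms(2) by (simp add: sum_nonneg_eq_0_iff)
  qed
  then have *: "\<not> (\<bar>\<Sum>y\<in>Y. X y w\<bar> > l * b \<and> (\<Sum>y\<in>Y. (X y w)\<^sup>2) \<le> b\<^sup>2)" for w using True by auto
  show ?thesis using assms(1) by (subst avg_cong[of D _ "\<lambda>_. 0"]) (use * in \<open>auto simp: avg_const\<close>)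
next
  case False
  then have b: "b > 0" using assms by auto
  have n: "odd_at x (\<lambda>w. - (V w))" if "odd_at x V" for x :: 'a and V using that by (auto simp: odd_at_def)
  have "avg D (\<lambda>w. of_bool (\<bar>\<Sum>y\<in>Y. X y w\<bar> > l * b \<and> (\<Sum>y\<in>Y. (X y w)\<^sup>2) \<le> b\<^sup>2))
    \<le> avg D (\<lambda>w. of_bool ((\<Sum>y\<in>Y. X y w) > l * b \<and> (\<Sum>y\<in>Y. (X y w)\<^sup>2) \<le> b\<^sup>2)
        + of_bool ((\<Sum>y\<in>Y. - X y w) > l * b \<and> (\<Sum>y\<in>Y. (- X y w)\<^sup>2) \<le> b\<^sup>2))"
    by (intro avg_mono) (auto simp: sum_negf)
  also have "\<dots> \<le> exp (- l\<^sup>2 / 2) + exp (- l\<^sup>2 / 2)"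
    unfolding avg_add
    using assms b by (intro add_mono martingale_tail_one_sided[where a = a]) (auto intro!: n simp: inv_at_def)
  finally show ?thesis by simp
qed

section \<open>Sums of r-functions\<close>

text \<open>Digit \<open>n\<close> is included: a Haar function of level \<open>n\<close> changes
  its sign in the middle of its interval, so the cells have side length
  \<open>2 powi - (n + 1)\<close>.\<close>

definition digits :: "nat \<Rightarrow> nat \<Rightarrow> (nat \<times> nat) set" where
  "digits d n = {..<d} \<times> {..n}"

definition idx :: "nat \<Rightarrow> nat \<Rightarrow> (nat \<Rightarrow> nat set) \<Rightarrow> (nat \<Rightarrow> nat) set" where
  "idx d n J = {r. (\<forall>j<d. r j \<in> J j) \<and> (\<forall>j\<ge>d. r j = 0) \<and> (\<Sum>j<d. r j) = n}"

text \<open>A set \<open>w\<close> of digits stands for a dyadic cell: \<open>(j, i) \<in> w\<close> iff the \<open>i\<close>-th binary digit of the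
  coordinate \<open>j\<close> is 1. A function of \<open>w\<close> of the type required of \<open>f r\<close> is an r-function with respect to the
  rectangles of side lengths \<open>2 powi - r j\<close>.\<close>

definition rsys :: "nat \<Rightarrow> nat \<Rightarrow> ((nat \<Rightarrow> nat) \<Rightarrow> (nat \<times> nat) set \<Rightarrow> real) \<Rightarrow> bool" where
  "rsys d n f \<longleftrightarrow> (\<forall>r\<in>idx d n (\<lambda>_. UNIV). (\<forall>w. \<bar>f r w\<bar> \<le> 1) \<and>
     (\<forall>j<d. odd_at (j, r j) (f r) \<and> (\<forall>i>r j. inv_at (j, i) (f r))))"

definition hsum :: "nat \<Rightarrow> nat \<Rightarrow> ((nat \<Rightarrow> nat) \<Rightarrow> 'w \<Rightarrow> real) \<Rightarrow> (nat \<Rightarrow> nat set) \<Rightarrow> 'w \<Rightarrow> real" where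
  "hsum d n f J w = (\<Sum>r\<in>idx d n J. f r w)"

text \<open>With overwhelming probability: \<open>l\<close> will be a small positive power of \<open>n\<close>, so that polynomially many
  such events hold simultaneously.\<close>

definition wop :: "nat \<Rightarrow> nat \<Rightarrow> real \<Rightarrow> nat \<Rightarrow> ((nat \<times> nat) set \<Rightarrow> bool) \<Rightarrow> bool" where
  "wop d n l k P \<longleftrightarrow> avg (digits d n) (\<lambda>w. of_bool (\<not> P w)) \<le> (real n + 2) ^ k * (2 * exp (- l\<^sup>2 / 2))"

lemma finite_digits [simp]: "finite (digits d n)"
  by (simp add: digits_def)

section \<open>Calculus of overwhelmingly probable events\<close>

lemma wop_mono:
  assumes "wop d n l k P" "k \<le> k'" "\<And>w. w \<subseteq> digits d n \<Longrightarrow> P w \<Longrightarrow> Q w"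
  shows "wop d n l k' Q"
proof -
  have "avg (digits d n) (\<lambda>w. of_bool (\<not> Q w)) \<le> avg (digits d n) (\<lambda>w. of_bool (\<not> P w))"
    using assms(3) by (intro avg_mono) auto
  also have "\<dots> \<le> (real n + 2) ^ k * (2 * exp (- l\<^sup>2 / 2))" using assms by (simp add: wop_def)
  also have "\<dots> \<le> (real n + 2) ^ k' * (2 * exp (- l\<^sup>2 / 2))"
    using assms by (intro mult_right_mono power_increasing) auto
  finally show ?thesis by (simp add: wop_def)
qed

lemma wop_true: "(\<And>w. w \<subseteq> digits d n \<Longrightarrow> P w) \<Longrightarrow> wop d n l k P"
  unfolding wop_def by (subst avg_cong[of _ _ "\<lambda>_. 0"]) (auto simp: avg_const)

lemma wop_all:
  assumes "finite I" "card I \<le> (n + 2) ^ m" "\<And>i. i \<in> I \<Longrightarrow> wop d n l k (P i)"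
  shows "wop d n l (k + m) (\<lambda>w. \<forall>i\<in>I. P i w)"
proof -
  have "avg (digits d n) (\<lambda>w. of_bool (\<not> (\<forall>i\<in>I. P i w))) \<le> avg (digits d n) (\<lambda>w. \<Sum>i\<in>I. of_bool (\<not> P i w))"
  proof (intro avg_mono)
    fix w
    show "of_bool (\<not> (\<forall>i\<in>I. P i w)) \<le> (\<Sum>i\<in>I. of_bool (\<not> P i w) :: real)"
    proof (cases "\<forall>i\<in>I. P i w")
      case False
      then obtain i where "i \<in> I" "\<not> P i w" by auto
      then show ?thesis using member_le_sum[of i I "\<lambda>i. of_bool (\<not> P i w) :: real"] assms(1) by auto
    qed (simp add: sum_nonneg)
  qed
  also have "\<dots> \<le> (\<Sum>i\<in>I. (real n + 2) ^ k * (2 * exp (- l\<^sup>2 / 2)))"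
    unfolding avg_sum using assms(3) by (intro sum_mono) (simp add: wop_def)
  also have "\<dots> = card I * ((real n + 2) ^ k * (2 * exp (- l\<^sup>2 / 2)))" by simp
  also have "\<dots> \<le> (real n + 2) ^ m * ((real n + 2) ^ k * (2 * exp (- l\<^sup>2 / 2)))"
  proof (intro mult_right_mono)
    have "real (card I) \<le> real ((n + 2) ^ m)" using assms(2) by (simp only: of_nat_le_iff)
    then show "real (card I) \<le> (real n + 2) ^ m" by (simp add: add.commute)
  qed auto
  finally show ?thesis by (simp add: wop_def power_add mult_ac)
qed

text \<open>As the base is \<open>n + 2 \<ge> 2\<close>, two events cost a single power; the same
  base also counts the \<open>n + 2\<close> partial sums indexed by
  \<open>{..Suc n}\<close>.\<close>

lemma wop_conj:
  assumes "wop d n l k P" "wop d n l k Q"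
  shows "wop d n l (k + 1) (\<lambda>w. P w \<and> Q w)"
proof -
  have "wop d n l (k + 1) (\<lambda>w. \<forall>i\<in>{True, False}. (if i then P w else Q w))"
  proof (intro wop_all)
    fix i show "wop d n l k (\<lambda>w. if i then P w else Q w)" using assms by (cases i) auto
  qed auto
  then show ?thesis by (rule wop_mono) auto
qed

text \<open>The quadratic variation has to be controlled only with overwhelming probability:
  \<open>martingale_tail\<close> covers the event where it is small, and its failure is absorbed in
  one more power.\<close>

lemma wop_martingale:
  fixes X :: "nat \<Rightarrow> (nat \<times> nat) set \<Rightarrow> real"
  assumes "finite Y" "\<And>y. y \<in> Y \<Longrightarrow> a y \<in> digits d n" "\<And>y. y \<in> Y \<Longrightarrow> odd_at (a y) (X y)"
    "\<And>y z. y \<in> Y \<Longrightarrow> z \<in> Y \<Longrightarrow> z < y \<Longrightarrow> inv_at (a y) (X z)" "b \<ge> 0" "l \<ge> 0"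
    "wop d n l k (\<lambda>w. (\<Sum>y\<in>Y. (X y w)\<^sup>2) \<le> b\<^sup>2)"
  shows "wop d n l (k + 1) (\<lambda>w. \<bar>\<Sum>y\<in>Y. X y w\<bar> \<le> l * b)"
proof -
  let ?P = "\<lambda>w. \<not> (\<bar>\<Sum>y\<in>Y. X y w\<bar> > l * b \<and> (\<Sum>y\<in>Y. (X y w)\<^sup>2) \<le> b\<^sup>2)"
  have "wop d n l 0 ?P"
    using martingale_tail[OF finite_digits assms(1-6)] by (simp add: wop_def)
  then have "wop d n l (k + 1) (\<lambda>w. ?P w \<and> (\<Sum>y\<in>Y. (X y w)\<^sup>2) \<le> b\<^sup>2)"
    by (intro wop_conj assms(7)) (rule wop_mono, auto)
  then show ?thesis by (rule wop_mono) auto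
qed

section \<open>Index boxes and square root cancellation\<close>

lemma idx_le: "r \<in> idx d n J \<Longrightarrow> j < d \<Longrightarrow> r j \<le> n"
  using member_le_sum[of j "{..<d}" r] by (auto simp: idx_def)

lemma finite_idx [simp]: "finite (idx d n J)"
proof (rule finite_subset)
  show "idx d n J \<subseteq> {f. \<forall>x. (x \<in> {..<d} \<longrightarrow> f x \<in> {..n}) \<and> (x \<notin> {..<d} \<longrightarrow> f x = 0)}"
    using idx_le by (auto simp: idx_def)
qed (intro finite_set_of_finite_funs, auto)

lemma idx_mono: "(\<And>j. j < d \<Longrightarrow> J j \<subseteq> J' j) \<Longrightarrow> idx d n J \<subseteq> idx d n J'"
  by (auto simp: idx_def)

lemma idx_UNIV: "r \<in> idx d n J \<Longrightarrow> r \<in> idx d n (\<lambda>_. UNIV)"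
  by (auto simp: idx_def)

lemma idx_empty: "j < d \<Longrightarrow> J j = {} \<Longrightarrow> idx d n J = {}"
  by (auto simp: idx_def)

lemma idx_upd: "c < d \<Longrightarrow> y \<in> J c \<Longrightarrow> idx d n (J(c := {y})) = {r \<in> idx d n J. r c = y}"
  by (auto simp: idx_def split: if_splits)

lemma hsum_split:
  assumes "c < d" "J c \<subseteq> {..n}"
  shows "hsum d n f J w = (\<Sum>y\<in>J c. hsum d n f (J(c := {y})) w)"
proof -
  have "(\<Sum>y\<in>J c. sum (\<lambda>r. f r w) {r \<in> idx d n J. r c = y}) = sum (\<lambda>r. f r w) (idx d n J)"
  proof (rule sum.group)
    show "(\<lambda>r. r c) ` idx d n J \<subseteq> J c" using assms by (auto simp: idx_def)
  qed (use assms in \<open>auto intro: finite_subset\<close>)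
  then show ?thesis using assms by (simp add: hsum_def idx_upd)
qed

lemma hsum_odd: "rsys d n f \<Longrightarrow> c < d \<Longrightarrow> J c \<subseteq> {y} \<Longrightarrow> odd_at (c, y) (hsum d n f J)"
  unfolding hsum_def[abs_def] rsys_def
  by (rule odd_sum) (auto simp: idx_def)

lemma hsum_inv: "rsys d n f \<Longrightarrow> c < d \<Longrightarrow> (\<And>y. y \<in> J c \<Longrightarrow> y < i) \<Longrightarrow> inv_at (c, i) (hsum d n f J)"
  unfolding hsum_def[abs_def] rsys_def
  by (rule inv_sum) (auto simp: idx_def)

text \<open>The condition on the sum determines the coordinate \<open>c\<close> from the others;
  hence \<open>d - 1\<close> instead of \<open>d\<close> in the exponents.\<close>

lemma card_idx:
  assumes "c < d" "\<And>j. j < d \<Longrightarrow> j \<noteq> c \<Longrightarrow> finite (J j)"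
  shows "card (idx d n J) \<le> (\<Prod>j\<in>{..<d} - {c}. card (J j))"
proof -
  have "card (idx d n J) \<le> card (PiE ({..<d} - {c}) J)"
  proof (rule card_inj_on_le)
    show "inj_on (\<lambda>r. restrict r ({..<d} - {c})) (idx d n J)"
    proof (rule inj_onI)
      fix r s assume r: "r \<in> idx d n J" and s: "s \<in> idx d n J"
        and eq: "restrict r ({..<d} - {c}) = restrict s ({..<d} - {c})"
      have *: "r j = s j" if "j < d" "j \<noteq> c" for j using fun_cong[OF eq, of j] that by simp
      have "(\<Sum>j<d. r j) = r c + (\<Sum>j\<in>{..<d} - {c}. r j)" "(\<Sum>j<d. s j) = s c + (\<Sum>j\<in>{..<d} - {c}. s j)"
        using assms(1) by (simp_all add: sum.remove)
      moreover have "(\<Sum>j\<in>{..<d} - {c}. r j) = (\<Sum>j\<in>{..<d} - {c}. s j)" using * by (intro sum.cong) auto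
      ultimately have "r c = s c" using r s by (simp add: idx_def)
      have "r j = s j" for j
      proof (cases "j < d")
        case True
        then show ?thesis using * \<open>r c = s c\<close> by (cases "j = c") auto
      next
        case False
        then show ?thesis using r s by (simp add: idx_def)
      qed
      then show "r = s" by (rule ext)
    qed
    show "(\<lambda>r. restrict r ({..<d} - {c})) ` idx d n J \<subseteq> PiE ({..<d} - {c}) J"
    proof (rule image_subsetI)
      fix r assume "r \<in> idx d n J"
      then have "r j \<in> J j" if "j < d" for j using that by (simp add: idx_def)
      then show "restrict r ({..<d} - {c}) \<in> PiE ({..<d} - {c}) J" by (simp add: restrict_PiE_iff)
    qed
    show "finite (PiE ({..<d} - {c}) J)"
    proof (rule finite_PiE)
      fix j assume "j \<in> {..<d} - {c}"
      then show "finite (J j)" using assms(2)[of j] by simp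
    qed simp
  qed
  then show ?thesis by (simp add: card_PiE)
qed

lemma hsum_le_card: "rsys d n f \<Longrightarrow> \<bar>hsum d n f J w\<bar> \<le> card (idx d n J)"
proof -
  assume f: "rsys d n f"
  have "\<bar>hsum d n f J w\<bar> \<le> (\<Sum>r\<in>idx d n J. \<bar>f r w\<bar>)" unfolding hsum_def by (rule sum_abs)
  also have "\<dots> \<le> (\<Sum>r\<in>idx d n J. 1)"
    using f idx_UNIV by (intro sum_mono) (auto simp: rsys_def)
  finally show ?thesis by simp
qed

lemma card_idx_le_1:
  assumes "c < d" "\<And>j. j < d \<Longrightarrow> j \<noteq> c \<Longrightarrow> \<exists>x. J j \<subseteq> {x}"
  shows "card (idx d n J) \<le> 1"
proof -
  have *: "finite (J j) \<and> card (J j) \<le> 1" if j: "j < d" "j \<noteq> c" for j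
  proof -
    obtain x where "J j \<subseteq> {x}" using assms(2)[OF j] by auto
    then show ?thesis using card_mono[of "{x}" "J j"] by (auto intro: finite_subset)
  qed
  have "card (idx d n J) \<le> (\<Prod>j\<in>{..<d} - {c}. card (J j))"
    using * assms(1) by (auto intro!: card_idx)
  also have "\<dots> \<le> (\<Prod>j\<in>{..<d} - {c}. 1)"
    using * by (intro prod_mono) auto
  finally show ?thesis by simp
qed

text \<open>Square root cancellation in every free coordinate. With a coordinate \<open>a\<close> of
  \<open>U\<close> fixed at \<open>y\<close>, the sum is odd in the digit \<open>(a, y)\<close> and
  blind to later ones, so the summation over \<open>y\<close> is a martingale in the digits of
  \<open>a\<close> and multiplies the bound by \<open>l * sqrt (card (J a))\<close>. One power of
  \<open>n + 2\<close> pays for all \<open>y\<close> at once and one for the martingale. The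
  coordinate \<open>c\<close> is reserved for the condition on the sum, so at most one index remains
  when \<open>U\<close> is exhausted.\<close>

lemma hsum_bound:
  assumes "rsys d n f" "l \<ge> 0" "c < d"
  shows "finite U \<Longrightarrow> U \<subseteq> {..<d} \<Longrightarrow> c \<notin> U \<Longrightarrow>
    (\<And>j. j < d \<Longrightarrow> j \<noteq> c \<Longrightarrow> j \<notin> U \<Longrightarrow> \<exists>x. J j \<subseteq> {x}) \<Longrightarrow> (\<And>j. j \<in> U \<Longrightarrow> J j \<subseteq> {..n}) \<Longrightarrow>
    wop d n l (2 * card U) (\<lambda>w. \<bar>hsum d n f J w\<bar> \<le> l ^ card U * sqrt (\<Prod>j\<in>U. real (card (J j))))"
proof (induction U arbitrary: J rule: finite_induct)
  case empty
  then have "real (card (idx d n J)) \<le> 1" using card_idx_le_1[of c d J n] assms by auto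
  then have "\<bar>hsum d n f J w\<bar> \<le> 1" for w using hsum_le_card[OF assms(1), of J w] by linarith
  then show ?case by (intro wop_true) auto
next
  case (insert a U)
  define b where "b = l ^ card U * sqrt (\<Prod>j\<in>U. real (card (J j)))"
  have a: "a < d" "J a \<subseteq> {..n}" "a \<noteq> c" using insert.prems by auto
  have fin: "finite (J a)" using a by (auto intro: finite_subset)
  have ca: "card (J a) \<le> n + 2" using card_mono[of "{..n}" "J a"] a by simp
  have "wop d n l (2 * card U) (\<lambda>w. \<bar>hsum d n f (J(a := {y})) w\<bar> \<le> b)" if "y \<in> J a" for y
  proof -
    have "(\<Prod>j\<in>U. real (card ((J(a := {y})) j))) = (\<Prod>j\<in>U. real (card (J j)))"
      using insert.hyps by (intro prod.cong) auto
    moreover have "wop d n l (2 * card U) (\<lambda>w. \<bar>hsum d n f (J(a := {y})) w\<bar> \<le>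
        l ^ card U * sqrt (\<Prod>j\<in>U. real (card ((J(a := {y})) j))))"
      using insert.prems insert.hyps by (intro insert.IH) auto
    ultimately show ?thesis by (simp only: b_def)
  qed
  then have "wop d n l (2 * card U + 1) (\<lambda>w. \<forall>y\<in>J a. \<bar>hsum d n f (J(a := {y})) w\<bar> \<le> b)"
    using fin ca by (intro wop_all) auto
  then have "wop d n l (2 * card U + 1) (\<lambda>w. (\<Sum>y\<in>J a. (hsum d n f (J(a := {y})) w)\<^sup>2) \<le> (sqrt (card (J a)) * b)\<^sup>2)"
  proof (rule wop_mono)
    fix w assume "\<forall>y\<in>J a. \<bar>hsum d n f (J(a := {y})) w\<bar> \<le> b"
    then have "(\<Sum>y\<in>J a. (hsum d n f (J(a := {y})) w)\<^sup>2) \<le> (\<Sum>y\<in>J a. b\<^sup>2)"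
      by (intro sum_mono) (metis abs_ge_zero power2_abs power_mono)
    then show "(\<Sum>y\<in>J a. (hsum d n f (J(a := {y})) w)\<^sup>2) \<le> (sqrt (card (J a)) * b)\<^sup>2"
      by (simp add: power_mult_distrib)
  qed simp
  then have "wop d n l (2 * card U + 1 + 1) (\<lambda>w. \<bar>\<Sum>y\<in>J a. hsum d n f (J(a := {y})) w\<bar> \<le> l * (sqrt (card (J a)) * b))"
    using a fin assms
    by (intro wop_martingale[where a = "\<lambda>y. (a, y)"])
       (auto simp: digits_def b_def intro!: hsum_odd hsum_inv mult_nonneg_nonneg prod_nonneg)
  then show ?case
    unfolding hsum_split[of a d J n f, OF a(1,2), symmetric]
    by (rule wop_mono) (use insert.hyps in \<open>auto simp: b_def real_sqrt_mult mult_ac\<close>)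
qed

lemma hsum_bound_all:
  assumes "rsys d n f" "l \<ge> 0" "c < d" "finite U" "U \<subseteq> {..<d}" "c \<notin> U"
    "\<And>j. j < d \<Longrightarrow> j \<noteq> c \<Longrightarrow> j \<notin> U \<Longrightarrow> \<exists>x. J j \<subseteq> {x}" "\<And>j. j \<in> U \<Longrightarrow> J j \<subseteq> {..n}"
  shows "wop d n l (2 * card U) (\<lambda>w. \<bar>hsum d n f J w\<bar> \<le> l ^ card U * sqrt ((real n + 1) ^ card U))"
proof -
  have "(\<Prod>j\<in>U. real (card (J j))) \<le> (\<Prod>j\<in>U. real n + 1)"
  proof (intro prod_mono conjI)
    fix j assume "j \<in> U"
    then have "card (J j) \<le> card {..n}" using assms(8) by (intro card_mono) auto
    then show "real (card (J j)) \<le> real n + 1" by simp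
  qed auto
  then have "l ^ card U * sqrt (\<Prod>j\<in>U. real (card (J j))) \<le> l ^ card U * sqrt ((real n + 1) ^ card U)"
    using assms by (intro mult_left_mono) auto
  note le = this
  have "wop d n l (2 * card U) (\<lambda>w. \<bar>hsum d n f J w\<bar> \<le> l ^ card U * sqrt (\<Prod>j\<in>U. real (card (J j))))"
    by (rule hsum_bound[of d n f l c]) (use assms in auto)
  then show ?thesis by (rule wop_mono) (use le in auto)
qed

text \<open>A short range in one free coordinate improves the bound by the square root of its
  proportion. Both the blocks in Beck's argument and those of the uncovering rely on this.\<close>

lemma hsum_bound_short:
  assumes "rsys d n f" "l \<ge> 0" "c < d" "finite U" "U \<subseteq> {..<d}" "c \<notin> U"
    "\<And>j. j < d \<Longrightarrow> j \<noteq> c \<Longrightarrow> j \<notin> U \<Longrightarrow> \<exists>x. J j \<subseteq> {x}" "\<And>j. j \<in> U \<Longrightarrow> J j \<subseteq> {..n}"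
    "a \<in> U" "card (J a) \<le> L"
  shows "wop d n l (2 * card U) (\<lambda>w. \<bar>hsum d n f J w\<bar> \<le> l ^ card U * sqrt (L * (real n + 1) ^ (card U - 1)))"
proof -
  have "(\<Prod>j\<in>U. real (card (J j))) = card (J a) * (\<Prod>j\<in>U - {a}. real (card (J j)))"
    using assms by (simp add: prod.remove)
  also have "\<dots> \<le> L * (\<Prod>j\<in>U - {a}. real n + 1)"
  proof (intro mult_mono prod_mono conjI)
    fix j assume "j \<in> U - {a}"
    then have "card (J j) \<le> card {..n}" using assms(8) by (intro card_mono) auto
    then show "real (card (J j)) \<le> real n + 1" by simp
  qed (use assms in \<open>auto simp: prod_nonneg\<close>)
  finally have "l ^ card U * sqrt (\<Prod>j\<in>U. real (card (J j))) \<le> l ^ card U * sqrt (L * (real n + 1) ^ (card U - 1))"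
    using assms by (intro mult_left_mono) auto
  note le = this
  have "wop d n l (2 * card U) (\<lambda>w. \<bar>hsum d n f J w\<bar> \<le> l ^ card U * sqrt (\<Prod>j\<in>U. real (card (J j))))"
    by (rule hsum_bound[of d n f l c]) (use assms in auto)
  then show ?thesis by (rule wop_mono) (use le in auto)
qed

section \<open>Pair sums with prescribed coincidences\<close>

definition fx :: "nat set \<Rightarrow> (nat \<Rightarrow> nat) \<Rightarrow> (nat \<Rightarrow> nat set) \<Rightarrow> nat \<Rightarrow> nat set" where
  "fx E e J = (\<lambda>j. if j \<in> E then J j \<inter> {e j} else J j)"

text \<open>The sum of \<open>f r w * f s w\<close> over the pairs of \<open>r \<in> idx d n J\<close> and \<open>s \<in> idx d n J'\<close>
  that coincide in the coordinates of \<open>E\<close>.\<close>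

definition psum :: "nat \<Rightarrow> nat \<Rightarrow> ((nat \<Rightarrow> nat) \<Rightarrow> 'w \<Rightarrow> real) \<Rightarrow> nat set \<Rightarrow>
    (nat \<Rightarrow> nat set) \<Rightarrow> (nat \<Rightarrow> nat set) \<Rightarrow> 'w \<Rightarrow> real" where
  "psum d n f E J J' w =
     (\<Sum>e\<in>PiE E (\<lambda>_. {..n}). hsum d n f (fx E e J) w * hsum d n f (fx E e J') w)"

text \<open>The pairs with \<open>s c < r c\<close>, sorted by the larger level
  \<open>y = r c\<close>. Each summand is odd in the digit \<open>(c, y)\<close>, which the partner
  does not see, so the sum over \<open>y\<close> is a martingale.\<close>

definition cross :: "nat \<Rightarrow> nat \<Rightarrow> ((nat \<Rightarrow> nat) \<Rightarrow> 'w \<Rightarrow> real) \<Rightarrow> nat \<Rightarrow> nat set \<Rightarrow>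
    (nat \<Rightarrow> nat set) \<Rightarrow> (nat \<Rightarrow> nat set) \<Rightarrow> 'w \<Rightarrow> real" where
  "cross d n f c E J J' w = (\<Sum>y\<in>J c. psum d n f E (J(c := {y})) (J'(c := J' c \<inter> {..<y})) w)"

lemma fx_upd: "c \<notin> E \<Longrightarrow> fx E e (J(c := S)) = (fx E e J)(c := S)"
  by (auto simp: fx_def fun_eq_iff)

lemma fx_apply: "c \<notin> E \<Longrightarrow> fx E e J c = J c"
  by (auto simp: fx_def)

lemma sum_PiE_insert:
  assumes "finite E" "c \<notin> E" "finite S"
  shows "(\<Sum>e\<in>PiE (insert c E) (\<lambda>_. S). g e) = (\<Sum>e\<in>PiE E (\<lambda>_. S). \<Sum>y\<in>S. g (e(c := y)))"
proof -
  have "(\<Sum>e\<in>PiE (insert c E) (\<lambda>_. S). g e) = (\<Sum>(y, e)\<in>S \<times> PiE E (\<lambda>_. S). g (e(c := y)))"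
    unfolding PiE_insert_eq
    by (subst sum.reindex[OF inj_combinator[OF assms(2)]]) (simp add: case_prod_unfold comp_def)
  also have "\<dots> = (\<Sum>y\<in>S. \<Sum>e\<in>PiE E (\<lambda>_. S). g (e(c := y)))" by (simp add: sum.cartesian_product)
  also have "\<dots> = (\<Sum>e\<in>PiE E (\<lambda>_. S). \<Sum>y\<in>S. g (e(c := y)))" by (rule sum.swap)
  finally show ?thesis .
qed

text \<open>The intersections, which come from \<open>fx\<close>, are empty for levels outside the
  boxes; this is why coincidences can be summed over all of \<open>{..n}\<close>.\<close>

lemma sum_single_outside:
  assumes "c < d" "J c \<subseteq> {..n}" "J' c \<subseteq> {..n}"
  shows "(\<Sum>y\<le>n. hsum d n f (J(c := J c \<inter> {y})) w * hsum d n f (J'(c := J' c \<inter> {y})) w) =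
    (\<Sum>y\<in>J c \<inter> J' c. hsum d n f (J(c := {y})) w * hsum d n f (J'(c := {y})) w)"
proof (rule sum.mono_neutral_cong_right)
  show "J c \<inter> J' c \<subseteq> {..n}" using assms by auto
  show "\<forall>y\<in>{..n} - J c \<inter> J' c. hsum d n f (J(c := J c \<inter> {y})) w * hsum d n f (J'(c := J' c \<inter> {y})) w = 0"
  proof
    fix y assume "y \<in> {..n} - J c \<inter> J' c"
    then have "idx d n (J(c := J c \<inter> {y})) = {} \<or> idx d n (J'(c := J' c \<inter> {y})) = {}"
      using idx_empty[OF assms(1), of "J(c := J c \<inter> {y})"] idx_empty[OF assms(1), of "J'(c := J' c \<inter> {y})"]
      by auto
    then show "hsum d n f (J(c := J c \<inter> {y})) w * hsum d n f (J'(c := J' c \<inter> {y})) w = 0"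
      by (auto simp: hsum_def)
  qed
  fix y assume "y \<in> J c \<inter> J' c"
  then have "J c \<inter> {y} = {y}" "J' c \<inter> {y} = {y}" by auto
  then show "hsum d n f (J(c := J c \<inter> {y})) w * hsum d n f (J'(c := J' c \<inter> {y})) w =
    hsum d n f (J(c := {y})) w * hsum d n f (J'(c := {y})) w" by simp
qed auto

lemma psum_insert:
  assumes "finite E" "c \<notin> E" "c < d" "J c \<subseteq> {..n}" "J' c \<subseteq> {..n}"
  shows "psum d n f (insert c E) J J' w = (\<Sum>e\<in>PiE E (\<lambda>_. {..n}). \<Sum>y\<in>J c \<inter> J' c.
    hsum d n f ((fx E e J)(c := {y})) w * hsum d n f ((fx E e J')(c := {y})) w)"
proof -
  have "fx (insert c E) (e(c := y)) J = (fx E e J)(c := fx E e J c \<inter> {y})" for e y and J :: "nat \<Rightarrow> nat set"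
    using assms(2) by (auto simp: fx_def fun_eq_iff)
  then show ?thesis
    unfolding psum_def sum_PiE_insert[OF assms(1,2) finite_atMost]
    using assms sum_single_outside[of c d "fx E _ J" n "fx E _ J'" f w]
    by (simp add: fx_apply)
qed

lemma psum_single:
  assumes "c < d" "J c \<subseteq> {..n}" "J' c \<subseteq> {..n}"
  shows "psum d n f {c} J J' w = (\<Sum>y\<in>J c \<inter> J' c. hsum d n f (J(c := {y})) w * hsum d n f (J'(c := {y})) w)"
  using psum_insert[of "{}" c d J n J' f w] assms by (simp add: fx_def)

lemma hsum_split_less:
  assumes "c < d" "J c \<subseteq> {..n}"
  shows "hsum d n f (J(c := J c \<inter> {..<y})) w = (\<Sum>z | z \<in> J c \<and> z < y. hsum d n f (J(c := {z})) w)"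
proof -
  have "J c \<inter> {..<y} = {z. z \<in> J c \<and> z < y}" by auto
  then show ?thesis using hsum_split[of c d "J(c := J c \<inter> {..<y})" n f w] assms by auto
qed

text \<open>Trichotomy of \<open>r c\<close> and \<open>s c\<close>: equality is one more
  coincidence, and either strict order gives a cross term with the larger level in front.\<close>

lemma psum_split:
  assumes "finite E" "c \<notin> E" "c < d" "J c \<subseteq> {..n}" "J' c \<subseteq> {..n}"
  shows "psum d n f E J J' w = psum d n f (insert c E) J J' w + cross d n f c E J J' w + cross d n f c E J' J w"
proof -
  have fin: "finite (J c)" "finite (J' c)" using assms by (auto intro: finite_subset)
  have *: "hsum d n f (fx E e J) w * hsum d n f (fx E e J') w =
      (\<Sum>y\<in>J c \<inter> J' c. hsum d n f ((fx E e J)(c := {y})) w * hsum d n f ((fx E e J')(c := {y})) w)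
    + (\<Sum>y\<in>J c. hsum d n f ((fx E e J)(c := {y})) w * hsum d n f ((fx E e J')(c := J' c \<inter> {..<y})) w)
    + (\<Sum>y\<in>J' c. hsum d n f ((fx E e J')(c := {y})) w * hsum d n f ((fx E e J)(c := J c \<inter> {..<y})) w)"
    (is "?l = ?a + ?b + ?c") for e
  proof -
    define h h' where "h y = hsum d n f ((fx E e J)(c := {y})) w" and "h' y = hsum d n f ((fx E e J')(c := {y})) w" for y
    have "?l = (\<Sum>y\<in>J c. \<Sum>z\<in>J' c. h y * h' z)"
      using hsum_split[of c d "fx E e J" n f w] hsum_split[of c d "fx E e J'" n f w] assms
      by (simp add: fx_apply h_def h'_def sum_product)
    also have "\<dots> = (\<Sum>y\<in>J c. (\<Sum>z | z \<in> J' c \<and> z = y. h y * h' z) + (\<Sum>z | z \<in> J' c \<and> z < y. h y * h' z)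
        + (\<Sum>z | z \<in> J' c \<and> y < z. h y * h' z))"
    proof (rule sum.cong[OF refl])
      fix y
      have "J' c = {z. z \<in> J' c \<and> z = y} \<union> {z. z \<in> J' c \<and> z < y} \<union> {z. z \<in> J' c \<and> y < z}" by auto
      then have "(\<Sum>z\<in>J' c. h y * h' z) =
        (\<Sum>z\<in>{z. z \<in> J' c \<and> z = y} \<union> {z. z \<in> J' c \<and> z < y} \<union> {z. z \<in> J' c \<and> y < z}. h y * h' z)" by simp
      also have "\<dots> = (\<Sum>z\<in>{z. z \<in> J' c \<and> z = y}. h y * h' z) + (\<Sum>z\<in>{z. z \<in> J' c \<and> z < y}. h y * h' z)
        + (\<Sum>z\<in>{z. z \<in> J' c \<and> y < z}. h y * h' z)"
        using fin by (subst sum.union_disjoint; (subst sum.union_disjoint)?) auto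
      finally show "(\<Sum>z\<in>J' c. h y * h' z) = (\<Sum>z | z \<in> J' c \<and> z = y. h y * h' z) + (\<Sum>z | z \<in> J' c \<and> z < y. h y * h' z)
        + (\<Sum>z | z \<in> J' c \<and> y < z. h y * h' z)" .
    qed
    also have "\<dots> = (\<Sum>y\<in>J c. \<Sum>z | z \<in> J' c \<and> z = y. h y * h' z) + (\<Sum>y\<in>J c. \<Sum>z | z \<in> J' c \<and> z < y. h y * h' z)
        + (\<Sum>y\<in>J c. \<Sum>z | z \<in> J' c \<and> y < z. h y * h' z)" by (simp add: sum.distrib)
    also have "(\<Sum>y\<in>J c. \<Sum>z | z \<in> J' c \<and> z = y. h y * h' z) = ?a"
    proof -
      have "(\<Sum>z | z \<in> J' c \<and> z = y. h y * h' z) = (if y \<in> J' c then h y * h' y else 0)" for y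
      proof -
        have "{z. z \<in> J' c \<and> z = y} = (if y \<in> J' c then {y} else {})" by auto
        then show ?thesis by simp
      qed
      then show ?thesis unfolding sum.inter_restrict[OF fin(1)] by (simp only: h_def h'_def)
    qed
    also have "(\<Sum>y\<in>J c. \<Sum>z | z \<in> J' c \<and> z < y. h y * h' z) = ?b"
      using assms hsum_split_less[of c d "fx E e J'" n f _ w]
      by (intro sum.cong) (auto simp: h_def h'_def fx_apply sum_distrib_left)
    also have "(\<Sum>y\<in>J c. \<Sum>z | z \<in> J' c \<and> y < z. h y * h' z) = ?c"
    proof -
      have "(\<Sum>y\<in>J c. \<Sum>z | z \<in> J' c \<and> y < z. h y * h' z) = (\<Sum>z\<in>J' c. \<Sum>y | y \<in> J c \<and> y < z. h y * h' z)"
        using fin by (rule sum.swap_restrict)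
      also have "\<dots> = ?c"
        using assms hsum_split_less[of c d "fx E e J" n f _ w]
        by (intro sum.cong) (auto simp: h_def h'_def fx_apply sum_distrib_left mult.commute)
      finally show ?thesis .
    qed
    finally show ?thesis .
  qed
  have "psum d n f E J J' w = (\<Sum>e\<in>PiE E (\<lambda>_. {..n}). hsum d n f (fx E e J) w * hsum d n f (fx E e J') w)"
    by (simp add: psum_def)
  also have "\<dots> = psum d n f (insert c E) J J' w + cross d n f c E J J' w + cross d n f c E J' J w"
    unfolding * sum.distrib psum_insert[of E c d J n J' f w, OF assms]
    using assms(2) by (simp add: cross_def psum_def fx_upd sum.swap[of _ "PiE E _"])
  finally show ?thesis .
qed

lemma psum_odd:
  assumes "rsys d n f" "c \<notin> E" "c < d"
  shows "odd_at (c, y) (psum d n f E (J(c := {y})) (J'(c := S \<inter> {..<y})))"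
  unfolding psum_def[abs_def] fx_upd[OF assms(2)] using assms
  by (intro odd_sum odd_mult_inv hsum_odd hsum_inv) auto

lemma psum_inv:
  assumes "rsys d n f" "c \<notin> E" "c < d" "z < y"
  shows "inv_at (c, y) (psum d n f E (J(c := {z})) (J'(c := S \<inter> {..<z})))"
  unfolding psum_def[abs_def] fx_upd[OF assms(2)] using assms
  by (intro inv_sum inv_comp2[where ?g2.0 = "(*)"] hsum_inv) auto

lemma wop_cross:
  assumes "rsys d n f" "c \<notin> E" "c < d" "J c \<subseteq> {..n}" "b \<ge> 0" "l \<ge> 0"
    "wop d n l k (\<lambda>w. (\<Sum>y\<in>J c. (psum d n f E (J(c := {y})) (J'(c := J' c \<inter> {..<y})) w)\<^sup>2) \<le> b\<^sup>2)"
  shows "wop d n l (k + 1) (\<lambda>w. \<bar>cross d n f c E J J' w\<bar> \<le> l * b)"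
  unfolding cross_def using assms
  by (intro wop_martingale[where a = "\<lambda>y. (c, y)"] psum_odd psum_inv)
     (auto simp: digits_def intro: finite_subset)

lemma hsum_union:
  assumes "c < d" "S \<inter> T = {}"
  shows "hsum d n f (J(c := S \<union> T)) w = hsum d n f (J(c := S)) w + hsum d n f (J(c := T)) w"
proof -
  have "idx d n (J(c := S \<union> T)) = idx d n (J(c := S)) \<union> idx d n (J(c := T))"
    using assms by (auto simp: idx_def split: if_splits)
  moreover have "idx d n (J(c := S)) \<inter> idx d n (J(c := T)) = {}"
    using assms by (auto simp: idx_def split: if_splits)
  ultimately show ?thesis by (simp add: hsum_def sum.union_disjoint)
qed

section \<open>The square function of a cross term\<close>

lemma card_sum_eq:
  assumes "finite E" "E \<noteq> {}"
  shows "card {e \<in> PiE E (\<lambda>_. {..n}). (\<Sum>j\<in>E. e j) = s} \<le> (n + 1) ^ (card E - 1)"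
proof -
  obtain c where c: "c \<in> E" using assms by auto
  have "card {e \<in> PiE E (\<lambda>_. {..n}). (\<Sum>j\<in>E. e j) = s} \<le> card (PiE (E - {c}) (\<lambda>_. {..n}))"
  proof (rule card_inj_on_le)
    show "inj_on (\<lambda>e. restrict e (E - {c})) {e \<in> PiE E (\<lambda>_. {..n}). (\<Sum>j\<in>E. e j) = s}"
    proof (rule inj_onI)
      fix e e' assume e: "e \<in> {e \<in> PiE E (\<lambda>_. {..n}). (\<Sum>j\<in>E. e j) = s}"
        and e': "e' \<in> {e \<in> PiE E (\<lambda>_. {..n}). (\<Sum>j\<in>E. e j) = s}"
        and eq: "restrict e (E - {c}) = restrict e' (E - {c})"
      have *: "e j = e' j" if "j \<in> E - {c}" for j using fun_cong[OF eq, of j] that by simp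
      then have "(\<Sum>j\<in>E - {c}. e j) = (\<Sum>j\<in>E - {c}. e' j)" by (intro sum.cong) auto
      moreover have "(\<Sum>j\<in>E. e j) = e c + (\<Sum>j\<in>E - {c}. e j)" "(\<Sum>j\<in>E. e' j) = e' c + (\<Sum>j\<in>E - {c}. e' j)"
        using assms c by (simp_all add: sum.remove)
      ultimately have "e c = e' c" using e e' by simp
      show "e = e'"
      proof
        fix j
        consider "j = c" | "j \<in> E - {c}" | "j \<notin> E" by blast
        then show "e j = e' j"
        proof cases
          case 3
          have "e \<in> PiE E (\<lambda>_. {..n})" "e' \<in> PiE E (\<lambda>_. {..n})" using e e' by simp_all
          then show ?thesis using PiE_arb[of e E _ j] PiE_arb[of e' E _ j] 3 by metis
        qed (use * \<open>e c = e' c\<close> in simp_all)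
      qed
    qed
    show "(\<lambda>e. restrict e (E - {c})) ` {e \<in> PiE E (\<lambda>_. {..n}). (\<Sum>j\<in>E. e j) = s} \<subseteq> PiE (E - {c}) (\<lambda>_. {..n})"
    proof (rule image_subsetI)
      fix e assume "e \<in> {e \<in> PiE E (\<lambda>_. {..n}). (\<Sum>j\<in>E. e j) = s}"
      then have "e j \<in> {..n}" if "j \<in> E" for j using that by (blast dest: PiE_mem)
      then show "restrict e (E - {c}) \<in> PiE (E - {c}) (\<lambda>_. {..n})" unfolding restrict_PiE_iff by blast
    qed
    show "finite (PiE (E - {c}) (\<lambda>_. {..n}))" using assms by (intro finite_PiE) auto
  qed
  also have "\<dots> = (n + 1) ^ (card E - 1)" using assms c by (simp add: card_PiE)
  finally show ?thesis .
qed

text \<open>The partner sum below \<open>y\<close> depends on \<open>y\<close>, which prevents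
  opening the square. It is therefore replaced by its value \<open>M e b\<close> at the start of the
  block of \<open>y\<close>; the remainder \<open>N\<close> is small because a block is short. With
  \<open>M\<close> constant on a block, the square opens into sums of
  \<open>\<alpha> e y * \<alpha> e' y\<close> over \<open>y\<close>, that is, into pair sums with a
  coincidence in the summed coordinate, for which \<open>V\<close> carries a gain. The relation
  \<open>R\<close> marks the few pairs without such a gain.\<close>

lemma cross_sum_bound:
  fixes \<alpha> :: "'e \<Rightarrow> nat \<Rightarrow> real" and M :: "'e \<Rightarrow> nat \<Rightarrow> real" and N :: "'e \<Rightarrow> nat \<Rightarrow> real"
    and A B B' V :: real
  assumes fin: "finite Es" "finite Y" "finite Bs" "blk ` Y \<subseteq> Bs"
    and \<alpha>: "\<And>e y. e \<in> Es \<Longrightarrow> y \<in> Y \<Longrightarrow> \<bar>\<alpha> e y\<bar> \<le> A" and M: "\<And>e b. e \<in> Es \<Longrightarrow> b \<in> Bs \<Longrightarrow> \<bar>M e b\<bar> \<le> B"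
    and N: "\<And>e y. e \<in> Es \<Longrightarrow> y \<in> Y \<Longrightarrow> \<bar>N e y\<bar> \<le> B'"
    and V: "\<And>b e e'. b \<in> Bs \<Longrightarrow> e \<in> Es \<Longrightarrow> e' \<in> Es \<Longrightarrow> \<not> R e e' \<Longrightarrow>
      \<bar>\<Sum>y\<in>{y \<in> Y. blk y = b}. \<alpha> e y * \<alpha> e' y\<bar> \<le> V"
    and R: "\<And>e. e \<in> Es \<Longrightarrow> card {e' \<in> Es. R e e'} \<le> \<rho>"
    and nn: "V \<ge> 0" "A \<ge> 0" "B \<ge> 0" "B' \<ge> 0"
  shows "(\<Sum>y\<in>Y. (\<Sum>e\<in>Es. \<alpha> e y * (M e (blk y) + N e y))\<^sup>2)
    \<le> 2 * card Bs * B\<^sup>2 * ((card Es)\<^sup>2 * V + card Es * \<rho> * (card Y * A\<^sup>2)) + 2 * card Y * (card Es * (A * B'))\<^sup>2"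
proof -
  define P where "P y = (\<Sum>e\<in>Es. \<alpha> e y * M e (blk y))" for y
  define Q where "Q y = (\<Sum>e\<in>Es. \<alpha> e y * N e y)" for y
  define T where "T e e' b = (\<Sum>y\<in>{y \<in> Y. blk y = b}. \<alpha> e y * \<alpha> e' y)" for e e' b
  have T_R: "\<bar>T e e' b\<bar> \<le> card Y * A\<^sup>2" if e: "e \<in> Es" "e' \<in> Es" for e e' b
  proof -
    have "\<bar>T e e' b\<bar> \<le> (\<Sum>y\<in>{y \<in> Y. blk y = b}. \<bar>\<alpha> e y * \<alpha> e' y\<bar>)" unfolding T_def by (rule sum_abs)
    also have "\<dots> \<le> (\<Sum>y\<in>Y. \<bar>\<alpha> e y * \<alpha> e' y\<bar>)" using fin by (intro sum_mono2) auto
    also have "\<dots> \<le> (\<Sum>y\<in>Y. A * A)" using \<alpha> e nn by (intro sum_mono) (auto simp: abs_mult intro!: mult_mono)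
    finally show ?thesis by (simp add: power2_eq_square)
  qed
  have T_le: "\<bar>T e e' b\<bar> \<le> V + (if R e e' then card Y * A\<^sup>2 else 0)" if "e \<in> Es" "e' \<in> Es" "b \<in> Bs" for e e' b
    using T_R[OF that(1,2), of b] V[of b e e'] that nn by (auto simp: T_def)
  have "(\<Sum>y\<in>Y. (P y)\<^sup>2) = (\<Sum>b\<in>Bs. \<Sum>y\<in>{y \<in> Y. blk y = b}. (P y)\<^sup>2)"
    using fin by (intro sum.group[symmetric]) auto
  also have "\<dots> = (\<Sum>b\<in>Bs. \<Sum>e\<in>Es. \<Sum>e'\<in>Es. M e b * M e' b * T e e' b)"
  proof (intro sum.cong refl)
    fix b assume "b \<in> Bs"
    have "(\<Sum>y\<in>{y \<in> Y. blk y = b}. (P y)\<^sup>2) =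
      (\<Sum>y\<in>{y \<in> Y. blk y = b}. \<Sum>e\<in>Es. \<Sum>e'\<in>Es. M e b * M e' b * (\<alpha> e y * \<alpha> e' y))"
      by (intro sum.cong) (auto simp: P_def power2_eq_square sum_product mult_ac)
    also have "\<dots> = (\<Sum>e\<in>Es. \<Sum>y\<in>{y \<in> Y. blk y = b}. \<Sum>e'\<in>Es. M e b * M e' b * (\<alpha> e y * \<alpha> e' y))"
      by (rule sum.swap)
    also have "\<dots> = (\<Sum>e\<in>Es. \<Sum>e'\<in>Es. \<Sum>y\<in>{y \<in> Y. blk y = b}. M e b * M e' b * (\<alpha> e y * \<alpha> e' y))"
      by (intro sum.cong refl sum.swap)
    finally show "(\<Sum>y\<in>{y \<in> Y. blk y = b}. (P y)\<^sup>2) = (\<Sum>e\<in>Es. \<Sum>e'\<in>Es. M e b * M e' b * T e e' b)"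
      by (simp add: T_def sum_distrib_left)
  qed
  also have "\<dots> \<le> (\<Sum>b\<in>Bs. \<Sum>e\<in>Es. \<Sum>e'\<in>Es. B * B * (V + (if R e e' then card Y * A\<^sup>2 else 0)))"
  proof (intro sum_mono)
    fix b e e' assume b: "b \<in> Bs" "e \<in> Es" "e' \<in> Es"
    have "M e b * M e' b * T e e' b \<le> \<bar>M e b\<bar> * \<bar>M e' b\<bar> * \<bar>T e e' b\<bar>"
      using abs_ge_self[of "M e b * M e' b * T e e' b"] by (simp add: abs_mult)
    also have "\<dots> \<le> B * B * (V + (if R e e' then card Y * A\<^sup>2 else 0))"
      using b M T_le nn by (intro mult_mono) auto
    finally show "M e b * M e' b * T e e' b \<le> B * B * (V + (if R e e' then card Y * A\<^sup>2 else 0))" .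
  qed
  also have "\<dots> = (\<Sum>b\<in>Bs. B * B * (\<Sum>e\<in>Es. card Es * V + card {e' \<in> Es. R e e'} * (card Y * A\<^sup>2)))"
    using fin by (simp add: sum_distrib_left[symmetric] sum.distrib sum.inter_filter[symmetric])
  also have "\<dots> \<le> (\<Sum>b\<in>Bs. B * B * (\<Sum>e\<in>Es. card Es * V + \<rho> * (card Y * A\<^sup>2)))"
    using R by (intro sum_mono mult_left_mono add_left_mono mult_right_mono) auto
  also have "\<dots> = card Bs * B\<^sup>2 * ((card Es)\<^sup>2 * V + card Es * \<rho> * (card Y * A\<^sup>2))"
    by (simp add: power2_eq_square algebra_simps)
  finally have PP: "(\<Sum>y\<in>Y. (P y)\<^sup>2) \<le> card Bs * B\<^sup>2 * ((card Es)\<^sup>2 * V + card Es * \<rho> * (card Y * A\<^sup>2))" .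
  have QQ: "(\<Sum>y\<in>Y. (Q y)\<^sup>2) \<le> card Y * (card Es * (A * B'))\<^sup>2"
  proof -
    have "(Q y)\<^sup>2 \<le> (card Es * (A * B'))\<^sup>2" if "y \<in> Y" for y
    proof -
      have "\<bar>Q y\<bar> \<le> (\<Sum>e\<in>Es. \<bar>\<alpha> e y * N e y\<bar>)" unfolding Q_def by (rule sum_abs)
      also have "\<dots> \<le> (\<Sum>e\<in>Es. A * B')" using \<alpha> N that nn by (intro sum_mono) (auto simp: abs_mult intro!: mult_mono)
      finally show ?thesis using power_mono[of "\<bar>Q y\<bar>" "card Es * (A * B')" 2] by simp
    qed
    then have "(\<Sum>y\<in>Y. (Q y)\<^sup>2) \<le> (\<Sum>y\<in>Y. (card Es * (A * B'))\<^sup>2)" by (rule sum_mono)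
    then show ?thesis by simp
  qed
  have "(\<Sum>y\<in>Y. (\<Sum>e\<in>Es. \<alpha> e y * (M e (blk y) + N e y))\<^sup>2) = (\<Sum>y\<in>Y. (P y + Q y)\<^sup>2)"
    by (simp add: P_def Q_def algebra_simps sum.distrib)
  also have "\<dots> \<le> (\<Sum>y\<in>Y. 2 * (P y)\<^sup>2 + 2 * (Q y)\<^sup>2)"
  proof (intro sum_mono)
    fix y show "(P y + Q y)\<^sup>2 \<le> 2 * (P y)\<^sup>2 + 2 * (Q y)\<^sup>2"
      using sum_squares_bound[of "P y" "Q y"] by (simp add: power2_sum)
  qed
  also have "\<dots> = 2 * (\<Sum>y\<in>Y. (P y)\<^sup>2) + 2 * (\<Sum>y\<in>Y. (Q y)\<^sup>2)" by (simp add: sum.distrib sum_distrib_left)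
  finally show ?thesis using PP QQ by (simp add: algebra_simps)
qed

text \<open>With blocks of length about \<open>K powr (1 - g / 2)\<close> there are about
  \<open>K powr (g / 2)\<close> of them. Their number spends half of the gain \<open>g\<close> in
  the first term, while the shortness of a block wins the same \<open>g / 2\<close> in the
  remainder. The resonant pairs win a whole factor \<open>K\<close> before the blocks are counted. A
  gain of \<open>g / 2\<close> in the square is the final \<open>g / 4\<close>.\<close>

lemma cross_numeric:
  fixes K l g C L nb :: real and p m a :: nat
  assumes K: "K \<ge> 1" and l: "l \<ge> 1" and p: "p \<ge> 1" and m: "m \<ge> 2" and g: "0 < g" "g \<le> 1" and C: "C \<ge> 0"
    and L: "0 \<le> L" "L \<le> 2 * K powr (1 - g / 2)" and nb: "0 \<le> nb" "nb \<le> 2 * K powr (g / 2)"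
  shows "2 * nb * (l ^ (m - 1) * sqrt (K ^ (m - 1)))\<^sup>2 * ((K ^ p)\<^sup>2 * (C * l ^ a * K powr (m - 1 - g))
      + K ^ p * K ^ (p - 1) * (K * (l ^ (m - 2) * sqrt (K ^ (m - 2)))\<^sup>2))
    + 2 * K * (K ^ p * ((l ^ (m - 2) * sqrt (K ^ (m - 2))) * (l ^ (m - 1) * sqrt (L * K ^ (m - 2)))))\<^sup>2
    \<le> (2 * (C + 2) * l ^ (a + 4 * m) * K powr (p + m - 1 - g / 4))\<^sup>2"
proof -
  define Z where "Z = l ^ (2 * (a + 4 * m)) * K powr (2 * real p + 2 * real m - 2 - g / 2)"
  have Kp: "K ^ i = K powr i" for i :: nat using K by (simp add: powr_realpow)
  have lp: "l ^ i \<le> l ^ (2 * (a + 4 * m))" if "i \<le> 2 * (a + 4 * m)" for i using l that by (intro power_increasing) auto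
  have r1: "real (m - 1) = real m - 1" "real (m - 2) = real m - 2" "real (p - 1) = real p - 1" "real (p + m - 1) = real p + real m - 1"
    using m p by auto
  have Z0: "Z \<ge> 0" using l by (simp add: Z_def)
  have sq1: "(l ^ (m - 1) * sqrt (K ^ (m - 1)))\<^sup>2 = l ^ (2 * (m - 1)) * K powr (real m - 1)"
    using K unfolding Kp r1 by (simp add: power_mult_distrib power_mult[symmetric] mult.commute)
  have sq2: "(l ^ (m - 2) * sqrt (K ^ (m - 2)))\<^sup>2 = l ^ (2 * (m - 2)) * K powr (real m - 2)"
    using K unfolding Kp r1 by (simp add: power_mult_distrib power_mult[symmetric] mult.commute)
  have sq3: "(l ^ (m - 1) * sqrt (L * K ^ (m - 2)))\<^sup>2 = l ^ (2 * (m - 1)) * (L * K powr (real m - 2))"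
    using K L unfolding Kp r1 by (simp add: power_mult_distrib power_mult[symmetric] mult.commute)
  have K2p: "(K ^ p)\<^sup>2 = K powr (2 * real p)" using K by (simp add: Kp power2_eq_square powr_add[symmetric])
  have K1: "K = K powr 1" using K by simp
  have t1: "2 * nb * (l ^ (m - 1) * sqrt (K ^ (m - 1)))\<^sup>2 * ((K ^ p)\<^sup>2 * (C * l ^ a * K powr (m - 1 - g))) \<le> 4 * C * Z"
  proof -
    have e: "K powr (2 * real p + 2 * real m - 2 - g) = K powr (real m - 1) * K powr (2 * real p) * K powr (m - 1 - g)"
      unfolding r1 by (simp add: algebra_simps flip: powr_add)
    have "2 * nb * (l ^ (m - 1) * sqrt (K ^ (m - 1)))\<^sup>2 * ((K ^ p)\<^sup>2 * (C * l ^ a * K powr (m - 1 - g)))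
       = 2 * C * l ^ (2 * (m - 1) + a) * (nb * K powr (2 * real p + 2 * real m - 2 - g))"
      unfolding sq1 K2p e power_add by (simp only: mult_ac)
    also have "\<dots> \<le> 2 * C * l ^ (2 * (a + 4 * m)) * ((2 * K powr (g / 2)) * K powr (2 * real p + 2 * real m - 2 - g))"
      using C nb l by (intro mult_mono lp mult_nonneg_nonneg) auto
    also have "\<dots> = 4 * C * l ^ (2 * (a + 4 * m)) * (K powr (g / 2) * K powr (2 * real p + 2 * real m - 2 - g))" by simp
    also have "K powr (g / 2) * K powr (2 * real p + 2 * real m - 2 - g) = K powr (2 * real p + 2 * real m - 2 - g / 2)"
      by (simp add: algebra_simps flip: powr_add)
    finally show ?thesis by (simp only: Z_def mult.assoc)
  qed
  have t2: "2 * nb * (l ^ (m - 1) * sqrt (K ^ (m - 1)))\<^sup>2 * (K ^ p * K ^ (p - 1) * (K * (l ^ (m - 2) * sqrt (K ^ (m - 2)))\<^sup>2)) \<le> 4 * Z"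
  proof -
    define w where "w = K powr (real m - 1) * (K ^ p * K ^ (p - 1) * (K * K powr (real m - 2)))"
    have w: "w = K powr (2 * real p + 2 * real m - 3)"
    proof -
      have "w = K powr (real m - 1) * (K powr real p * K powr (real p - 1) * (K powr 1 * K powr (real m - 2)))"
        unfolding w_def Kp r1 using K by simp
      also have "\<dots> = K powr ((real m - 1) + (p + (real p - 1) + (1 + (real m - 2))))" by (simp only: powr_add)
      also have "(real m - 1) + (p + (real p - 1) + (1 + (real m - 2))) = 2 * real p + 2 * real m - 3" by simp
      finally show ?thesis .
    qed
    have w0: "w \<ge> 0" unfolding w by simp
    have "2 * nb * (l ^ (m - 1) * sqrt (K ^ (m - 1)))\<^sup>2 * (K ^ p * K ^ (p - 1) * (K * (l ^ (m - 2) * sqrt (K ^ (m - 2)))\<^sup>2))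
       = 2 * l ^ (2 * (m - 1) + 2 * (m - 2)) * (nb * w)"
      unfolding sq1 sq2 w_def power_add by (simp only: mult_ac)
    also have "\<dots> \<le> 2 * l ^ (2 * (a + 4 * m)) * ((2 * K powr (g / 2)) * w)"
      using nb l w0 by (intro mult_mono lp mult_nonneg_nonneg) auto
    also have "\<dots> = 4 * l ^ (2 * (a + 4 * m)) * K powr (g / 2 + (2 * real p + 2 * real m - 3))"
      unfolding w powr_add[of K "g / 2"] by simp
    also have "\<dots> \<le> 4 * l ^ (2 * (a + 4 * m)) * K powr (2 * real p + 2 * real m - 2 - g / 2)"
      using K l g by (intro mult_left_mono powr_mono) auto
    finally show ?thesis by (simp only: Z_def mult.assoc)
  qed
  have t3: "2 * K * (K ^ p * ((l ^ (m - 2) * sqrt (K ^ (m - 2))) * (l ^ (m - 1) * sqrt (L * K ^ (m - 2)))))\<^sup>2 \<le> 4 * Z"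
  proof -
    define w where "w = K * K powr (2 * real p) * K powr (real m - 2) * K powr (real m - 2)"
    have w: "w = K powr (1 + 2 * real p + (real m - 2) + (real m - 2))"
    proof -
      have "w = K powr 1 * K powr (2 * real p) * K powr (real m - 2) * K powr (real m - 2)"
        using K by (simp add: w_def)
      then show ?thesis by (simp only: powr_add)
    qed
    have w0: "w \<ge> 0" unfolding w by simp
    have "2 * K * (K ^ p * ((l ^ (m - 2) * sqrt (K ^ (m - 2))) * (l ^ (m - 1) * sqrt (L * K ^ (m - 2)))))\<^sup>2
      = 2 * K * (K powr (2 * real p) * ((l ^ (2 * (m - 2)) * K powr (real m - 2)) * (l ^ (2 * (m - 1)) * (L * K powr (real m - 2)))))"
      unfolding power_mult_distrib[of "K ^ p"] power_mult_distrib[of "l ^ (m - 2) * sqrt (K ^ (m - 2))"] sq2 sq3 K2p ..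
    also have "\<dots> = 2 * l ^ (2 * (m - 2) + 2 * (m - 1)) * (L * w)"
      unfolding w_def power_add by (simp only: mult_ac)
    also have "\<dots> \<le> 2 * l ^ (2 * (a + 4 * m)) * ((2 * K powr (1 - g / 2)) * w)"
      using L l w0 by (intro mult_mono lp mult_nonneg_nonneg) auto
    also have "\<dots> = 4 * l ^ (2 * (a + 4 * m)) * K powr ((1 - g / 2) + (1 + 2 * real p + (real m - 2) + (real m - 2)))"
      unfolding w powr_add[of K "1 - g / 2"] by simp
    also have "(1 - g / 2) + (1 + 2 * real p + (real m - 2) + (real m - 2)) = 2 * real p + 2 * real m - 2 - g / 2" by simp
    finally show ?thesis by (simp only: Z_def mult.assoc)
  qed
  have "4 * C * Z + 4 * Z + 4 * Z \<le> 4 * (C + 2)\<^sup>2 * Z"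
    using C Z0 mult_right_mono[of "C + 2" "(C + 2)\<^sup>2" "4 * Z"] by (simp add: power2_eq_square algebra_simps)
  also have "4 * (C + 2)\<^sup>2 * Z = (2 * (C + 2) * l ^ (a + 4 * m) * K powr (p + m - 1 - g / 4))\<^sup>2"
  proof -
    have "(K powr (p + m - 1 - g / 4))\<^sup>2 = K powr (2 * real p + 2 * real m - 2 - g / 2)"
      unfolding r1 power2_eq_square powr_add[symmetric] by (rule arg_cong[where f = "(powr) K"]) simp
    moreover have "(l ^ (a + 4 * m))\<^sup>2 = l ^ (2 * (a + 4 * m))" by (simp only: power_mult[symmetric] mult.commute)
    ultimately show ?thesis unfolding Z_def power_mult_distrib by (simp only: mult.assoc) simp
  qed
  finally have le: "4 * C * Z + 4 * Z + 4 * Z \<le> (2 * (C + 2) * l ^ (a + 4 * m) * K powr (p + m - 1 - g / 4))\<^sup>2" .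
  show ?thesis unfolding distrib_left using t1 t2 t3 le[unfolded distrib_left] by linarith
qed

lemma block_length:
  fixes K e :: real
  assumes "K = real n + 1" "0 \<le> e" "e \<le> 1"
  obtains L :: nat where "L \<ge> 1" "L \<le> n + 1" "K powr (1 - e) \<le> L" "L \<le> 2 * K powr (1 - e)" "n div L + 1 \<le> 2 * K powr e"
proof
  define L where "L = nat \<lceil>K powr (1 - e)\<rceil>"
  have K: "K \<ge> 1" using assms by simp
  have p: "K powr (1 - e) \<ge> 1" "K powr e \<ge> 1" using K assms by (auto intro: ge_one_powr_ge_zero)
  have L: "real L = \<lceil>K powr (1 - e)\<rceil>" unfolding L_def using p by (simp add: of_nat_nat)
  show 1: "K powr (1 - e) \<le> L" unfolding L by (rule le_of_int_ceiling)
  show L1: "L \<ge> 1" using 1 p by linarith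
  show "L \<le> 2 * K powr (1 - e)" unfolding L using p by linarith
  have "K powr (1 - e) \<le> K powr 1" using K assms by (intro powr_mono) auto
  then have "K powr (1 - e) \<le> real n + 1" using K assms by simp
  then have "\<lceil>K powr (1 - e)\<rceil> \<le> int (n + 1)" by linarith
  then show "L \<le> n + 1" unfolding L_def by (simp only: nat_le_iff)
  have "real (n div L) \<le> n / L" by (rule of_nat_div_le_of_nat)
  also have "\<dots> \<le> K / K powr (1 - e)" using 1 p assms K by (intro frac_le) auto
  also have "\<dots> = K powr e" using K by (simp add: powr_diff)
  finally show "n div L + 1 \<le> 2 * K powr e" using p by simp
qed

section \<open>Beck's gain\<close>

text \<open>Square root cancellation in the two factors of each term of \<open>psum d n f E J J'\<close> alone gives the exponent
  \<open>card E + m - 1\<close>. The point is the gain \<open>g\<close> over it, which needs that no pair consists of equal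
  indices: this is what the condition on the sums of \<open>x\<close> and \<open>x'\<close> ensures.\<close>

definition pair_bound :: "nat \<Rightarrow> nat \<Rightarrow> real \<Rightarrow> nat \<Rightarrow> nat \<Rightarrow> real \<Rightarrow> bool" where
  "pair_bound d m C a k g \<longleftrightarrow> (\<forall>n l f E U J J' x x'. rsys d n f \<longrightarrow> l \<ge> 1 \<longrightarrow> E \<union> U \<subseteq> {..<d} \<longrightarrow>
     E \<inter> U = {} \<longrightarrow> E \<noteq> {} \<longrightarrow> card U = m \<longrightarrow> (\<forall>j<d. J j \<subseteq> {..n} \<and> J' j \<subseteq> {..n}) \<longrightarrow>
     (\<forall>j<d. j \<notin> E \<union> U \<longrightarrow> J j \<subseteq> {x j} \<and> J' j \<subseteq> {x' j}) \<longrightarrow>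
     (\<Sum>j\<in>{..<d} - (E \<union> U). x j) \<noteq> (\<Sum>j\<in>{..<d} - (E \<union> U). x' j) \<longrightarrow>
     wop d n l k (\<lambda>w. \<bar>psum d n f E J J' w\<bar> \<le> C * l ^ a * (real n + 1) powr (real (card E + m - 1) - g)))"

lemmas pair_boundD = pair_bound_def[THEN iffD1, rule_format]

lemma card_PiE_le: "E \<subseteq> {..<d} \<Longrightarrow> card (PiE E (\<lambda>_. {..n})) \<le> (n + 2) ^ d"
proof -
  assume E: "E \<subseteq> {..<d}"
  then have "finite E" "card E \<le> d" using card_mono[of "{..<d}" E] by (auto intro: finite_subset)
  then have "card (PiE E (\<lambda>_. {..n})) = (n + 1) ^ card E" by (simp add: card_PiE)
  also have "\<dots> \<le> (n + 2) ^ card E" by (intro power_mono) auto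
  also have "\<dots> \<le> (n + 2) ^ d" using \<open>card E \<le> d\<close> by (intro power_increasing) auto
  finally show ?thesis .
qed

text \<open>Opening the square compares \<open>J\<close> with itself for two coincidence tuples
  \<open>e\<close> and \<open>e'\<close>. If their sums differ, the levels fixed outside
  \<open>U\<close> have different sums, which is exactly the condition of \<open>pair_bound\<close>;
  tuples with equal sums are the resonant ones. Since \<open>J\<close> is never compared with
  \<open>J'\<close> here, the fixed levels of the two boxes may well agree.\<close>

lemma cross_bound:
  fixes C1 g :: real
  assumes G: "pair_bound d (m - 1) C1 a1 k1 g" "0 < g" "g \<le> 1" "0 \<le> C1" and m: "2 \<le> m"
    and f: "rsys d n f" and l: "1 \<le> l"
    and EU: "E \<union> U \<subseteq> {..<d}" "E \<inter> U = {}" "E \<noteq> {}" "card U = m" "c \<in> U"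
    and J: "\<And>j. j < d \<Longrightarrow> J j \<subseteq> {..n}" "\<And>j. j < d \<Longrightarrow> J' j \<subseteq> {..n}"
    and X: "\<And>j. j < d \<Longrightarrow> j \<notin> E \<union> U \<Longrightarrow> \<exists>x. J j \<subseteq> {x}"
    and X': "\<And>j. j < d \<Longrightarrow> j \<notin> E \<union> U \<Longrightarrow> \<exists>x. J' j \<subseteq> {x}"
  shows "wop d n l (k1 + 2 * m + 2 * d + 5) (\<lambda>w. \<bar>cross d n f c E J J' w\<bar> \<le>
    2 * (C1 + 2) * l ^ (a1 + 4 * m + 1) * (real n + 1) powr (card E + m - 1 - g / 4))"
proof -
  define K where "K = real n + 1"
  have finE: "finite E" and finU: "finite U" and cd: "c < d" and cE: "c \<notin> E"
    using EU by (auto intro: finite_subset)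
  have "card (U - {c}) = m - 1" using EU finU by simp
  have "U - {c} \<noteq> {}"
  proof
    assume "U - {c} = {}"
    then have "m - 1 = 0" using \<open>card (U - {c}) = m - 1\<close> by (simp only: card.empty)
    then show False using m by simp
  qed
  \<comment> \<open>\<open>c1\<close> is left to the condition on the sum; the other coordinates of
    \<open>U\<close> provide the cancellation in \<open>\<alpha>\<close>, \<open>M\<close> and
    \<open>N\<close>.\<close>
  then obtain c1 where c1: "c1 \<in> U" "c1 \<noteq> c" by blast
  have c1d: "c1 < d" using c1 EU by auto
  obtain L where L: "L \<ge> 1" "K powr (1 - g / 2) \<le> real L" "real L \<le> 2 * K powr (1 - g / 2)"
    "real (n div L + 1) \<le> 2 * K powr (g / 2)"
  proof (rule block_length[OF K_def, of "g / 2"])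
    show "0 \<le> g / 2" "g / 2 \<le> 1" using G by simp_all
  qed (rule that, auto)
  define Es where "Es = PiE E (\<lambda>_. {..n})"
  define blk where "blk y = y div L" for y
  define Bs where "Bs = {..n div L}"
  define R where "R e e' \<longleftrightarrow> (\<Sum>j\<in>E. e j) = (\<Sum>j\<in>E. e' j)" for e e' :: "nat \<Rightarrow> nat"
  define \<alpha> where "\<alpha> w e y = hsum d n f ((fx E e J)(c := {y})) w" for w e y
  define M where "M w e b = hsum d n f ((fx E e J')(c := J' c \<inter> {..<b * L})) w" for w e b
  define N where "N w e y = hsum d n f ((fx E e J')(c := J' c \<inter> {blk y * L..<y})) w" for w e y
  define A where "A = l ^ (m - 2) * sqrt (K ^ (m - 2))"
  define B where "B = l ^ (m - 1) * sqrt (K ^ (m - 1))"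
  define B' where "B' = l ^ (m - 1) * sqrt (L * K ^ (m - 2))"
  define V where "V = C1 * l ^ a1 * K powr (m - 1 - g)"
  define S where "S b = {y \<in> J c. blk y = b}" for b
  define kk where "kk = k1 + 2 * m + 2 * d + 1"
  have l0: "l \<ge> 0" using l by simp
  have K0: "K \<ge> 1" by (simp add: K_def)
  have finEs: "finite Es" unfolding Es_def using finE by (intro finite_PiE) auto
  have cEs: "card Es = (n + 1) ^ card E" unfolding Es_def using finE by (simp add: card_PiE)
  have Es_le: "card Es \<le> (n + 2) ^ d" unfolding Es_def using EU by (intro card_PiE_le) auto
  have finJ: "finite (J c)" using J(1)[OF cd] by (auto intro: finite_subset)
  have cJ: "card (J c) \<le> n + 1" using card_mono[OF _ J(1)[OF cd]] by simp
  have cBs: "card Bs = n div L + 1" by (simp add: Bs_def)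
  have Ls: "card Bs \<le> n + 2" unfolding cBs using div_le_dividend[of n L] by linarith
  have nn: "V \<ge> 0" "A \<ge> 0" "B \<ge> 0" "B' \<ge> 0" using l0 K0 G by (auto simp: V_def A_def B_def B'_def)
  have w\<alpha>: "wop d n l kk (\<lambda>w. \<forall>p\<in>Es \<times> J c. \<bar>\<alpha> w (fst p) (snd p)\<bar> \<le> A)"
  proof (rule wop_mono[OF wop_all[where m = "d + 1" and k = "2 * (m - 2)"]])
    have "card (Es \<times> J c) \<le> (n + 2) ^ d * (n + 2)"
      unfolding card_cartesian_product using Es_le cJ by (intro mult_mono) auto
    then show "card (Es \<times> J c) \<le> (n + 2) ^ (d + 1)" by (simp only: power_add power_one_right)
    fix p assume p: "p \<in> Es \<times> J c"
    have cU: "card (U - {c, c1}) = m - 2"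
      using EU c1 finU by (subst card_Diff_subset) auto
    have "wop d n l (2 * card (U - {c, c1})) (\<lambda>w. \<bar>hsum d n f ((fx E (fst p) J)(c := {snd p})) w\<bar> \<le>
        l ^ card (U - {c, c1}) * sqrt ((real n + 1) ^ card (U - {c, c1})))"
    proof (rule hsum_bound_all[OF f l0 c1d])
      fix j assume j: "j < d" "j \<noteq> c1" "j \<notin> U - {c, c1}"
      then have "j = c \<or> j \<in> E \<or> j \<notin> E \<union> U" by auto
      then show "\<exists>x. ((fx E (fst p) J)(c := {snd p})) j \<subseteq> {x}" using X[OF j(1)] by (auto simp: fx_def)
    next
      fix j assume "j \<in> U - {c, c1}"
      then show "((fx E (fst p) J)(c := {snd p})) j \<subseteq> {..n}" using J(1)[of j] EU by (auto simp: fx_def)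
    qed (use EU finU in auto)
    then show "wop d n l (2 * (m - 2)) (\<lambda>w. \<bar>\<alpha> w (fst p) (snd p)\<bar> \<le> A)"
      unfolding cU by (simp add: \<alpha>_def A_def K_def)
  qed (use finEs finJ in \<open>auto simp: kk_def\<close>)
  have wM: "wop d n l kk (\<lambda>w. \<forall>p\<in>Es \<times> Bs. \<bar>M w (fst p) (snd p)\<bar> \<le> B)"
  proof (rule wop_mono[OF wop_all[where m = "d + 1" and k = "2 * (m - 1)"]])
    have "card (Es \<times> Bs) \<le> (n + 2) ^ d * (n + 2)"
      unfolding card_cartesian_product using Es_le Ls by (intro mult_mono) auto
    then show "card (Es \<times> Bs) \<le> (n + 2) ^ (d + 1)" by (simp only: power_add power_one_right)
    fix p assume p: "p \<in> Es \<times> Bs"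
    have cU: "card (U - {c1}) = m - 1" using EU c1 finU by simp
    have "wop d n l (2 * card (U - {c1})) (\<lambda>w. \<bar>hsum d n f ((fx E (fst p) J')(c := J' c \<inter> {..<snd p * L})) w\<bar> \<le>
        l ^ card (U - {c1}) * sqrt ((real n + 1) ^ card (U - {c1})))"
    proof (rule hsum_bound_all[OF f l0 c1d])
      fix j assume j: "j < d" "j \<noteq> c1" "j \<notin> U - {c1}"
      then have "j \<noteq> c" "j \<in> E \<or> j \<notin> E \<union> U" using EU by auto
      then show "\<exists>x. ((fx E (fst p) J')(c := J' c \<inter> {..<snd p * L})) j \<subseteq> {x}" using X'[OF j(1)] by (auto simp: fx_def)
    next
      fix j assume "j \<in> U - {c1}"
      then show "((fx E (fst p) J')(c := J' c \<inter> {..<snd p * L})) j \<subseteq> {..n}" using J(2)[of j] EU by (auto simp: fx_def)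
    qed (use EU finU in auto)
    then show "wop d n l (2 * (m - 1)) (\<lambda>w. \<bar>M w (fst p) (snd p)\<bar> \<le> B)"
      unfolding cU by (simp add: M_def B_def K_def)
  qed (use finEs in \<open>auto simp: kk_def Bs_def\<close>)
  have wN: "wop d n l kk (\<lambda>w. \<forall>p\<in>Es \<times> J c. \<bar>N w (fst p) (snd p)\<bar> \<le> B')"
  proof (rule wop_mono[OF wop_all[where m = "d + 1" and k = "2 * (m - 1)"]])
    have "card (Es \<times> J c) \<le> (n + 2) ^ d * (n + 2)"
      unfolding card_cartesian_product using Es_le cJ by (intro mult_mono) auto
    then show "card (Es \<times> J c) \<le> (n + 2) ^ (d + 1)" by (simp only: power_add power_one_right)
    fix p assume p: "p \<in> Es \<times> J c"
    let ?y = "snd p"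
    have cU: "card (U - {c1}) = m - 1" using EU c1 finU by simp
    have "wop d n l (2 * card (U - {c1})) (\<lambda>w. \<bar>hsum d n f ((fx E (fst p) J')(c := J' c \<inter> {blk ?y * L..<?y})) w\<bar> \<le>
        l ^ card (U - {c1}) * sqrt (L * (real n + 1) ^ (card (U - {c1}) - 1)))"
    proof (rule hsum_bound_short[OF f l0 c1d])
      fix j assume j: "j < d" "j \<noteq> c1" "j \<notin> U - {c1}"
      then have "j \<noteq> c" "j \<in> E \<or> j \<notin> E \<union> U" using EU by auto
      then show "\<exists>x. ((fx E (fst p) J')(c := J' c \<inter> {blk ?y * L..<?y})) j \<subseteq> {x}" using X'[OF j(1)] by (auto simp: fx_def)
    next
      fix j assume "j \<in> U - {c1}"
      then show "((fx E (fst p) J')(c := J' c \<inter> {blk ?y * L..<?y})) j \<subseteq> {..n}" using J(2)[of j] EU by (auto simp: fx_def)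
    next
      show "c \<in> U - {c1}" using EU c1 by auto
      have "card (J' c \<inter> {blk ?y * L..<?y}) \<le> card {blk ?y * L..<?y}" by (intro card_mono) auto
      also have "\<dots> = ?y mod L" by (simp add: blk_def minus_div_mult_eq_mod)
      also have "\<dots> \<le> L" using L(1) by (simp add: less_imp_le)
      finally show "card (((fx E (fst p) J')(c := J' c \<inter> {blk ?y * L..<?y})) c) \<le> L" by simp
    qed (use EU finU in auto)
    then show "wop d n l (2 * (m - 1)) (\<lambda>w. \<bar>N w (fst p) (snd p)\<bar> \<le> B')"
      unfolding cU using m by (simp add: N_def B'_def K_def numeral_2_eq_2)
  qed (use finEs finJ in \<open>auto simp: kk_def\<close>)
  obtain x where x: "\<And>j. j < d \<Longrightarrow> j \<notin> E \<union> U \<Longrightarrow> J j \<subseteq> {x j}" using X by metis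
  have V_eq: "(\<Sum>y\<in>S b. \<alpha> w e y * \<alpha> w e' y) = psum d n f {c} ((fx E e J)(c := S b)) ((fx E e' J)(c := S b)) w" for w e e' b
    using J(1)[OF cd] cd by (subst psum_single) (auto simp: \<alpha>_def S_def)
  have wV: "wop d n l kk (\<lambda>w. \<forall>p\<in>{p \<in> Es \<times> Es \<times> Bs. \<not> R (fst p) (fst (snd p))}.
      \<bar>\<Sum>y\<in>S (snd (snd p)). \<alpha> w (fst p) y * \<alpha> w (fst (snd p)) y\<bar> \<le> V)"
  proof (rule wop_mono[OF wop_all[where m = "2 * d + 1" and k = k1]])
    have "card {p \<in> Es \<times> Es \<times> Bs. \<not> R (fst p) (fst (snd p))} \<le> card (Es \<times> Es \<times> Bs)"
      using finEs by (intro card_mono) (auto simp: Bs_def)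
    also have "\<dots> \<le> (n + 2) ^ d * ((n + 2) ^ d * (n + 2))"
      unfolding card_cartesian_product using Es_le Ls by (intro mult_mono) auto
    finally show "card {p \<in> Es \<times> Es \<times> Bs. \<not> R (fst p) (fst (snd p))} \<le> (n + 2) ^ (2 * d + 1)"
      by (simp only: power_add power_one_right mult_2 mult.assoc)
    fix p assume "p \<in> {p \<in> Es \<times> Es \<times> Bs. \<not> R (fst p) (fst (snd p))}"
    then obtain e e' b where p: "p = (e, e', b)" "e \<in> Es" "e' \<in> Es" "\<not> R e e'" by (cases p) auto
    \<comment> \<open>With \<open>e\<close> given, the coordinates of \<open>E\<close> count as
      fixed, and \<open>c\<close> is the only coincidence.\<close>
    let ?x = "\<lambda>e j. if j \<in> E then e j else x j"
    have UE: "{..<d} - ({c} \<union> (U - {c})) = E \<union> ({..<d} - (E \<union> U))" using EU by auto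
    have sums: "(\<Sum>j\<in>{..<d} - ({c} \<union> (U - {c})). ?x e j) = (\<Sum>j\<in>E. e j) + (\<Sum>j\<in>{..<d} - (E \<union> U). x j)" for e
    proof -
      have "(\<Sum>j\<in>E \<union> ({..<d} - (E \<union> U)). ?x e j) = (\<Sum>j\<in>E. ?x e j) + (\<Sum>j\<in>{..<d} - (E \<union> U). ?x e j)"
        using finE by (intro sum.union_disjoint) auto
      also have "\<dots> = (\<Sum>j\<in>E. e j) + (\<Sum>j\<in>{..<d} - (E \<union> U). x j)"
        by (intro arg_cong2[where f = "(+)"] sum.cong) auto
      finally show ?thesis unfolding UE .
    qed
    have "wop d n l k1 (\<lambda>w. \<bar>psum d n f {c} ((fx E e J)(c := S b)) ((fx E e' J)(c := S b)) w\<bar> \<le>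
      C1 * l ^ a1 * (real n + 1) powr (card {c} + (m - 1) - 1 - g))"
    proof (rule pair_boundD[OF G(1), where E = "{c}" and U = "U - {c}" and x = "?x e" and x' = "?x e'"])
      show "rsys d n f" by fact
      show "1 \<le> l" by fact
      show "{c} \<union> (U - {c}) \<subseteq> {..<d}" "{c} \<inter> (U - {c}) = {}" "{c} \<noteq> {}" "card (U - {c}) = m - 1"
        using EU finU by auto
      show "((fx E e J)(c := S b)) j \<subseteq> {..n} \<and> ((fx E e' J)(c := S b)) j \<subseteq> {..n}" if "j < d" for j
        using J(1)[OF that] J(1)[OF cd] by (auto simp: fx_def S_def)
      show "((fx E e J)(c := S b)) j \<subseteq> {?x e j} \<and> ((fx E e' J)(c := S b)) j \<subseteq> {?x e' j}"
        if "j < d" "j \<notin> {c} \<union> (U - {c})" for j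
        using x[OF that(1)] that by (auto simp: fx_def)
      show "(\<Sum>j\<in>{..<d} - ({c} \<union> (U - {c})). ?x e j) \<noteq> (\<Sum>j\<in>{..<d} - ({c} \<union> (U - {c})). ?x e' j)"
        using p unfolding sums by (simp add: R_def)
    qed
    then show "wop d n l k1 (\<lambda>w. \<bar>\<Sum>y\<in>S (snd (snd p)). \<alpha> w (fst p) y * \<alpha> w (fst (snd p)) y\<bar> \<le> V)"
      unfolding V_eq p using m by (simp add: V_def K_def)
  qed (use finEs in \<open>auto simp: kk_def Bs_def\<close>)
  define b where "b = 2 * (C1 + 2) * l ^ (a1 + 4 * m) * K powr (card E + m - 1 - g / 4)"
  have psum_eq: "psum d n f E (J(c := {y})) (J'(c := J' c \<inter> {..<y})) w = (\<Sum>e\<in>Es. \<alpha> w e y * (M w e (blk y) + N w e y))"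
    if "y \<in> J c" for y w
  proof -
    have "blk y * L \<le> y" by (simp add: blk_def)
    then have un: "J' c \<inter> {..<y} = (J' c \<inter> {..<blk y * L}) \<union> (J' c \<inter> {blk y * L..<y})" by auto
    have "hsum d n f ((fx E e J')(c := J' c \<inter> {..<y})) w = M w e (blk y) + N w e y" for e
      unfolding M_def N_def un using cd by (intro hsum_union) auto
    then show ?thesis by (simp add: psum_def Es_def fx_upd[OF cE] \<alpha>_def)
  qed
  have "wop d n l (kk + 1 + 1 + 1) (\<lambda>w. ((
      (\<forall>p\<in>Es \<times> J c. \<bar>\<alpha> w (fst p) (snd p)\<bar> \<le> A) \<and> (\<forall>p\<in>Es \<times> Bs. \<bar>M w (fst p) (snd p)\<bar> \<le> B)) \<and>
      (\<forall>p\<in>Es \<times> J c. \<bar>N w (fst p) (snd p)\<bar> \<le> B')) \<and>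
      (\<forall>p\<in>{p \<in> Es \<times> Es \<times> Bs. \<not> R (fst p) (fst (snd p))}.
      \<bar>\<Sum>y\<in>S (snd (snd p)). \<alpha> w (fst p) y * \<alpha> w (fst (snd p)) y\<bar> \<le> V))"
    by (intro wop_conj w\<alpha> wop_mono[OF wM] wop_mono[OF wN] wop_mono[OF wV]) auto
  then have "wop d n l (kk + 3) (\<lambda>w. (\<Sum>y\<in>J c. (psum d n f E (J(c := {y})) (J'(c := J' c \<inter> {..<y})) w)\<^sup>2) \<le> b\<^sup>2)"
  proof (rule wop_mono)
    fix w
    assume ev: "((
      (\<forall>p\<in>Es \<times> J c. \<bar>\<alpha> w (fst p) (snd p)\<bar> \<le> A) \<and> (\<forall>p\<in>Es \<times> Bs. \<bar>M w (fst p) (snd p)\<bar> \<le> B)) \<and>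
      (\<forall>p\<in>Es \<times> J c. \<bar>N w (fst p) (snd p)\<bar> \<le> B')) \<and>
      (\<forall>p\<in>{p \<in> Es \<times> Es \<times> Bs. \<not> R (fst p) (fst (snd p))}.
      \<bar>\<Sum>y\<in>S (snd (snd p)). \<alpha> w (fst p) y * \<alpha> w (fst (snd p)) y\<bar> \<le> V)"
    have "(\<Sum>y\<in>J c. (psum d n f E (J(c := {y})) (J'(c := J' c \<inter> {..<y})) w)\<^sup>2)
       = (\<Sum>y\<in>J c. (\<Sum>e\<in>Es. \<alpha> w e y * (M w e (blk y) + N w e y))\<^sup>2)"
      by (simp add: psum_eq)
    also have "\<dots> \<le> 2 * card Bs * B\<^sup>2 * ((card Es)\<^sup>2 * V + card Es * (n + 1) ^ (card E - 1) * (card (J c) * A\<^sup>2))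
      + 2 * card (J c) * (card Es * (A * B'))\<^sup>2"
    proof (rule cross_sum_bound[where R = R])
      show "blk ` J c \<subseteq> Bs" using J(1)[OF cd] by (auto simp: blk_def Bs_def intro: div_le_mono)
      show "card {e' \<in> Es. R e e'} \<le> (n + 1) ^ (card E - 1)" for e
        using card_sum_eq[OF finE EU(3), of n "\<Sum>j\<in>E. e j"] by (simp add: Es_def R_def eq_commute)
      show "\<bar>\<Sum>y\<in>{y \<in> J c. blk y = b}. \<alpha> w e y * \<alpha> w e' y\<bar> \<le> V"
        if "b \<in> Bs" "e \<in> Es" "e' \<in> Es" "\<not> R e e'" for b e e'
        using ev that by (force simp: S_def)
    qed (use ev finEs finJ nn in \<open>auto simp: Bs_def\<close>)
    also have "\<dots> \<le> 2 * card Bs * B\<^sup>2 * ((K ^ card E)\<^sup>2 * V + K ^ card E * K ^ (card E - 1) * (K * A\<^sup>2))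
      + 2 * K * (K ^ card E * (A * B'))\<^sup>2"
    proof -
      have 1: "real (card Es) = K ^ card E" "real ((n + 1) ^ (card E - 1)) = K ^ (card E - 1)" "real (card (J c)) \<le> K"
        using cJ by (auto simp: cEs K_def add.commute)
      have "real (card Es) * real ((n + 1) ^ (card E - 1)) * (card (J c) * A\<^sup>2) \<le> K ^ card E * K ^ (card E - 1) * (K * A\<^sup>2)"
        unfolding 1 using 1 K0 by (intro mult_left_mono mult_right_mono) auto
      then show ?thesis using 1 K0 nn
        by (intro add_mono mult_mono mult_left_mono) auto
    qed
    also have "\<dots> \<le> b\<^sup>2"
      unfolding b_def A_def B_def B'_def V_def
      using cross_numeric[of K l "card E" m g C1 "real L" "real (card Bs)" a1] K0 l m G L EU finE
      by (simp add: Bs_def Suc_le_eq card_gt_0_iff)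
    finally show "(\<Sum>y\<in>J c. (psum d n f E (J(c := {y})) (J'(c := J' c \<inter> {..<y})) w)\<^sup>2) \<le> b\<^sup>2" .
  qed simp
  then have "wop d n l (kk + 3 + 1) (\<lambda>w. \<bar>cross d n f c E J J' w\<bar> \<le> l * b)"
    using f cE cd J l0 G by (intro wop_cross) (auto simp: b_def)
  then show ?thesis
    by (rule wop_mono) (auto simp: kk_def b_def K_def algebra_simps)
qed

lemma wop_sum3:
  assumes "wop d n l k (\<lambda>w. \<bar>p w\<bar> \<le> a)" "wop d n l k (\<lambda>w. \<bar>q w\<bar> \<le> b)" "wop d n l k (\<lambda>w. \<bar>r w\<bar> \<le> c)"
    "a + b + c \<le> B" "k + 2 \<le> k'"
  shows "wop d n l k' (\<lambda>w. \<bar>p w + q w + r w :: real\<bar> \<le> B)"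
proof -
  have "wop d n l (k + 1 + 1) (\<lambda>w. (\<bar>p w\<bar> \<le> a \<and> \<bar>q w\<bar> \<le> b) \<and> \<bar>r w\<bar> \<le> c)"
    by (intro wop_conj assms wop_mono[OF assms(3)]) auto
  then show ?thesis
  proof (rule wop_mono)
    fix w assume "(\<bar>p w\<bar> \<le> a \<and> \<bar>q w\<bar> \<le> b) \<and> \<bar>r w\<bar> \<le> c"
    then show "\<bar>p w + q w + r w\<bar> \<le> B" using assms(4) by linarith
  qed (use assms in simp)
qed

lemma sum_idx_split:
  assumes "r \<in> idx d n (fx E e J)" "E \<subseteq> {..<d}"
  shows "(\<Sum>j\<in>E. e j) + (\<Sum>j\<in>{..<d} - E. r j) = n"
proof -
  have "(\<Sum>j<d. r j) = (\<Sum>j\<in>E. r j) + (\<Sum>j\<in>{..<d} - E. r j)"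
    using assms(2) by (metis add.commute finite_lessThan sum.subset_diff)
  moreover have "(\<Sum>j\<in>E. r j) = (\<Sum>j\<in>E. e j)"
    using assms by (intro sum.cong) (auto simp: idx_def fx_def split: if_splits)
  ultimately show ?thesis using assms by (simp add: idx_def)
qed

lemma idx_fx_out: "r \<in> idx d n (fx E e J) \<Longrightarrow> j < d \<Longrightarrow> j \<notin> E \<Longrightarrow> r j \<in> J j"
  by (force simp: idx_def fx_def)

lemma hsum_fx_eq_0: "idx d n J = {} \<Longrightarrow> hsum d n f J w = 0"
  by (simp add: hsum_def)

lemma psum_eq_0:
  assumes "\<And>e r s. e \<in> PiE E (\<lambda>_. {..n}) \<Longrightarrow> r \<in> idx d n (fx E e J) \<Longrightarrow> s \<in> idx d n (fx E e J') \<Longrightarrow> False"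
  shows "psum d n f E J J' w = 0"
proof -
  have "idx d n (fx E e J) = {} \<or> idx d n (fx E e J') = {}" if "e \<in> PiE E (\<lambda>_. {..n})" for e
    using assms[OF that] by blast
  then show ?thesis unfolding psum_def by (intro sum.neutral) (metis hsum_fx_eq_0 mult_zero_left mult_zero_right)
qed

text \<open>With \<open>c\<close> the only free coordinate, fixing \<open>r c = y\<close> determines
  the sum of \<open>e\<close> and thus saves a factor \<open>n + 1\<close>. The sum over the
  \<open>n + 1\<close> values of \<open>y\<close> is a martingale and returns only half of it: a
  gain of 1 / 2 over the exponent \<open>card E\<close>.\<close>

lemma base_cross:
  assumes f: "rsys d n f" and l: "l \<ge> 1" and E: "insert c E \<subseteq> {..<d}" "c \<notin> E" "E \<noteq> {}" and J: "J c \<subseteq> {..n}"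
    and X: "\<And>j. j < d \<Longrightarrow> j \<notin> insert c E \<Longrightarrow> J j \<subseteq> {x j} \<and> J' j \<subseteq> {x' j}"
  shows "wop d n l 1 (\<lambda>w. \<bar>cross d n f c E J J' w\<bar> \<le> l * (real n + 1) powr (card E - 1 / 2))"
proof -
  have cd: "c < d" and finE: "finite E" using E by (auto intro: finite_subset)
  define b where "b = (real n + 1) powr (card E - 1 / 2)"
  have p1: "card E \<ge> 1" using E finE by (simp add: Suc_le_eq card_gt_0_iff)
  have D: "\<bar>psum d n f E (J(c := {y})) (J'(c := J' c \<inter> {..<y})) w\<bar> \<le> real ((n + 1) ^ (card E - 1))" for y w
  proof -
    \<comment> \<open>The truncated subtraction is harmless: if the box contains an index, the
      differences are genuine, and otherwise the product vanishes.\<close>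
    define s where "s = n - y - (\<Sum>j\<in>{..<d} - insert c E. x j)"
    have h: "\<bar>hsum d n f (fx E e (J(c := {y}))) w * hsum d n f (fx E e (J'(c := J' c \<inter> {..<y}))) w\<bar> \<le> of_bool ((\<Sum>j\<in>E. e j) = s)" for e
    proof (cases "idx d n (fx E e (J(c := {y}))) = {}")
      case True
      then show ?thesis by (simp add: hsum_fx_eq_0)
    next
      case False
      then obtain r where r: "r \<in> idx d n (fx E e (J(c := {y})))" by auto
      have "(\<Sum>j\<in>{..<d} - E. r j) = r c + (\<Sum>j\<in>{..<d} - E - {c}. r j)" using E by (intro sum.remove) auto
      also have "r c = y" using r cd E by (auto simp: idx_def fx_def)
      also have "(\<Sum>j\<in>{..<d} - E - {c}. r j) = (\<Sum>j\<in>{..<d} - insert c E. x j)"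
      proof (rule sum.cong)
        show "r j = x j" if "j \<in> {..<d} - insert c E" for j
        proof -
          have "r j \<in> fx E e (J(c := {y})) j" using r that by (simp add: idx_def)
          then show ?thesis using X[of j] that by (auto simp: fx_def)
        qed
      qed auto
      finally have "(\<Sum>j\<in>E. e j) = s" using sum_idx_split[OF r] E by (simp add: s_def)
      moreover have "card (idx d n (fx E e (J(c := {y})))) \<le> 1" "card (idx d n (fx E e (J'(c := J' c \<inter> {..<y})))) \<le> 1"
        using X cd by (intro card_idx_le_1[of c]; force simp: fx_def)+
      then have "\<bar>hsum d n f (fx E e (J(c := {y}))) w\<bar> \<le> 1" "\<bar>hsum d n f (fx E e (J'(c := J' c \<inter> {..<y}))) w\<bar> \<le> 1"
        using hsum_le_card[OF f, of "fx E e (J(c := {y}))" w] hsum_le_card[OF f, of "fx E e (J'(c := J' c \<inter> {..<y}))" w]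
        by linarith+
      ultimately show ?thesis by (simp add: abs_mult mult_le_one)
    qed
    have finP: "finite (PiE E (\<lambda>_. {..n}))" using finE by (intro finite_PiE) auto
    have "\<bar>psum d n f E (J(c := {y})) (J'(c := J' c \<inter> {..<y})) w\<bar> \<le> (\<Sum>e\<in>PiE E (\<lambda>_. {..n}). of_bool ((\<Sum>j\<in>E. e j) = s))"
      unfolding psum_def by (rule order_trans[OF sum_abs sum_mono[OF h]])
    also have "\<dots> = card {e \<in> PiE E (\<lambda>_. {..n}). (\<Sum>j\<in>E. e j) = s}" using finP by (simp add: Int_def)
    also have "\<dots> \<le> real ((n + 1) ^ (card E - 1))" using card_sum_eq[OF finE E(3), of n s] by (simp only: of_nat_le_iff)
    finally show ?thesis .
  qed
  have "wop d n l (0 + 1) (\<lambda>w. \<bar>cross d n f c E J J' w\<bar> \<le> l * b)"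
  proof (rule wop_cross[of d n f c E J b l 0 J', OF f E(2) cd J])
    show "wop d n l 0 (\<lambda>w. (\<Sum>y\<in>J c. (psum d n f E (J(c := {y})) (J'(c := J' c \<inter> {..<y})) w)\<^sup>2) \<le> b\<^sup>2)"
    proof (rule wop_true)
      fix w
      have "(\<Sum>y\<in>J c. (psum d n f E (J(c := {y})) (J'(c := J' c \<inter> {..<y})) w)\<^sup>2)
         \<le> (\<Sum>y\<in>J c. (real ((n + 1) ^ (card E - 1)))\<^sup>2)"
        using power_mono[OF D, of _ _ 2] by (intro sum_mono) simp
      also have "\<dots> = card (J c) * (real ((n + 1) ^ (card E - 1)))\<^sup>2" by simp
      also have "\<dots> \<le> (real n + 1) * (real ((n + 1) ^ (card E - 1)))\<^sup>2"
        using card_mono[OF _ J] by (intro mult_right_mono) auto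
      also have "\<dots> = (real n + 1) powr 1 * ((real n + 1) powr (real (card E) - 1) * (real n + 1) powr (real (card E) - 1))"
      proof -
        have "real ((n + 1) ^ (card E - 1)) = (real n + 1) powr (real (card E - 1))"
          by (subst powr_realpow) (auto simp: add.commute)
        then show ?thesis using p1 by (simp add: power2_eq_square of_nat_diff)
      qed
      also have "\<dots> = b\<^sup>2"
        unfolding b_def power2_eq_square powr_add[symmetric] by (rule arg_cong[where f = "(powr) _"]) simp
      finally show "(\<Sum>y\<in>J c. (psum d n f E (J(c := {y})) (J'(c := J' c \<inter> {..<y})) w)\<^sup>2) \<le> b\<^sup>2" .
    qed
  qed (use l in \<open>auto simp: b_def\<close>)
  then show ?thesis by (simp add: b_def)
qed

text \<open>If \<open>r\<close> and \<open>s\<close> also coincided in \<open>c\<close>, the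
  condition on the sum would give the fixed levels equal sums; hence only the cross terms
  remain.\<close>

lemma pair_bound_1: "pair_bound d 1 2 1 3 (1 / 2)"
  unfolding pair_bound_def
proof (intro allI impI)
  fix n and l :: real and f E U J J' x x'
  assume f: "rsys d n f" and l: "1 \<le> l" and EU: "E \<union> U \<subseteq> {..<d}" "E \<inter> U = {}" "E \<noteq> {}" "card U = 1"
    and J: "\<forall>j<d. J j \<subseteq> {..n} \<and> J' j \<subseteq> {..n}"
    and X: "\<forall>j<d. j \<notin> E \<union> U \<longrightarrow> J j \<subseteq> {x j} \<and> J' j \<subseteq> {x' j}"
    and ne: "(\<Sum>j\<in>{..<d} - (E \<union> U). x j) \<noteq> (\<Sum>j\<in>{..<d} - (E \<union> U). x' j)"
  obtain c where U: "U = {c}" using EU(4) by (auto simp: card_1_singleton_iff)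
  have c: "c \<notin> E" "c < d" and finE: "finite E" using EU U by (auto intro: finite_subset)
  have ins: "insert c E = E \<union> U" using U by auto
  have "psum d n f (insert c E) J J' w = 0" for w
  proof (rule psum_eq_0)
    fix e r s
    assume r: "r \<in> idx d n (fx (insert c E) e J)" and s: "s \<in> idx d n (fx (insert c E) e J')"
    have "r j = x j" "s j = x' j" if "j \<in> {..<d} - insert c E" for j
      using that idx_fx_out[OF r, of j] idx_fx_out[OF s, of j] X[rule_format, of j] unfolding ins by auto
    then have "(\<Sum>j\<in>{..<d} - insert c E. r j) = (\<Sum>j\<in>{..<d} - insert c E. x j)"
      "(\<Sum>j\<in>{..<d} - insert c E. s j) = (\<Sum>j\<in>{..<d} - insert c E. x' j)"
      by (intro sum.cong refl; blast)+
    then show False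
      using sum_idx_split[OF r] sum_idx_split[OF s] ne EU unfolding ins by simp
  qed
  then have z: "wop d n l 1 (\<lambda>w. \<bar>psum d n f (insert c E) J J' w\<bar> \<le> 0)" by (intro wop_true) simp
  have c1: "wop d n l 1 (\<lambda>w. \<bar>cross d n f c E J J' w\<bar> \<le> l * (real n + 1) powr (card E - 1 / 2))"
    using f l EU J X U c by (intro base_cross[where x = x and x' = x']) auto
  have c2: "wop d n l 1 (\<lambda>w. \<bar>cross d n f c E J' J w\<bar> \<le> l * (real n + 1) powr (card E - 1 / 2))"
    using f l EU J X U c by (intro base_cross[where x = x' and x' = x]) auto
  have "wop d n l 3 (\<lambda>w. \<bar>psum d n f (insert c E) J J' w + cross d n f c E J J' w + cross d n f c E J' J w\<bar>
      \<le> 2 * l ^ 1 * (real n + 1) powr (real (card E + 1 - 1) - 1 / 2))"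
    by (rule wop_sum3[OF z c1 c2]) auto
  then show "wop d n l 3 (\<lambda>w. \<bar>psum d n f E J J' w\<bar> \<le> 2 * l ^ 1 * (real n + 1) powr (real (card E + 1 - 1) - 1 / 2))"
    using J c finE by (subst psum_split[of E c]) auto
qed

text \<open>A free coordinate \<open>c\<close> either coincides and moves to \<open>E\<close>, which
  leaves one free coordinate less, or it produces cross terms, which keep a quarter of the gain by
  \<open>cross_bound\<close>.\<close>

lemma pair_bound_Suc:
  assumes G: "pair_bound d m C1 a1 k1 g" "0 < g" "g \<le> 1" "0 \<le> C1" and m: "1 \<le> m"
  shows "pair_bound d (Suc m) (C1 + 4 * (C1 + 2)) (a1 + 4 * Suc m + 1) (k1 + 2 * Suc m + 2 * d + 7) (g / 4)"
  unfolding pair_bound_def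
proof (intro allI impI)
  fix n and l :: real and f E U J J' x x'
  assume f: "rsys d n f" and l: "1 \<le> l" and EU: "E \<union> U \<subseteq> {..<d}" "E \<inter> U = {}" "E \<noteq> {}" "card U = Suc m"
    and J: "\<forall>j<d. J j \<subseteq> {..n} \<and> J' j \<subseteq> {..n}"
    and X: "\<forall>j<d. j \<notin> E \<union> U \<longrightarrow> J j \<subseteq> {x j} \<and> J' j \<subseteq> {x' j}"
    and ne: "(\<Sum>j\<in>{..<d} - (E \<union> U). x j) \<noteq> (\<Sum>j\<in>{..<d} - (E \<union> U). x' j)"
  have "U \<noteq> {}" using EU(4) by auto
  then obtain c where U: "c \<in> U" by auto
  have c: "c \<notin> E" "c < d" and finE: "finite E" and finU: "finite U" using EU U by (auto intro: finite_subset)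
  have ins: "insert c (E \<union> (U - {c})) = E \<union> U" using U by auto
  define K where "K = real n + 1"
  define Z where "Z = l ^ (a1 + 4 * Suc m + 1) * K powr (real (card E + Suc m - 1) - g / 4)"
  have "wop d n l k1 (\<lambda>w. \<bar>psum d n f (insert c E) J J' w\<bar> \<le>
      C1 * l ^ a1 * (real n + 1) powr (real (card (insert c E) + m - 1) - g))"
    by (rule pair_boundD[OF G(1), where E = "insert c E" and U = "U - {c}" and x = x and x' = x'])
      (use f l EU J X ne U c finU in \<open>auto simp: ins\<close>)
  then have p: "wop d n l (k1 + 2 * Suc m + 2 * d + 5) (\<lambda>w. \<bar>psum d n f (insert c E) J J' w\<bar> \<le> C1 * Z)"
  proof (rule wop_mono)
    fix w assume le: "\<bar>psum d n f (insert c E) J J' w\<bar> \<le>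
      C1 * l ^ a1 * (real n + 1) powr (real (card (insert c E) + m - 1) - g)"
    have "l ^ a1 \<le> l ^ (a1 + 4 * Suc m + 1)" using l by (intro power_increasing) auto
    moreover have "K powr (real (card (insert c E) + m - 1) - g) \<le> K powr (real (card E + Suc m - 1) - g / 4)"
      using c finE G by (intro powr_mono) (auto simp: K_def)
    ultimately have "l ^ a1 * K powr (real (card (insert c E) + m - 1) - g) \<le> Z"
      unfolding Z_def using l by (intro mult_mono) auto
    then have "C1 * (l ^ a1 * K powr (real (card (insert c E) + m - 1) - g)) \<le> C1 * Z"
      using G by (intro mult_left_mono) auto
    then show "\<bar>psum d n f (insert c E) J J' w\<bar> \<le> C1 * Z" using le by (simp add: K_def mult.assoc)
  qed auto
  have cr: "wop d n l (k1 + 2 * Suc m + 2 * d + 5) (\<lambda>w. \<bar>cross d n f c E J1 J2 w\<bar> \<le> 2 * (C1 + 2) * Z)"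
    if "\<forall>j<d. J1 j \<subseteq> {..n} \<and> J2 j \<subseteq> {..n}" "\<And>j. j < d \<Longrightarrow> j \<notin> E \<union> U \<Longrightarrow> (\<exists>x. J1 j \<subseteq> {x}) \<and> (\<exists>x. J2 j \<subseteq> {x})" for J1 J2
    using cross_bound[of d "Suc m" C1 a1 k1 g n f l E U c J1 J2] G m f l EU U that
    by (simp add: Z_def K_def mult.assoc)
  have c1: "wop d n l (k1 + 2 * Suc m + 2 * d + 5) (\<lambda>w. \<bar>cross d n f c E J J' w\<bar> \<le> 2 * (C1 + 2) * Z)"
    and c2: "wop d n l (k1 + 2 * Suc m + 2 * d + 5) (\<lambda>w. \<bar>cross d n f c E J' J w\<bar> \<le> 2 * (C1 + 2) * Z)"
    using J X by (intro cr; blast)+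
  have "wop d n l (k1 + 2 * Suc m + 2 * d + 7) (\<lambda>w. \<bar>psum d n f (insert c E) J J' w + cross d n f c E J J' w + cross d n f c E J' J w\<bar>
      \<le> (C1 + 4 * (C1 + 2)) * Z)"
    by (rule wop_sum3[OF p c1 c2]) (auto simp: algebra_simps)
  then show "wop d n l (k1 + 2 * Suc m + 2 * d + 7) (\<lambda>w. \<bar>psum d n f E J J' w\<bar> \<le>
      (C1 + 4 * (C1 + 2)) * l ^ (a1 + 4 * Suc m + 1) * (real n + 1) powr (real (card E + Suc m - 1) - g / 4))"
    using J c finE by (subst psum_split[of E c]) (auto simp: Z_def K_def mult.assoc)
qed

lemma pair_bound_ex: "1 \<le> m \<Longrightarrow> \<exists>C a k g. 0 \<le> C \<and> 0 < g \<and> g \<le> 1 \<and> pair_bound d m C a k g"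
proof (induction m rule: dec_induct)
  case base
  show ?case by (rule exI[of _ 2], rule exI[of _ 1], rule exI[of _ 3], rule exI[of _ "1 / 2"]) (simp add: pair_bound_1[simplified])
next
  case (step m)
  then obtain C a k g where "0 \<le> C" "0 < g" "g \<le> 1" "pair_bound d m C a k g" by blast
  then show ?case using pair_bound_Suc[of d m C a k g] step.hyps
    by (intro exI[of _ "C + 4 * (C + 2)"] exI[of _ "a + 4 * Suc m + 1"] exI[of _ "k + 2 * Suc m + 2 * d + 7"] exI[of _ "g / 4"]) auto
qed

section \<open>Pairs from one box and the quadratic variation\<close>

lemma idx_fx: "E \<subseteq> {..<d} \<Longrightarrow> idx d n (fx E e J) = {r \<in> idx d n J. \<forall>j\<in>E. r j = e j}"
  by (auto simp: idx_def fx_def split: if_splits)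

lemma psum_diag_all:
  assumes "rsys d n f" "E = {..<d}" "E \<noteq> {}"
  shows "psum d n f E J J w \<le> card (idx d n J)"
proof -
  have d: "0 < d" and finP: "finite (PiE E (\<lambda>_. {..n}))" using assms by (auto intro: finite_PiE)
  have "psum d n f E J J w \<le> (\<Sum>e\<in>PiE E (\<lambda>_. {..n}). real (card (idx d n (fx E e J))))"
    unfolding psum_def
  proof (intro sum_mono)
    fix e
    have "card (idx d n (fx E e J)) \<le> 1"
      using assms d by (intro card_idx_le_1[of 0]) (auto simp: fx_def)
    then have "\<bar>hsum d n f (fx E e J) w\<bar> \<le> 1" and le: "\<bar>hsum d n f (fx E e J) w\<bar> \<le> card (idx d n (fx E e J))"
      using hsum_le_card[OF assms(1), of "fx E e J" w] by linarith+
    then have "\<bar>hsum d n f (fx E e J) w\<bar> * \<bar>hsum d n f (fx E e J) w\<bar> \<le> 1 * \<bar>hsum d n f (fx E e J) w\<bar>"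
      by (intro mult_right_mono) auto
    then show "hsum d n f (fx E e J) w * hsum d n f (fx E e J) w \<le> card (idx d n (fx E e J))"
      using le by (simp add: abs_mult[symmetric])
  qed
  also have "\<dots> = (\<Sum>e\<in>PiE E (\<lambda>_. {..n}). (\<Sum>r\<in>{r \<in> idx d n J. restrict r E = e}. 1))"
  proof (intro sum.cong refl)
    fix e assume e: "e \<in> PiE E (\<lambda>_. {..n})"
    have "(\<forall>j\<in>E. r j = e j) \<longleftrightarrow> restrict r E = e" for r
      using e by (auto simp: fun_eq_iff restrict_def PiE_def extensional_def)
    then show "real (card (idx d n (fx E e J))) = (\<Sum>r\<in>{r \<in> idx d n J. restrict r E = e}. 1)"
      using assms by (simp add: idx_fx)
  qed
  also have "\<dots> = (\<Sum>r\<in>idx d n J. 1)"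
  proof (rule sum.group)
    show "(\<lambda>r. restrict r E) ` idx d n J \<subseteq> PiE E (\<lambda>_. {..n})"
    proof (rule image_subsetI)
      fix r assume "r \<in> idx d n J"
      then have "r j \<in> {..n}" if "j \<in> E" for j using idx_le[of r d n J j] that assms by auto
      then show "restrict r E \<in> PiE E (\<lambda>_. {..n})" unfolding restrict_PiE_iff by blast
    qed
  qed (use finP in auto)
  finally show ?thesis by simp
qed

text \<open>The counterpart of \<open>pair_bound\<close> for \<open>J = J'\<close> without fixed
  levels: the pairs \<open>r = s\<close> now contribute, up to the number of indices. With
  \<open>E = {0}\<close> this controls the quadratic variation of a slab sum along the first
  coordinate.\<close>

definition diag_bound :: "nat \<Rightarrow> nat \<Rightarrow> real \<Rightarrow> nat \<Rightarrow> nat \<Rightarrow> real \<Rightarrow> bool" where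
  "diag_bound d m C a k g \<longleftrightarrow> (\<forall>n l f E U J. rsys d n f \<longrightarrow> l \<ge> 1 \<longrightarrow> E \<union> U = {..<d} \<longrightarrow>
     E \<inter> U = {} \<longrightarrow> E \<noteq> {} \<longrightarrow> card U = m \<longrightarrow> (\<forall>j<d. J j \<subseteq> {..n}) \<longrightarrow>
     wop d n l k (\<lambda>w. psum d n f E J J w \<le>
       card (idx d n J) + C * l ^ a * (real n + 1) powr (real (card E + m - 1) - g)))"

lemmas diag_boundD = diag_bound_def[THEN iffD1, rule_format]

text \<open>All coordinates but \<open>c\<close> coincide, so the condition on the sum forces
  \<open>r c = s c\<close>.\<close>

lemma cross_diag_eq_0:
  assumes "insert c E = {..<d}" "c \<notin> E" "c < d"
  shows "cross d n f c E J J w = 0"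
  unfolding cross_def
proof (intro sum.neutral ballI psum_eq_0)
  fix y e r s
  assume r: "r \<in> idx d n (fx E e (J(c := {y})))" and s: "s \<in> idx d n (fx E e (J(c := J c \<inter> {..<y})))"
  have E: "{..<d} - E = {c}" "E \<subseteq> {..<d}" using assms by auto
  have "r c = y" "s c < y" using r s assms by (auto simp: idx_def fx_def)
  then show False using sum_idx_split[OF r E(2)] sum_idx_split[OF s E(2)] unfolding E by simp
qed

text \<open>The free coordinates move to \<open>E\<close> one by one. The cross terms have Beck's
  gain also for equal boxes, and what is left when all coordinates coincide is the main
  term.\<close>

lemma diag_bound_ex: "\<exists>C a k g. 0 \<le> C \<and> 0 < g \<and> g \<le> 1 \<and> diag_bound d m C a k g"
proof (induction m)
  case 0
  have "diag_bound d 0 0 0 0 1"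
    unfolding diag_bound_def
  proof (intro allI impI)
    fix n and l :: real and f E U J
    assume "rsys d n f" "E \<union> U = {..<d}" "E \<inter> U = {}" "E \<noteq> {}" "card U = 0"
    moreover have "finite U" using \<open>E \<union> U = {..<d}\<close> by (metis finite_Un finite_lessThan)
    ultimately show "wop d n l 0 (\<lambda>w. psum d n f E J J w \<le>
       card (idx d n J) + 0 * l ^ 0 * (real n + 1) powr (real (card E + 0 - 1) - 1))"
      by (intro wop_true) (simp add: psum_diag_all)
  qed
  then show ?case by (intro exI[of _ 0] exI[of _ 1]) auto
next
  case (Suc m)
  then obtain C0 a0 k0 g0 where D: "0 \<le> C0" "0 < g0" "g0 \<le> 1" "diag_bound d m C0 a0 k0 g0" by blast
  obtain C1 a1 k1 g1 where G: "0 \<le> C1" "0 < g1" "g1 \<le> 1" "m \<ge> 1 \<Longrightarrow> pair_bound d m C1 a1 k1 g1"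
    using pair_bound_ex[of m d] by (cases "m \<ge> 1") (auto, metis zero_less_one order_refl zero_le_one)
  define g where "g = min g0 (g1 / 4)"
  define a where "a = a0 + a1 + 4 * Suc m + 1"
  define kk where "kk = k0 + k1 + 2 * Suc m + 2 * d + 5"
  define C where "C = C0 + 4 * (C1 + 2)"
  have "diag_bound d (Suc m) C a (kk + 1) g"
    unfolding diag_bound_def
  proof (intro allI impI)
    fix n and l :: real and f E U J
    assume f: "rsys d n f" and l: "1 \<le> l" and EU: "E \<union> U = {..<d}" "E \<inter> U = {}" "E \<noteq> {}" "card U = Suc m"
      and J: "\<forall>j<d. J j \<subseteq> {..n}"
    have "U \<noteq> {}" using EU(4) by auto
    then obtain c where U: "c \<in> U" by auto
    have fin: "finite (E \<union> U)" unfolding EU(1) by simp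
    then have finE: "finite E" and finU: "finite U" by simp_all
    have c: "c \<notin> E" "c < d" using EU U by auto
    define Z where "Z = l ^ a * (real n + 1) powr (real (card E + Suc m - 1) - g)"
    have mono: "c * l ^ i * (real n + 1) powr (real (card E + Suc m - 1) - h) \<le> c * Z" if "i \<le> a" "g \<le> h" "c \<ge> 0" for c i h
    proof -
      have "l ^ i * (real n + 1) powr (real (card E + Suc m - 1) - h) \<le> Z"
        unfolding Z_def using l that by (intro mult_mono power_increasing powr_mono) auto
      then show ?thesis using that by (simp add: mult_left_mono mult.assoc)
    qed
    have "wop d n l k0 (\<lambda>w. psum d n f (insert c E) J J w \<le>
       card (idx d n J) + C0 * l ^ a0 * (real n + 1) powr (real (card (insert c E) + m - 1) - g0))"
      by (rule diag_boundD[OF D(4), where U = "U - {c}"]) (use f l EU J U c finU in auto)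
    then have p: "wop d n l kk (\<lambda>w. psum d n f (insert c E) J J w \<le> card (idx d n J) + C0 * Z)"
    proof (rule wop_mono)
      fix w assume le: "psum d n f (insert c E) J J w \<le>
       card (idx d n J) + C0 * l ^ a0 * (real n + 1) powr (real (card (insert c E) + m - 1) - g0)"
      then show "psum d n f (insert c E) J J w \<le> card (idx d n J) + C0 * Z"
        using mono[of a0 g0 C0] D c finE by (simp add: a_def g_def)
    qed (simp add: kk_def)
    have cr: "wop d n l kk (\<lambda>w. \<bar>cross d n f c E J J w\<bar> \<le> 2 * (C1 + 2) * Z)"
    proof (cases "m \<ge> 1")
      case True
      then have "wop d n l (k1 + 2 * Suc m + 2 * d + 5) (\<lambda>w. \<bar>cross d n f c E J J w\<bar> \<le>
          2 * (C1 + 2) * l ^ (a1 + 4 * Suc m + 1) * (real n + 1) powr (real (card E + Suc m - 1) - g1 / 4))"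
        using cross_bound[of d "Suc m" C1 a1 k1 g1 n f l E U c J J] G f l EU U J by auto
      then show ?thesis
      proof (rule wop_mono)
        fix w assume le: "\<bar>cross d n f c E J J w\<bar> \<le>
          2 * (C1 + 2) * l ^ (a1 + 4 * Suc m + 1) * (real n + 1) powr (real (card E + Suc m - 1) - g1 / 4)"
        show "\<bar>cross d n f c E J J w\<bar> \<le> 2 * (C1 + 2) * Z"
          by (rule order_trans[OF le], rule mono) (use G in \<open>auto simp: a_def g_def\<close>)
      qed (simp add: kk_def)
    next
      case False
      then have "card U = 1" using EU(4) by simp
      then obtain c' where "U = {c'}" by (rule card_1_singletonE)
      then have "U = {c}" using U by auto
      then have "cross d n f c E J J w = 0" for w
        using EU c by (intro cross_diag_eq_0) auto
      then show ?thesis using G l by (intro wop_true) (simp add: Z_def)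
    qed
    from wop_conj[OF p cr]
    show "wop d n l (kk + 1) (\<lambda>w. psum d n f E J J w \<le>
       card (idx d n J) + C * l ^ a * (real n + 1) powr (real (card E + Suc m - 1) - g))"
    proof (rule wop_mono)
      fix w
      assume "psum d n f (insert c E) J J w \<le> card (idx d n J) + C0 * Z \<and> \<bar>cross d n f c E J J w\<bar> \<le> 2 * (C1 + 2) * Z"
      moreover have "psum d n f E J J w = psum d n f (insert c E) J J w + cross d n f c E J J w + cross d n f c E J J w"
        using J c finE by (intro psum_split) auto
      ultimately have "psum d n f E J J w \<le> card (idx d n J) + C0 * Z + 2 * (2 * (C1 + 2) * Z)" by linarith
      then have "psum d n f E J J w \<le> card (idx d n J) + C * Z" by (simp add: C_def algebra_simps)
      then show "psum d n f E J J w \<le>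
       card (idx d n J) + C * l ^ a * (real n + 1) powr (real (card E + Suc m - 1) - g)"
        by (simp add: Z_def mult.assoc)
    qed simp
  qed
  then show ?case using D G by (intro exI[of _ C] exI[of _ a] exI[of _ "kk + 1"] exI[of _ g]) (auto simp: C_def g_def)
qed

text \<open>Beck's gain: square root cancellation would give the exponent \<open>d - 1\<close>.\<close>

definition beck_bound :: "nat \<Rightarrow> real \<Rightarrow> nat \<Rightarrow> nat \<Rightarrow> real \<Rightarrow> bool" where
  "beck_bound d C a k g \<longleftrightarrow> (\<forall>n l f c J J'. rsys d n f \<longrightarrow> l \<ge> 1 \<longrightarrow> 1 \<le> c \<longrightarrow> c < d \<longrightarrow>
    (\<forall>j<d. J j \<subseteq> {..n} \<and> J' j \<subseteq> {..n}) \<longrightarrow> J 0 \<inter> J' 0 = {} \<longrightarrow>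
    wop d n l k (\<lambda>w. \<bar>psum d n f {c} J J' w\<bar> \<le> C * l ^ a * (real n + 1) powr (real d - 1 - g)))"

lemmas beck_boundD = beck_bound_def[THEN iffD1, rule_format]

text \<open>One more split, along the first coordinate: the ranges there are disjoint, so no pair
  coincides and only cross terms remain. They rest on \<open>pair_bound\<close> with
  \<open>d - 2\<close> free coordinates, and \<open>d \<ge> 3\<close> makes this number
  positive.\<close>

lemma beck_bound_ex:
  assumes "d \<ge> 3"
  shows "\<exists>C a k g. 0 \<le> C \<and> 0 < g \<and> g \<le> 1 \<and> beck_bound d C a k g"
proof -
  obtain C1 a1 k1 g1 where G: "0 \<le> C1" "0 < g1" "g1 \<le> 1" "pair_bound d (d - 2) C1 a1 k1 g1"
  proof -
    have "1 \<le> d - 2" using assms by simp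
    from pair_bound_ex[OF this, of d] show ?thesis using that by blast
  qed
  define m where "m = d - 1"
  have m: "m - 1 = d - 2" "2 \<le> m" using assms by (auto simp: m_def)
  define kk where "kk = k1 + 2 * m + 2 * d + 5"
  define a where "a = a1 + 4 * m + 1"
  have "wop d n l (kk + 2) (\<lambda>w. \<bar>psum d n f {c} J J' w\<bar> \<le> 4 * (C1 + 2) * l ^ a * (real n + 1) powr (real d - 1 - g1 / 4))"
    if f: "rsys d n f" and l: "l \<ge> 1" and c: "1 \<le> c" "c < d" and J: "\<forall>j<d. J j \<subseteq> {..n} \<and> J' j \<subseteq> {..n}"
      and dis: "J 0 \<inter> J' 0 = {}" for n l f c J J'
  proof -
    have cr: "wop d n l kk (\<lambda>w. \<bar>cross d n f 0 {c} J1 J2 w\<bar> \<le> 2 * (C1 + 2) * l ^ a * (real n + 1) powr (real d - 1 - g1 / 4))"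
      if "\<forall>j<d. J1 j \<subseteq> {..n} \<and> J2 j \<subseteq> {..n}" for J1 J2
    proof -
      have "real (card {c} + m - 1) = real d - 1" using m c by (simp add: m_def of_nat_diff)
      moreover have "{c} \<union> ({..<d} - {c}) = {..<d}" "card ({..<d} - {c}) = m" using c by (auto simp: m_def)
      ultimately show ?thesis
        using cross_bound[of d m C1 a1 k1 g1 n f l "{c}" "{..<d} - {c}" 0 J1 J2] G m f l c that assms
        by (simp add: kk_def a_def)
    qed
    have "psum d n f (insert 0 {c}) J J' w = 0" for w
      using c J by (subst psum_insert) (auto simp: dis)
    then have z: "wop d n l kk (\<lambda>w. \<bar>psum d n f (insert 0 {c}) J J' w\<bar> \<le> 0)" by (intro wop_true) simp
    have "wop d n l (kk + 2) (\<lambda>w. \<bar>psum d n f (insert 0 {c}) J J' w + cross d n f 0 {c} J J' w + cross d n f 0 {c} J' J w\<bar>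
      \<le> 4 * (C1 + 2) * l ^ a * (real n + 1) powr (real d - 1 - g1 / 4))"
      using J by (intro wop_sum3[OF z cr cr]) (auto simp: algebra_simps)
    then show ?thesis using J c by (subst psum_split[of "{c}" 0]) auto
  qed
  then have "beck_bound d (4 * (C1 + 2)) a (kk + 2) (g1 / 4)" unfolding beck_bound_def by blast
  then show ?thesis using G by (intro exI[of _ "4 * (C1 + 2)"] exI[of _ a] exI[of _ "kk + 2"] exI[of _ "g1 / 4"]) auto
qed

section \<open>The stopped Riesz product\<close>

text \<open>The test includes the square of the term \<open>x m\<close> that is about to be added.
  This bounds the overshoot by \<open>sqrt Q\<close>, and it preserves the martingale property: for
  a term that only changes its sign with the new digit, the outcome of the test is the same.\<close>

primrec stopped :: "real \<Rightarrow> real \<Rightarrow> (nat \<Rightarrow> real) \<Rightarrow> nat \<Rightarrow> real" where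
  "stopped D Q x 0 = 0"
| "stopped D Q x (Suc m) = stopped D Q x m +
    (if \<bar>stopped D Q x m\<bar> \<le> D \<and> (\<Sum>k\<le>m. (x k)\<^sup>2) \<le> Q then x m else 0)"

lemma stopped_bound: "0 \<le> D \<Longrightarrow> 0 \<le> Q \<Longrightarrow> \<bar>stopped D Q x m\<bar> \<le> D + sqrt Q"
proof (induction m)
  case (Suc m)
  show ?case
  proof (cases "\<bar>stopped D Q x m\<bar> \<le> D \<and> (\<Sum>k\<le>m. (x k)\<^sup>2) \<le> Q")
    case True
    have "(x m)\<^sup>2 \<le> (\<Sum>k\<le>m. (x k)\<^sup>2)" by (intro member_le_sum) auto
    then have "\<bar>x m\<bar> \<le> sqrt Q" using True by (intro real_le_rsqrt) auto
    then have "\<bar>stopped D Q x m + x m\<bar> \<le> D + sqrt Q" using True by linarith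
    then show ?thesis using True by simp
  qed (use Suc in auto)
qed simp

lemma stopped_eq_sum:
  assumes "\<And>m. m \<le> N \<Longrightarrow> \<bar>\<Sum>k<m. x k\<bar> \<le> D" "(\<Sum>k<N. (x k)\<^sup>2) \<le> Q"
  shows "stopped D Q x N = (\<Sum>k<N. x k)"
proof -
  have "m \<le> N \<Longrightarrow> stopped D Q x m = (\<Sum>k<m. x k)" for m
  proof (induction m)
    case (Suc m)
    have "(\<Sum>k\<le>m. (x k)\<^sup>2) \<le> (\<Sum>k<N. (x k)\<^sup>2)" using Suc by (intro sum_mono2) auto
    then show ?case using Suc assms(1)[of m] assms(2) by simp
  qed simp
  then show ?thesis by simp
qed

lemma stopped_cong: "(\<And>k. k < m \<Longrightarrow> (x k :: real) = y k) \<Longrightarrow> stopped D Q x m = stopped D Q y m"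
  by (induction m) auto

definition incr :: "real \<Rightarrow> real \<Rightarrow> (nat \<Rightarrow> real) \<Rightarrow> nat \<Rightarrow> real" where
  "incr D Q x m = (if \<bar>stopped D Q x m\<bar> \<le> D \<and> (\<Sum>k\<le>m. (x k)\<^sup>2) \<le> Q then x m else 0)"

lemma stopped_Suc: "stopped D Q x (Suc m) = stopped D Q x m + incr D Q x m"
  by (simp add: incr_def)

text \<open>The second bound carries the induction: a nonzero increment occurs only while the full
  sum of squares is at most \<open>Q\<close>.\<close>

lemma incr_squares: "0 \<le> Q \<Longrightarrow> (\<Sum>m<N. (incr D Q x m)\<^sup>2) \<le> Q \<and> (\<Sum>m<N. (incr D Q x m)\<^sup>2) \<le> (\<Sum>k<N. (x k)\<^sup>2)"
proof (induction N)
  case (Suc N)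
  have "{..N} = insert N {..<N}" by auto
  then have "(\<Sum>k\<le>N. (x k)\<^sup>2) = (\<Sum>k<N. (x k)\<^sup>2) + (x N)\<^sup>2" by simp
  moreover have "(incr D Q x N)\<^sup>2 \<le> (x N)\<^sup>2" by (simp add: incr_def)
  moreover have "(incr D Q x N)\<^sup>2 = 0 \<or> (\<Sum>k\<le>N. (x k)\<^sup>2) \<le> Q" by (simp add: incr_def)
  moreover have "(\<Sum>m<Suc N. (incr D Q x m)\<^sup>2) = (\<Sum>m<N. (incr D Q x m)\<^sup>2) + (incr D Q x N)\<^sup>2"
    "(\<Sum>k<Suc N. (x k)\<^sup>2) = (\<Sum>k<N. (x k)\<^sup>2) + (x N)\<^sup>2" by simp_all
  moreover have "(\<Sum>m<N. (incr D Q x m)\<^sup>2) \<le> Q" "(\<Sum>m<N. (incr D Q x m)\<^sup>2) \<le> (\<Sum>k<N. (x k)\<^sup>2)"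
    using Suc by simp_all
  moreover have "0 \<le> (x N)\<^sup>2" by simp
  ultimately show ?case by (elim disjE; intro conjI; linarith)
qed simp

text \<open>\<open>Y\<close> is a weight that ignores the digits of the summation. The alternative
  that \<open>g k\<close> vanishes is meant for levels outside a slab, on whose digits
  \<open>Y\<close> may depend.\<close>

locale stopped_sum =
  fixes D :: "'a set" and a :: "nat \<Rightarrow> 'a" and g :: "nat \<Rightarrow> 'a set \<Rightarrow> real" and Dm Q :: real and N :: nat and Y :: "'a set \<Rightarrow> real"
  assumes odd: "\<And>k. k < N \<Longrightarrow> odd_at (a k) (g k)" and inv: "\<And>k i. i < k \<Longrightarrow> k < N \<Longrightarrow> inv_at (a k) (g i)"
    and Y: "\<And>k. k < N \<Longrightarrow> (\<forall>w. g k w = 0) \<or> (a k \<in> D \<and> inv_at (a k) Y)"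
begin

lemma inv_stopped: "k < N \<Longrightarrow> m \<le> k \<Longrightarrow> inv_at (a k) (\<lambda>w. stopped Dm Q (\<lambda>i. g i w) m)"
  using inv by (auto simp: inv_at_def intro!: stopped_cong)

lemma odd_incr: "k < N \<Longrightarrow> odd_at (a k) (\<lambda>w. incr Dm Q (\<lambda>i. g i w) k)"
proof -
  assume k: "k < N"
  have "(\<Sum>i\<le>k. (g i (flip (a k) w))\<^sup>2) = (\<Sum>i\<le>k. (g i w)\<^sup>2)" for w
  proof (intro sum.cong refl)
    fix i assume "i \<in> {..k}"
    then show "(g i (flip (a k) w))\<^sup>2 = (g i w)\<^sup>2"
      using odd[OF k] inv[of i k] k by (cases "i = k") (auto simp: odd_at_def inv_at_def)
  qed
  moreover have "stopped Dm Q (\<lambda>i. g i (flip (a k) w)) k = stopped Dm Q (\<lambda>i. g i w) k" for w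
    using inv_stopped[OF k, of k] by (simp add: inv_at_def)
  ultimately show ?thesis using odd[OF k] by (auto simp: odd_at_def incr_def)
qed

lemma incr_0: "\<forall>w. g k w = 0 \<Longrightarrow> incr Dm Q (\<lambda>i. g i w) k = 0"
  by (simp add: incr_def)

lemma avg_incr: 
  assumes "k < N" "inv_at (a k) Z"
  shows "avg D (\<lambda>w. incr Dm Q (\<lambda>i. g i w) k * (Z w * Y w)) = 0"
proof (cases "\<forall>w. g k w = 0")
  case True
  then show ?thesis by (simp add: incr_0 avg_def)
next
  case False
  then have "a k \<in> D" "inv_at (a k) Y" using Y[OF assms(1)] by auto
  then show ?thesis using assms odd_incr
    by (intro avg_odd[of "a k"] odd_mult_inv inv_comp2[where ?g2.0 = "(*)"]) auto
qed

lemma avg_stopped: "m \<le> N \<Longrightarrow> avg D (\<lambda>w. stopped Dm Q (\<lambda>i. g i w) m * Y w) = 0"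
proof (induction m)
  case (Suc m)
  then show ?case
    using avg_incr[of m "\<lambda>_. 1"] unfolding stopped_Suc distrib_right avg_add by (simp add: inv_const)
qed (simp add: avg_def)

text \<open>The increments are orthogonal under the weight \<open>Y\<close>, so the second moment is
  the mean of their squares, which are bounded surely by \<open>incr_squares\<close>.\<close>

lemma avg_stopped_sq:
  assumes "0 \<le> Q" "\<And>w. 0 \<le> Y w"
  shows "avg D (\<lambda>w. (stopped Dm Q (\<lambda>i. g i w) N)\<^sup>2 * Y w) \<le> Q * avg D Y"
proof -
  have "m \<le> N \<Longrightarrow> avg D (\<lambda>w. (stopped Dm Q (\<lambda>i. g i w) m)\<^sup>2 * Y w) =
    avg D (\<lambda>w. (\<Sum>k<m. (incr Dm Q (\<lambda>i. g i w) k)\<^sup>2) * Y w)" for m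
  proof (induction m)
    case (Suc m)
    have "avg D (\<lambda>w. (stopped Dm Q (\<lambda>i. g i w) (Suc m))\<^sup>2 * Y w) =
      avg D (\<lambda>w. (stopped Dm Q (\<lambda>i. g i w) m)\<^sup>2 * Y w + 2 * (incr Dm Q (\<lambda>i. g i w) m * (stopped Dm Q (\<lambda>i. g i w) m * Y w))
        + (incr Dm Q (\<lambda>i. g i w) m)\<^sup>2 * Y w)"
      by (intro avg_cong) (simp add: stopped_Suc power2_eq_square algebra_simps del: stopped.simps)
    also have "\<dots> = avg D (\<lambda>w. (stopped Dm Q (\<lambda>i. g i w) m)\<^sup>2 * Y w) + 0 + avg D (\<lambda>w. (incr Dm Q (\<lambda>i. g i w) m)\<^sup>2 * Y w)"
      unfolding avg_add avg_cmult using Suc.prems avg_incr[of m "\<lambda>w. stopped Dm Q (\<lambda>i. g i w) m"] inv_stopped[of m m] by simp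
    also have "\<dots> = avg D (\<lambda>w. (\<Sum>k<Suc m. (incr Dm Q (\<lambda>i. g i w) k)\<^sup>2) * Y w)"
      using Suc by (simp add: avg_add distrib_right)
    finally show ?case .
  qed simp
  then have "avg D (\<lambda>w. (stopped Dm Q (\<lambda>i. g i w) N)\<^sup>2 * Y w) =
    avg D (\<lambda>w. (\<Sum>k<N. (incr Dm Q (\<lambda>i. g i w) k)\<^sup>2) * Y w)" by simp
  also have "\<dots> \<le> avg D (\<lambda>w. Q * Y w)"
    using assms incr_squares by (intro avg_mono mult_right_mono) auto
  finally show ?thesis by (simp add: avg_cmult)
qed

end

section \<open>Stopped sums along the first coordinate\<close>

definition slice :: "nat \<Rightarrow> nat \<Rightarrow> ((nat \<Rightarrow> nat) \<Rightarrow> 'w \<Rightarrow> real) \<Rightarrow> (nat \<Rightarrow> nat set) \<Rightarrow> 'w \<Rightarrow> nat \<Rightarrow> real" where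
  "slice d n f J w k = hsum d n f (J(0 := J 0 \<inter> {k})) w"

text \<open>The sum \<open>hsum d n f J\<close>, accumulated along the first coordinate and frozen as soon as it or its
  quadratic variation becomes too large. This keeps the martingale property exact.\<close>

definition frozen :: "nat \<Rightarrow> nat \<Rightarrow> ((nat \<Rightarrow> nat) \<Rightarrow> 'w \<Rightarrow> real) \<Rightarrow> real \<Rightarrow> real \<Rightarrow> (nat \<Rightarrow> nat set) \<Rightarrow> 'w \<Rightarrow> real" where
  "frozen d n f Dm Q J w = stopped Dm Q (slice d n f J w) (Suc n)"

text \<open>The event on which the stopping does not act. All partial sums have to be small, since a
  single large one freezes the process for good.\<close>

definition tame :: "nat \<Rightarrow> nat \<Rightarrow> ((nat \<Rightarrow> nat) \<Rightarrow> 'w \<Rightarrow> real) \<Rightarrow> real \<Rightarrow> real \<Rightarrow> (nat \<Rightarrow> nat set) \<Rightarrow> 'w \<Rightarrow> bool" where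
  "tame d n f Dm Q J w \<longleftrightarrow> (\<forall>m\<le>Suc n. \<bar>\<Sum>k<m. slice d n f J w k\<bar> \<le> Dm) \<and> (\<Sum>k<Suc n. (slice d n f J w k)\<^sup>2) \<le> Q"

lemma slice_outside: "0 < d \<Longrightarrow> k \<notin> J 0 \<Longrightarrow> slice d n f J w k = 0"
  using idx_empty[of 0 d "J(0 := J 0 \<inter> {k})" n] by (simp add: slice_def hsum_def)

lemma slice_inside: "k \<in> J 0 \<Longrightarrow> slice d n f J w k = hsum d n f (J(0 := {k})) w"
  by (simp add: slice_def)

lemma sum_slice_sub:
  assumes "0 < d" "J 0 \<subseteq> {..n}" "h 0 = (0 :: real)"
  shows "(\<Sum>k<Suc n. h (slice d n f J w k)) = (\<Sum>k\<in>J 0. h (hsum d n f (J(0 := {k})) w))"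
proof -
  have "(\<Sum>k\<in>J 0. h (hsum d n f (J(0 := {k})) w)) = (\<Sum>k\<in>J 0. h (slice d n f J w k))"
    by (intro sum.cong refl) (simp add: slice_inside)
  also have "\<dots> = (\<Sum>k<Suc n. h (slice d n f J w k))"
  proof (rule sum.mono_neutral_left)
    show "J 0 \<subseteq> {..<Suc n}" using assms(2) by auto
    show "\<forall>i\<in>{..<Suc n} - J 0. h (slice d n f J w i) = 0"
      by (auto simp: slice_outside[OF assms(1)] assms(3) simp del: lessThan_Suc)
  qed simp
  finally show ?thesis by simp
qed

lemma sum_slice:
  assumes "0 < d" "J 0 \<subseteq> {..n}"
  shows "(\<Sum>k<Suc n. slice d n f J w k) = hsum d n f J w"
  using sum_slice_sub[of d J n "\<lambda>x. x" f w, OF assms] hsum_split[of 0 d J n f w] assms by simp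

lemma tame_frozen:
  assumes "0 < d" "J 0 \<subseteq> {..n}" "tame d n f Dm Q J w"
  shows "frozen d n f Dm Q J w = hsum d n f J w" "\<bar>hsum d n f J w\<bar> \<le> Dm"
proof -
  show "frozen d n f Dm Q J w = hsum d n f J w"
    unfolding frozen_def sum_slice[of d J n f w, OF assms(1,2), symmetric]
    using assms(3) by (intro stopped_eq_sum) (auto simp: tame_def simp del: sum.lessThan_Suc)
  show "\<bar>hsum d n f J w\<bar> \<le> Dm"
    using assms(3) unfolding tame_def sum_slice[of d J n f w, OF assms(1,2), symmetric] by blast
qed

lemma frozen_inv: "(\<And>k. inv_at a (\<lambda>w. slice d n f J w k)) \<Longrightarrow> inv_at a (frozen d n f Dm Q J)"
proof -
  assume "\<And>k. inv_at a (\<lambda>w. slice d n f J w k)"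
  then have "slice d n f J (flip a w) = slice d n f J w" for w by (auto simp: inv_at_def)
  then show ?thesis by (simp add: inv_at_def frozen_def)
qed

lemma slice_inv:
  assumes "rsys d n f" "c < d" "\<And>y. y \<in> J c \<Longrightarrow> y < i"
  shows "inv_at (c, i) (\<lambda>w. slice d n f J w k)"
  unfolding slice_def by (rule hsum_inv[OF assms(1,2)]) (use assms(3) in \<open>auto split: if_splits\<close>)

lemma frozen_inv': "rsys d n f \<Longrightarrow> c < d \<Longrightarrow> (\<And>y. y \<in> J c \<Longrightarrow> y < i) \<Longrightarrow> inv_at (c, i) (frozen d n f Dm Q J)"
  by (intro frozen_inv slice_inv)

lemma frozen_stopped_sum:
  assumes "rsys d n f" "0 < d" "\<And>k. k \<in> J 0 \<Longrightarrow> inv_at (0, k) Y"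
  shows "stopped_sum (digits d n) (\<lambda>k. (0, k)) (\<lambda>k w. slice d n f J w k) (Suc n) Y"
proof
  fix k
  show "odd_at (0, k) (\<lambda>w. slice d n f J w k)"
    unfolding slice_def using hsum_odd[OF assms(1,2), of "J(0 := J 0 \<inter> {k})" k] by auto
  show "(\<forall>w. slice d n f J w k = 0) \<or> ((0, k) \<in> digits d n \<and> inv_at (0, k) Y)" if "k < Suc n"
    using assms that slice_outside[OF assms(2)] by (cases "k \<in> J 0") (auto simp: digits_def)
  fix i assume "i < k"
  then show "inv_at (0, k) (\<lambda>w. slice d n f J w i)"
    unfolding slice_def using hsum_inv[OF assms(1,2), of "J(0 := J 0 \<inter> {i})" k] by auto
qed

lemma avg_frozen:
  assumes "rsys d n f" "0 < d" "\<And>k. k \<in> J 0 \<Longrightarrow> inv_at (0, k) Y"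
  shows "avg (digits d n) (\<lambda>w. frozen d n f Dm Q J w * Y w) = 0"
  using stopped_sum.avg_stopped[OF frozen_stopped_sum[OF assms], where m = "Suc n" and Dm = Dm and Q = Q]
  by (simp add: frozen_def del: stopped.simps)

lemma avg_frozen_sq:
  assumes "rsys d n f" "0 < d" "\<And>k. k \<in> J 0 \<Longrightarrow> inv_at (0, k) Y" "0 \<le> Q" "\<And>w. 0 \<le> Y w"
  shows "avg (digits d n) (\<lambda>w. (frozen d n f Dm Q J w)\<^sup>2 * Y w) \<le> Q * avg (digits d n) Y"
  using stopped_sum.avg_stopped_sq[OF frozen_stopped_sum[OF assms(1-3)] assms(4,5), where Dm = Dm]
  by (simp add: frozen_def del: stopped.simps)

text \<open>The Riesz product. Its factors are bounded below by \<open>1 / 2\<close> and belong to different slabs of the first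
  coordinate, so that its mean is exactly 1.\<close>

locale tilted =
  fixes d n :: nat and f :: "(nat \<Rightarrow> nat) \<Rightarrow> (nat \<times> nat) set \<Rightarrow> real" and \<rho> Dm Q :: real and L :: nat
  assumes f: "rsys d n f" and d: "3 \<le> d" and \<rho>: "0 \<le> \<rho>" and Dm: "0 \<le> Dm" and Q: "0 \<le> Q"
    and half: "\<rho> * (Dm + sqrt Q) \<le> 1 / 2"
begin

abbreviation "E \<equiv> avg (digits d n)"

definition slabbed :: "(nat \<Rightarrow> nat \<Rightarrow> nat set) \<Rightarrow> bool" where
  "slabbed J \<longleftrightarrow> (\<forall>t j. J t j \<subseteq> {..n}) \<and> (\<forall>t. \<forall>k\<in>J t 0. k div L = t)"

definition tilt :: "(nat \<Rightarrow> nat \<Rightarrow> nat set) \<Rightarrow> nat set \<Rightarrow> (nat \<times> nat) set \<Rightarrow> real" where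
  "tilt J T w = (\<Prod>t\<in>T. 1 + \<rho> * frozen d n f Dm Q (J t) w)"

lemma d0: "0 < d" using d by simp

lemma factor_bounds: "1 / 2 \<le> 1 + \<rho> * frozen d n f Dm Q J w" "1 + \<rho> * frozen d n f Dm Q J w \<le> 3 / 2"
proof -
  have "\<bar>frozen d n f Dm Q J w\<bar> \<le> Dm + sqrt Q" unfolding frozen_def using Dm Q by (rule stopped_bound)
  then have "\<rho> * \<bar>frozen d n f Dm Q J w\<bar> \<le> 1 / 2" using half \<rho> by (meson mult_left_mono order_trans)
  then have "\<bar>\<rho> * frozen d n f Dm Q J w\<bar> \<le> 1 / 2" using \<rho> by (simp add: abs_mult)
  then show "1 / 2 \<le> 1 + \<rho> * frozen d n f Dm Q J w" "1 + \<rho> * frozen d n f Dm Q J w \<le> 3 / 2" by linarith+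
qed

lemma tilt_pos: "0 < tilt J T w"
  unfolding tilt_def
proof (rule prod_pos)
  fix t show "0 < 1 + \<rho> * frozen d n f Dm Q (J t) w" using factor_bounds(1)[of "J t" w] by linarith
qed

lemma slabbed_less:
  assumes "slabbed J" "s < t" "y \<in> J s 0" "k \<in> J t 0"
  shows "y < k"
proof (rule ccontr)
  assume "\<not> y < k"
  then have "k div L \<le> y div L" by (intro div_le_mono) simp
  then show False using assms by (auto simp: slabbed_def)
qed

lemma tilt_inv: "c < d \<Longrightarrow> (\<And>t y. t \<in> T \<Longrightarrow> y \<in> J t c \<Longrightarrow> y < i) \<Longrightarrow> inv_at (c, i) (tilt J T)"
  unfolding tilt_def[abs_def] using f by (intro inv_prod inv_comp2[where ?g2.0 = "\<lambda>x y. 1 + x * y"] inv_const frozen_inv') auto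

text \<open>The top slab is removed first: \<open>Y\<close> and the lower factors ignore its digits,
  so its frozen martingale has mean zero against them.\<close>

lemma avg_tilt:
  assumes "finite T" "slabbed J" "\<And>t k. t \<in> T \<Longrightarrow> k \<in> J t 0 \<Longrightarrow> inv_at (0, k) Y"
  shows "E (\<lambda>w. Y w * tilt J T w) = E Y"
  using assms
proof (induction T rule: finite_linorder_max_induct)
  case (insert t T)
  have "E (\<lambda>w. Y w * tilt J (insert t T) w) =
    E (\<lambda>w. Y w * tilt J T w + \<rho> * (frozen d n f Dm Q (J t) w * (Y w * tilt J T w)))"
    using insert.hyps by (intro avg_cong) (auto simp: tilt_def algebra_simps)
  also have "\<dots> = E (\<lambda>w. Y w * tilt J T w) + \<rho> * 0"
    unfolding avg_add avg_cmult
    using insert.prems insert.hyps slabbed_less[OF assms(2)] f d0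
    by (subst avg_frozen) (auto intro!: inv_comp2[where ?g2.0 = "(*)"] tilt_inv)
  also have "E (\<lambda>w. Y w * tilt J T w) = E Y"
    by (rule insert.IH) (use insert.prems in auto)
  finally show ?case by simp
qed (simp add: tilt_def)

lemma avg_tilt_1: "finite T \<Longrightarrow> slabbed J \<Longrightarrow> E (tilt J T) = 1"
  using avg_tilt[of T J "\<lambda>_. 1"] by (simp add: inv_const avg_const)

lemma avg_tilt_sq:
  assumes "finite T" "slabbed J"
  shows "E (\<lambda>w. (tilt J T w)\<^sup>2) \<le> (1 + \<rho>\<^sup>2 * Q) ^ card T"
  using assms(1)
proof (induction T rule: finite_linorder_max_induct)
  case empty
  then show ?case by (simp add: tilt_def avg_const)
next
  case (insert t T)
  have inv: "inv_at (0, k) (\<lambda>w. (tilt J T w)\<^sup>2)" if "k \<in> J t 0" for k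
    using insert.hyps slabbed_less[OF assms(2)] d0 that by (intro inv_comp1[where g = "\<lambda>x. x\<^sup>2"] tilt_inv) auto
  have "E (\<lambda>w. (tilt J (insert t T) w)\<^sup>2) =
    E (\<lambda>w. (tilt J T w)\<^sup>2 + 2 * \<rho> * (frozen d n f Dm Q (J t) w * (tilt J T w)\<^sup>2)
      + \<rho>\<^sup>2 * ((frozen d n f Dm Q (J t) w)\<^sup>2 * (tilt J T w)\<^sup>2))"
    using insert.hyps by (intro avg_cong) (auto simp: tilt_def power2_eq_square algebra_simps)
  also have "\<dots> = E (\<lambda>w. (tilt J T w)\<^sup>2) + 2 * \<rho> * 0 + \<rho>\<^sup>2 * E (\<lambda>w. (frozen d n f Dm Q (J t) w)\<^sup>2 * (tilt J T w)\<^sup>2)"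
    unfolding avg_add avg_cmult using inv f d0 by (subst avg_frozen[where Y = "\<lambda>w. (tilt J T w)\<^sup>2"]) auto
  also have "\<dots> \<le> E (\<lambda>w. (tilt J T w)\<^sup>2) + 2 * \<rho> * 0 + \<rho>\<^sup>2 * (Q * E (\<lambda>w. (tilt J T w)\<^sup>2))"
    using inv f d0 Q by (intro add_left_mono mult_left_mono avg_frozen_sq) auto
  also have "\<dots> = (1 + \<rho>\<^sup>2 * Q) * E (\<lambda>w. (tilt J T w)\<^sup>2)" by (simp add: algebra_simps)
  also have "\<dots> \<le> (1 + \<rho>\<^sup>2 * Q) * (1 + \<rho>\<^sup>2 * Q) ^ card T"
    using insert.IH Q by (intro mult_left_mono) auto
  also have "\<dots> = (1 + \<rho>\<^sup>2 * Q) ^ card (insert t T)" using insert.hyps by auto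
  finally show ?case .
qed

text \<open>Cauchy-Schwarz transfers a small probability to the tilted measure. The second moment of
  the tilt may be exponentially large, but with the parameters chosen later the bad events are rarer
  still.\<close>

lemma avg_bad_tilt:
  assumes "finite T" "slabbed J" "E (\<lambda>w. of_bool (\<not> G w)) \<le> p" "card T \<le> q"
  shows "E (\<lambda>w. of_bool (\<not> G w) * tilt J T w) \<le> sqrt (p * (1 + \<rho>\<^sup>2 * Q) ^ q)"
proof (rule real_le_rsqrt)
  have le: "0 \<le> E (\<lambda>w. of_bool (\<not> G w))" by (rule avg_nonneg) simp
  have "(\<Sum>w\<in>Pow (digits d n). of_bool (\<not> G w) * tilt J T w)\<^sup>2
     \<le> (\<Sum>w\<in>Pow (digits d n). (of_bool (\<not> G w))\<^sup>2) * (\<Sum>w\<in>Pow (digits d n). (tilt J T w)\<^sup>2)"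
    by (rule Cauchy_Schwarz_ineq_sum)
  then have "(E (\<lambda>w. of_bool (\<not> G w) * tilt J T w))\<^sup>2 \<le> E (\<lambda>w. of_bool (\<not> G w)) * E (\<lambda>w. (tilt J T w)\<^sup>2)"
    by (simp add: avg_def power_divide divide_right_mono power2_eq_square)
  also have "\<dots> \<le> p * (1 + \<rho>\<^sup>2 * Q) ^ card T"
    using assms le avg_nonneg[of "digits d n" "\<lambda>w. (tilt J T w)\<^sup>2"] by (intro mult_mono avg_tilt_sq) auto
  also have "\<dots> \<le> p * (1 + \<rho>\<^sup>2 * Q) ^ q"
    using assms le Q by (intro mult_left_mono power_increasing) auto
  finally show "(E (\<lambda>w. of_bool (\<not> G w) * tilt J T w))\<^sup>2 \<le> p * (1 + \<rho>\<^sup>2 * Q) ^ q" .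
qed

end

section \<open>Uncovering one coordinate\<close>

lemma finite_subsets_Collect: "finite T \<Longrightarrow> finite {U. U \<subseteq> T \<and> P U}"
  by (rule finite_subset[of _ "Pow T"]) auto

lemma card_subsets_le: "finite T \<Longrightarrow> card T \<le> q \<Longrightarrow> card {U. U \<subseteq> T \<and> card U = k} \<le> q ^ k"
proof -
  assume T: "finite T" "card T \<le> q"
  have "card {U. U \<subseteq> T \<and> card U = k} = card T choose k" using T by (intro n_subsets)
  also have "\<dots> \<le> card T ^ k" by (cases "k \<le> card T") (simp_all add: binomial_le_pow binomial_eq_0)
  also have "\<dots> \<le> q ^ k" using T by (intro power_mono) auto
  finally show ?thesis .
qed

lemma geometric_tail: "0 \<le> z \<Longrightarrow> 2 * z \<le> 1 \<Longrightarrow> (\<Sum>k=m..N. z ^ k) \<le> 2 * (z :: real) ^ m"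
proof -
  assume z: "0 \<le> z" "2 * z \<le> 1"
  have *: "(\<Sum>k=m..m + i. z ^ k) \<le> 2 * z ^ m - z ^ (m + i)" for i
  proof (induction i)
    case (Suc i)
    have "2 * z * z ^ (m + i) \<le> 1 * z ^ (m + i)" using z by (intro mult_right_mono) auto
    moreover have "(\<Sum>k=m..m + Suc i. z ^ k) = (\<Sum>k=m..m + i. z ^ k) + z * z ^ (m + i)" by simp
    moreover have "z ^ (m + Suc i) = z * z ^ (m + i)" by simp
    ultimately show ?case using Suc by linarith
  qed simp
  show ?thesis
  proof (cases "m \<le> N")
    case True
    then obtain i where "N = m + i" using le_Suc_ex by blast
    then show ?thesis using *[of i] zero_le_power[OF z(1), of "m + i"] by (simp only:)
  next
    case False
    then have "{m..N} = {}" by simp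
    then show ?thesis using zero_le_power[OF z(1), of m] by (simp only: sum.empty)
  qed
qed

text \<open>There are at most \<open>q ^ k\<close> subsets of size \<open>k\<close>, so a geometric
  series of ratio at most 1 / 2 dominates.\<close>

lemma sum_large_subsets:
  fixes y :: real and T :: "'t set"
  assumes "finite T" "card T \<le> q" "0 \<le> y" "2 * (y * real q) \<le> 1"
  shows "(\<Sum>U | U \<subseteq> T \<and> m \<le> card U. y ^ card U) \<le> 2 * (y * real q) ^ m"
proof -
  have fin: "finite {U. U \<subseteq> T \<and> m \<le> card U}" using assms(1) by (simp add: finite_subsets_Collect)
  have "(\<Sum>U | U \<subseteq> T \<and> m \<le> card U. y ^ card U)
    = (\<Sum>k=m..card T. \<Sum>U | U \<in> {U. U \<subseteq> T \<and> m \<le> card U} \<and> card U = k. y ^ card U)"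
  proof (rule sum.group[symmetric])
    show "card ` {U. U \<subseteq> T \<and> m \<le> card U} \<subseteq> {m..card T}"
      using card_mono[OF assms(1)] by (simp add: image_subset_iff)
  qed (use fin in simp_all)
  also have "\<dots> \<le> (\<Sum>k=m..card T. (y * real q) ^ k)"
  proof (intro sum_mono)
    fix k assume "k \<in> {m..card T}"
    have "(\<Sum>U | U \<in> {U. U \<subseteq> T \<and> m \<le> card U} \<and> card U = k. y ^ card U) \<le> (\<Sum>U | U \<subseteq> T \<and> card U = k. y ^ k)"
    proof -
      have "{U. U \<in> {U. U \<subseteq> T \<and> m \<le> card U} \<and> card U = k} = {U. U \<subseteq> T \<and> card U = k}"
        using \<open>k \<in> {m..card T}\<close> by auto
      then show ?thesis by (intro eq_refl sum.cong) auto
    qed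
    also have "\<dots> = real (card {U. U \<subseteq> T \<and> card U = k}) * y ^ k" by simp
    also have "\<dots> \<le> real (q ^ k) * y ^ k"
      using card_subsets_le[OF assms(1,2), of k] assms(3) by (intro mult_right_mono) (simp_all only: of_nat_le_iff zero_le_power)
    finally show "(\<Sum>U | U \<in> {U. U \<subseteq> T \<and> m \<le> card U} \<and> card U = k. y ^ card U) \<le> (y * real q) ^ k"
      by (simp add: power_mult_distrib mult.commute)
  qed
  also have "\<dots> \<le> 2 * (y * real q) ^ m" using assms by (intro geometric_tail) auto
  finally show ?thesis .
qed

text \<open>Every factor of \<open>T - A\<close> is at least 1 / 2, so leaving it out costs at most
  a factor 2. Thus all terms of an expansion are compared with one and the same positive product,
  which in the applications is a probability density; no loss exponential in the number of slabs
  occurs.\<close>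

lemma expansion_term_bound:
  fixes a x :: "'t \<Rightarrow> real"
  assumes "finite T" "U \<subseteq> T" "\<And>t. t \<in> T \<inter> A \<Longrightarrow> \<bar>a t\<bar> \<le> 1" "\<And>t. t \<in> T - A \<Longrightarrow> 1 / 2 \<le> a t" "\<And>t. t \<in> U \<Longrightarrow> \<bar>x t\<bar> \<le> \<xi>"
  shows "\<bar>(\<Prod>t\<in>U. x t) * (\<Prod>t\<in>T - U. a t)\<bar> \<le> (2 * \<xi>) ^ card U * (\<Prod>t\<in>T - A. a t)"
proof -
  have finU: "finite U" using assms finite_subset by auto
  have x: "\<bar>\<Prod>t\<in>U. x t\<bar> \<le> \<xi> ^ card U"
    unfolding abs_prod using prod_mono[of U "\<lambda>t. \<bar>x t\<bar>" "\<lambda>_. \<xi>"] assms(5) by simp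
  have pos: "0 < a t" if "t \<in> T - A" for t using assms(4)[OF that] by linarith
  have "\<bar>\<Prod>t\<in>T - U. a t\<bar> = (\<Prod>t\<in>(T - U) \<inter> A. \<bar>a t\<bar>) * (\<Prod>t\<in>T - U - A. \<bar>a t\<bar>)"
    unfolding abs_prod using assms(1) by (subst prod.Int_Diff[of _ _ A]) auto
  also have "(\<Prod>t\<in>T - U - A. \<bar>a t\<bar>) = (\<Prod>t\<in>T - A - U. a t)"
    using pos by (intro prod.cong) (auto simp: less_imp_le)
  also have "(\<Prod>t\<in>(T - U) \<inter> A. \<bar>a t\<bar>) * (\<Prod>t\<in>T - A - U. a t) \<le> 1 * (\<Prod>t\<in>T - A - U. a t)"
    using assms(3) pos by (intro mult_right_mono prod_le_1 prod_nonneg) (auto simp: less_imp_le)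
  also have "\<dots> \<le> 2 ^ card U * (\<Prod>t\<in>T - A. a t)"
  proof -
    have "(1 / 2) ^ card U \<le> (1 / 2 :: real) ^ card ((T - A) \<inter> U)"
      using finU by (intro power_decreasing card_mono) auto
    also have "\<dots> \<le> (\<Prod>t\<in>(T - A) \<inter> U. a t)"
      using prod_mono[of "(T - A) \<inter> U" "\<lambda>_. 1 / 2" a] assms(4) by simp
    finally have "(1 / 2) ^ card U * (\<Prod>t\<in>T - A - U. a t) \<le> (\<Prod>t\<in>(T - A) \<inter> U. a t) * (\<Prod>t\<in>T - A - U. a t)"
      using pos by (intro mult_right_mono prod_nonneg) (auto simp: less_imp_le)
    also have "\<dots> = (\<Prod>t\<in>T - A. a t)" using assms(1) by (intro prod.Int_Diff[symmetric]) auto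
    finally have "2 ^ card U * ((1 / 2) ^ card U * (\<Prod>t\<in>T - A - U. a t)) \<le> 2 ^ card U * (\<Prod>t\<in>T - A. a t)"
      by (intro mult_left_mono) auto
    then show ?thesis by (simp add: power_one_over)
  qed
  finally have "\<bar>\<Prod>t\<in>U. x t\<bar> * \<bar>\<Prod>t\<in>T - U. a t\<bar> \<le> \<xi> ^ card U * (2 ^ card U * (\<Prod>t\<in>T - A. a t))"
    using x by (intro mult_mono order_trans[OF abs_ge_zero x]) auto
  then show ?thesis by (simp add: abs_mult power_mult_distrib mult_ac)
qed

lemma avg_split_good:
  assumes "\<And>w. G w \<Longrightarrow> \<bar>Z w\<bar> \<le> X w" "\<And>w. \<bar>Z w\<bar> \<le> V w" "\<And>w. 0 \<le> X w"
  shows "avg D (\<lambda>w. \<bar>Z w\<bar>) \<le> avg D X + avg D (\<lambda>w. of_bool (\<not> G w) * V w)"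
  unfolding avg_add[symmetric]
proof (rule avg_mono)
  fix w show "\<bar>Z w\<bar> \<le> X w + of_bool (\<not> G w) * V w"
    using assms(1)[of w] assms(2)[of w] assms(3)[of w] by (cases "G w") auto
qed

context tilted begin

text \<open>A factor in \<open>A\<close> has entered through a difference of two boxes, in which the
  constant 1 cancels. It is kept unstopped, because its sum is later expanded into single
  indices.\<close>

definition prodX :: "(nat \<Rightarrow> nat \<Rightarrow> nat set) \<Rightarrow> nat set \<Rightarrow> nat set \<Rightarrow> (nat \<times> nat) set \<Rightarrow> real" where
  "prodX J A T w = (\<Prod>t\<in>T. if t \<in> A then \<rho> * hsum d n f (J t) w else 1 + \<rho> * frozen d n f Dm Q (J t) w)"

end

text \<open>The coordinate \<open>c\<close> of the boxes is uncovered block by block, and the change of the product is expanded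
  in the number of factors that the new block enters. One factor gives the main term, two factors are controlled by
  Beck's gain where their levels coincide in \<open>c\<close> and by orthogonality where they do not, and three or more factors
  are small trivially. The square function of \<open>H\<close> along \<open>c\<close> pays for the number of blocks.\<close>

locale stage = tilted +
  fixes H :: "(nat \<times> nat) set \<Rightarrow> real" and J :: "nat \<Rightarrow> nat \<Rightarrow> nat set" and A T :: "nat set" and q c Lc Nc :: nat
    and p \<xi> \<zeta> \<Gamma> :: real and G :: "nat \<Rightarrow> (nat \<times> nat) set \<Rightarrow> bool"
  assumes H: "\<And>w. \<bar>H w\<bar> \<le> 1" "E H = 0" and T: "finite T" "card T \<le> q" "A \<subseteq> T" and c: "1 \<le> c" "c < d"
    and Lc: "1 \<le> Lc" "n < Nc * Lc" and J: "slabbed J"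
    and bad: "\<And>\<kappa>. \<kappa> < Nc \<Longrightarrow> E (\<lambda>w. of_bool (\<not> G \<kappa> w)) \<le> p"
    and G1: "\<And>\<kappa> w t. G \<kappa> w \<Longrightarrow> \<kappa> < Nc \<Longrightarrow> t \<in> T \<Longrightarrow> tame d n f Dm Q ((J t)(c := J t c \<inter> {..<\<kappa> * Lc})) w"
    and G2: "\<And>\<kappa> w t. G \<kappa> w \<Longrightarrow> \<kappa> < Nc \<Longrightarrow> t \<in> T \<Longrightarrow> tame d n f Dm Q ((J t)(c := J t c \<inter> {..<Suc \<kappa> * Lc})) w"
    and G3: "\<And>\<kappa> w t. G \<kappa> w \<Longrightarrow> \<kappa> < Nc \<Longrightarrow> t \<in> T \<Longrightarrow>
      \<bar>\<rho> * hsum d n f ((J t)(c := J t c \<inter> {\<kappa> * Lc..<Suc \<kappa> * Lc})) w\<bar> \<le> \<xi>"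
    and G4: "\<And>\<kappa> w s t. G \<kappa> w \<Longrightarrow> \<kappa> < Nc \<Longrightarrow> s \<in> T \<Longrightarrow> t \<in> T \<Longrightarrow> s \<noteq> t \<Longrightarrow>
      \<bar>\<rho>\<^sup>2 * psum d n f {c} ((J s)(c := J s c \<inter> {\<kappa> * Lc..<Suc \<kappa> * Lc})) ((J t)(c := J t c \<inter> {\<kappa> * Lc..<Suc \<kappa> * Lc})) w\<bar> \<le> \<zeta>"
    and \<Gamma>: "1 \<le> \<Gamma>" "\<And>I w. (\<forall>j. I j \<subseteq> {..n}) \<Longrightarrow> \<bar>\<rho> * hsum d n f I w\<bar> \<le> \<Gamma>"
      "\<And>I I' w. (\<forall>j. I j \<subseteq> {..n} \<and> I' j \<subseteq> {..n}) \<Longrightarrow> \<bar>\<rho>\<^sup>2 * psum d n f {c} I I' w\<bar> \<le> \<Gamma>\<^sup>2"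
    and num: "0 \<le> \<xi>" "0 \<le> \<zeta>" "4 * (\<xi> * q) \<le> 1" "0 \<le> p"
begin

definition low :: "nat \<Rightarrow> nat \<Rightarrow> nat \<Rightarrow> nat set" where
  "low \<kappa> t = (J t)(c := J t c \<inter> {..<\<kappa> * Lc})"

definition mid :: "nat \<Rightarrow> nat \<Rightarrow> nat \<Rightarrow> nat set" where
  "mid \<kappa> t = (J t)(c := J t c \<inter> {\<kappa> * Lc..<Suc \<kappa> * Lc})"

definition a :: "nat \<Rightarrow> nat \<Rightarrow> (nat \<times> nat) set \<Rightarrow> real" where
  "a \<kappa> t w = (if t \<in> A then \<rho> * hsum d n f (low \<kappa> t) w else 1 + \<rho> * frozen d n f Dm Q (low \<kappa> t) w)"

definition x :: "nat \<Rightarrow> nat \<Rightarrow> (nat \<times> nat) set \<Rightarrow> real" where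
  "x \<kappa> t w = \<rho> * hsum d n f (mid \<kappa> t) w"

definition W :: "nat \<Rightarrow> (nat \<times> nat) set \<Rightarrow> real" where
  "W \<kappa> w = tilt (low \<kappa>) (T - A) w"

definition \<beta> :: real where "\<beta> = sqrt (p * (1 + \<rho>\<^sup>2 * Q) ^ q)"

text \<open>The contribution of a bad event: \<open>\<beta>\<close> bounds its tilted probability,
  and \<open>\<Gamma>\<close> each unstopped factor, of which \<open>card A\<close> are old and at
  most two are new.\<close>

definition B :: real where "B = \<Gamma> ^ (card A + 2) * \<beta>"

definition trm :: "nat \<Rightarrow> nat set \<Rightarrow> (nat \<times> nat) set \<Rightarrow> real" where
  "trm \<kappa> U w = (\<Prod>t\<in>U. x \<kappa> t w) * (\<Prod>t\<in>T - U. a \<kappa> t w)"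

definition subs :: "nat \<Rightarrow> nat set set" where
  "subs k = {U. U \<subseteq> T \<and> card U = k}"

text \<open>\<open>H\<close> with the digits of the coordinate \<open>c\<close> from block
  \<open>\<kappa>\<close> on averaged out; as \<open>\<kappa>\<close> grows this is a
  martingale.\<close>

definition Hc :: "nat \<Rightarrow> (nat \<times> nat) set \<Rightarrow> real" where
  "Hc \<kappa> = cex (digits d n) {u. \<not> (fst u = c \<and> \<kappa> * Lc \<le> snd u)} H"

lemma c0: "c \<noteq> 0" "0 < d" using c by auto

lemma \<beta>_nonneg: "0 \<le> \<beta>" using num Q by (simp add: \<beta>_def)

lemma \<beta>_le_B: "\<beta> \<le> B"
  using \<Gamma>(1) \<beta>_nonneg one_le_power[of \<Gamma> "card A + 2"] mult_right_mono[of 1 "\<Gamma> ^ (card A + 2)" \<beta>] by (simp add: B_def)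

lemma finA: "finite A" using T finite_subset by auto

lemma fin_subs: "finite (subs k)" unfolding subs_def using T by (simp add: finite_subsets_Collect)

lemma card_subs: "card (subs k) \<le> q ^ k" unfolding subs_def using T by (intro card_subsets_le) auto

lemma J_le: "J t j \<subseteq> {..n}" using J by (simp add: slabbed_def)

lemma low_le: "low \<kappa> t j \<subseteq> {..n}" and mid_le: "mid \<kappa> t j \<subseteq> {..n}"
  using J_le[of t j] by (auto simp: low_def mid_def)

lemma slabbed_low: "slabbed (low \<kappa>)"
  using J c0 by (auto simp: slabbed_def low_def)

lemma low_c: "y \<in> low \<kappa> t c \<Longrightarrow> y < \<kappa> * Lc" and mid_c: "y \<in> mid \<kappa> t c \<Longrightarrow> \<kappa> * Lc \<le> y \<and> y < Suc \<kappa> * Lc"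
  by (auto simp: low_def mid_def)

lemma W_pos: "0 < W \<kappa> w" by (simp add: W_def tilt_pos)

lemma W_avg: "E (W \<kappa>) = 1"
  unfolding W_def[abs_def] using T slabbed_low by (intro avg_tilt_1) auto

lemma bad_tilt: "\<kappa> < Nc \<Longrightarrow> U \<subseteq> T \<Longrightarrow> E (\<lambda>w. of_bool (\<not> G \<kappa> w) * tilt (low \<kappa>') U w) \<le> \<beta>"
  unfolding \<beta>_def using T slabbed_low bad card_mono[of T U]
  by (intro avg_bad_tilt) (auto intro: finite_subset)

lemma a_inv: "\<kappa> * Lc \<le> y \<Longrightarrow> inv_at (c, y) (a \<kappa> t)"
proof -
  assume y: "\<kappa> * Lc \<le> y"
  have "inv_at (c, y) (hsum d n f (low \<kappa> t))" "inv_at (c, y) (frozen d n f Dm Q (low \<kappa> t))"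
    using f c y low_c by (intro hsum_inv frozen_inv'; force)+
  then show ?thesis by (simp add: inv_at_def a_def)
qed

lemma x_inv: "Suc \<kappa> * Lc \<le> y \<Longrightarrow> inv_at (c, y) (x \<kappa> t)"
proof -
  assume y: "Suc \<kappa> * Lc \<le> y"
  have "inv_at (c, y) (hsum d n f (mid \<kappa> t))" using f c y mid_c by (intro hsum_inv; force)
  then show ?thesis by (simp add: inv_at_def x_def)
qed

lemma Hc_inv: "\<kappa> * Lc \<le> y \<Longrightarrow> inv_at (c, y) (Hc \<kappa>)"
  unfolding Hc_def by (intro inv_cex) simp

lemma Hc_bound: "\<bar>Hc \<kappa> w\<bar> \<le> 1"
  unfolding Hc_def using H by (intro cex_bound) auto

lemma Hc_avg:
  assumes "\<And>y. \<kappa> * Lc \<le> y \<Longrightarrow> inv_at (c, y) Y"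
  shows "E (\<lambda>w. Hc \<kappa> w * Y w) = E (\<lambda>w. H w * Y w)"
  unfolding Hc_def using assms by (intro avg_cex_mult) auto

lemma good_a: "G \<kappa> w \<Longrightarrow> \<kappa> < Nc \<Longrightarrow> t \<in> T \<inter> A \<Longrightarrow> \<bar>a \<kappa> t w\<bar> \<le> 1"
proof -
  assume g: "G \<kappa> w" "\<kappa> < Nc" "t \<in> T \<inter> A"
  have "\<bar>hsum d n f (low \<kappa> t) w\<bar> \<le> Dm"
  proof (rule tame_frozen(2)[OF d0 low_le])
    show "tame d n f Dm Q (low \<kappa> t) w" using G1[OF g(1,2), of t] g(3) by (simp only: low_def) blast
  qed
  moreover have "0 \<le> sqrt Q" using Q by simp
  ultimately have "\<rho> * \<bar>hsum d n f (low \<kappa> t) w\<bar> \<le> \<rho> * (Dm + sqrt Q)" using \<rho> by (intro mult_left_mono) linarith+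
  then show ?thesis using g(3) half \<rho> by (simp add: a_def abs_mult)
qed

lemma a_half: "t \<in> T - A \<Longrightarrow> 1 / 2 \<le> a \<kappa> t w"
  using factor_bounds(1)[of "low \<kappa> t" w] by (simp add: a_def)

lemma W_prod: "W \<kappa> w = (\<Prod>t\<in>T - A. a \<kappa> t w)"
  unfolding W_def tilt_def by (intro prod.cong) (auto simp: a_def)

lemma good_trm:
  assumes "G \<kappa> w" "\<kappa> < Nc" "U \<subseteq> T"
  shows "\<bar>trm \<kappa> U w\<bar> \<le> (2 * \<xi>) ^ card U * W \<kappa> w"
  unfolding trm_def W_prod using T assms good_a a_half G3
  by (intro expansion_term_bound) (auto simp: x_def mid_def)

lemma prod_a_crude: "V \<subseteq> T \<Longrightarrow> \<bar>\<Prod>t\<in>V. a \<kappa> t w\<bar> \<le> \<Gamma> ^ card A * tilt (low \<kappa>) (V - A) w"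
proof -
  assume V: "V \<subseteq> T"
  then have finV: "finite V" using T finite_subset by auto
  have "\<bar>\<Prod>t\<in>V. a \<kappa> t w\<bar> = (\<Prod>t\<in>V \<inter> A. \<bar>a \<kappa> t w\<bar>) * (\<Prod>t\<in>V - A. \<bar>a \<kappa> t w\<bar>)"
    unfolding abs_prod using finV by (rule prod.Int_Diff)
  also have "(\<Prod>t\<in>V - A. \<bar>a \<kappa> t w\<bar>) = tilt (low \<kappa>) (V - A) w"
    unfolding tilt_def
  proof (intro prod.cong refl)
    fix t assume t: "t \<in> V - A"
    then have "1 / 2 \<le> a \<kappa> t w" using V by (intro a_half) auto
    then have "\<bar>a \<kappa> t w\<bar> = a \<kappa> t w" by linarith
    then show "\<bar>a \<kappa> t w\<bar> = 1 + \<rho> * frozen d n f Dm Q (low \<kappa> t) w" using t by (simp add: a_def)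
  qed
  also have "(\<Prod>t\<in>V \<inter> A. \<bar>a \<kappa> t w\<bar>) * tilt (low \<kappa>) (V - A) w \<le> \<Gamma> ^ card (V \<inter> A) * tilt (low \<kappa>) (V - A) w"
  proof (intro mult_right_mono)
    have "\<bar>a \<kappa> t w\<bar> \<le> \<Gamma>" if "t \<in> V \<inter> A" for t using \<Gamma>(2)[of "low \<kappa> t" w] low_le that by (simp add: a_def)
    then show "(\<Prod>t\<in>V \<inter> A. \<bar>a \<kappa> t w\<bar>) \<le> \<Gamma> ^ card (V \<inter> A)"
      using prod_mono[of "V \<inter> A" "\<lambda>t. \<bar>a \<kappa> t w\<bar>" "\<lambda>_. \<Gamma>"] by simp
  qed (use tilt_pos[of "low \<kappa>" "V - A" w] in simp)
  also have "\<dots> \<le> \<Gamma> ^ card A * tilt (low \<kappa>) (V - A) w"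
    using \<Gamma>(1) finA tilt_pos[of "low \<kappa>" "V - A" w] by (intro mult_right_mono power_increasing card_mono) auto
  finally show ?thesis .
qed

lemma trm_crude: "U \<subseteq> T \<Longrightarrow> card U \<le> 2 \<Longrightarrow> \<bar>trm \<kappa> U w\<bar> \<le> \<Gamma> ^ (card A + 2) * tilt (low \<kappa>) (T - U - A) w"
proof -
  assume U: "U \<subseteq> T" "card U \<le> 2"
  have "\<bar>x \<kappa> t w\<bar> \<le> \<Gamma>" for t using \<Gamma>(2)[of "mid \<kappa> t" w] mid_le by (simp add: x_def)
  then have "\<bar>\<Prod>t\<in>U. x \<kappa> t w\<bar> \<le> \<Gamma> ^ card U"
    unfolding abs_prod using prod_mono[of U "\<lambda>t. \<bar>x \<kappa> t w\<bar>" "\<lambda>_. \<Gamma>"] by simp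
  also have "\<dots> \<le> \<Gamma> ^ 2" using \<Gamma>(1) U by (intro power_increasing) auto
  finally have "\<bar>\<Prod>t\<in>U. x \<kappa> t w\<bar> * \<bar>\<Prod>t\<in>T - U. a \<kappa> t w\<bar> \<le> \<Gamma> ^ 2 * (\<Gamma> ^ card A * tilt (low \<kappa>) (T - U - A) w)"
    by (intro mult_mono prod_a_crude) auto
  then show ?thesis by (simp add: trm_def abs_mult power_add mult_ac power2_eq_square)
qed

lemma bad_trm: "\<kappa> < Nc \<Longrightarrow> V \<subseteq> T \<Longrightarrow> E (\<lambda>w. of_bool (\<not> G \<kappa> w) * (\<Gamma> ^ (card A + 2) * tilt (low \<kappa>') V w)) \<le> B"
proof -
  assume k: "\<kappa> < Nc" "V \<subseteq> T"
  have "E (\<lambda>w. of_bool (\<not> G \<kappa> w) * (\<Gamma> ^ (card A + 2) * tilt (low \<kappa>') V w))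
     = \<Gamma> ^ (card A + 2) * E (\<lambda>w. of_bool (\<not> G \<kappa> w) * tilt (low \<kappa>') V w)"
    unfolding avg_cmult[symmetric] by (intro avg_cong) simp
  also have "\<dots> \<le> B" unfolding B_def using \<Gamma>(1) k by (intro mult_left_mono bad_tilt) auto
  finally show ?thesis .
qed

lemma low_union: "(J t)(c := J t c \<inter> {..<Suc \<kappa> * Lc}) = (J t)(c := (J t c \<inter> {..<\<kappa> * Lc}) \<union> (J t c \<inter> {\<kappa> * Lc..<Suc \<kappa> * Lc}))"
proof -
  have "{..<Suc \<kappa> * Lc} = {..<\<kappa> * Lc} \<union> {\<kappa> * Lc..<Suc \<kappa> * Lc}" by auto
  then have "J t c \<inter> {..<Suc \<kappa> * Lc} = (J t c \<inter> {..<\<kappa> * Lc}) \<union> (J t c \<inter> {\<kappa> * Lc..<Suc \<kappa> * Lc})" by blast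
  then show ?thesis by simp
qed

lemma hsum_low_Suc: "hsum d n f (low (Suc \<kappa>) t) w = hsum d n f (low \<kappa> t) w + hsum d n f (mid \<kappa> t) w"
  unfolding low_def mid_def low_union using c by (intro hsum_union) auto

lemma a_Suc: "G \<kappa> w \<Longrightarrow> \<kappa> < Nc \<Longrightarrow> t \<in> T \<Longrightarrow> a (Suc \<kappa>) t w = a \<kappa> t w + x \<kappa> t w"
proof -
  assume g: "G \<kappa> w" "\<kappa> < Nc" "t \<in> T"
  have "frozen d n f Dm Q (low \<kappa> t) w = hsum d n f (low \<kappa> t) w"
  proof (rule tame_frozen(1)[OF d0 low_le])
    show "tame d n f Dm Q (low \<kappa> t) w" using G1[OF g] by (simp only: low_def)
  qed
  moreover have "frozen d n f Dm Q (low (Suc \<kappa>) t) w = hsum d n f (low (Suc \<kappa>) t) w"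
  proof (rule tame_frozen(1)[OF d0 low_le])
    show "tame d n f Dm Q (low (Suc \<kappa>) t) w" using G2[OF g] by (simp only: low_def)
  qed
  ultimately show ?thesis by (simp add: a_def x_def hsum_low_Suc algebra_simps)
qed

lemma prod_expand: "G \<kappa> w \<Longrightarrow> \<kappa> < Nc \<Longrightarrow> A' \<subseteq> T \<Longrightarrow>
    (\<Prod>t\<in>A'. a (Suc \<kappa>) t w) = (\<Sum>U\<in>Pow A'. (\<Prod>t\<in>U. x \<kappa> t w) * (\<Prod>t\<in>A' - U. a \<kappa> t w))"
proof -
  assume g: "G \<kappa> w" "\<kappa> < Nc" "A' \<subseteq> T"
  have "(\<Prod>t\<in>A'. a (Suc \<kappa>) t w) = (\<Prod>t\<in>A'. x \<kappa> t w + a \<kappa> t w)"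
    using a_Suc[OF g(1,2)] g(3) by (intro prod.cong) auto
  also have "\<dots> = (\<Sum>U\<in>Pow A'. (\<Prod>t\<in>U. x \<kappa> t w) * (\<Prod>t\<in>A' - U. a \<kappa> t w))"
    using T g(3) by (intro prod_add) (auto intro: finite_subset)
  finally show ?thesis .
qed

definition R :: "nat \<Rightarrow> (nat \<times> nat) set \<Rightarrow> real" where
  "R \<kappa> w = (\<Prod>t\<in>T. a (Suc \<kappa>) t w) - (\<Prod>t\<in>T. a \<kappa> t w) - (\<Sum>U\<in>subs 1. trm \<kappa> U w) - (\<Sum>U\<in>subs 2. trm \<kappa> U w)"

text \<open>On the good event the remainder consists of the terms in which at least three factors
  enter the new block. Off it, the four parts of \<open>R\<close> are bounded one by one.\<close>

lemma R_bound:
  assumes \<kappa>: "\<kappa> < Nc"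
  shows "E (\<lambda>w. \<bar>R \<kappa> w\<bar>) \<le> 16 * (\<xi> * q) ^ 3 + (2 + q + q\<^sup>2) * B"
proof -
  define V where "V w = \<Gamma> ^ (card A + 2) * tilt (low (Suc \<kappa>)) (T - A) w + \<Gamma> ^ (card A + 2) * tilt (low \<kappa>) (T - A) w
    + (\<Sum>U\<in>subs 1. \<Gamma> ^ (card A + 2) * tilt (low \<kappa>) (T - U - A) w) + (\<Sum>U\<in>subs 2. \<Gamma> ^ (card A + 2) * tilt (low \<kappa>) (T - U - A) w)" for w
  have pc: "\<bar>\<Prod>t\<in>T. a \<kappa>' t w\<bar> \<le> \<Gamma> ^ (card A + 2) * tilt (low \<kappa>') (T - A) w" for \<kappa>' w
    using trm_crude[of "{}" \<kappa>' w] by (simp add: trm_def)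
  have s1: "\<bar>\<Sum>U\<in>subs k. trm \<kappa> U w\<bar> \<le> (\<Sum>U\<in>subs k. \<Gamma> ^ (card A + 2) * tilt (low \<kappa>) (T - U - A) w)" if "k \<le> 2" for k w
    using that by (intro order_trans[OF sum_abs sum_mono] trm_crude) (auto simp: subs_def)
  have "E (\<lambda>w. \<bar>R \<kappa> w\<bar>) \<le> E (\<lambda>w. 16 * (\<xi> * q) ^ 3 * W \<kappa> w) + E (\<lambda>w. of_bool (\<not> G \<kappa> w) * V w)"
  proof (rule avg_split_good)
    fix w
    show "0 \<le> 16 * (\<xi> * q) ^ 3 * W \<kappa> w" using num W_pos[of \<kappa> w] by simp
    show "\<bar>R \<kappa> w\<bar> \<le> V w"
      using pc[of "Suc \<kappa>" w] pc[of \<kappa> w] s1[of 1 w] s1[of 2 w] unfolding R_def V_def by linarith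
    assume g: "G \<kappa> w"
    have "(\<Prod>t\<in>T. a (Suc \<kappa>) t w) = (\<Sum>U\<in>Pow T. trm \<kappa> U w)"
      unfolding trm_def by (rule prod_expand[OF g \<kappa>]) simp
    also have "Pow T = insert {} (subs 1 \<union> subs 2 \<union> {U. U \<subseteq> T \<and> 3 \<le> card U})"
    proof -
      have "U = {} \<or> card U = 1 \<or> card U = 2 \<or> 3 \<le> card U" if "U \<subseteq> T" for U
      proof -
        have "finite U" using that T finite_subset by auto
        then have "U = {} \<or> 0 < card U" by (auto simp: card_gt_0_iff)
        moreover have "0 < card U \<Longrightarrow> card U = 1 \<or> card U = 2 \<or> 3 \<le> card U" by linarith
        ultimately show ?thesis by blast
      qed
      then show ?thesis by (auto simp: subs_def)
    qed
    also have "(\<Sum>U\<in>insert {} (subs 1 \<union> subs 2 \<union> {U. U \<subseteq> T \<and> 3 \<le> card U}). trm \<kappa> U w) =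
      trm \<kappa> {} w + ((\<Sum>U\<in>subs 1. trm \<kappa> U w) + (\<Sum>U\<in>subs 2. trm \<kappa> U w) + (\<Sum>U | U \<subseteq> T \<and> 3 \<le> card U. trm \<kappa> U w))"
    proof -
      have fin3: "finite {U. U \<subseteq> T \<and> 3 \<le> card U}" using T by (simp add: finite_subsets_Collect)
      have "(\<Sum>U\<in>subs 1 \<union> subs 2 \<union> {U. U \<subseteq> T \<and> 3 \<le> card U}. trm \<kappa> U w) =
        (\<Sum>U\<in>subs 1 \<union> subs 2. trm \<kappa> U w) + (\<Sum>U | U \<subseteq> T \<and> 3 \<le> card U. trm \<kappa> U w)"
        using fin_subs fin3 by (intro sum.union_disjoint) (auto simp: subs_def)
      also have "(\<Sum>U\<in>subs 1 \<union> subs 2. trm \<kappa> U w) = (\<Sum>U\<in>subs 1. trm \<kappa> U w) + (\<Sum>U\<in>subs 2. trm \<kappa> U w)"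
        using fin_subs by (intro sum.union_disjoint) (auto simp: subs_def)
      finally show ?thesis using fin_subs fin3 by (subst sum.insert) (auto simp: subs_def)
    qed
    finally have "R \<kappa> w = (\<Sum>U | U \<subseteq> T \<and> 3 \<le> card U. trm \<kappa> U w)" by (simp add: R_def trm_def)
    then have "\<bar>R \<kappa> w\<bar> \<le> (\<Sum>U | U \<subseteq> T \<and> 3 \<le> card U. (2 * \<xi>) ^ card U * W \<kappa> w)"
      using good_trm[OF g \<kappa>] by (auto intro!: order_trans[OF sum_abs sum_mono])
    also have "\<dots> = (\<Sum>U | U \<subseteq> T \<and> 3 \<le> card U. (2 * \<xi>) ^ card U) * W \<kappa> w" by (simp add: sum_distrib_right)
    also have "\<dots> \<le> 2 * (2 * \<xi> * q) ^ 3 * W \<kappa> w"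
      using T num W_pos[of \<kappa> w] by (intro mult_right_mono sum_large_subsets) auto
    finally show "\<bar>R \<kappa> w\<bar> \<le> 16 * (\<xi> * q) ^ 3 * W \<kappa> w" by (simp add: power_mult_distrib mult_ac)
  qed
  also have "E (\<lambda>w. 16 * (\<xi> * q) ^ 3 * W \<kappa> w) = 16 * (\<xi> * q) ^ 3" by (simp add: avg_cmult W_avg)
  also have "E (\<lambda>w. of_bool (\<not> G \<kappa> w) * V w) \<le> B + B + (\<Sum>U\<in>subs 1. B) + (\<Sum>U\<in>subs 2. B)"
    unfolding V_def distrib_left sum_distrib_left avg_add avg_sum
    using \<kappa> by (intro add_mono sum_mono bad_trm) auto
  also have "\<dots> \<le> (2 + q + q\<^sup>2) * B"
  proof -
    have "real (card (subs 1)) \<le> q" "real (card (subs 2)) \<le> q\<^sup>2"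
      using card_subs[of 1] card_subs[of 2] by (simp_all flip: of_nat_power)
    then have "real (card (subs 1)) * B \<le> q * B" "real (card (subs 2)) * B \<le> q\<^sup>2 * B"
      using \<beta>_le_B \<beta>_nonneg by (auto intro!: mult_right_mono)
    then show ?thesis by (simp add: distrib_right)
  qed
  finally show ?thesis by simp
qed

text \<open>Of the product of two new sums only the pairs with equal level in \<open>c\<close>
  survive: a pair with different levels is odd in a digit of block \<open>\<kappa>\<close>, which
  neither \<open>Hc \<kappa>\<close> nor the remaining factors see. The surviving pairs are what
  \<open>\<zeta>\<close> controls.\<close>

lemma second_low:
  assumes \<kappa>: "\<kappa> < Nc" and U: "U \<in> subs 2"
  shows "\<bar>E (\<lambda>w. Hc \<kappa> w * trm \<kappa> U w)\<bar> \<le> 4 * \<zeta> + B"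
proof -
  obtain s t where st: "U = {s, t}" "s \<noteq> t" using U by (auto simp: subs_def card_2_iff)
  have stT: "s \<in> T" "t \<in> T" using U st by (auto simp: subs_def)
  define r where "r w = (\<Prod>t\<in>T - U. a \<kappa> t w)" for w
  define P where "P w = \<rho>\<^sup>2 * psum d n f {c} (mid \<kappa> s) (mid \<kappa> t) w" for w
  have r_inv: "inv_at (c, y) r" if "\<kappa> * Lc \<le> y" for y
    unfolding r_def[abs_def] using that by (intro inv_prod a_inv)
  have cr0: "E (\<lambda>w. Hc \<kappa> w * (cross d n f c {} (mid \<kappa> s') (mid \<kappa> t') w * r w)) = 0" for s' t'
  proof -
    have "E (\<lambda>w. Hc \<kappa> w * (cross d n f c {} (mid \<kappa> s') (mid \<kappa> t') w * r w)) =
      (\<Sum>y\<in>mid \<kappa> s' c. E (\<lambda>w. (Hc \<kappa> w * r w) * psum d n f {} ((mid \<kappa> s')(c := {y})) ((mid \<kappa> t')(c := mid \<kappa> t' c \<inter> {..<y})) w))"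
      unfolding avg_sum[symmetric] cross_def by (intro avg_cong) (simp add: sum_distrib_left sum_distrib_right mult_ac)
    also have "\<dots> = 0"
    proof (intro sum.neutral ballI)
      fix y assume y: "y \<in> mid \<kappa> s' c"
      then have "\<kappa> * Lc \<le> y" "y \<le> n" using mid_c mid_le by blast+
      then show "E (\<lambda>w. (Hc \<kappa> w * r w) * psum d n f {} ((mid \<kappa> s')(c := {y})) ((mid \<kappa> t')(c := mid \<kappa> t' c \<inter> {..<y})) w) = 0"
        using c by (intro avg_odd[of "(c, y)"] inv_mult_odd psum_odd[OF f] inv_comp2[where ?g2.0 = "(*)"] Hc_inv r_inv)
          (auto simp: digits_def)
    qed
    finally show ?thesis .
  qed
  have "trm \<kappa> U w = P w * r w + \<rho>\<^sup>2 * (cross d n f c {} (mid \<kappa> s) (mid \<kappa> t) w * r w)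
      + \<rho>\<^sup>2 * (cross d n f c {} (mid \<kappa> t) (mid \<kappa> s) w * r w)" for w
  proof -
    have "hsum d n f (mid \<kappa> s) w * hsum d n f (mid \<kappa> t) w = psum d n f {} (mid \<kappa> s) (mid \<kappa> t) w"
      by (simp add: psum_def fx_def)
    also have "\<dots> = psum d n f {c} (mid \<kappa> s) (mid \<kappa> t) w + cross d n f c {} (mid \<kappa> s) (mid \<kappa> t) w + cross d n f c {} (mid \<kappa> t) (mid \<kappa> s) w"
      using c mid_le by (intro psum_split) auto
    finally show ?thesis using st by (simp add: trm_def x_def r_def P_def power2_eq_square algebra_simps)
  qed
  then have "E (\<lambda>w. Hc \<kappa> w * trm \<kappa> U w) = E (\<lambda>w. Hc \<kappa> w * (P w * r w)
      + \<rho>\<^sup>2 * (Hc \<kappa> w * (cross d n f c {} (mid \<kappa> s) (mid \<kappa> t) w * r w))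
      + \<rho>\<^sup>2 * (Hc \<kappa> w * (cross d n f c {} (mid \<kappa> t) (mid \<kappa> s) w * r w)))"
    by (intro avg_cong) (simp add: algebra_simps)
  also have "\<dots> = E (\<lambda>w. Hc \<kappa> w * (P w * r w))" unfolding avg_add avg_cmult cr0 by simp
  finally have "\<bar>E (\<lambda>w. Hc \<kappa> w * trm \<kappa> U w)\<bar> \<le> E (\<lambda>w. \<bar>Hc \<kappa> w * (P w * r w)\<bar>)" by (simp add: avg_abs)
  also have "\<dots> \<le> E (\<lambda>w. 4 * \<zeta> * W \<kappa> w) + E (\<lambda>w. of_bool (\<not> G \<kappa> w) * (\<Gamma> ^ (card A + 2) * tilt (low \<kappa>) (T - U - A) w))"
  proof (rule avg_split_good)
    fix w
    show "0 \<le> 4 * \<zeta> * W \<kappa> w" using num W_pos[of \<kappa> w] by simp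
    have h: "\<bar>Hc \<kappa> w * (P w * r w)\<bar> \<le> \<bar>P w\<bar> * \<bar>r w\<bar>"
      using mult_right_mono[OF Hc_bound[of \<kappa> w], of "\<bar>P w\<bar> * \<bar>r w\<bar>"] by (simp add: abs_mult)
    have "\<bar>P w\<bar> * \<bar>r w\<bar> \<le> \<Gamma>\<^sup>2 * (\<Gamma> ^ card A * tilt (low \<kappa>) (T - U - A) w)"
      unfolding P_def r_def using mid_le by (intro mult_mono \<Gamma>(3) prod_a_crude) auto
    then show "\<bar>Hc \<kappa> w * (P w * r w)\<bar> \<le> \<Gamma> ^ (card A + 2) * tilt (low \<kappa>) (T - U - A) w"
      using h by (simp add: power_add power2_eq_square mult_ac)
    assume g: "G \<kappa> w"
    have "\<bar>(\<Prod>t\<in>U. 1) * (\<Prod>t\<in>T - U. a \<kappa> t w)\<bar> \<le> (2 * 1) ^ card U * (\<Prod>t\<in>T - A. a \<kappa> t w)"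
      using T stT st good_a[OF g \<kappa>] a_half by (intro expansion_term_bound) auto
    then have "\<bar>r w\<bar> \<le> 4 * W \<kappa> w" using U by (simp add: r_def W_prod subs_def)
    moreover have "\<bar>P w\<bar> \<le> \<zeta>" unfolding P_def mid_def using G4[OF g \<kappa> stT st(2)] .
    ultimately have "\<bar>P w\<bar> * \<bar>r w\<bar> \<le> \<zeta> * (4 * W \<kappa> w)" by (intro mult_mono) (use num in auto)
    then show "\<bar>Hc \<kappa> w * (P w * r w)\<bar> \<le> 4 * \<zeta> * W \<kappa> w" using h by simp
  qed
  also have "\<dots> \<le> 4 * \<zeta> + B" using \<kappa> bad_trm[of \<kappa> "T - U - A" \<kappa>] by (auto simp: avg_cmult W_avg)
  finally show ?thesis .
qed

text \<open>The square function of the martingale \<open>Hc\<close>, block by block, with respect to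
  the probability density \<open>W \<kappa>\<close>.\<close>

definition V :: "nat \<Rightarrow> real" where
  "V \<kappa> = E (\<lambda>w. (Hc (Suc \<kappa>) w - Hc \<kappa> w)\<^sup>2 * W \<kappa> w)"

text \<open>The martingale difference of \<open>H\<close> need not be small in a single block.
  Splitting it by \<open>\<bar>u\<bar> \<le> \<tau> / 2 + u\<^sup>2 / (2 * \<tau>)\<close> with a
  common \<open>\<tau>\<close> reduces everything to the sum of the \<open>V \<kappa>\<close> over
  all blocks.\<close>

lemma second_high:
  assumes \<kappa>: "\<kappa> < Nc" and U: "U \<in> subs 2" and \<tau>: "0 < \<tau>"
  shows "\<bar>E (\<lambda>w. (Hc (Suc \<kappa>) w - Hc \<kappa> w) * trm \<kappa> U w)\<bar> \<le> 4 * \<xi>\<^sup>2 * (\<tau> / 2 + V \<kappa> / (2 * \<tau>)) + 2 * B"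
proof -
  define h where "h w = Hc (Suc \<kappa>) w - Hc \<kappa> w" for w
  have "\<bar>E (\<lambda>w. h w * trm \<kappa> U w)\<bar> \<le> E (\<lambda>w. \<bar>h w * trm \<kappa> U w\<bar>)" by (rule avg_abs)
  also have "\<dots> \<le> E (\<lambda>w. 4 * \<xi>\<^sup>2 * ((\<tau> / 2 + (h w)\<^sup>2 / (2 * \<tau>)) * W \<kappa> w))
      + E (\<lambda>w. of_bool (\<not> G \<kappa> w) * (2 * (\<Gamma> ^ (card A + 2) * tilt (low \<kappa>) (T - U - A) w)))"
  proof (rule avg_split_good)
    fix w
    show "0 \<le> 4 * \<xi>\<^sup>2 * ((\<tau> / 2 + (h w)\<^sup>2 / (2 * \<tau>)) * W \<kappa> w)"
      using num W_pos[of \<kappa> w] \<tau> by simp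
    have "\<bar>h w\<bar> \<le> 2" unfolding h_def using Hc_bound[of \<kappa> w] Hc_bound[of "Suc \<kappa>" w] by linarith
    then show "\<bar>h w * trm \<kappa> U w\<bar> \<le> 2 * (\<Gamma> ^ (card A + 2) * tilt (low \<kappa>) (T - U - A) w)"
      unfolding abs_mult using U by (intro mult_mono trm_crude) (auto simp: subs_def)
    assume g: "G \<kappa> w"
    have "\<bar>trm \<kappa> U w\<bar> \<le> (2 * \<xi>)\<^sup>2 * W \<kappa> w" using good_trm[OF g \<kappa>, of U] U by (simp add: subs_def)
    moreover have "\<bar>h w\<bar> \<le> \<tau> / 2 + (h w)\<^sup>2 / (2 * \<tau>)"
    proof -
      have "0 \<le> (\<bar>h w\<bar> - \<tau>)\<^sup>2" by simp
      then have "2 * \<tau> * \<bar>h w\<bar> \<le> \<tau>\<^sup>2 + (h w)\<^sup>2" by (simp add: power2_diff mult_ac)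
      then show ?thesis using \<tau> by (simp add: field_simps power2_eq_square)
    qed
    ultimately have "\<bar>h w\<bar> * \<bar>trm \<kappa> U w\<bar> \<le> (\<tau> / 2 + (h w)\<^sup>2 / (2 * \<tau>)) * ((2 * \<xi>)\<^sup>2 * W \<kappa> w)"
      using \<tau> by (intro mult_mono) auto
    then show "\<bar>h w * trm \<kappa> U w\<bar> \<le> 4 * \<xi>\<^sup>2 * ((\<tau> / 2 + (h w)\<^sup>2 / (2 * \<tau>)) * W \<kappa> w)"
      by (simp add: abs_mult power_mult_distrib mult_ac)
  qed
  also have "E (\<lambda>w. 4 * \<xi>\<^sup>2 * ((\<tau> / 2 + (h w)\<^sup>2 / (2 * \<tau>)) * W \<kappa> w)) = 4 * \<xi>\<^sup>2 * (\<tau> / 2 + V \<kappa> / (2 * \<tau>))"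
  proof -
    have "E (\<lambda>w. (\<tau> / 2 + (h w)\<^sup>2 / (2 * \<tau>)) * W \<kappa> w) = E (\<lambda>w. \<tau> / 2 * W \<kappa> w + 1 / (2 * \<tau>) * ((h w)\<^sup>2 * W \<kappa> w))"
      by (intro avg_cong) (simp add: algebra_simps)
    also have "\<dots> = \<tau> / 2 + V \<kappa> / (2 * \<tau>)" unfolding avg_add avg_cmult W_avg by (simp add: V_def h_def)
    finally show ?thesis by (simp add: avg_cmult)
  qed
  also have "E (\<lambda>w. of_bool (\<not> G \<kappa> w) * (2 * (\<Gamma> ^ (card A + 2) * tilt (low \<kappa>) (T - U - A) w))) \<le> 2 * B"
  proof -
    have "E (\<lambda>w. of_bool (\<not> G \<kappa> w) * (2 * (\<Gamma> ^ (card A + 2) * tilt (low \<kappa>) (T - U - A) w)))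
      = 2 * E (\<lambda>w. of_bool (\<not> G \<kappa> w) * (\<Gamma> ^ (card A + 2) * tilt (low \<kappa>) (T - U - A) w))"
      unfolding avg_cmult[symmetric] by (intro avg_cong) simp
    then show ?thesis using bad_trm[OF \<kappa>, of "T - U - A" \<kappa>] by auto
  qed
  finally show ?thesis by (simp add: h_def)
qed

lemma W_step:
  assumes \<kappa>: "\<kappa> < Nc"
  shows "E (\<lambda>w. \<bar>W (Suc \<kappa>) w - W \<kappa> w\<bar>) \<le> 4 * (\<xi> * q) + 2 * B"
proof -
  have "E (\<lambda>w. \<bar>W (Suc \<kappa>) w - W \<kappa> w\<bar>) \<le> E (\<lambda>w. 4 * (\<xi> * q) * W \<kappa> w) + E (\<lambda>w. of_bool (\<not> G \<kappa> w) * (W (Suc \<kappa>) w + W \<kappa> w))"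
  proof (rule avg_split_good)
    fix w
    show "0 \<le> 4 * (\<xi> * q) * W \<kappa> w" using num W_pos[of \<kappa> w] by simp
    show "\<bar>W (Suc \<kappa>) w - W \<kappa> w\<bar> \<le> W (Suc \<kappa>) w + W \<kappa> w" using W_pos[of \<kappa> w] W_pos[of "Suc \<kappa>" w] by linarith
    assume g: "G \<kappa> w"
    let ?T = "T - A"
    have finT: "finite ?T" and cT: "card ?T \<le> q" using T card_mono[of T "T - A"] by auto
    have "W (Suc \<kappa>) w = (\<Sum>U\<in>Pow ?T. (\<Prod>t\<in>U. x \<kappa> t w) * (\<Prod>t\<in>?T - U. a \<kappa> t w))"
      unfolding W_prod by (rule prod_expand[OF g \<kappa>]) auto
    also have "Pow ?T = insert {} {U. U \<subseteq> ?T \<and> 1 \<le> card U}"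
    proof -
      have "U = {} \<or> 1 \<le> card U" if "U \<subseteq> ?T" for U
        using finite_subset[OF that finT] by (auto simp: Suc_le_eq card_gt_0_iff)
      then show ?thesis by auto
    qed
    also have "(\<Sum>U\<in>insert {} {U. U \<subseteq> ?T \<and> 1 \<le> card U}. (\<Prod>t\<in>U. x \<kappa> t w) * (\<Prod>t\<in>?T - U. a \<kappa> t w)) =
      W \<kappa> w + (\<Sum>U | U \<subseteq> ?T \<and> 1 \<le> card U. (\<Prod>t\<in>U. x \<kappa> t w) * (\<Prod>t\<in>?T - U. a \<kappa> t w))"
    proof (subst sum.insert)
      show "finite {U. U \<subseteq> ?T \<and> 1 \<le> card U}" using finT by (simp add: finite_subsets_Collect)
    qed (auto simp: W_prod)
    finally have "\<bar>W (Suc \<kappa>) w - W \<kappa> w\<bar> = \<bar>\<Sum>U | U \<subseteq> ?T \<and> 1 \<le> card U. (\<Prod>t\<in>U. x \<kappa> t w) * (\<Prod>t\<in>?T - U. a \<kappa> t w)\<bar>"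
      by simp
    also have "\<dots> \<le> (\<Sum>U | U \<subseteq> ?T \<and> 1 \<le> card U. (2 * \<xi>) ^ card U * W \<kappa> w)"
    proof (rule order_trans[OF sum_abs sum_mono])
      fix U assume U: "U \<in> {U. U \<subseteq> ?T \<and> 1 \<le> card U}"
      have "\<bar>(\<Prod>t\<in>U. x \<kappa> t w) * (\<Prod>t\<in>?T - U. a \<kappa> t w)\<bar> \<le> (2 * \<xi>) ^ card U * (\<Prod>t\<in>?T - A. a \<kappa> t w)"
      proof (rule expansion_term_bound[OF finT])
        show "\<bar>x \<kappa> t w\<bar> \<le> \<xi>" if "t \<in> U" for t using G3[OF g \<kappa>, of t] that U by (auto simp: x_def mid_def)
      qed (use U a_half in auto)
      moreover have "?T - A = T - A" by auto
      ultimately show "\<bar>(\<Prod>t\<in>U. x \<kappa> t w) * (\<Prod>t\<in>?T - U. a \<kappa> t w)\<bar> \<le> (2 * \<xi>) ^ card U * W \<kappa> w"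
        by (simp add: W_prod)
    qed
    also have "\<dots> = (\<Sum>U | U \<subseteq> ?T \<and> 1 \<le> card U. (2 * \<xi>) ^ card U) * W \<kappa> w" by (simp add: sum_distrib_right)
    also have "\<dots> \<le> 2 * (2 * \<xi> * q) ^ 1 * W \<kappa> w"
      using finT cT num W_pos[of \<kappa> w] by (intro mult_right_mono sum_large_subsets) auto
    finally show "\<bar>W (Suc \<kappa>) w - W \<kappa> w\<bar> \<le> 4 * (\<xi> * q) * W \<kappa> w" by simp
  qed
  also have "E (\<lambda>w. 4 * (\<xi> * q) * W \<kappa> w) = 4 * (\<xi> * q)" by (simp add: avg_cmult W_avg)
  also have "E (\<lambda>w. of_bool (\<not> G \<kappa> w) * (W (Suc \<kappa>) w + W \<kappa> w)) \<le> \<beta> + \<beta>"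
    unfolding distrib_left avg_add W_def using \<kappa> by (intro add_mono bad_tilt) auto
  finally show ?thesis using \<beta>_le_B by linarith
qed

text \<open>Martingale differences stay orthogonal under \<open>W \<kappa>\<close>, because this
  density ignores the digits from block \<open>\<kappa>\<close> on.\<close>

lemma V_eq: "V \<kappa> = E (\<lambda>w. (Hc (Suc \<kappa>) w)\<^sup>2 * W \<kappa> w) - E (\<lambda>w. (Hc \<kappa> w)\<^sup>2 * W \<kappa> w)"
proof -
  have W_inv: "inv_at (c, y) (W \<kappa>)" if "\<kappa> * Lc \<le> y" for y
    unfolding W_prod[abs_def] using that by (intro inv_prod a_inv)
  have inv: "inv_at (c, y) (\<lambda>w. Hc \<kappa> w * W \<kappa> w)" if "\<kappa> * Lc \<le> y" for y
    using that by (intro inv_comp2[where ?g2.0 = "(*)"] Hc_inv W_inv)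
  have "E (\<lambda>w. Hc (Suc \<kappa>) w * (Hc \<kappa> w * W \<kappa> w)) = E (\<lambda>w. Hc \<kappa> w * (Hc \<kappa> w * W \<kappa> w))"
    using inv by (subst (1 2) Hc_avg) auto
  moreover have "V \<kappa> = E (\<lambda>w. (Hc (Suc \<kappa>) w)\<^sup>2 * W \<kappa> w - 2 * (Hc (Suc \<kappa>) w * (Hc \<kappa> w * W \<kappa> w)) + (Hc \<kappa> w)\<^sup>2 * W \<kappa> w)"
    unfolding V_def by (intro avg_cong) (simp add: power2_eq_square algebra_simps)
  ultimately show ?thesis unfolding avg_add avg_diff avg_cmult by (simp add: power2_eq_square mult.assoc)
qed

text \<open>With a fixed density the sum would telescope to at most 1; \<open>W_step\<close> pays
  for the change of the density from block to block.\<close>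

lemma V_sum: "(\<Sum>\<kappa><Nc. V \<kappa>) \<le> 1 + Nc * (4 * (\<xi> * q) + 2 * B)"
proof -
  define v where "v \<kappa> = E (\<lambda>w. (Hc \<kappa> w)\<^sup>2 * W \<kappa> w)" for \<kappa>
  have sq: "(Hc \<kappa> w)\<^sup>2 \<le> 1" for \<kappa> w using Hc_bound[of \<kappa> w] by (simp add: abs_square_le_1)
  have "V \<kappa> \<le> (v (Suc \<kappa>) - v \<kappa>) + (4 * (\<xi> * q) + 2 * B)" if "\<kappa> < Nc" for \<kappa>
  proof -
    have "E (\<lambda>w. (Hc (Suc \<kappa>) w)\<^sup>2 * W \<kappa> w) \<le> E (\<lambda>w. (Hc (Suc \<kappa>) w)\<^sup>2 * W (Suc \<kappa>) w + \<bar>W (Suc \<kappa>) w - W \<kappa> w\<bar>)"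
    proof (rule avg_mono)
      fix w
      have "(Hc (Suc \<kappa>) w)\<^sup>2 * (W \<kappa> w - W (Suc \<kappa>) w) \<le> (Hc (Suc \<kappa>) w)\<^sup>2 * \<bar>W (Suc \<kappa>) w - W \<kappa> w\<bar>"
        by (intro mult_left_mono) auto
      also have "\<dots> \<le> 1 * \<bar>W (Suc \<kappa>) w - W \<kappa> w\<bar>" using sq by (intro mult_right_mono) auto
      finally show "(Hc (Suc \<kappa>) w)\<^sup>2 * W \<kappa> w \<le> (Hc (Suc \<kappa>) w)\<^sup>2 * W (Suc \<kappa>) w + \<bar>W (Suc \<kappa>) w - W \<kappa> w\<bar>"
        by (simp add: algebra_simps)
    qed
    then show ?thesis using W_step[OF that] unfolding V_eq avg_add by (simp add: v_def)
  qed
  then have "(\<Sum>\<kappa><Nc. V \<kappa>) \<le> (\<Sum>\<kappa><Nc. (v (Suc \<kappa>) - v \<kappa>) + (4 * (\<xi> * q) + 2 * B))" by (intro sum_mono) auto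
  also have "\<dots> = v Nc - v 0 + Nc * (4 * (\<xi> * q) + 2 * B)" by (simp add: sum.distrib sum_lessThan_telescope)
  finally have "(\<Sum>\<kappa><Nc. V \<kappa>) \<le> v Nc - v 0 + Nc * (4 * (\<xi> * q) + 2 * B)" .
  moreover have "v 0 \<ge> 0" unfolding v_def using W_pos by (intro avg_nonneg) (auto simp: less_imp_le)
  moreover have "v Nc \<le> E (W Nc)"
    unfolding v_def
  proof (rule avg_mono)
    fix w
    show "(Hc Nc w)\<^sup>2 * W Nc w \<le> W Nc w" using mult_right_mono[OF sq[of Nc w], of "W Nc w"] W_pos[of Nc w] by simp
  qed
  ultimately show ?thesis using W_avg[of Nc] by linarith
qed

definition nxt :: "nat \<Rightarrow> nat \<Rightarrow> nat \<Rightarrow> nat \<Rightarrow> nat set" where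
  "nxt \<kappa> t s = (if s = t then mid \<kappa> s else low \<kappa> s)"

lemma prodX_low: "prodX (low \<kappa>) A T w = (\<Prod>t\<in>T. a \<kappa> t w)"
  by (simp add: prodX_def a_def)

lemma low_Nc: "low Nc = J"
proof -
  have "J t c \<inter> {..<Nc * Lc} = J t c" for t using J_le[of t c] Lc(2) by auto
  then show ?thesis by (auto simp: low_def fun_eq_iff)
qed

text \<open>At the start all boxes are empty in \<open>c\<close>, so the product is the constant 1
  if \<open>A\<close> is empty and 0 otherwise; in the first case \<open>E H = 0\<close>
  helps.\<close>

lemma avg_low_0: "E (\<lambda>w. H w * (\<Prod>t\<in>T. a 0 t w)) = 0"
proof -
  have h0: "hsum d n f (low 0 t) w = 0" for t w
    using idx_empty[OF c(2), of "low 0 t" n] by (simp add: hsum_def low_def)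
  have s0: "slice d n f (low 0 t) w k = 0" for t w k
    using idx_empty[OF c(2), of "(low 0 t)(0 := low 0 t 0 \<inter> {k})" n] c0 by (simp add: slice_def hsum_def low_def)
  have "stopped Dm Q (\<lambda>k. 0) m = 0" for m by (induction m) auto
  then have "frozen d n f Dm Q (low 0 t) w = 0" for t w unfolding frozen_def s0[abs_def] .
  then have "a 0 t w = (if t \<in> A then 0 else 1)" for t w by (simp add: a_def h0)
  then have "(\<Prod>t\<in>T. a 0 t w) = (if A = {} then 1 else 0)" for w
    using T by (auto simp: prod_zero_iff)
  then show ?thesis using H by (cases "A = {}") (simp_all add: avg_def)
qed

text \<open>The first-order terms are again products of the same kind, with \<open>t\<close> as an
  additional unstopped factor that owns the block. This is what lets the procedure pass on to the
  next coordinate.\<close>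

lemma first_order:
  "(\<Sum>U\<in>subs 1. E (\<lambda>w. H w * trm \<kappa> U w)) = (\<Sum>t\<in>T. E (\<lambda>w. H w * prodX (nxt \<kappa> t) (insert t A) T w))"
proof -
  have s1: "subs 1 = (\<lambda>t. {t}) ` T" by (auto simp: subs_def card_1_singleton_iff)
  have "trm \<kappa> {t} w = prodX (nxt \<kappa> t) (insert t A) T w" if "t \<in> T" for t w
  proof -
    have "prodX (nxt \<kappa> t) (insert t A) T w = \<rho> * hsum d n f (nxt \<kappa> t t) w *
      (\<Prod>s\<in>T - {t}. if s \<in> insert t A then \<rho> * hsum d n f (nxt \<kappa> t s) w else 1 + \<rho> * frozen d n f Dm Q (nxt \<kappa> t s) w)"
      unfolding prodX_def using T that by (subst prod.remove[of T t]) auto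
    also have "\<dots> = trm \<kappa> {t} w"
      unfolding trm_def by (intro arg_cong2[where f = "(*)"] prod.cong) (auto simp: nxt_def x_def a_def)
    finally show ?thesis by simp
  qed
  then show ?thesis unfolding s1 by (subst sum.reindex) (auto simp: inj_on_def)
qed

lemma second_order:
  assumes \<kappa>: "\<kappa> < Nc" and U: "U \<in> subs 2" and \<tau>: "0 < \<tau>"
  shows "\<bar>E (\<lambda>w. H w * trm \<kappa> U w)\<bar> \<le> 4 * \<zeta> + 3 * B + 4 * \<xi>\<^sup>2 * (\<tau> / 2 + V \<kappa> / (2 * \<tau>))"
proof -
  have inv: "inv_at (c, y) (trm \<kappa> U)" if "Suc \<kappa> * Lc \<le> y" for y
    unfolding trm_def[abs_def] using that
    by (intro inv_comp2[where ?g2.0 = "(*)"] inv_prod x_inv a_inv) auto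
  have "E (\<lambda>w. H w * trm \<kappa> U w) = E (\<lambda>w. Hc (Suc \<kappa>) w * trm \<kappa> U w)"
    using inv by (intro Hc_avg[symmetric])
  also have "\<dots> = E (\<lambda>w. Hc \<kappa> w * trm \<kappa> U w + (Hc (Suc \<kappa>) w - Hc \<kappa> w) * trm \<kappa> U w)"
    by (intro avg_cong) (simp add: algebra_simps)
  finally show ?thesis using second_low[OF \<kappa> U] second_high[OF \<kappa> U \<tau>] unfolding avg_add by linarith
qed

lemma stage_step:
  fixes \<tau> :: real
  assumes \<tau>: "0 < \<tau>"
  shows "\<bar>E (\<lambda>w. H w * prodX J A T w) - (\<Sum>\<kappa><Nc. \<Sum>t\<in>T. E (\<lambda>w. H w * prodX (nxt \<kappa> t) (insert t A) T w))\<bar>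
    \<le> Nc * (16 * (\<xi> * q) ^ 3 + (2 + q + q\<^sup>2) * B + q\<^sup>2 * (4 * \<zeta> + 3 * B))
      + q\<^sup>2 * (4 * \<xi>\<^sup>2 * (Nc * \<tau> / 2 + (1 + Nc * (4 * (\<xi> * q) + 2 * B)) / (2 * \<tau>)))"
proof -
  define P where "P \<kappa> = E (\<lambda>w. H w * (\<Prod>t\<in>T. a \<kappa> t w))" for \<kappa>
  define F where "F \<kappa> = (\<Sum>t\<in>T. E (\<lambda>w. H w * prodX (nxt \<kappa> t) (insert t A) T w))" for \<kappa>
  have step: "\<bar>P (Suc \<kappa>) - P \<kappa> - F \<kappa>\<bar> \<le> 16 * (\<xi> * q) ^ 3 + (2 + q + q\<^sup>2) * B
      + q\<^sup>2 * (4 * \<zeta> + 3 * B + 4 * \<xi>\<^sup>2 * (\<tau> / 2 + V \<kappa> / (2 * \<tau>)))" if \<kappa>: "\<kappa> < Nc" for \<kappa>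
  proof -
    have "P (Suc \<kappa>) = E (\<lambda>w. H w * (\<Prod>t\<in>T. a \<kappa> t w) + (\<Sum>U\<in>subs 1. H w * trm \<kappa> U w) + (\<Sum>U\<in>subs 2. H w * trm \<kappa> U w) + H w * R \<kappa> w)"
      unfolding P_def R_def by (intro avg_cong) (simp add: algebra_simps sum_distrib_left)
    also have "\<dots> = P \<kappa> + F \<kappa> + (\<Sum>U\<in>subs 2. E (\<lambda>w. H w * trm \<kappa> U w)) + E (\<lambda>w. H w * R \<kappa> w)"
      unfolding avg_add avg_sum first_order by (simp add: P_def F_def)
    finally have "P (Suc \<kappa>) - P \<kappa> - F \<kappa> = (\<Sum>U\<in>subs 2. E (\<lambda>w. H w * trm \<kappa> U w)) + E (\<lambda>w. H w * R \<kappa> w)" by simp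
    moreover have "\<bar>E (\<lambda>w. H w * R \<kappa> w)\<bar> \<le> 16 * (\<xi> * q) ^ 3 + (2 + q + q\<^sup>2) * B"
    proof -
      have "\<bar>E (\<lambda>w. H w * R \<kappa> w)\<bar> \<le> E (\<lambda>w. \<bar>H w * R \<kappa> w\<bar>)" by (rule avg_abs)
      also have "\<dots> \<le> E (\<lambda>w. \<bar>R \<kappa> w\<bar>)"
      proof (rule avg_mono)
        fix w show "\<bar>H w * R \<kappa> w\<bar> \<le> \<bar>R \<kappa> w\<bar>"
          using mult_right_mono[OF H(1)[of w], of "\<bar>R \<kappa> w\<bar>"] by (simp add: abs_mult)
      qed
      finally show ?thesis using R_bound[OF \<kappa>] by linarith
    qed
    moreover have "\<bar>\<Sum>U\<in>subs 2. E (\<lambda>w. H w * trm \<kappa> U w)\<bar> \<le> q\<^sup>2 * (4 * \<zeta> + 3 * B + 4 * \<xi>\<^sup>2 * (\<tau> / 2 + V \<kappa> / (2 * \<tau>)))"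
    proof -
      let ?s = "4 * \<zeta> + 3 * B + 4 * \<xi>\<^sup>2 * (\<tau> / 2 + V \<kappa> / (2 * \<tau>))"
      have "0 \<le> V \<kappa>" unfolding V_def using W_pos by (intro avg_nonneg) (auto simp: less_imp_le)
      then have s0: "0 \<le> ?s" using num \<tau> \<beta>_le_B \<beta>_nonneg by simp
      have "\<bar>\<Sum>U\<in>subs 2. E (\<lambda>w. H w * trm \<kappa> U w)\<bar> \<le> (\<Sum>U\<in>subs 2. ?s)"
        by (rule order_trans[OF sum_abs sum_mono]) (rule second_order[OF \<kappa>], assumption, rule \<tau>)
      also have "\<dots> = card (subs 2) * ?s" by simp
      also have "\<dots> \<le> q\<^sup>2 * ?s"
        using card_subs[of 2] s0 by (intro mult_right_mono) (simp_all flip: of_nat_power)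
      finally show ?thesis .
    qed
    ultimately show ?thesis by linarith
  qed
  define a1 where "a1 = 16 * (\<xi> * q) ^ 3 + (2 + q + q\<^sup>2) * B + q\<^sup>2 * (4 * \<zeta> + 3 * B)"
  define a2 where "a2 = q\<^sup>2 * (4 * \<xi>\<^sup>2)"
  have a12: "16 * (\<xi> * q) ^ 3 + (2 + q + q\<^sup>2) * B + q\<^sup>2 * (4 * \<zeta> + 3 * B + 4 * \<xi>\<^sup>2 * z) = a1 + a2 * z" for z
    by (simp add: a1_def a2_def distrib_left mult.assoc)
  have "E (\<lambda>w. H w * prodX J A T w) = P Nc" unfolding P_def prodX_low[symmetric] low_Nc ..
  moreover have "P 0 = 0" unfolding P_def by (rule avg_low_0)
  ultimately have "E (\<lambda>w. H w * prodX J A T w) - (\<Sum>\<kappa><Nc. F \<kappa>) = (\<Sum>\<kappa><Nc. P (Suc \<kappa>) - P \<kappa> - F \<kappa>)"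
    unfolding sum_subtractf[of _ F] sum_lessThan_telescope by simp
  also have "\<bar>\<dots>\<bar> \<le> (\<Sum>\<kappa><Nc. a1 + a2 * (\<tau> / 2 + V \<kappa> / (2 * \<tau>)))"
    using step unfolding a12 by (intro order_trans[OF sum_abs sum_mono]) auto
  also have "\<dots> = Nc * a1 + a2 * (Nc * \<tau> / 2 + (\<Sum>\<kappa><Nc. V \<kappa>) / (2 * \<tau>))"
    unfolding sum.distrib sum_distrib_left[symmetric] sum_divide_distrib[symmetric] by simp
  also have "\<dots> \<le> Nc * a1 + a2 * (Nc * \<tau> / 2 + (1 + Nc * (4 * (\<xi> * q) + 2 * B)) / (2 * \<tau>))"
    using V_sum \<tau> by (intro add_left_mono mult_left_mono divide_right_mono) (auto simp: a2_def)
  finally show ?thesis by (simp only: F_def a1_def a2_def mult.assoc)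
qed

end

section \<open>Orthogonality of the remaining products\<close>

text \<open>\<open>Q\<close> is the number of indices in a slab, counted trivially, plus the error
  of \<open>diag_bound\<close>. Once the quadratic variation is below it,
  \<open>wop_martingale\<close> applies to each partial sum.\<close>

lemma tame_wop:
  assumes diag: "diag_bound d (d - 1) C a k g" and f: "rsys d n f" and l: "1 \<le> l" and d: "2 \<le> d"
    and J: "\<And>j. J j \<subseteq> {..n}" "card (J 0) \<le> L"
    and Q: "L * (real n + 1) ^ (d - 2) + C * l ^ a * (real n + 1) powr (real d - 1 - g) \<le> Q" and Q0: "0 \<le> Q"
  shows "wop d n l (k + 3) (tame d n f (l * sqrt Q) Q J)"
proof -
  have d0: "0 < d" using d by simp
  have "real (card (idx d n J)) \<le> real (\<Prod>j\<in>{..<d} - {d - 1}. card (J j))"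
    using J d by (simp only: of_nat_le_iff) (intro card_idx; auto intro: finite_subset)
  also have "(\<Prod>j\<in>{..<d} - {d - 1}. card (J j)) = card (J 0) * (\<Prod>j\<in>{..<d} - {d - 1} - {0}. card (J j))"
    using d by (subst prod.remove[of _ 0]) auto
  also have "real \<dots> \<le> L * (\<Prod>j\<in>{..<d} - {d - 1} - {0}. real n + 1)"
    unfolding of_nat_mult of_nat_prod
  proof (intro mult_mono prod_mono conjI)
    fix j show "real (card (J j)) \<le> real n + 1" using card_mono[OF _ J(1)[of j]] by simp
  qed (use J in \<open>auto simp: prod_nonneg\<close>)
  also have "(\<Prod>j\<in>{..<d} - {d - 1} - {0}. real n + 1) = (real n + 1) ^ (d - 2)"
  proof -
    have "card ({..<d} - {d - 1} - {0}) = d - 2" using d by (simp add: card_Diff_subset)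
    then show ?thesis by simp
  qed
  finally have ci: "real (card (idx d n J)) \<le> L * (real n + 1) ^ (d - 2)" .
  have "wop d n l k (\<lambda>w. psum d n f {0} J J w \<le> card (idx d n J) + C * l ^ a * (real n + 1) powr (real (card {0::nat} + (d - 1) - 1) - g))"
    by (rule diag_boundD[OF diag, where U = "{1..<d}"]) (use f l d J in auto)
  then have w1: "wop d n l k (\<lambda>w. (\<Sum>k<Suc n. (slice d n f J w k)\<^sup>2) \<le> Q)"
  proof (rule wop_mono)
    fix w assume le: "psum d n f {0} J J w \<le> card (idx d n J) + C * l ^ a * (real n + 1) powr (real (card {0::nat} + (d - 1) - 1) - g)"
    have eq: "real (card {0::nat} + (d - 1) - 1) = real d - 1" using d by simp
    have "(\<Sum>k<Suc n. (slice d n f J w k)\<^sup>2) = psum d n f {0} J J w"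
      using sum_slice_sub[of d J n "\<lambda>x. x\<^sup>2" f w] d0 J(1)[of 0]
      by (simp add: psum_single[OF d0 J(1) J(1)] power2_eq_square del: sum.lessThan_Suc)
    then show "(\<Sum>k<Suc n. (slice d n f J w k)\<^sup>2) \<le> Q" using le[unfolded eq] ci Q by linarith
  qed simp
  have w2: "wop d n l (k + 1) (\<lambda>w. \<bar>\<Sum>k<m. slice d n f J w k\<bar> \<le> l * sqrt Q)" if m: "m \<le> Suc n" for m
  proof (rule wop_martingale[where a = "\<lambda>k. (0, k)"])
    show "odd_at (0, y) (\<lambda>w. slice d n f J w y)" for y
      unfolding slice_def using hsum_odd[OF f d0, of "J(0 := J 0 \<inter> {y})" y] by auto
    show "inv_at (0, y) (\<lambda>w. slice d n f J w z)" if "z < y" for y z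
      unfolding slice_def using hsum_inv[OF f d0, of "J(0 := J 0 \<inter> {z})" y] that by auto
    show "wop d n l k (\<lambda>w. (\<Sum>y<m. (slice d n f J w y)\<^sup>2) \<le> (sqrt Q)\<^sup>2)"
      using w1
    proof (rule wop_mono)
      fix w assume "(\<Sum>k<Suc n. (slice d n f J w k)\<^sup>2) \<le> Q"
      moreover have "(\<Sum>y<m. (slice d n f J w y)\<^sup>2) \<le> (\<Sum>k<Suc n. (slice d n f J w k)\<^sup>2)"
        using m by (intro sum_mono2) auto
      ultimately have "(\<Sum>y<m. (slice d n f J w y)\<^sup>2) \<le> Q" by linarith
      then show "(\<Sum>y<m. (slice d n f J w y)\<^sup>2) \<le> (sqrt Q)\<^sup>2" using Q0 by simp
    qed simp
  qed (use m d0 l Q0 in \<open>auto simp: digits_def\<close>)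
  have "wop d n l (k + 1 + 1) (\<lambda>w. \<forall>m\<in>{..Suc n}. \<bar>\<Sum>k<m. slice d n f J w k\<bar> \<le> l * sqrt Q)"
    using w2 by (intro wop_all) auto
  then have "wop d n l (k + 1 + 1 + 1) (\<lambda>w. (\<forall>m\<in>{..Suc n}. \<bar>\<Sum>k<m. slice d n f J w k\<bar> \<le> l * sqrt Q) \<and> (\<Sum>k<Suc n. (slice d n f J w k)\<^sup>2) \<le> Q)"
    by (rule wop_conj) (rule wop_mono[OF w1]; simp)
  then show ?thesis
  proof (rule wop_mono)
    fix w assume "(\<forall>m\<in>{..Suc n}. \<bar>\<Sum>k<m. slice d n f J w k\<bar> \<le> l * sqrt Q) \<and> (\<Sum>k<Suc n. (slice d n f J w k)\<^sup>2) \<le> Q"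
    then show "tame d n f (l * sqrt Q) Q J w" unfolding tame_def by blast
  qed simp
qed

section \<open>The levels of the Haar sum against owned products\<close>

definition levels :: "nat \<Rightarrow> nat \<Rightarrow> (nat \<Rightarrow> nat) set" where
  "levels d n = {v. (\<forall>j\<ge>d. v j = 0) \<and> (\<Sum>j<d. v j) \<le> n}"

definition hsys :: "nat \<Rightarrow> nat \<Rightarrow> ((nat \<Rightarrow> nat) \<Rightarrow> (nat \<times> nat) set \<Rightarrow> real) \<Rightarrow> bool" where
  "hsys d n h \<longleftrightarrow> (\<forall>v\<in>levels d n. \<forall>j<d. odd_at (j, v j) (h v) \<and> (\<forall>i>v j. inv_at (j, i) (h v)))"

lemma finite_levels [simp]: "finite (levels d n)"
proof (rule finite_subset)
  show "levels d n \<subseteq> {f. \<forall>x. (x \<in> {..<d} \<longrightarrow> f x \<in> {..n}) \<and> (x \<notin> {..<d} \<longrightarrow> f x = 0)}"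
  proof
    fix v assume v: "v \<in> levels d n"
    have "v j \<le> n" if "j < d" for j
      using member_le_sum[of j "{..<d}" v] v that by (simp add: levels_def)
    then show "v \<in> {f. \<forall>x. (x \<in> {..<d} \<longrightarrow> f x \<in> {..n}) \<and> (x \<notin> {..<d} \<longrightarrow> f x = 0)}"
      using v by (simp add: levels_def)
  qed
qed (intro finite_set_of_finite_funs, auto)

lemma idx_levels: "r \<in> idx d n J \<Longrightarrow> r \<in> levels d n"
  by (simp add: idx_def levels_def)

text \<open>When every coordinate other than the first has its own top block, owned by exactly one of the
  factors, the products of two or more of the sums are orthogonal to the low levels: a level
  that reaches the top of every other coordinate is too short in the first coordinate.\<close>

locale owned = tilted +
  fixes h :: "(nat \<Rightarrow> nat) \<Rightarrow> (nat \<times> nat) set \<Rightarrow> real" and J :: "nat \<Rightarrow> nat \<Rightarrow> nat set" and T A :: "nat set"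
    and own s :: "nat \<Rightarrow> nat"
  assumes h: "hsys d n h" and fh: "\<And>r w. r \<in> idx d n (\<lambda>_. UNIV) \<Longrightarrow> f r w = sgn (h r w)"
    and T: "finite T" "A \<subseteq> T" "A = own ` {1..<d}" and J: "slabbed J"
    and own_ge: "\<And>j y. j \<in> {1..<d} \<Longrightarrow> y \<in> J (own j) j \<Longrightarrow> s j \<le> y"
    and less_own: "\<And>j t y. j \<in> {1..<d} \<Longrightarrow> t \<in> T \<Longrightarrow> t \<noteq> own j \<Longrightarrow> y \<in> J t j \<Longrightarrow> y < s j"
begin

lemma own_A: "j \<in> {1..<d} \<Longrightarrow> own j \<in> A" using T by auto

lemma A_ne: "A \<noteq> {}" using own_A[of 1] d by auto

lemma finA: "finite A" using T finite_subset by auto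

lemma hv_inv: "v \<in> levels d n \<Longrightarrow> j < d \<Longrightarrow> v j < i \<Longrightarrow> inv_at (j, i) (h v)"
  using h by (auto simp: hsys_def)

lemma f_odd: "r \<in> idx d n I \<Longrightarrow> j < d \<Longrightarrow> odd_at (j, r j) (f r)"
  and f_inv: "r \<in> idx d n I \<Longrightarrow> j < d \<Longrightarrow> r j < i \<Longrightarrow> inv_at (j, i) (f r)"
  using f idx_UNIV[of r d n I] by (auto simp: rsys_def)

lemma prod_f_odd:
  assumes "t \<in> A" "odd_at u (f (R t))" "\<And>t'. t' \<in> A \<Longrightarrow> t' \<noteq> t \<Longrightarrow> inv_at u (f (R t'))"
  shows "odd_at u (\<lambda>w. \<Prod>t\<in>A. f (R t) w)"
proof -
  have "odd_at u (\<lambda>w. f (R t) w * (\<Prod>t\<in>A - {t}. f (R t) w))"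
    using assms by (intro odd_mult_inv inv_prod) auto
  then show ?thesis using finA assms(1) by (simp add: prod.remove[of A t])
qed

lemma tilt_split: "tilt J (T - A) w = tilt J {t \<in> T - A. t \<le> m} w * tilt J {t \<in> T - A. m < t} w"
proof -
  have "T - A = {t \<in> T - A. t \<le> m} \<union> {t \<in> T - A. m < t}" by auto
  then have "tilt J (T - A) w = tilt J ({t \<in> T - A. t \<le> m} \<union> {t \<in> T - A. m < t}) w" by (rule arg_cong)
  also have "\<dots> = tilt J {t \<in> T - A. t \<le> m} w * tilt J {t \<in> T - A. m < t} w"
    unfolding tilt_def using T by (intro prod.union_disjoint) auto
  finally show ?thesis .
qed

text \<open>Either the level of some owner exceeds \<open>v\<close> in its coordinate, and that
  digit is odd in exactly one factor; or \<open>v\<close> dominates the owners in all coordinates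
  from 1 on. In the second case the condition on the sums pushes \<open>v 0\<close> below the first
  level of the highest slab in \<open>A\<close>, except for the excluded diagonal case, and then the
  digit of this first level is odd.\<close>

lemma zero_term:
  assumes v: "v \<in> levels d n" and R: "\<And>t. t \<in> A \<Longrightarrow> R t \<in> idx d n (J t)" and ne: "\<not> (\<exists>t. A = {t} \<and> v = R t)"
  shows "E (\<lambda>w. h v w * (\<Prod>t\<in>A. f (R t) w) * tilt J (T - A) w) = 0"
proof (cases "\<exists>j\<in>{1..<d}. v j < R (own j) j")
  case True
  then obtain j where j: "j \<in> {1..<d}" "v j < R (own j) j" by blast
  define u where "u = (j, R (own j) j)"
  have jd: "j < d" using j by simp
  have Rj: "R t j \<in> J t j" if "t \<in> A" for t using R[OF that] jd by (simp add: idx_def)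
  have top: "s j \<le> R (own j) j" using own_ge[OF j(1)] Rj own_A[OF j(1)] by simp
  have "odd_at u (\<lambda>w. \<Prod>t\<in>A. f (R t) w)"
  proof (rule prod_f_odd[OF own_A[OF j(1)]])
    show "odd_at u (f (R (own j)))" unfolding u_def using f_odd[OF R[OF own_A[OF j(1)]] jd] .
    fix t assume t: "t \<in> A" "t \<noteq> own j"
    then have "R t j < R (own j) j" using less_own[OF j(1) _ t(2) Rj[OF t(1)]] top T by auto
    then show "inv_at u (f (R t))" unfolding u_def using f_inv[OF R[OF t(1)] jd] by simp
  qed
  moreover have "inv_at u (h v)" unfolding u_def using hv_inv[OF v jd] j by simp
  moreover have "inv_at u (tilt J (T - A))"
    unfolding u_def
  proof (rule tilt_inv[OF jd])
    fix t y assume ty: "t \<in> T - A" "y \<in> J t j"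
    then have "t \<noteq> own j" using own_A[OF j(1)] by auto
    then show "y < R (own j) j" using less_own[OF j(1) _ _ ty(2)] ty top by fastforce
  qed
  moreover have "u \<in> digits d n" using jd idx_le[OF R[OF own_A[OF j(1)]] jd] by (simp add: u_def digits_def)
  ultimately show ?thesis by (intro avg_odd[of u] odd_mult_inv inv_mult_odd)
next
  case False
  then have ge: "R (own j) j \<le> v j" if "j \<in> {1..<d}" for j using that by force
  define m where "m = Max A"
  have mA: "m \<in> A" unfolding m_def using finA A_ne by simp
  have mle: "t \<le> m" if "t \<in> A" for t unfolding m_def using finA that by simp
  have Rj: "R t j \<in> J t j" if "t \<in> A" "j < d" for t j using R[OF that(1)] that(2) by (simp add: idx_def)
  have Rm: "(\<Sum>j<d. R m j) = n" using R[OF mA] by (simp add: idx_def)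
  have le_top: "R m j \<le> R (own j) j" if j: "j \<in> {1..<d}" for j
  proof (cases "own j = m")
    case False
    then have "R m j < s j" using less_own[OF j _ _ Rj[OF mA, of j]] mA T j by auto
    moreover have "s j \<le> R (own j) j" using own_ge[OF j Rj[OF own_A[OF j]]] j by simp
    ultimately show ?thesis by simp
  qed simp
  have le: "R m j \<le> v j" if "j \<in> {1..<d}" for j using le_top[OF that] ge[OF that] by simp
  \<comment> \<open>\<open>v\<close> has sum at most \<open>n\<close> and \<open>R m\<close> has sum
    \<open>n\<close>. So \<open>R m 0 \<le> v 0\<close> would give \<open>v = R m\<close>, and a
    coordinate owned by another factor would contradict \<open>ge\<close>; that is the excluded
    case.\<close>
  have v0: "v 0 < R m 0"
  proof (rule ccontr)
    assume "\<not> v 0 < R m 0"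
    then have le0: "R m j \<le> v j" if "j < d" for j using le[of j] that by (cases "j = 0") auto
    have vn: "(\<Sum>j<d. v j) \<le> n" using v by (simp add: levels_def)
    have eq: "v j = R m j" if "j < d" for j
    proof (rule ccontr)
      assume "v j \<noteq> R m j"
      then have "(\<Sum>j<d. R m j) < (\<Sum>j<d. v j)"
        using le0 that by (intro sum_strict_mono_ex1) (auto intro!: bexI[of _ j] simp: order.strict_iff_order)
      then show False using vn Rm by simp
    qed
    have "v = R m"
    proof
      fix j show "v j = R m j"
        using eq[of j] v R[OF mA] by (cases "j < d") (auto simp: levels_def idx_def)
    qed
    moreover have "A = {m}"
    proof (rule ccontr)
      assume "A \<noteq> {m}"
      have "\<exists>j\<in>{1..<d}. own j \<noteq> m"
      proof (rule ccontr)
        assume "\<not> ?thesis"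
        then have "A \<subseteq> {m}" unfolding T(3) by blast
        then show False using mA \<open>A \<noteq> {m}\<close> by blast
      qed
      then obtain j where j: "j \<in> {1..<d}" "own j \<noteq> m" by blast
      have "R m j < s j" using less_own[OF j(1) _ _ Rj[OF mA, of j]] mA T j by auto
      moreover have "s j \<le> R (own j) j" using own_ge[OF j(1) Rj[OF own_A[OF j(1)]]] j by simp
      ultimately show False using ge[OF j(1)] eq[of j] j by simp
    qed
    ultimately show False using ne by blast
  qed
  \<comment> \<open>The factors of slabs above \<open>m\<close> may depend on the digit
    \<open>(0, R m 0)\<close>. They are integrated out first, which is possible because
    \<open>Y\<close> ignores the digits of their levels.\<close>
  define Y where "Y w = h v w * (\<Prod>t\<in>A. f (R t) w) * tilt J {t \<in> T - A. t \<le> m} w" for w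
  have "E (\<lambda>w. h v w * (\<Prod>t\<in>A. f (R t) w) * tilt J (T - A) w) = E (\<lambda>w. Y w * tilt J {t \<in> T - A. m < t} w)"
    unfolding Y_def tilt_split[of _ m] by (simp only: mult.assoc)
  also have "\<dots> = E Y"
  proof (rule avg_tilt)
    fix t k assume t: "t \<in> {t \<in> T - A. m < t}" and k: "k \<in> J t 0"
    have "R t' 0 < k" if "t' \<in> A" for t'
      using slabbed_less[OF J _ Rj[OF that d0] k] mle[OF that] t by simp
    moreover have "y < k" if "t' \<le> m" "y \<in> J t' 0" for t' y
      using slabbed_less[OF J _ that(2) k] that(1) t by simp
    ultimately show "inv_at (0, k) Y"
      unfolding Y_def[abs_def] using v0 mA d0
      by (intro inv_comp2[where ?g2.0 = "(*)"] inv_prod tilt_inv hv_inv[OF v] f_inv[OF R]) (auto intro: less_trans)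
  qed (use T J in auto)
  also have "\<dots> = 0"
  proof (rule avg_odd[of "(0, R m 0)"])
    show "(0, R m 0) \<in> digits d n" using d0 idx_le[OF R[OF mA] d0] by (simp add: digits_def)
    have lt: "R t 0 < R m 0" if "t \<in> A" "t \<noteq> m" for t
      using slabbed_less[OF J _ Rj[OF that(1) d0] Rj[OF mA d0]] mle[OF that(1)] that(2) by simp
    have "odd_at (0, R m 0) (\<lambda>w. \<Prod>t\<in>A. f (R t) w)"
      using lt d0 mA by (intro prod_f_odd[OF mA] f_odd[OF R] f_inv[OF R]) auto
    moreover have "inv_at (0, R m 0) (h v)" using hv_inv[OF v d0 v0] .
    moreover have "inv_at (0, R m 0) (tilt J {t \<in> T - A. t \<le> m})"
    proof (rule tilt_inv[OF d0])
      fix t y assume t: "t \<in> {t \<in> T - A. t \<le> m}" "y \<in> J t 0"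
      then have "t \<noteq> m" using mA by auto
      then show "y < R m 0" using slabbed_less[OF J _ t(2) Rj[OF mA d0]] t(1) by simp
    qed
    ultimately show "odd_at (0, R m 0) Y" unfolding Y_def[abs_def] by (intro odd_mult_inv inv_mult_odd)
  qed
  finally show ?thesis .
qed

text \<open>As \<open>t\<close> owns the top block in every other coordinate, an index of a lower
  slab would lie below \<open>r\<close> in all coordinates, against the equal sums; hence the lower
  factors are 1. The higher ones are integrated out, and \<open>h r * sgn (h r)\<close>
  remains.\<close>

lemma diagonal_term:
  assumes At: "A = {t}" and r: "r \<in> idx d n (J t)"
  shows "E (\<lambda>w. h r w * f r w * tilt J (T - A) w) = E (\<lambda>w. \<bar>h r w\<bar>)"
proof -
  have lv: "r \<in> levels d n" using r by (rule idx_levels)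
  have tT: "t \<in> T" using T(2) At by blast
  have rj: "r j \<in> J t j" if "j < d" for j using r that by (simp add: idx_def)
  have own: "own j = t" if "j \<in> {1..<d}" for j using own_A[OF that] At by simp
  have empty: "idx d n (J t') = {}" if t': "t' \<in> T" "t' < t" for t'
  proof (rule ccontr)
    assume "idx d n (J t') \<noteq> {}"
    then obtain z where z: "z \<in> idx d n (J t')" by auto
    have zj: "z j \<in> J t' j" if "j < d" for j using z that by (simp add: idx_def)
    have "z j < r j" if "j < d" for j
    proof (cases "j = 0")
      case True
      then show ?thesis using slabbed_less[OF J t'(2) zj[OF d0] rj[OF d0]] by simp
    next
      case False
      then have j: "j \<in> {1..<d}" using that by simp
      have "z j < s j" using less_own[OF j t'(1) _ zj[OF that]] own[OF j] t' by simp
      moreover have "s j \<le> r j" using own_ge[OF j] own[OF j] rj[OF that] by simp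
      ultimately show ?thesis by simp
    qed
    then have "(\<Sum>j<d. z j) < (\<Sum>j<d. r j)" using d0 by (intro sum_strict_mono) auto
    then show False using z r by (simp add: idx_def)
  qed
  have tilt1: "tilt J {t' \<in> T - A. t' \<le> t} w = 1" for w
  proof -
    have "frozen d n f Dm Q (J t') w = 0" if "t' \<in> {t' \<in> T - A. t' \<le> t}" for t'
    proof -
      have "t' \<in> T" "t' < t" using that At by auto
      then have "idx d n ((J t')(0 := J t' 0 \<inter> {k})) = {}" for k
        using empty idx_mono[of d "(J t')(0 := J t' 0 \<inter> {k})" "J t'" n] by auto
      then have s0: "slice d n f (J t') w k = 0" for k by (simp add: slice_def hsum_def)
      have "stopped Dm Q (\<lambda>k. 0) m = 0" for m by (induction m) auto
      then show ?thesis unfolding frozen_def s0[abs_def] .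
    qed
    then show ?thesis unfolding tilt_def by (intro prod.neutral) auto
  qed
  define Y where "Y w = h r w * f r w" for w
  have "E (\<lambda>w. h r w * f r w * tilt J (T - A) w) = E (\<lambda>w. Y w * tilt J {t' \<in> T - A. t < t'} w)"
    unfolding Y_def tilt_split[of _ t] tilt1 by simp
  also have "\<dots> = E Y"
  proof (rule avg_tilt)
    fix t' k assume t': "t' \<in> {t' \<in> T - A. t < t'}" and k: "k \<in> J t' 0"
    have "r 0 < k" using slabbed_less[OF J _ rj[OF d0] k] t' by simp
    then show "inv_at (0, k) Y"
      unfolding Y_def[abs_def] using d0
      by (intro inv_comp2[where ?g2.0 = "(*)"] hv_inv[OF lv] f_inv[OF r]) auto
  qed (use T J in auto)
  also have "Y = (\<lambda>w. \<bar>h r w\<bar>)"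
    using fh[OF idx_UNIV[OF r]] by (auto simp: Y_def fun_eq_iff sgn_if)
  finally show ?thesis .
qed

text \<open>After expansion into single indices, only a common owner of all coordinates survives,
  together with \<open>v\<close> equal to its index.\<close>

lemma owned_avg:
  "E (\<lambda>w. (\<Sum>v\<in>levels d n. h v w) * prodX J A T w) =
    (if \<exists>t. A = {t} then \<rho> * (\<Sum>r\<in>idx d n (J (THE t. A = {t})). E (\<lambda>w. \<bar>h r w\<bar>)) else 0)"
proof -
  define RR where "RR = PiE A (\<lambda>t. idx d n (J t))"
  have RRm: "R t \<in> idx d n (J t)" if "R \<in> RR" "t \<in> A" for R t using that by (auto simp: RR_def)
  define X where "X v R = E (\<lambda>w. h v w * (\<Prod>t\<in>A. f (R t) w) * tilt J (T - A) w)" for v R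
  have pX: "prodX J A T w = \<rho> ^ card A * (\<Sum>R\<in>RR. \<Prod>t\<in>A. f (R t) w) * tilt J (T - A) w" for w
  proof -
    have "prodX J A T w = (\<Prod>t\<in>T \<inter> A. \<rho> * hsum d n f (J t) w) * tilt J (T - A) w"
      unfolding prodX_def tilt_def using T(1) by (subst prod.Int_Diff[of T _ A]) (auto intro!: arg_cong2[where f = "(*)"] prod.cong)
    also have "T \<inter> A = A" using T by auto
    also have "(\<Prod>t\<in>A. \<rho> * hsum d n f (J t) w) = \<rho> ^ card A * (\<Prod>t\<in>A. \<Sum>r\<in>idx d n (J t). f r w)"
      by (simp add: prod.distrib hsum_def)
    also have "(\<Prod>t\<in>A. \<Sum>r\<in>idx d n (J t). f r w) = (\<Sum>R\<in>RR. \<Prod>t\<in>A. f (R t) w)"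
      unfolding RR_def using finA by (intro prod_sum_PiE) auto
    finally show ?thesis .
  qed
  have "E (\<lambda>w. (\<Sum>v\<in>levels d n. h v w) * prodX J A T w) =
    E (\<lambda>w. \<Sum>v\<in>levels d n. \<Sum>R\<in>RR. \<rho> ^ card A * (h v w * (\<Prod>t\<in>A. f (R t) w) * tilt J (T - A) w))"
  proof (rule avg_cong)
    fix w
    have "(\<Sum>v\<in>levels d n. h v w) * prodX J A T w =
      (\<Sum>v\<in>levels d n. h v w) * (\<Sum>R\<in>RR. \<rho> ^ card A * (\<Prod>t\<in>A. f (R t) w) * tilt J (T - A) w)"
      unfolding pX sum_distrib_left sum_distrib_right ..
    also have "\<dots> = (\<Sum>v\<in>levels d n. \<Sum>R\<in>RR. \<rho> ^ card A * (h v w * (\<Prod>t\<in>A. f (R t) w) * tilt J (T - A) w))"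
      unfolding sum_product by (intro sum.cong) (simp_all add: mult_ac)
    finally show "(\<Sum>v\<in>levels d n. h v w) * prodX J A T w =
      (\<Sum>v\<in>levels d n. \<Sum>R\<in>RR. \<rho> ^ card A * (h v w * (\<Prod>t\<in>A. f (R t) w) * tilt J (T - A) w))" .
  qed
  also have "\<dots> = (\<Sum>v\<in>levels d n. \<Sum>R\<in>RR. \<rho> ^ card A * X v R)"
    unfolding avg_sum avg_cmult X_def ..
  also have "\<dots> = (if \<exists>t. A = {t} then \<rho> * (\<Sum>r\<in>idx d n (J (THE t. A = {t})). E (\<lambda>w. \<bar>h r w\<bar>)) else 0)"
  proof (cases "\<exists>t. A = {t}")
    case False
    then have "X v R = 0" if "v \<in> levels d n" "R \<in> RR" for v R
      unfolding X_def using that RRm by (intro zero_term) auto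
    then show ?thesis using False by simp
  next
    case True
    then obtain t where t: "A = {t}" by auto
    have "(\<Sum>v\<in>levels d n. \<Sum>R\<in>RR. \<rho> ^ card A * X v R) = (\<Sum>R\<in>RR. \<Sum>v\<in>levels d n. \<rho> * X v R)"
      unfolding t by (subst sum.swap) simp
    also have "\<dots> = (\<Sum>R\<in>RR. \<rho> * E (\<lambda>w. \<bar>h (R t) w\<bar>))"
    proof (intro sum.cong refl)
      fix R assume R: "R \<in> RR"
      have Rt: "R t \<in> idx d n (J t)" using RRm[OF R, of t] t by simp
      have "(\<Sum>v\<in>levels d n. \<rho> * X v R) = (\<Sum>v\<in>levels d n. if v = R t then \<rho> * X (R t) R else 0)"
      proof (intro sum.cong refl)
        fix v assume v: "v \<in> levels d n"
        show "\<rho> * X v R = (if v = R t then \<rho> * X (R t) R else 0)"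
        proof (cases "v = R t")
          case False
          then have "X v R = 0" unfolding X_def using v RRm[OF R] t by (intro zero_term) auto
          then show ?thesis using False by simp
        qed simp
      qed
      also have "\<dots> = \<rho> * X (R t) R" using idx_levels[OF Rt] by simp
      also have "X (R t) R = E (\<lambda>w. \<bar>h (R t) w\<bar>)"
        using diagonal_term[OF t Rt] by (simp add: X_def t)
      finally show "(\<Sum>v\<in>levels d n. \<rho> * X v R) = \<rho> * E (\<lambda>w. \<bar>h (R t) w\<bar>)" .
    qed
    also have "\<dots> = (\<Sum>r\<in>idx d n (J t). \<rho> * E (\<lambda>w. \<bar>h r w\<bar>))"
      by (rule sum.reindex_bij_witness[of _ "\<lambda>r. restrict (\<lambda>_. r) {t}" "\<lambda>R. R t"])
        (auto simp: RR_def t fun_eq_iff PiE_iff extensional_def)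
    finally show ?thesis using t by (simp add: sum_distrib_left)
  qed
  finally show ?thesis .
qed

end

section \<open>Uncovering all coordinates\<close>

lemma div_eq_block: "0 < m \<Longrightarrow> y div m = t \<longleftrightarrow> y \<in> {t * m..<Suc t * m}" for y m t :: nat
  using dividend_less_times_div[of m y] div_times_less_eq_dividend[of y m] div_nat_eqI[of m t y]
  by (auto simp: mult.commute)

locale staged = tilted +
  fixes h :: "(nat \<Rightarrow> nat) \<Rightarrow> (nat \<times> nat) set \<Rightarrow> real" and Ls :: "nat \<Rightarrow> nat" and \<xi> \<tau> :: "nat \<Rightarrow> real"
    and \<zeta> \<Gamma> l :: real and k :: nat
  assumes h: "hsys d n h" and fh: "\<And>r w. r \<in> idx d n (\<lambda>_. UNIV) \<Longrightarrow> f r w = sgn (h r w)"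
    and H1: "\<And>w. \<bar>\<Sum>v\<in>levels d n. h v w\<bar> \<le> 1"
    and L: "1 \<le> L" and Ls: "\<And>c. 1 \<le> c \<Longrightarrow> c < d \<Longrightarrow> 1 \<le> Ls c"
    and tameB: "\<And>I. (\<And>j. I j \<subseteq> {..n}) \<Longrightarrow> card (I 0) \<le> L \<Longrightarrow> wop d n l k (tame d n f Dm Q I)"
    and \<xi>B: "\<And>c I. 1 \<le> c \<Longrightarrow> c < d \<Longrightarrow> (\<And>j. I j \<subseteq> {..n}) \<Longrightarrow> card (I c) \<le> Ls c \<Longrightarrow>
      wop d n l k (\<lambda>w. \<bar>\<rho> * hsum d n f I w\<bar> \<le> \<xi> c)"
    and \<zeta>B: "\<And>c I I'. 1 \<le> c \<Longrightarrow> c < d \<Longrightarrow> (\<And>j. I j \<subseteq> {..n}) \<Longrightarrow> (\<And>j. I' j \<subseteq> {..n}) \<Longrightarrow> I 0 \<inter> I' 0 = {} \<Longrightarrow>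
      wop d n l k (\<lambda>w. \<bar>\<rho>\<^sup>2 * psum d n f {c} I I' w\<bar> \<le> \<zeta>)"
    and \<Gamma>: "1 \<le> \<Gamma>" "\<And>I w. (\<forall>j. I j \<subseteq> {..n}) \<Longrightarrow> \<bar>\<rho> * hsum d n f I w\<bar> \<le> \<Gamma>"
      "\<And>c I I' w. 1 \<le> c \<Longrightarrow> c < d \<Longrightarrow> (\<forall>j. I j \<subseteq> {..n} \<and> I' j \<subseteq> {..n}) \<Longrightarrow> \<bar>\<rho>\<^sup>2 * psum d n f {c} I I' w\<bar> \<le> \<Gamma>\<^sup>2"
    and num: "\<And>c. 1 \<le> c \<Longrightarrow> c < d \<Longrightarrow> 0 \<le> \<xi> c" "0 \<le> \<zeta>" "\<And>c. 1 \<le> c \<Longrightarrow> c < d \<Longrightarrow> 4 * (\<xi> c * (n div L + 1)) \<le> 1"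
      "\<And>c. 1 \<le> c \<Longrightarrow> c < d \<Longrightarrow> 0 < \<tau> c"
begin

definition q :: nat where "q = n div L + 1"
definition Nc :: "nat \<Rightarrow> nat" where "Nc c = n div Ls c + 1"
definition slabs :: "nat set" where "slabs = {..n div L}"
definition H :: "(nat \<times> nat) set \<Rightarrow> real" where "H w = (\<Sum>v\<in>levels d n. h v w)"
text \<open>The 5 is made up of three conjunctions of events and a union over pairs of
  slabs.\<close>

definition p :: real where "p = (real n + 2) ^ (k + 5) * (2 * exp (- l\<^sup>2 / 2))"

text \<open>Coordinates \<open>1, \<dots>, i\<close> have been treated: in the coordinate \<open>j\<close> the factor \<open>ow j\<close> owns the block
  \<open>b j\<close>, and all other factors are confined to lower blocks.\<close>

definition boxes :: "nat \<Rightarrow> (nat \<Rightarrow> nat) \<Rightarrow> (nat \<Rightarrow> nat) \<Rightarrow> nat \<Rightarrow> nat \<Rightarrow> nat set" where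
  "boxes i b ow t j = {y. y \<le> n \<and> (if j = 0 then y div L = t else
     if j \<le> i then (if ow j = t then y div Ls j = b j else y div Ls j < b j) else True)}"

definition mass :: "(nat \<Rightarrow> nat set) \<Rightarrow> real" where
  "mass I = (\<Sum>r\<in>idx d n I. E (\<lambda>w. \<bar>h r w\<bar>))"

text \<open>Only slabs that own all the treated coordinates contribute. Inclusion instead of
  equality makes every slab count at \<open>i = 0\<close>.\<close>

definition main_term :: "nat \<Rightarrow> (nat \<Rightarrow> nat) \<Rightarrow> (nat \<Rightarrow> nat) \<Rightarrow> real" where
  "main_term i b ow = (\<Sum>t\<in>slabs. if ow ` {1..i} \<subseteq> {t} then \<rho> * mass (boxes i b ow t) else 0)"

definition B :: real where "B = \<Gamma> ^ d * sqrt (p * (1 + \<rho>\<^sup>2 * Q) ^ q)"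

definition stage_error :: "nat \<Rightarrow> real" where
  "stage_error c = Nc c * (16 * (\<xi> c * q) ^ 3 + (2 + q + q\<^sup>2) * B + q\<^sup>2 * (4 * \<zeta> + 3 * B))
      + q\<^sup>2 * (4 * (\<xi> c)\<^sup>2 * (Nc c * \<tau> c / 2 + (1 + Nc c * (4 * (\<xi> c * q) + 2 * B)) / (2 * \<tau> c)))"

text \<open>The number of products present when \<open>c\<close> is treated: each earlier coordinate
  multiplies it by the choices of an owner and a block.\<close>

definition branches :: "nat \<Rightarrow> real" where "branches c = (\<Prod>j\<in>{1..<c}. q * Nc j)"

lemma slabs: "finite slabs" "card slabs = q" "slabs \<noteq> {}" by (auto simp: slabs_def q_def)

lemma p0: "0 \<le> p" by (simp add: p_def)

lemma slabbed_boxes: "slabbed (boxes i b ow)" by (auto simp: slabbed_def boxes_def)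

lemma boxes_0: "card (boxes i b ow t 0) \<le> L"
proof -
  have "boxes i b ow t 0 \<subseteq> {t * L..<Suc t * L}"
  proof
    fix y assume "y \<in> boxes i b ow t 0"
    then have "y div L = t" by (simp add: boxes_def)
    then show "y \<in> {t * L..<Suc t * L}" using div_eq_block[of L y t] L by simp
  qed
  from card_mono[OF _ this] show ?thesis by simp
qed

lemma boxes_disjoint: "s \<noteq> t \<Longrightarrow> boxes i b ow s 0 \<inter> boxes i b ow t 0 = {}" by (auto simp: boxes_def)

lemma EH: "E H = 0"
proof -
  have "E (h v) = 0" if v: "v \<in> levels d n" for v
  proof (rule avg_odd)
    show "odd_at (0, v 0) (h v)" using h v d0 by (auto simp: hsys_def)
    have "v 0 \<le> n" using v member_le_sum[of 0 "{..<d}" v] d0 by (auto simp: levels_def)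
    then show "(0, v 0) \<in> digits d n" using d0 by (simp add: digits_def)
  qed
  then show ?thesis unfolding H_def[abs_def] avg_sum by simp
qed

lemma H1': "\<bar>H w\<bar> \<le> 1" using H1 by (simp add: H_def)

lemma \<beta>0: "0 \<le> sqrt (p * (1 + \<rho>\<^sup>2 * Q) ^ q)" using p0 Q by simp

lemma B0: "0 \<le> B" using \<beta>0 \<Gamma>(1) by (simp add: B_def)

lemma stage_boxes:
  assumes c: "1 \<le> c" "c < d" and ow: "\<And>j. ow j \<in> slabs"
  shows "\<bar>E (\<lambda>w. H w * prodX (boxes (c - 1) b ow) (ow ` {1..c - 1}) slabs w)
    - (\<Sum>\<kappa><Nc c. \<Sum>t\<in>slabs. E (\<lambda>w. H w * prodX (boxes c (b(c := \<kappa>)) (ow(c := t))) ((ow(c := t)) ` {1..c}) slabs w))\<bar> \<le> stage_error c"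
proof -
  define I where "I = boxes (c - 1) b ow"
  define lw where "lw \<kappa> t = (I t)(c := I t c \<inter> {..<\<kappa> * Ls c})" for \<kappa> t
  define md where "md \<kappa> t = (I t)(c := I t c \<inter> {\<kappa> * Ls c..<Suc \<kappa> * Ls c})" for \<kappa> t
  define G where "G \<kappa> w \<longleftrightarrow> (\<forall>x\<in>slabs \<times> slabs. ((tame d n f Dm Q (lw \<kappa> (fst x)) w \<and> tame d n f Dm Q (lw (Suc \<kappa>) (fst x)) w) \<and>
     (\<bar>\<rho> * hsum d n f (md \<kappa> (fst x)) w\<bar> \<le> \<xi> c)) \<and>
     (fst x \<noteq> snd x \<longrightarrow> \<bar>\<rho>\<^sup>2 * psum d n f {c} (md \<kappa> (fst x)) (md \<kappa> (snd x)) w\<bar> \<le> \<zeta>))" for \<kappa> w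
  have Isub: "I t j \<subseteq> {..n}" for t j by (auto simp: I_def boxes_def)
  have lwsub: "lw \<kappa> t j \<subseteq> {..n}" for \<kappa> t j using Isub[of t j] by (auto simp: lw_def)
  have mdsub: "md \<kappa> t j \<subseteq> {..n}" for \<kappa> t j using Isub[of t j] by (auto simp: md_def)
  have c0: "c \<noteq> 0" using c by simp
  have Ic: "I t c = {..n}" for t using c by (auto simp: I_def boxes_def)
  have lw0: "card (lw \<kappa> t 0) \<le> L" for \<kappa> t using boxes_0 c0 by (simp add: lw_def I_def)
  have mdc: "card (md \<kappa> t c) \<le> Ls c" for \<kappa> t
  proof -
    have "card (md \<kappa> t c) \<le> card {\<kappa> * Ls c..<Suc \<kappa> * Ls c}" by (intro card_mono) (auto simp: md_def)
    then show ?thesis by simp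
  qed
  have bad: "wop d n l (k + 5) (G \<kappa>)" for \<kappa>
  proof -
    have "wop d n l (k + 3 + 2) (G \<kappa>)"
      unfolding G_def[abs_def]
    proof (intro wop_all)
      have "card (slabs \<times> slabs) = q ^ 2" using slabs by (simp add: card_cartesian_product power2_eq_square)
      also have "\<dots> \<le> (n + 2) ^ 2" unfolding q_def by (intro power_mono) (auto intro: le_trans[OF div_le_dividend])
      finally show "card (slabs \<times> slabs) \<le> (n + 2)\<^sup>2" .
      fix x :: "nat \<times> nat"
      have w1: "wop d n l (k + 1) (\<lambda>w. tame d n f Dm Q (lw \<kappa> (fst x)) w \<and> tame d n f Dm Q (lw (Suc \<kappa>) (fst x)) w)"
        by (intro wop_conj tameB[of "lw \<kappa> (fst x)"] tameB[of "lw (Suc \<kappa>) (fst x)"] lwsub lw0)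
      have w2: "wop d n l (k + 1) (\<lambda>w. \<bar>\<rho> * hsum d n f (md \<kappa> (fst x)) w\<bar> \<le> \<xi> c)"
        by (rule wop_mono[OF \<xi>B[of c "md \<kappa> (fst x)", OF c mdsub mdc]]) auto
      have w3: "wop d n l (k + 2) (\<lambda>w. fst x \<noteq> snd x \<longrightarrow> \<bar>\<rho>\<^sup>2 * psum d n f {c} (md \<kappa> (fst x)) (md \<kappa> (snd x)) w\<bar> \<le> \<zeta>)"
      proof (cases "fst x = snd x")
        case False
        have "md \<kappa> (fst x) 0 \<inter> md \<kappa> (snd x) 0 = {}" using boxes_disjoint[OF False] c0 by (simp add: md_def I_def)
        from \<zeta>B[of c "md \<kappa> (fst x)" "md \<kappa> (snd x)", OF c mdsub mdsub this] show ?thesis by (rule wop_mono) auto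
      qed (auto intro: wop_true)
      have "wop d n l (k + 2 + 1) (\<lambda>w. ((tame d n f Dm Q (lw \<kappa> (fst x)) w \<and> tame d n f Dm Q (lw (Suc \<kappa>) (fst x)) w) \<and>
         (\<bar>\<rho> * hsum d n f (md \<kappa> (fst x)) w\<bar> \<le> \<xi> c)) \<and>
         (fst x \<noteq> snd x \<longrightarrow> \<bar>\<rho>\<^sup>2 * psum d n f {c} (md \<kappa> (fst x)) (md \<kappa> (snd x)) w\<bar> \<le> \<zeta>))"
        using wop_conj[OF w1 w2] w3 by (intro wop_conj) simp_all
      then show "wop d n l (k + 3) (\<lambda>w. ((tame d n f Dm Q (lw \<kappa> (fst x)) w \<and> tame d n f Dm Q (lw (Suc \<kappa>) (fst x)) w) \<and>
         (\<bar>\<rho> * hsum d n f (md \<kappa> (fst x)) w\<bar> \<le> \<xi> c)) \<and>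
         (fst x \<noteq> snd x \<longrightarrow> \<bar>\<rho>\<^sup>2 * psum d n f {c} (md \<kappa> (fst x)) (md \<kappa> (snd x)) w\<bar> \<le> \<zeta>))"
        by (simp add: numeral_3_eq_3)
    qed (use slabs in auto)
    then show ?thesis by (simp add: numeral_eq_Suc)
  qed
  have n_less: "n < Nc c * Ls c"
    using Ls[OF c] dividend_less_div_times[of "Ls c" n] by (simp add: Nc_def)
  interpret S: stage d n f \<rho> Dm Q L H I "ow ` {1..c - 1}" slabs q c "Ls c" "Nc c" p "\<xi> c" \<zeta> \<Gamma> G
  proof
    show "\<bar>H w\<bar> \<le> 1" for w by (rule H1')
    show "E H = 0" by (rule EH)
    show "finite slabs" "card slabs \<le> q" using slabs by auto
    show "ow ` {1..c - 1} \<subseteq> slabs" using ow by auto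
    show "1 \<le> c" "c < d" "1 \<le> Ls c" "n < Nc c * Ls c" using c Ls n_less by auto
    show "slabbed I" unfolding I_def by (rule slabbed_boxes)
    show "E (\<lambda>w. of_bool (\<not> G \<kappa> w)) \<le> p" for \<kappa> using bad[of \<kappa>] by (simp add: wop_def p_def)
    show "tame d n f Dm Q ((I t)(c := I t c \<inter> {..<\<kappa> * Ls c})) w" if "G \<kappa> w" "t \<in> slabs" for \<kappa> w t
      using that by (auto simp: G_def lw_def)
    show "tame d n f Dm Q ((I t)(c := I t c \<inter> {..<Suc \<kappa> * Ls c})) w" if "G \<kappa> w" "t \<in> slabs" for \<kappa> w t
      using that by (auto simp: G_def lw_def)
    show "\<bar>\<rho> * hsum d n f ((I t)(c := I t c \<inter> {\<kappa> * Ls c..<Suc \<kappa> * Ls c})) w\<bar> \<le> \<xi> c" if "G \<kappa> w" "t \<in> slabs" for \<kappa> w t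
      using that by (auto simp: G_def md_def)
    show "\<bar>\<rho>\<^sup>2 * psum d n f {c} ((I s)(c := I s c \<inter> {\<kappa> * Ls c..<Suc \<kappa> * Ls c})) ((I t)(c := I t c \<inter> {\<kappa> * Ls c..<Suc \<kappa> * Ls c})) w\<bar> \<le> \<zeta>"
      if "G \<kappa> w" "s \<in> slabs" "t \<in> slabs" "s \<noteq> t" for \<kappa> w s t
      using that by (auto simp: G_def md_def)
    show "4 * (\<xi> c * real q) \<le> 1" using num(3)[OF c] by (simp add: q_def)
    show "0 \<le> \<xi> c" using num(1)[OF c] .
  qed (use \<Gamma> num c p0 in auto)
  have nxt: "S.nxt \<kappa> t s = (if s = t then md \<kappa> s else lw \<kappa> s)" for \<kappa> t s
    unfolding S.nxt_def S.mid_def S.low_def md_def lw_def ..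
  have nx: "S.nxt \<kappa> t = boxes c (b(c := \<kappa>)) (ow(c := t))" for \<kappa> t
  proof (intro ext)
    fix s j
    have b: "(y div Ls c = \<kappa>) = (y \<in> {\<kappa> * Ls c..<Suc \<kappa> * Ls c})" "(y div Ls c < \<kappa>) = (y < \<kappa> * Ls c)" for y
      using Ls[OF c] div_eq_block[of "Ls c" y \<kappa>] by (auto simp: div_less_iff_less_mult)
    show "S.nxt \<kappa> t s j = boxes c (b(c := \<kappa>)) (ow(c := t)) s j"
    proof (cases "j = c")
      case True
      then show ?thesis using Ic[of s] c0 b by (auto simp: nxt md_def lw_def boxes_def)
    next
      case False
      then have "j \<le> c - 1 \<longleftrightarrow> j \<le> c" using c0 by auto
      then show ?thesis using False c0 unfolding nxt md_def lw_def by (simp add: I_def boxes_def)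
    qed
  qed
  have im: "(ow(c := t)) ` {1..c} = insert t (ow ` {1..c - 1})" for t
  proof -
    have "{1..c} = insert c {1..c - 1}" using c0 by auto
    moreover have "(ow(c := t)) ` {1..c - 1} = ow ` {1..c - 1}" using c0 by (intro image_cong) auto
    ultimately show ?thesis by (simp only: image_insert fun_upd_same)
  qed
  have SB: "S.B \<le> B"
  proof -
    have "card (ow ` {1..c - 1}) \<le> c - 1" using card_image_le[of "{1..c - 1}" ow] by simp
    then have "card (ow ` {1..c - 1}) + 2 \<le> d" using c d by linarith
    then have "\<Gamma> ^ (card (ow ` {1..c - 1}) + 2) \<le> \<Gamma> ^ d" using \<Gamma>(1) by (intro power_increasing) auto
    then show ?thesis unfolding S.B_def B_def S.\<beta>_def using \<beta>0 by (rule mult_right_mono)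
  qed
  have "\<bar>E (\<lambda>w. H w * prodX I (ow ` {1..c - 1}) slabs w)
    - (\<Sum>\<kappa><Nc c. \<Sum>t\<in>slabs. E (\<lambda>w. H w * prodX (S.nxt \<kappa> t) (insert t (ow ` {1..c - 1})) slabs w))\<bar>
    \<le> Nc c * (16 * (\<xi> c * q) ^ 3 + (2 + q + q\<^sup>2) * S.B + q\<^sup>2 * (4 * \<zeta> + 3 * S.B))
      + q\<^sup>2 * (4 * (\<xi> c)\<^sup>2 * (Nc c * \<tau> c / 2 + (1 + Nc c * (4 * (\<xi> c * q) + 2 * S.B)) / (2 * \<tau> c)))"
    by (rule S.stage_step) (use num c in auto)
  also have "\<dots> \<le> stage_error c"
    unfolding stage_error_def using SB num(1)[OF c] num(4)[OF c]
    by (intro add_mono mult_left_mono divide_right_mono order_refl) auto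
  finally show ?thesis unfolding nx im unfolding I_def .
qed

lemma mass_split:
  assumes c: "c < d" and I: "I c \<subseteq> {..n}" and b: "finite K" "\<And>y. y \<in> I c \<Longrightarrow> g y \<in> K"
  shows "(\<Sum>\<kappa>\<in>K. mass (I(c := {y \<in> I c. g y = \<kappa>}))) = mass I"
proof -
  have "mass I = (\<Sum>\<kappa>\<in>K. \<Sum>r\<in>{r \<in> idx d n I. g (r c) = \<kappa>}. E (\<lambda>w. \<bar>h r w\<bar>))"
    unfolding mass_def using b c by (intro sum.group[symmetric] finite_idx) (auto simp: idx_def)
  also have "\<dots> = (\<Sum>\<kappa>\<in>K. mass (I(c := {y \<in> I c. g y = \<kappa>})))"
    unfolding mass_def using c by (intro sum.cong refl arg_cong[where f = "sum _"]) (auto simp: idx_def split: if_splits)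
  finally show ?thesis ..
qed

text \<open>For a slab \<open>t\<close> only the choice \<open>s = t\<close> keeps the owner common,
  and the blocks of \<open>c\<close> partition its box; so the main term is passed on
  exactly.\<close>

lemma main_term_step:
  assumes c: "1 \<le> c" "c < d"
  shows "(\<Sum>\<kappa><Nc c. \<Sum>s\<in>slabs. main_term c (b(c := \<kappa>)) (ow(c := s))) = main_term (c - 1) b ow"
proof -
  have c0: "c \<noteq> 0" using c by simp
  have im: "(ow(c := t)) ` {1..c} = insert t (ow ` {1..c - 1})" for t
  proof -
    have "{1..c} = insert c {1..c - 1}" using c0 by auto
    moreover have "(ow(c := t)) ` {1..c - 1} = ow ` {1..c - 1}" using c0 by (intro image_cong) auto
    ultimately show ?thesis by (simp only: image_insert fun_upd_same)
  qed
  have inner: "main_term c (b(c := \<kappa>)) (ow(c := s)) =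
    (if ow ` {1..c - 1} \<subseteq> {s} then \<rho> * mass (boxes c (b(c := \<kappa>)) (ow(c := s)) s) else 0)" if s: "s \<in> slabs" for s \<kappa>
  proof -
    have "main_term c (b(c := \<kappa>)) (ow(c := s)) = (\<Sum>t\<in>slabs. if s = t then
      (if ow ` {1..c - 1} \<subseteq> {s} then \<rho> * mass (boxes c (b(c := \<kappa>)) (ow(c := s)) s) else 0) else 0)"
      unfolding main_term_def im by (intro sum.cong) auto
    then show ?thesis using s slabs(1) by simp
  qed
  have J: "boxes c (b(c := \<kappa>)) (ow(c := s)) s = (boxes (c - 1) b ow s)(c := {y \<in> boxes (c - 1) b ow s c. y div Ls c = \<kappa>})" for s \<kappa>
    using c0 by (auto simp: fun_eq_iff boxes_def)
  have "(\<Sum>\<kappa><Nc c. \<Sum>s\<in>slabs. main_term c (b(c := \<kappa>)) (ow(c := s))) =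
    (\<Sum>s\<in>slabs. \<Sum>\<kappa><Nc c. if ow ` {1..c - 1} \<subseteq> {s} then \<rho> * mass (boxes c (b(c := \<kappa>)) (ow(c := s)) s) else 0)"
    by (subst sum.swap) (intro sum.cong refl inner)
  also have "\<dots> = main_term (c - 1) b ow"
    unfolding main_term_def
  proof (intro sum.cong refl)
    fix s
    have "(\<Sum>\<kappa><Nc c. mass (boxes c (b(c := \<kappa>)) (ow(c := s)) s)) = mass (boxes (c - 1) b ow s)"
      unfolding J using c by (intro mass_split) (auto simp: boxes_def Nc_def less_Suc_eq_le div_le_mono)
    then show "(\<Sum>\<kappa><Nc c. if ow ` {1..c - 1} \<subseteq> {s} then \<rho> * mass (boxes c (b(c := \<kappa>)) (ow(c := s)) s) else 0) =
      (if ow ` {1..c - 1} \<subseteq> {s} then \<rho> * mass (boxes (c - 1) b ow s) else 0)"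
      by (simp add: sum_distrib_left[symmetric])
  qed
  finally show ?thesis .
qed

lemma main_term_last:
  assumes ow: "\<And>j. ow j \<in> slabs"
  shows "E (\<lambda>w. H w * prodX (boxes (d - 1) b ow) (ow ` {1..d - 1}) slabs w) = main_term (d - 1) b ow"
proof -
  have im: "{1..d - 1} = {1..<d}" using d0 by auto
  interpret O: owned d n f \<rho> Dm Q L h "boxes (d - 1) b ow" slabs "ow ` {1..d - 1}" ow "\<lambda>j. b j * Ls j"
  proof
    show "hsys d n h" by (rule h)
    show "f r w = sgn (h r w)" if "r \<in> idx d n (\<lambda>_. UNIV)" for r w using fh that .
    show "ow ` {1..d - 1} \<subseteq> slabs" using ow by auto
    show "ow ` {1..d - 1} = ow ` {1..<d}" using im by simp
    show "slabbed (boxes (d - 1) b ow)" by (rule slabbed_boxes)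
    show "b j * Ls j \<le> y" if "j \<in> {1..<d}" "y \<in> boxes (d - 1) b ow (ow j) j" for j y
    proof -
      have "y div Ls j = b j" using that by (auto simp: boxes_def split: if_splits)
      then show ?thesis using div_times_less_eq_dividend[of y "Ls j"] by simp
    qed
    show "y < b j * Ls j" if "j \<in> {1..<d}" "t \<in> slabs" "t \<noteq> ow j" "y \<in> boxes (d - 1) b ow t j" for j t y
      using that Ls[of j] by (auto simp: boxes_def div_less_iff_less_mult split: if_splits)
  qed (use slabs in auto)
  have "main_term (d - 1) b ow = (if \<exists>t. ow ` {1..d - 1} = {t} then \<rho> * mass (boxes (d - 1) b ow (THE t. ow ` {1..d - 1} = {t})) else 0)"
  proof (cases "\<exists>t. ow ` {1..d - 1} = {t}")
    case True
    then obtain t where t: "ow ` {1..d - 1} = {t}" by auto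
    have "ow 1 \<in> {t}" unfolding t[symmetric] using d by (intro imageI) simp
    then have "t \<in> slabs" using ow[of 1] by simp
    then show ?thesis unfolding main_term_def t using slabs(1) by (simp add: if_distrib cong: if_cong)
  next
    case False
    have "ow ` {1..d - 1} \<noteq> {}" using d by auto
    then have "\<not> ow ` {1..d - 1} \<subseteq> {t}" for t using False by (meson subset_singletonD)
    then show ?thesis using False by (simp add: main_term_def)
  qed
  then show ?thesis using O.owned_avg by (simp add: H_def mass_def)
qed

text \<open>Backward induction from the last coordinate, where \<open>main_term_last\<close> is
  exact. The weights \<open>branches\<close> record how many products incur the error of a
  stage.\<close>

lemma stages:
  assumes "i \<le> d - 1" "\<And>j. ow j \<in> slabs"
  shows "branches (Suc i) * \<bar>E (\<lambda>w. H w * prodX (boxes i b ow) (ow ` {1..i}) slabs w) - main_term i b ow\<bar> \<le> (\<Sum>c\<in>{Suc i..<d}. branches c * stage_error c)"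
  using assms
proof (induction i arbitrary: b ow rule: inc_induct)
  case base
  then show ?case using main_term_last[OF base, of b] d0 by simp
next
  case (step i)
  define X where "X \<kappa> t = E (\<lambda>w. H w * prodX (boxes (Suc i) (b(Suc i := \<kappa>)) (ow(Suc i := t))) ((ow(Suc i := t)) ` {1..Suc i}) slabs w)" for \<kappa> t
  define Y where "Y \<kappa> t = main_term (Suc i) (b(Suc i := \<kappa>)) (ow(Suc i := t))" for \<kappa> t
  define e where "e = (\<Sum>c\<in>{Suc (Suc i)..<d}. branches c * stage_error c)"
  have c: "1 \<le> Suc i" "Suc i < d" using step.hyps by auto
  have XY: "branches (Suc (Suc i)) * \<bar>X \<kappa> t - Y \<kappa> t\<bar> \<le> e" if "t \<in> slabs" for \<kappa> t
    unfolding X_def Y_def e_def by (rule step.IH) (use step.prems that in auto)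
  have Msuc: "branches (Suc (Suc i)) = branches (Suc i) * (q * Nc (Suc i))" by (simp add: branches_def)
  have M: "0 < branches (Suc i)" unfolding branches_def of_nat_prod by (intro prod_pos) (simp add: q_def Nc_def add_pos_nonneg del: of_nat_mult)
  have qN: "0 < real q * real (Nc (Suc i))" by (simp add: q_def Nc_def)
  have M': "0 < branches (Suc (Suc i))" unfolding Msuc using M qN by simp
  have qN0: "q \<noteq> 0" "Nc (Suc i) \<noteq> 0" by (simp_all add: q_def Nc_def)
  have "branches (Suc i) * \<bar>(\<Sum>\<kappa><Nc (Suc i). \<Sum>t\<in>slabs. X \<kappa> t) - (\<Sum>\<kappa><Nc (Suc i). \<Sum>t\<in>slabs. Y \<kappa> t)\<bar>
    \<le> branches (Suc i) * (\<Sum>\<kappa><Nc (Suc i). \<Sum>t\<in>slabs. \<bar>X \<kappa> t - Y \<kappa> t\<bar>)"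
    unfolding sum_subtractf[symmetric] using M
    by (intro mult_left_mono) (auto intro!: order_trans[OF sum_abs] sum_mono)
  also have "\<dots> \<le> branches (Suc i) * (\<Sum>\<kappa><Nc (Suc i). \<Sum>t\<in>slabs. e / branches (Suc (Suc i)))"
  proof (intro mult_left_mono sum_mono)
    fix \<kappa> t assume "t \<in> slabs"
    then show "\<bar>X \<kappa> t - Y \<kappa> t\<bar> \<le> e / branches (Suc (Suc i))"
      using XY[of t \<kappa>] M' by (simp add: pos_le_divide_eq mult.commute)
  qed (use M in auto)
  also have "\<dots> = e" using M qN0 slabs(2) by (simp add: Msuc)
  finally have main_e: "branches (Suc i) * \<bar>(\<Sum>\<kappa><Nc (Suc i). \<Sum>t\<in>slabs. X \<kappa> t) - main_term i b ow\<bar> \<le> e"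
    using main_term_step[OF c, of b ow] by (simp add: Y_def)
  have "\<bar>E (\<lambda>w. H w * prodX (boxes i b ow) (ow ` {1..i}) slabs w) - (\<Sum>\<kappa><Nc (Suc i). \<Sum>t\<in>slabs. X \<kappa> t)\<bar> \<le> stage_error (Suc i)"
    using stage_boxes[OF c, of ow b] step.prems by (simp add: X_def)
  then have "branches (Suc i) * \<bar>E (\<lambda>w. H w * prodX (boxes i b ow) (ow ` {1..i}) slabs w) - (\<Sum>\<kappa><Nc (Suc i). \<Sum>t\<in>slabs. X \<kappa> t)\<bar> \<le> branches (Suc i) * stage_error (Suc i)"
    using M by simp
  moreover have "branches (Suc i) * \<bar>E (\<lambda>w. H w * prodX (boxes i b ow) (ow ` {1..i}) slabs w) - main_term i b ow\<bar> \<le>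
     branches (Suc i) * \<bar>E (\<lambda>w. H w * prodX (boxes i b ow) (ow ` {1..i}) slabs w) - (\<Sum>\<kappa><Nc (Suc i). \<Sum>t\<in>slabs. X \<kappa> t)\<bar> +
     branches (Suc i) * \<bar>(\<Sum>\<kappa><Nc (Suc i). \<Sum>t\<in>slabs. X \<kappa> t) - main_term i b ow\<bar>"
    unfolding distrib_left[symmetric] using M by (intro mult_left_mono) linarith+
  moreover have "(\<Sum>c\<in>{Suc i..<d}. branches c * stage_error c) = branches (Suc i) * stage_error (Suc i) + e"
    unfolding e_def using c by (simp add: sum.atLeast_Suc_lessThan)
  ultimately show ?case using main_e by linarith
qed

text \<open>Before any coordinate is uncovered the product is the Riesz product itself, a positive
  density of mean 1, so its test of \<open>H\<close> is at most 1.\<close>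

lemma total_mass:
  "\<rho> * mass (\<lambda>_. UNIV) \<le> 1 + (\<Sum>c\<in>{1..<d}. branches c * stage_error c)"
proof -
  define b :: "nat \<Rightarrow> nat" where "b = (\<lambda>_. 0)"
  have "\<bar>E (\<lambda>w. H w * prodX (boxes 0 b (\<lambda>_. 0)) {} slabs w) - main_term 0 b (\<lambda>_. 0)\<bar> \<le> (\<Sum>c\<in>{1..<d}. branches c * stage_error c)"
    using stages[of 0 "\<lambda>_. 0" b] by (simp add: slabs_def branches_def)
  moreover have "E (\<lambda>w. H w * prodX (boxes 0 b (\<lambda>_. 0)) {} slabs w) \<le> E (tilt (boxes 0 b (\<lambda>_. 0)) slabs)"
  proof (rule avg_mono)
    fix w
    have "H w * tilt (boxes 0 b (\<lambda>_. 0)) slabs w \<le> 1 * tilt (boxes 0 b (\<lambda>_. 0)) slabs w"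
      using H1'[of w] tilt_pos[of "boxes 0 b (\<lambda>_. 0)" slabs w] by (intro mult_right_mono) linarith+
    then show "H w * prodX (boxes 0 b (\<lambda>_. 0)) {} slabs w \<le> tilt (boxes 0 b (\<lambda>_. 0)) slabs w"
      by (simp add: prodX_def tilt_def)
  qed
  moreover have "E (tilt (boxes 0 b (\<lambda>_. 0)) slabs) = 1" using slabs(1) slabbed_boxes by (rule avg_tilt_1)
  moreover have "main_term 0 b (\<lambda>_. 0) = \<rho> * mass (\<lambda>_. UNIV)"
  proof -
    have J: "boxes 0 b (\<lambda>_. 0) t = (\<lambda>_. {..n})(0 := {y \<in> {..n}. y div L = t})" for t
      by (auto simp: boxes_def fun_eq_iff)
    have "main_term 0 b (\<lambda>_. 0) = \<rho> * (\<Sum>t\<in>slabs. mass ((\<lambda>_. {..n})(0 := {y \<in> {..n}. y div L = t})))"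
      by (simp add: main_term_def J sum_distrib_left)
    also have "(\<Sum>t\<in>slabs. mass ((\<lambda>_. {..n})(0 := {y \<in> {..n}. y div L = t}))) = mass (\<lambda>_. {..n})"
      using mass_split[OF d0, of "\<lambda>_. {..n}" slabs "\<lambda>y. y div L"] slabs(1) by (simp add: slabs_def div_le_mono)
    also have "mass (\<lambda>_. {..n}) = mass (\<lambda>_. UNIV)"
    proof -
      have "idx d n (\<lambda>_. {..n}) = idx d n (\<lambda>_. UNIV)" using idx_le[of _ d n "\<lambda>_. UNIV"] by (auto simp: idx_def)
      then show ?thesis by (simp add: mass_def)
    qed
    finally show ?thesis .
  qed
  ultimately show ?thesis by linarith
qed

end

section \<open>Choice of the parameters\<close>

lemma block_length_power:
  fixes z :: real
  assumes z: "1 \<le> z" "z ^ Y = real n + 1" and E: "E \<le> Y" "0 < Y"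
  shows "\<exists>L::nat. 1 \<le> L \<and> L \<le> 2 * (z ^ Y / z ^ E) \<and> n div L + 1 \<le> 2 * z ^ E"
proof -
  have pz: "(z ^ Y) powr (real E / real Y) = z ^ E"
  proof -
    have "(z ^ Y) powr (real E / real Y) = z powr (real Y * (real E / real Y))"
      using z powr_powr[of z "real Y" "real E / real Y"] by (simp only: powr_realpow)
    also have "real Y * (real E / real Y) = real E" using E by simp
    finally show ?thesis using z by (simp add: powr_realpow)
  qed
  have e: "0 \<le> real E / real Y" "real E / real Y \<le> 1" using E by auto
  obtain L :: nat where L: "L \<ge> 1" "L \<le> 2 * (z ^ Y) powr (1 - real E / real Y)" "n div L + 1 \<le> 2 * (z ^ Y) powr (real E / real Y)"
    using block_length[OF z(2) e] by metis
  moreover have "(z ^ Y) powr (1 - real E / real Y) = z ^ Y / z ^ E"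
    using z pz by (simp add: powr_diff)
  ultimately show ?thesis using pz by auto
qed

lemma power_ratio_le:
  fixes z :: real
  assumes "1 \<le> z" "i + k \<le> j"
  shows "z ^ i / z ^ j \<le> 1 / z ^ k"
proof -
  have "z ^ i * z ^ k \<le> z ^ j" using assms by (simp add: power_add[symmetric] power_increasing)
  then show ?thesis using assms by (simp add: field_simps)
qed

text \<open>There are about \<open>z ^ (4 * m)\<close> blocks, each contributing
  \<open>\<xi>\<close> of order \<open>1 / z ^ (2 * m)\<close>. So the third-order terms add up to
  order \<open>1 / z ^ (2 * m)\<close>, but the second-order ones alone only to a constant. The
  square function is of order \<open>z ^ (2 * m)\<close> at most, and
  \<open>\<tau> = 1 / z ^ m\<close> balances it against \<open>N * \<tau>\<close>, which leaves
  \<open>1 / z ^ m\<close>. This must still beat \<open>z ^ s\<close> from the branches and powers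
  up to \<open>3 * D + 24\<close> from \<open>\<xi>\<close> and \<open>q\<close>.\<close>

lemma stage_numeric:
  fixes z M q N \<xi> \<tau> \<zeta> B :: real and s m D X :: nat
  assumes z: "1 \<le> z" and q: "0 \<le> q" "q \<le> 2 * z ^ 8" and N: "0 \<le> N" "N \<le> 2 * z ^ (4 * m)"
    and \<xi>: "\<xi> = 2 * z ^ D / z ^ (2 * m)" and \<tau>: "\<tau> = 1 / z ^ m" and \<zeta>: "0 \<le> \<zeta>" "\<zeta> \<le> 1 / z ^ X"
    and B: "0 \<le> B" "B \<le> 1 / z ^ X" and m: "s + 3 * D + 25 \<le> m" "5 * m \<le> X" and M: "0 \<le> M"
  shows "M * z ^ s * (N * (16 * (\<xi> * q) ^ 3 + (2 + q + q\<^sup>2) * B + q\<^sup>2 * (4 * \<zeta> + 3 * B))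
      + q\<^sup>2 * (4 * \<xi>\<^sup>2 * (N * \<tau> / 2 + (1 + N * (4 * (\<xi> * q) + 2 * B)) / (2 * \<tau>)))) \<le> 3400 * M / z"
proof -
  have z0: "0 < z" using z by simp
  have zp: "1 \<le> z ^ i" for i using z by simp
  have \<xi>0: "0 \<le> \<xi>" unfolding \<xi> using z0 by simp
  have \<tau>0: "0 < \<tau>" unfolding \<tau> using z0 by simp
  define \<theta> where "\<theta> = 1 / z ^ (s + 1)"
  have q2: "q\<^sup>2 \<le> 4 * z ^ 16" using power_mono[OF q(2,1), of 2] by (simp add: power_mult_distrib flip: power_mult)
  have \<xi>q: "\<xi> * q \<le> 4 * (z ^ (D + 8) / z ^ (2 * m))"
  proof -
    have "\<xi> * q \<le> \<xi> * (2 * z ^ 8)" using q \<xi>0 by (intro mult_left_mono) auto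
    also have "\<dots> = 4 * (z ^ (D + 8) / z ^ (2 * m))" unfolding \<xi> power_add by simp
    finally show ?thesis .
  qed
  have \<xi>2: "\<xi>\<^sup>2 = 4 * (z ^ (2 * D) / z ^ (4 * m))"
    unfolding \<xi> by (simp add: power_divide power_mult_distrib power_mult[symmetric] mult.commute)
  define x where "x = \<xi> * q"
  have x: "0 \<le> x" "x \<le> 4 * (z ^ (D + 8) / z ^ (2 * m))" using \<xi>q \<xi>0 q by (simp_all add: x_def)
  have T1: "N * (16 * x ^ 3) \<le> 2048 * \<theta>"
  proof -
    have "N * (16 * x ^ 3) \<le> (2 * z ^ (4 * m)) * (16 * (4 * (z ^ (D + 8) / z ^ (2 * m))) ^ 3)"
      using N x z0 by (intro mult_mono power_mono) auto
    also have "\<dots> = 2048 * (z ^ (4 * m) * z ^ (3 * D + 24) / z ^ (6 * m))"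
      by (simp add: power_mult_distrib power_divide power_mult[symmetric] algebra_simps)
    also have "\<dots> = 2048 * (z ^ (4 * m + (3 * D + 24)) / z ^ (6 * m))" by (simp only: power_add)
    also have "\<dots> \<le> 2048 * (1 / z ^ (s + 1))" using m z by (intro mult_left_mono power_ratio_le) auto
    finally show ?thesis by (simp add: \<theta>_def)
  qed
  have big: "z ^ (4 * m) * z ^ 16 * (1 / z ^ X) \<le> \<theta>"
  proof -
    have "z ^ (4 * m) * z ^ 16 * (1 / z ^ X) = z ^ (4 * m + 16) / z ^ X" by (simp add: power_add)
    also have "\<dots> \<le> 1 / z ^ (s + 1)" using m z by (intro power_ratio_le) auto
    finally show ?thesis by (simp add: \<theta>_def)
  qed
  have T2: "N * ((2 + q + q\<^sup>2) * B) \<le> 16 * \<theta>"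
  proof -
    have "z ^ 8 \<le> z ^ 16" using z by (intro power_increasing) auto
    then have "2 + q + q\<^sup>2 \<le> 8 * z ^ 16" using q(2) q2 zp[of 16] by linarith
    then have "N * ((2 + q + q\<^sup>2) * B) \<le> (2 * z ^ (4 * m)) * ((8 * z ^ 16) * (1 / z ^ X))"
      using N B q z0 by (intro mult_mono) auto
    also have "\<dots> = 16 * (z ^ (4 * m) * z ^ 16 * (1 / z ^ X))" by simp
    finally show ?thesis using big by linarith
  qed
  have T3: "N * (q\<^sup>2 * (4 * \<zeta> + 3 * B)) \<le> 56 * \<theta>"
  proof -
    have "4 * \<zeta> + 3 * B \<le> 7 * (1 / z ^ X)" using \<zeta> B by linarith
    then have "N * (q\<^sup>2 * (4 * \<zeta> + 3 * B)) \<le> (2 * z ^ (4 * m)) * ((4 * z ^ 16) * (7 * (1 / z ^ X)))"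
      using N B \<zeta> q2 z0 by (intro mult_mono) auto
    also have "\<dots> = 56 * (z ^ (4 * m) * z ^ 16 * (1 / z ^ X))" by simp
    finally show ?thesis using big by linarith
  qed
  define u where "u = q\<^sup>2 * (4 * \<xi>\<^sup>2)"
  have u0: "0 \<le> u" by (simp add: u_def)
  have ub: "u \<le> 64 * (z ^ (2 * D + 16) / z ^ (4 * m))"
  proof -
    have "u \<le> (4 * z ^ 16) * (4 * \<xi>\<^sup>2)" unfolding u_def using q2 by (intro mult_right_mono) auto
    also have "\<dots> = 64 * (z ^ (2 * D + 16) / z ^ (4 * m))" unfolding \<xi>2 power_add by simp
    finally show ?thesis .
  qed
  have T4: "u * (N * \<tau> / 2) \<le> 64 * \<theta>"
  proof -
    have "u * (N * \<tau> / 2) \<le> (64 * (z ^ (2 * D + 16) / z ^ (4 * m))) * ((2 * z ^ (4 * m)) * \<tau> / 2)"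
      using u0 ub N \<tau>0 z0 by (intro mult_mono divide_right_mono) auto
    also have "\<dots> = 64 * (z ^ (2 * D + 16) / z ^ m)" using z0 by (simp add: \<tau>)
    also have "\<dots> \<le> 64 * (1 / z ^ (s + 1))" using m z by (intro mult_left_mono power_ratio_le) auto
    finally show ?thesis by (simp add: \<theta>_def)
  qed
  have T5: "u * ((1 + N * (4 * x + 2 * B)) / (2 * \<tau>)) \<le> 1216 * \<theta>"
  proof -
    have "N * (4 * x) \<le> (2 * z ^ (4 * m)) * (4 * (4 * (z ^ (D + 8) / z ^ (2 * m))))"
      using N x z0 by (intro mult_mono) auto
    also have "\<dots> = 32 * z ^ (2 * m + D + 8)"
    proof -
      have "z ^ (4 * m) = z ^ (2 * m) * z ^ (2 * m)" by (simp flip: power_add)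
      then show ?thesis using z0 by (simp add: power_add)
    qed
    finally have a: "N * (4 * x) \<le> 32 * z ^ (2 * m + D + 8)" .
    have "N * (2 * B) \<le> (2 * z ^ (4 * m)) * (2 * (1 / z ^ X))" using N B z0 by (intro mult_mono) auto
    also have "\<dots> = 4 * (z ^ (4 * m) / z ^ X)" by simp
    also have "\<dots> \<le> 4 * (1 / z ^ 0)" using m z by (intro mult_left_mono power_ratio_le) auto
    finally have "1 + N * (4 * x + 2 * B) \<le> 38 * z ^ (2 * m + D + 8)"
      using a zp[of "2 * m + D + 8"] unfolding distrib_left power_0 div_by_1 mult_1_right by linarith
    then have "(1 + N * (4 * x + 2 * B)) / (2 * \<tau>) \<le> 38 * z ^ (2 * m + D + 8) / (2 * \<tau>)"
      using \<tau>0 by (intro divide_right_mono) auto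
    also have "\<dots> = 19 * (z ^ (2 * m + D + 8) * z ^ m)" by (simp add: \<tau>)
    also have "z ^ (2 * m + D + 8) * z ^ m = z ^ (3 * m + D + 8)"
      unfolding power_add[symmetric] by (simp add: algebra_simps)
    finally have b: "(1 + N * (4 * x + 2 * B)) / (2 * \<tau>) \<le> 19 * z ^ (3 * m + D + 8)" .
    have "u * ((1 + N * (4 * x + 2 * B)) / (2 * \<tau>))
      \<le> (64 * (z ^ (2 * D + 16) / z ^ (4 * m))) * (19 * z ^ (3 * m + D + 8))"
      using u0 ub b N B x \<tau>0 z0 by (intro mult_mono) auto
    also have "\<dots> = 1216 * (z ^ ((2 * D + 16) + (3 * m + D + 8)) / z ^ (4 * m))"
      unfolding power_add[of z "2 * D + 16"] by simp
    also have "\<dots> = 1216 * (z ^ (3 * m + 3 * D + 24) / z ^ (4 * m))"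
      by (rule arg_cong[where f = "\<lambda>i. 1216 * (z ^ i / z ^ (4 * m))"]) simp
    also have "\<dots> \<le> 1216 * (1 / z ^ (s + 1))" using m z by (intro mult_left_mono power_ratio_le) auto
    finally show ?thesis by (simp add: \<theta>_def)
  qed
  have sum: "N * (16 * (\<xi> * q) ^ 3 + (2 + q + q\<^sup>2) * B + q\<^sup>2 * (4 * \<zeta> + 3 * B))
      + q\<^sup>2 * (4 * \<xi>\<^sup>2 * (N * \<tau> / 2 + (1 + N * (4 * (\<xi> * q) + 2 * B)) / (2 * \<tau>))) \<le> 3400 * \<theta>"
  proof -
    have "N * (16 * (\<xi> * q) ^ 3 + (2 + q + q\<^sup>2) * B + q\<^sup>2 * (4 * \<zeta> + 3 * B))
      + q\<^sup>2 * (4 * \<xi>\<^sup>2 * (N * \<tau> / 2 + (1 + N * (4 * (\<xi> * q) + 2 * B)) / (2 * \<tau>))) =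
      N * (16 * (\<xi> * q) ^ 3) + N * ((2 + q + q\<^sup>2) * B) + N * (q\<^sup>2 * (4 * \<zeta> + 3 * B))
      + q\<^sup>2 * (4 * \<xi>\<^sup>2) * (N * \<tau> / 2) + q\<^sup>2 * (4 * \<xi>\<^sup>2) * ((1 + N * (4 * (\<xi> * q) + 2 * B)) / (2 * \<tau>))"
      by (simp only: distrib_left mult.assoc add.assoc)
    moreover have "0 \<le> \<theta>" using z0 by (simp add: \<theta>_def)
    ultimately show ?thesis using T1 T2 T3 T4 T5 unfolding x_def u_def by linarith
  qed
  have "M * z ^ s * (N * (16 * (\<xi> * q) ^ 3 + (2 + q + q\<^sup>2) * B + q\<^sup>2 * (4 * \<zeta> + 3 * B))
      + q\<^sup>2 * (4 * \<xi>\<^sup>2 * (N * \<tau> / 2 + (1 + N * (4 * (\<xi> * q) + 2 * B)) / (2 * \<tau>)))) \<le> M * z ^ s * (3400 * \<theta>)"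
    using M z0 by (intro mult_left_mono[OF sum]) auto
  also have "\<dots> = 3400 * M / z" using z0 by (simp add: \<theta>_def)
  finally show ?thesis .
qed

text \<open>\<open>6 * z\<^sup>2\<close> will be the logarithm of the second moment bound of the
  tilt, and \<open>z ^ 4 / 2\<close> is \<open>l\<^sup>2 / 2\<close> for
  \<open>l = z\<^sup>2\<close>, the rarity of bad events. The power of \<open>z\<close> collects all
  polynomial losses.\<close>

lemma exp_beats_power:
  fixes b :: real
  shows "\<exists>z0\<ge>1. \<forall>z\<ge>z0. z ^ i * b * exp (6 * z\<^sup>2 - z ^ 4 / 2) \<le> 1"
proof -
  have "((\<lambda>z::real. \<bar>b\<bar> * (z ^ i / exp z)) \<longlongrightarrow> \<bar>b\<bar> * 0) at_top"
    by (intro tendsto_mult_left tendsto_power_div_exp_0)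
  then have "\<forall>\<^sub>F z::real in at_top. \<bar>b\<bar> * (z ^ i / exp z) < 1" by (rule order_tendstoD) simp
  then obtain y where y: "\<And>z. y \<le> z \<Longrightarrow> \<bar>b\<bar> * (z ^ i / exp z) < 1" unfolding eventually_at_top_linorder by blast
  show ?thesis
  proof (intro exI[of _ "max 4 y"] conjI allI impI)
    fix z :: real assume z: "max 4 y \<le> z"
    have "16 \<le> z\<^sup>2" using z power_mono[of 4 z 2] by simp
    moreover have "z ^ 4 = z\<^sup>2 * z\<^sup>2" by (simp flip: power_add)
    ultimately have "16 * z\<^sup>2 \<le> z ^ 4" by (metis mult_right_mono zero_le_power2)
    moreover have "z * 1 \<le> z\<^sup>2" unfolding power2_eq_square using z by (intro mult_left_mono) auto
    moreover have "0 \<le> z\<^sup>2" by simp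
    ultimately have "6 * z\<^sup>2 - z ^ 4 / 2 \<le> - z" by linarith
    then have "z ^ i * b * exp (6 * z\<^sup>2 - z ^ 4 / 2) \<le> z ^ i * \<bar>b\<bar> * exp (- z)"
      using z by (intro mult_mono[OF mult_left_mono]) auto
    also have "\<dots> = \<bar>b\<bar> * (z ^ i / exp z)" by (simp add: exp_minus field_simps)
    also have "\<dots> \<le> 1" using y[of z] z by simp
    finally show "z ^ i * b * exp (6 * z\<^sup>2 - z ^ 4 / 2) \<le> 1" .
  qed simp
qed

lemma powr_gain:
  fixes z :: real
  assumes "1 \<le> z" "z ^ Y = K" "real G \<le> real Y * g" "1 \<le> d"
  shows "K powr (real d - 1 - g) \<le> K ^ (d - 1) / z ^ G"
proof -
  have K: "0 < K" using assms by auto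
  have "z ^ G = z powr real G" using assms by (simp add: powr_realpow)
  also have "\<dots> \<le> z powr (real Y * g)" using assms by (intro powr_mono) auto
  also have "\<dots> = K powr g" using assms(1) unfolding assms(2)[symmetric] by (simp add: powr_powr flip: powr_realpow)
  finally have "z ^ G \<le> K powr g" .
  then have "K ^ (d - 1) / K powr g \<le> K ^ (d - 1) / z ^ G" using assms(1) K by (intro divide_left_mono) auto
  moreover have "K powr (real d - 1 - g) = K ^ (d - 1) / K powr g"
    using K assms(4) by (simp add: powr_diff of_nat_diff flip: powr_realpow)
  ultimately show ?thesis by simp
qed

lemma hsys_sgn:
  assumes "hsys d n h"
  shows "rsys d n (\<lambda>r w. sgn (h r w))"
  unfolding rsys_def
proof (intro ballI conjI allI impI)
  fix r j assume r: "r \<in> idx d n (\<lambda>_. UNIV)" and j: "j < d"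
  have o: "odd_at (j, r j) (h r)" and i: "r j < i \<Longrightarrow> inv_at (j, i) (h r)" for i
    using assms idx_levels[OF r] j by (auto simp: hsys_def)
  show "odd_at (j, r j) (\<lambda>w. sgn (h r w))" using o by (simp add: odd_at_def sgn_minus)
  fix i assume "r j < i" then show "inv_at (j, i) (\<lambda>w. sgn (h r w))" using i by (intro inv_comp1[where g = sgn])
qed (simp add: abs_sgn_eq)

lemma card_idx_le_power:
  assumes "0 < d" "\<And>j. I j \<subseteq> {..n}"
  shows "real (card (idx d n I)) \<le> (real n + 1) ^ d"
proof -
  have "card (idx d n I) \<le> (\<Prod>j\<in>{..<d} - {0}. card (I j))"
    using assms by (intro card_idx) (auto intro: finite_subset)
  also have "\<dots> \<le> (\<Prod>j\<in>{..<d} - {0}. n + 1)"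
    using card_mono[OF _ assms(2)] by (intro prod_mono) auto
  also have "\<dots> = (n + 1) ^ (d - 1)" using assms(1) by simp
  also have "\<dots> \<le> (n + 1) ^ d" by (intro power_increasing) auto
  finally have "real (card (idx d n I)) \<le> real ((n + 1) ^ d)" by (simp only: of_nat_le_iff)
  then show ?thesis by (simp add: add.commute)
qed

lemma psum_crude:
  assumes f: "rsys d n f" and c: "c < d" and I: "\<And>j. I j \<subseteq> {..n}" "\<And>j. I' j \<subseteq> {..n}"
  shows "\<bar>psum d n f {c} I I' w\<bar> \<le> (real n + 1) * ((real n + 1) ^ d * (real n + 1) ^ d)"
proof -
  have le: "\<bar>hsum d n f (fx {c} e J) w\<bar> \<le> (real n + 1) ^ d" if "\<And>j. J j \<subseteq> {..n}" for e J
  proof -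
    have "fx {c} e J j \<subseteq> {..n}" for j using that[of j] by (auto simp: fx_def)
    then have "real (card (idx d n (fx {c} e J))) \<le> (real n + 1) ^ d" using c by (intro card_idx_le_power) auto
    then show ?thesis using hsum_le_card[OF f, of "fx {c} e J" w] by linarith
  qed
  have "\<bar>psum d n f {c} I I' w\<bar> \<le> (\<Sum>e\<in>PiE {c} (\<lambda>_. {..n}). \<bar>hsum d n f (fx {c} e I) w\<bar> * \<bar>hsum d n f (fx {c} e I') w\<bar>)"
    unfolding psum_def abs_mult[symmetric] by (rule sum_abs)
  also have "\<dots> \<le> (\<Sum>e\<in>PiE {c} (\<lambda>_. {..n}). (real n + 1) ^ d * (real n + 1) ^ d)"
    using le[of I] le[of I'] I by (intro sum_mono mult_mono) auto
  also have "\<dots> = (real n + 1) * ((real n + 1) ^ d * (real n + 1) ^ d)" by (simp add: card_PiE add.commute)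
  finally show ?thesis .
qed

text \<open>All parameters are powers of \<open>z\<close>, which is \<open>n + 1\<close> to a small power \<open>1 / Y\<close>. The coordinate \<open>c\<close> is cut
  into \<open>z ^ (4 * m c)\<close> blocks. As errors accumulate over the coordinates, \<open>m c\<close> has to dominate the
  sum of the previous ones.\<close>

lemma mass_bound_large:
  fixes z :: real and m :: "nat \<Rightarrow> nat"
  assumes d: "3 \<le> d" and diag: "diag_bound d (d - 1) C a k g" and beck: "beck_bound d C' a' k' g'"
    and m: "\<And>c. 1 \<le> c \<Longrightarrow> c < d \<Longrightarrow> (\<Sum>j\<in>{1..<c}. 8 + 4 * m j) + 3 * (2 * d - 1) + 25 \<le> m c"
      "\<And>c. 1 \<le> c \<Longrightarrow> c < d \<Longrightarrow> 5 * m c \<le> X" "\<And>c. 1 \<le> c \<Longrightarrow> c < d \<Longrightarrow> 4 * m c \<le> Y" and Y: "8 \<le> Y"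
    and G: "real (2 * a + 9) \<le> Y * g" "real (X + 2 * a' + 3) \<le> Y * g'"
    and kk: "k + 3 \<le> kk" "2 * d \<le> kk" "k' \<le> kk"
    and z: "16 \<le> z" "C \<le> z" "C' \<le> z" "3400 * 4 ^ d * d \<le> z" "z ^ Y = real n + 1"
      "z ^ (2 * (X + Y * (d + 1) * d) + Y * (kk + 5)) * 2 ^ (kk + 6) * exp (6 * z\<^sup>2 - z ^ 4 / 2) \<le> 1"
    and C: "0 \<le> C" "0 \<le> C'"
    and h: "hsys d n h" "\<And>w. \<bar>\<Sum>v\<in>levels d n. h v w\<bar> \<le> 1"
  shows "(\<Sum>r\<in>idx d n (\<lambda>_. UNIV). avg (digits d n) (\<lambda>w. \<bar>h r w\<bar>)) \<le> 2 * sqrt ((real n + 1) ^ (d - 1)) / z"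
proof -
  define K where "K = real n + 1"
  define KD where "KD = K ^ (d - 1)"
  define \<rho> where "\<rho> = z / sqrt KD"
  \<comment> \<open>Two of the three parts bound the number of indices in a slab of length at most
    \<open>2 * (K / z ^ 8)\<close>, the third bounds the error of \<open>diag_bound\<close>.\<close>
  define Q where "Q = 3 * KD / z ^ 8"
  define l where "l = z\<^sup>2"
  define f where "f r w = sgn (h r w)" for r w
  \<comment> \<open>\<open>\<rho>\<close> contributes one \<open>z\<close>, the cancellation in
    \<open>d - 1\<close> coordinates contributes \<open>l ^ (d - 1) = z ^ (2 * (d - 1))\<close>, and
    a block, being about the fraction \<open>1 / z ^ (4 * m c)\<close> of its coordinate, enters
    under a square root.\<close>
  define \<xi> where "\<xi> c = 2 * z ^ (2 * d - 1) / z ^ (2 * m c)" for c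
  define \<tau> where "\<tau> c = 1 / z ^ m c" for c
  define \<zeta> where "\<zeta> = 1 / z ^ X"
  \<comment> \<open>A crude sure bound; it acts off the good events, where the superpolynomially
    small probability absorbs it.\<close>
  define \<Gamma> where "\<Gamma> = K ^ (d + 1)"
  have z1: "1 \<le> z" and z0: "0 < z" using z by auto
  have K1: "1 \<le> K" by (simp add: K_def)
  have Kz: "z ^ Y = K" using z by (simp add: K_def)
  have KD: "0 < KD" using K1 by (simp add: KD_def)
  have KD': "KD = K * K ^ (d - 2)"
  proof -
    have "d - 1 = Suc (d - 2)" using d by simp
    then show ?thesis by (simp add: KD_def)
  qed
  have f: "rsys d n f" unfolding f_def[abs_def] using h(1) by (rule hsys_sgn)
  have \<rho>0: "0 < \<rho>" using z0 KD by (simp add: \<rho>_def)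
  have \<rho>2: "\<rho>\<^sup>2 = z\<^sup>2 / KD" using KD by (simp add: \<rho>_def power_divide)
  have \<rho>1: "\<rho> \<le> 1"
  proof -
    have "z\<^sup>2 \<le> z ^ Y" using z1 Y by (intro power_increasing) auto
    also have "\<dots> = K ^ 1" using Kz by simp
    also have "\<dots> \<le> KD" unfolding KD_def using K1 d by (intro power_increasing) auto
    finally have "z \<le> sqrt KD" using z0 by (intro real_le_rsqrt) auto
    then show ?thesis using KD by (simp add: \<rho>_def)
  qed
  have l: "1 \<le> l" using z1 by (simp add: l_def)
  have Q0: "0 \<le> Q" using KD z0 by (simp add: Q_def)
  have \<rho>2Q: "\<rho>\<^sup>2 * Q = 3 / z ^ 6"
  proof -
    have "z ^ 8 = z\<^sup>2 * z ^ 6" by (simp flip: power_add)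
    moreover have "z\<^sup>2 / KD * (3 * KD / (z\<^sup>2 * y)) = 3 / y" for y using KD z0 by simp
    ultimately show ?thesis by (simp only: \<rho>2 Q_def)
  qed
  have half: "\<rho> * (l * sqrt Q + sqrt Q) \<le> 1 / 2"
  proof -
    have "\<rho> * sqrt Q = sqrt (\<rho>\<^sup>2 * Q)" using \<rho>0 by (simp add: real_sqrt_mult)
    also have "\<dots> \<le> 2 / z ^ 3"
    proof (rule real_le_lsqrt)
      have "(2 / z ^ 3)\<^sup>2 = 4 / z ^ 6" by (simp add: power_divide flip: power_mult)
      then show "\<rho>\<^sup>2 * Q \<le> (2 / z ^ 3)\<^sup>2" unfolding \<rho>2Q using z0 by (simp add: divide_right_mono)
    qed (use z0 in auto)
    finally have "(l + 1) * (\<rho> * sqrt Q) \<le> (2 * l) * (2 / z ^ 3)" using l \<rho>0 Q0 by (intro mult_mono) auto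
    also have "\<dots> = 4 / z" using z0 by (simp add: l_def power2_eq_square power3_eq_cube)
    also have "\<dots> \<le> 1 / 2" using z by (simp add: field_simps)
    finally show ?thesis by (simp add: algebra_simps)
  qed
  obtain L :: nat where L: "1 \<le> L" "L \<le> 2 * (K / z ^ 8)" "n div L + 1 \<le> 2 * z ^ 8"
    using block_length_power[OF z1 z(5), of 8] Y Kz by auto
  have "\<exists>L::nat. 1 \<le> L \<and> L \<le> 2 * (K / z ^ (4 * m c)) \<and> n div L + 1 \<le> 2 * z ^ (4 * m c)" if "1 \<le> c" "c < d" for c
    using block_length_power[OF z1 z(5) m(3)[OF that]] Y Kz by auto
  then obtain Ls where Ls: "\<And>c. 1 \<le> c \<Longrightarrow> c < d \<Longrightarrow> 1 \<le> (Ls c :: nat)"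
    "\<And>c. 1 \<le> c \<Longrightarrow> c < d \<Longrightarrow> Ls c \<le> 2 * (K / z ^ (4 * m c))"
    "\<And>c. 1 \<le> c \<Longrightarrow> c < d \<Longrightarrow> n div Ls c + 1 \<le> 2 * z ^ (4 * m c)" by metis
  have qbig: "4 * (\<xi> c * (n div L + 1)) \<le> 1" if c: "1 \<le> c" "c < d" for c
  proof -
    have "4 * (\<xi> c * (n div L + 1)) \<le> 4 * (\<xi> c * (2 * z ^ 8))"
      using L(3) z0 by (intro mult_left_mono) (auto simp: \<xi>_def)
    also have "\<dots> = 16 * (z ^ (2 * d - 1 + 8) / z ^ (2 * m c))" by (simp add: \<xi>_def power_add)
    also have "\<dots> \<le> 16 * (1 / z ^ 1)" using m(1)[OF c] z1 by (intro mult_left_mono power_ratio_le) auto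
    also have "\<dots> \<le> 1" using z by simp
    finally show ?thesis .
  qed
  interpret R: staged d n f \<rho> "l * sqrt Q" Q L h Ls \<xi> \<tau> \<zeta> \<Gamma> l kk
  proof
    show "rsys d n f" by (rule f)
    show "3 \<le> d" by (rule d)
    show "0 \<le> \<rho>" using \<rho>0 by simp
    show "0 \<le> l * sqrt Q" using l Q0 by simp
    show "0 \<le> Q" by (rule Q0)
    show "\<rho> * (l * sqrt Q + sqrt Q) \<le> 1 / 2" by (rule half)
    show "hsys d n h" by (rule h)
    show "f r w = sgn (h r w)" for r w by (simp add: f_def)
    show "\<bar>\<Sum>v\<in>levels d n. h v w\<bar> \<le> 1" for w by (rule h)
    show "1 \<le> L" by (rule L)
    show "1 \<le> Ls c" if "1 \<le> c" "c < d" for c using Ls that by simp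
    show "wop d n l kk (tame d n f (l * sqrt Q) Q I)" if I: "\<And>j. I j \<subseteq> {..n}" "card (I 0) \<le> L" for I
    proof -
      have "L * (real n + 1) ^ (d - 2) \<le> 2 * (K / z ^ 8) * K ^ (d - 2)"
        unfolding K_def[symmetric] using L(2) K1 by (intro mult_right_mono) auto
      also have "\<dots> = 2 * (KD / z ^ 8)" by (simp add: KD')
      finally have 1: "L * (real n + 1) ^ (d - 2) \<le> 2 * (KD / z ^ 8)" .
      have "C * l ^ a * (real n + 1) powr (real d - 1 - g) \<le> z * (z ^ (2 * a)) * (KD / z ^ (2 * a + 9))"
      proof (intro mult_mono)
        show "(real n + 1) powr (real d - 1 - g) \<le> KD / z ^ (2 * a + 9)"
          unfolding KD_def K_def[symmetric] using z1 Kz G(1) d by (intro powr_gain) auto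
      qed (use z C z0 in \<open>auto simp: l_def power_mult\<close>)
      also have "\<dots> = KD * (z ^ (2 * a + 1) / z ^ (2 * a + 9))" by simp
      also have "\<dots> \<le> KD * (1 / z ^ 8)" using KD z1 by (intro mult_left_mono power_ratio_le) auto
      finally have 2: "C * l ^ a * (real n + 1) powr (real d - 1 - g) \<le> KD / z ^ 8" by simp
      have "Q = 2 * (KD / z ^ 8) + KD / z ^ 8" by (simp add: Q_def)
      then have "L * (real n + 1) ^ (d - 2) + C * l ^ a * (real n + 1) powr (real d - 1 - g) \<le> Q" using 1 2 by linarith
      then have "wop d n l (k + 3) (tame d n f (l * sqrt Q) Q I)"
        using I d Q0 l f by (intro tame_wop[OF diag]) auto
      then show ?thesis by (rule wop_mono) (use kk in auto)
    qed
    show "wop d n l kk (\<lambda>w. \<bar>\<rho> * hsum d n f I w\<bar> \<le> \<xi> c)"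
      if c: "1 \<le> c" "c < d" and I: "\<And>j. I j \<subseteq> {..n}" "card (I c) \<le> Ls c" for c I
    proof -
      have "wop d n l (2 * card {1..<d}) (\<lambda>w. \<bar>hsum d n f I w\<bar> \<le> l ^ card {1..<d} * sqrt (Ls c * (real n + 1) ^ (card {1..<d} - 1)))"
        using c I d l by (intro hsum_bound_short[OF f, where c = 0 and a = c]) auto
      then show ?thesis
      proof (rule wop_mono)
        show "2 * card {1..<d} \<le> kk" using kk by simp
        fix w assume "\<bar>hsum d n f I w\<bar> \<le> l ^ card {1..<d} * sqrt (Ls c * (real n + 1) ^ (card {1..<d} - 1))"
        then have le: "\<bar>hsum d n f I w\<bar> \<le> l ^ (d - 1) * sqrt (Ls c * K ^ (d - 2))"
          using d by (simp add: K_def numeral_2_eq_2)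
        have "Ls c * K ^ (d - 2) \<le> 2 * (K / z ^ (4 * m c)) * K ^ (d - 2)"
          using Ls(2)[OF c] K1 by (intro mult_right_mono) auto
        also have "\<dots> = 2 * (KD / z ^ (4 * m c))" by (simp add: KD')
        also have "\<dots> \<le> 4 * (KD / z ^ (4 * m c))" using KD z0 by (intro mult_right_mono) auto
        also have "\<dots> = (2 * (sqrt KD / z ^ (2 * m c)))\<^sup>2"
          using KD by (simp add: power_mult_distrib power_divide mult.commute flip: power_mult)
        finally have "sqrt (Ls c * K ^ (d - 2)) \<le> 2 * (sqrt KD / z ^ (2 * m c))"
          using KD z0 by (intro real_le_lsqrt) auto
        then have "\<bar>hsum d n f I w\<bar> \<le> l ^ (d - 1) * (2 * (sqrt KD / z ^ (2 * m c)))"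
          using le l by (meson mult_left_mono order_trans zero_le_one zero_le_power)
        then have "\<rho> * \<bar>hsum d n f I w\<bar> \<le> \<rho> * (l ^ (d - 1) * (2 * (sqrt KD / z ^ (2 * m c))))"
          using \<rho>0 by (intro mult_left_mono) auto
        also have "\<dots> = 2 * (z * l ^ (d - 1)) / z ^ (2 * m c)" using KD by (simp add: \<rho>_def)
        also have "z * l ^ (d - 1) = z ^ (2 * d - 1)"
        proof -
          have "z * l ^ (d - 1) = z ^ Suc (2 * (d - 1))" by (simp add: l_def power_mult)
          also have "Suc (2 * (d - 1)) = 2 * d - 1" using d by simp
          finally show ?thesis .
        qed
        finally show "\<bar>\<rho> * hsum d n f I w\<bar> \<le> \<xi> c" using \<rho>0 by (simp add: \<xi>_def abs_mult)
      qed
    qed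
    show "wop d n l kk (\<lambda>w. \<bar>\<rho>\<^sup>2 * psum d n f {c} I I' w\<bar> \<le> \<zeta>)"
      if c: "1 \<le> c" "c < d" and I: "\<And>j. I j \<subseteq> {..n}" "\<And>j. I' j \<subseteq> {..n}" "I 0 \<inter> I' 0 = {}" for c I I'
    proof -
      have "wop d n l k' (\<lambda>w. \<bar>psum d n f {c} I I' w\<bar> \<le> C' * l ^ a' * (real n + 1) powr (real d - 1 - g'))"
        using c I f l by (intro beck_boundD[OF beck]) auto
      then show ?thesis
      proof (rule wop_mono)
        fix w assume le: "\<bar>psum d n f {c} I I' w\<bar> \<le> C' * l ^ a' * (real n + 1) powr (real d - 1 - g')"
        have "C' * l ^ a' * (real n + 1) powr (real d - 1 - g') \<le> z * (z ^ (2 * a')) * (KD / z ^ (X + 2 * a' + 3))"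
        proof (intro mult_mono)
          show "(real n + 1) powr (real d - 1 - g') \<le> KD / z ^ (X + 2 * a' + 3)"
            unfolding KD_def K_def[symmetric] using z1 Kz G(2) d by (intro powr_gain) auto
        qed (use z C z0 in \<open>auto simp: l_def power_mult\<close>)
        also have "\<dots> = KD * (z ^ (2 * a' + 1) / z ^ (X + 2 * a' + 3))" by simp
        also have "\<dots> \<le> KD * (1 / z ^ (X + 2))" using KD z1 by (intro mult_left_mono power_ratio_le) auto
        finally have "\<bar>psum d n f {c} I I' w\<bar> \<le> KD * (1 / z ^ (X + 2))" using le by linarith
        then have "\<rho>\<^sup>2 * \<bar>psum d n f {c} I I' w\<bar> \<le> \<rho>\<^sup>2 * (KD * (1 / z ^ (X + 2)))" by (intro mult_left_mono) auto
        also have "\<dots> = \<zeta>"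
        proof -
          have "z\<^sup>2 / KD * (KD * (1 / (y * z\<^sup>2))) = 1 / y" for y using KD z0 by simp
          then show ?thesis unfolding \<rho>2 \<zeta>_def power_add .
        qed
        finally show "\<bar>\<rho>\<^sup>2 * psum d n f {c} I I' w\<bar> \<le> \<zeta>" by (simp add: abs_mult)
      qed (rule kk)
    qed
    show "1 \<le> \<Gamma>" unfolding \<Gamma>_def using K1 by (rule one_le_power)
    show "\<bar>\<rho> * hsum d n f I w\<bar> \<le> \<Gamma>" if I: "\<forall>j. I j \<subseteq> {..n}" for I w
    proof -
      have "\<bar>hsum d n f I w\<bar> \<le> K ^ d"
        using hsum_le_card[OF f, of I w] card_idx_le_power[of d I n] I d unfolding K_def by fastforce
      then have "\<rho> * \<bar>hsum d n f I w\<bar> \<le> 1 * K ^ d" using \<rho>0 \<rho>1 by (intro mult_mono) auto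
      also have "\<dots> \<le> \<Gamma>" unfolding \<Gamma>_def mult_1 using K1 by (intro power_increasing) auto
      finally show ?thesis using \<rho>0 by (simp add: abs_mult)
    qed
    show "\<bar>\<rho>\<^sup>2 * psum d n f {c} I I' w\<bar> \<le> \<Gamma>\<^sup>2"
      if "1 \<le> c" "c < d" "\<forall>j. I j \<subseteq> {..n} \<and> I' j \<subseteq> {..n}" for c I I' w
    proof -
      have "\<bar>psum d n f {c} I I' w\<bar> \<le> K * (K ^ d * K ^ d)"
        unfolding K_def using that by (intro psum_crude[OF f]) auto
      moreover have "\<rho>\<^sup>2 \<le> 1" using \<rho>0 \<rho>1 by (simp add: power_le_one)
      ultimately have "\<rho>\<^sup>2 * \<bar>psum d n f {c} I I' w\<bar> \<le> 1 * (K * (K ^ d * K ^ d))" by (intro mult_mono) auto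
      also have "\<dots> = K ^ (2 * d + 1)" by (simp add: mult_2 power_add)
      also have "\<dots> \<le> K ^ (2 * (d + 1))" using K1 by (intro power_increasing) auto
      also have "\<dots> = \<Gamma>\<^sup>2" unfolding \<Gamma>_def by (simp only: power_mult[symmetric] mult.commute)
      finally show ?thesis by (simp add: abs_mult)
    qed
    show "4 * (\<xi> c * (n div L + 1)) \<le> 1" if "1 \<le> c" "c < d" for c using qbig[OF that] by simp
    show "0 \<le> \<xi> c" "0 < \<tau> c" for c using z0 by (auto simp: \<xi>_def \<tau>_def)
    show "0 \<le> \<zeta>" using z0 by (simp add: \<zeta>_def)
  qed
  have q: "real R.q \<le> 2 * z ^ 8" using L(3) by (simp add: R.q_def)
  have B: "R.B \<le> 1 / z ^ X"
  proof -
    \<comment> \<open>At most \<open>2 * z ^ 8\<close> slabs, each with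
      \<open>\<rho>\<^sup>2 * Q = 3 / z ^ 6\<close>.\<close>
    have e: "(1 + \<rho>\<^sup>2 * Q) ^ R.q \<le> exp (6 * z\<^sup>2)"
    proof -
      have "(1 + \<rho>\<^sup>2 * Q) ^ R.q \<le> exp (\<rho>\<^sup>2 * Q) ^ R.q" using Q0 exp_ge_add_one_self[of "\<rho>\<^sup>2 * Q"] by (intro power_mono) auto
      also have "\<dots> = exp (real R.q * (3 / z ^ 6))" unfolding \<rho>2Q by (rule exp_of_nat_mult[symmetric])
      also have "\<dots> \<le> exp (2 * z ^ 8 * (3 / z ^ 6))" unfolding exp_le_cancel_iff using q z0 by (intro mult_right_mono) auto
      also have "2 * z ^ 8 * (3 / z ^ 6) = 6 * z\<^sup>2"
      proof -
        have "z ^ 8 = z\<^sup>2 * z ^ 6" by (simp flip: power_add)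
        moreover have "2 * (z\<^sup>2 * y) * (3 / y) = 6 * z\<^sup>2" if "0 < y" for y using that by simp
        ultimately show ?thesis using z0 by (simp only: zero_less_power)
      qed
      finally show ?thesis .
    qed
    have "real n + 2 \<le> 2 * z ^ Y" using z(5) by simp
    then have "(real n + 2) ^ (kk + 5) \<le> (2 * z ^ Y) ^ (kk + 5)" by (intro power_mono) auto
    also have "\<dots> = 2 ^ (kk + 5) * z ^ (Y * (kk + 5))" by (simp only: power_mult_distrib power_mult)
    finally have "R.p \<le> 2 ^ (kk + 5) * z ^ (Y * (kk + 5)) * (2 * exp (- l\<^sup>2 / 2))"
      unfolding R.p_def by (intro mult_right_mono) auto
    then have "R.p * (1 + \<rho>\<^sup>2 * Q) ^ R.q \<le> 2 ^ (kk + 5) * z ^ (Y * (kk + 5)) * (2 * exp (- l\<^sup>2 / 2)) * exp (6 * z\<^sup>2)"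
      using e R.p0 Q0 z0 by (intro mult_mono) auto
    also have "\<dots> = z ^ (Y * (kk + 5)) * 2 ^ (kk + 6) * (exp (6 * z\<^sup>2) * exp (- l\<^sup>2 / 2))"
    proof -
      have "(2::real) ^ (kk + 6) = 2 ^ (kk + 5) * 2" by (simp add: power_add)
      then show ?thesis by simp
    qed
    also have "exp (6 * z\<^sup>2) * exp (- l\<^sup>2 / 2) = exp (6 * z\<^sup>2 - z ^ 4 / 2)"
      by (simp add: exp_add[symmetric] l_def flip: power_mult)
    finally have le: "R.p * (1 + \<rho>\<^sup>2 * Q) ^ R.q \<le> z ^ (Y * (kk + 5)) * 2 ^ (kk + 6) * exp (6 * z\<^sup>2 - z ^ 4 / 2)" .
    \<comment> \<open>Chosen so that \<open>1 / z ^ X\<close> is left after the loss of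
      \<open>\<Gamma> ^ d = z ^ (Y * (d + 1) * d)\<close>.\<close>
    define P where "P = X + Y * (d + 1) * d"
    have "z ^ (2 * P) * (R.p * (1 + \<rho>\<^sup>2 * Q) ^ R.q) \<le> z ^ (2 * P) * (z ^ (Y * (kk + 5)) * 2 ^ (kk + 6) * exp (6 * z\<^sup>2 - z ^ 4 / 2))"
      using z0 by (intro mult_left_mono[OF le]) auto
    also have "\<dots> \<le> 1" using z(6) unfolding P_def[symmetric] power_add[of z "2 * P"] by (simp only: mult.assoc)
    finally have "R.p * (1 + \<rho>\<^sup>2 * Q) ^ R.q \<le> (1 / z ^ P)\<^sup>2"
      using z0 by (simp add: field_simps flip: power_mult)
    then have "sqrt (R.p * (1 + \<rho>\<^sup>2 * Q) ^ R.q) \<le> 1 / z ^ P"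
      using z0 R.p0 Q0 by (intro real_le_lsqrt) auto
    then have "R.B \<le> \<Gamma> ^ d * (1 / z ^ P)" unfolding R.B_def using K1 by (intro mult_left_mono) (auto simp: \<Gamma>_def)
    also have "\<Gamma> ^ d = z ^ (Y * (d + 1) * d)" unfolding \<Gamma>_def Kz[symmetric] by (simp only: power_mult)
    also have "z ^ (Y * (d + 1) * d) * (1 / z ^ P) = 1 / z ^ X" using z0 by (simp add: P_def power_add)
    finally show ?thesis .
  qed
  have small: "R.branches c * R.stage_error c \<le> 3400 * 4 ^ d / z" if c: "1 \<le> c" "c < d" for c
  proof -
    define s where "s = (\<Sum>j\<in>{1..<c}. 8 + 4 * m j)"
    have Nc: "real (R.Nc c) \<le> 2 * z ^ (4 * m c)" if "1 \<le> c" "c < d" for c using Ls(3)[OF that] by (simp add: R.Nc_def)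
    have "R.branches c \<le> (\<Prod>j\<in>{1..<c}. 4 * z ^ (8 + 4 * m j))"
      unfolding R.branches_def of_nat_prod
    proof (intro prod_mono conjI)
      fix j assume j: "j \<in> {1..<c}"
      have "real (R.q * R.Nc j) \<le> (2 * z ^ 8) * (2 * z ^ (4 * m j))"
        unfolding of_nat_mult using q Nc[of j] j c z0 by (intro mult_mono) auto
      then show "real (R.q * R.Nc j) \<le> 4 * z ^ (8 + 4 * m j)" by (simp add: power_add)
    qed simp
    also have "\<dots> = 4 ^ (c - 1) * z ^ s" by (simp add: prod.distrib s_def power_sum)
    also have "\<dots> \<le> 4 ^ d * z ^ s" using c z0 by (intro mult_right_mono power_increasing) auto
    finally have M: "R.branches c \<le> 4 ^ d * z ^ s" .
    have num: "4 ^ d * z ^ s * R.stage_error c \<le> 3400 * 4 ^ d / z"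
      unfolding R.stage_error_def of_nat_power of_nat_add of_nat_numeral
    proof (rule stage_numeric[where D = "2 * d - 1" and m = "m c" and X = X])
      show "\<xi> c = 2 * z ^ (2 * d - 1) / z ^ (2 * m c)" "\<tau> c = 1 / z ^ m c" "0 \<le> \<zeta>" "\<zeta> \<le> 1 / z ^ X"
        using z0 by (simp_all add: \<xi>_def \<tau>_def \<zeta>_def)
      show "s + 3 * (2 * d - 1) + 25 \<le> m c" "5 * m c \<le> X" using m c by (auto simp: s_def)
    qed (use z1 q Nc[OF c] B R.B0 in auto)
    have "0 \<le> R.stage_error c"
      unfolding R.stage_error_def using R.num(1)[OF c] R.num(2) R.num(4)[OF c] R.B0
      by (intro add_nonneg_nonneg mult_nonneg_nonneg divide_nonneg_nonneg) auto
    then have "R.branches c * R.stage_error c \<le> 4 ^ d * z ^ s * R.stage_error c" using M by (intro mult_right_mono) auto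
    then show ?thesis using num by linarith
  qed
  have "(\<Sum>c\<in>{1..<d}. R.branches c * R.stage_error c) \<le> (\<Sum>c\<in>{1..<d}. 3400 * 4 ^ d / z)" using small by (intro sum_mono) auto
  also have "\<dots> = real (d - 1) * (3400 * 4 ^ d / z)" by simp
  also have "\<dots> \<le> real d * (3400 * 4 ^ d / z)" using z0 by (intro mult_right_mono) auto
  also have "\<dots> \<le> 1" using z(4) z0 by (simp add: field_simps)
  finally have "\<rho> * R.mass (\<lambda>_. UNIV) \<le> 2" using R.total_mass by linarith
  then have "R.mass (\<lambda>_. UNIV) \<le> 2 / \<rho>" using \<rho>0 by (simp add: field_simps)
  also have "2 / \<rho> = 2 * sqrt KD / z" by (simp add: \<rho>_def)
  finally show ?thesis by (simp add: R.mass_def KD_def K_def)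
qed

text \<open>Testing against the single function \<open>sgn (h r)\<close> isolates
  \<open>h r\<close>: any other level lies below \<open>r\<close> in some coordinate, because its
  sum is at most \<open>n\<close>, and is killed by that digit. Counting the \<open>r\<close> loses
  a power of \<open>n + 1\<close>, which is a constant for the finitely many \<open>n\<close> that
  \<open>mass_bound_large\<close> does not reach.\<close>

lemma mass_bound_small:
  assumes d: "0 < d" and h: "hsys d n h" "\<And>w. \<bar>\<Sum>v\<in>levels d n. h v w\<bar> \<le> M"
  shows "(\<Sum>r\<in>idx d n (\<lambda>_. UNIV). avg (digits d n) (\<lambda>w. \<bar>h r w\<bar>)) \<le> (real n + 1) ^ d * M"
proof -
  have M: "0 \<le> M" using h(2)[of undefined] by linarith
  have "avg (digits d n) (\<lambda>w. \<bar>h r w\<bar>) \<le> M" if r: "r \<in> idx d n (\<lambda>_. UNIV)" for r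
  proof -
    have rl: "r \<in> levels d n" using r by (rule idx_levels)
    have z: "avg (digits d n) (\<lambda>w. h v w * sgn (h r w)) = 0" if v: "v \<in> levels d n" "v \<noteq> r" for v
    proof -
      have "\<exists>j<d. v j < r j"
      proof (rule ccontr)
        assume "\<not> ?thesis"
        then have le: "r j \<le> v j" if "j < d" for j using that by force
        obtain j where j: "v j \<noteq> r j" using v(2) by auto
        have "v j = r j" if "d \<le> j" using v(1) rl that by (simp add: levels_def)
        then have "j < d" using j by force
        then have "(\<Sum>j<d. r j) < (\<Sum>j<d. v j)"
          using le j by (intro sum_strict_mono_ex1) (auto intro!: bexI[of _ j] simp: order.strict_iff_order)
        then show False using v(1) r by (simp add: levels_def idx_def)
      qed
      then obtain j where j: "j < d" "v j < r j" by blast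
      have "inv_at (j, r j) (h v)" "odd_at (j, r j) (\<lambda>w. sgn (h r w))"
        using h(1) v(1) hsys_sgn[OF h(1)] r j by (auto simp: hsys_def rsys_def)
      moreover have "(j, r j) \<in> digits d n" using j idx_le[OF r j(1)] by (simp add: digits_def)
      ultimately show ?thesis by (intro avg_odd[of "(j, r j)"] inv_mult_odd)
    qed
    have "avg (digits d n) (\<lambda>w. \<bar>h r w\<bar>) = (\<Sum>v\<in>levels d n. if v = r then avg (digits d n) (\<lambda>w. \<bar>h r w\<bar>) else 0)"
      using rl by simp
    also have "\<dots> = (\<Sum>v\<in>levels d n. avg (digits d n) (\<lambda>w. h v w * sgn (h r w)))"
      using z by (intro sum.cong) (auto simp: abs_sgn)
    also have "\<dots> = avg (digits d n) (\<lambda>w. (\<Sum>v\<in>levels d n. h v w) * sgn (h r w))"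
      unfolding avg_sum[symmetric] sum_distrib_right ..
    also have "\<dots> \<le> avg (digits d n) (\<lambda>w. M)"
    proof (rule avg_mono)
      fix w
      have "\<bar>(\<Sum>v\<in>levels d n. h v w) * sgn (h r w)\<bar> \<le> M * 1"
        unfolding abs_mult using h(2)[of w] M by (intro mult_mono) (auto simp: abs_sgn_eq)
      then show "(\<Sum>v\<in>levels d n. h v w) * sgn (h r w) \<le> M" by linarith
    qed
    also have "\<dots> = M" by (simp add: avg_const)
    finally show ?thesis .
  qed
  then have "(\<Sum>r\<in>idx d n (\<lambda>_. UNIV). avg (digits d n) (\<lambda>w. \<bar>h r w\<bar>)) \<le> real (card (idx d n (\<lambda>_. UNIV))) * M"
    using sum_bounded_above[of "idx d n (\<lambda>_. UNIV)" _ M] by simp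
  also have "\<dots> \<le> (real n + 1) ^ d * M"
  proof -
    have "idx d n (\<lambda>_. UNIV) = idx d n (\<lambda>_. {..n})" using idx_le[of _ d n "\<lambda>_. UNIV"] by (auto simp: idx_def)
    then show ?thesis using d M by (auto intro!: mult_right_mono card_idx_le_power)
  qed
  finally show ?thesis .
qed

theorem mass_bound:
  assumes d: "3 \<le> d"
  shows "\<exists>\<eta>>0. \<exists>C>0. \<forall>n h M. hsys d n h \<longrightarrow> (\<forall>w. \<bar>\<Sum>v\<in>levels d n. h v w\<bar> \<le> M) \<longrightarrow> 0 < M \<longrightarrow>
    (\<Sum>r\<in>idx d n (\<lambda>_. UNIV). avg (digits d n) (\<lambda>w. \<bar>h r w\<bar>)) \<le> C * (real n + 1) powr ((real d - 1) / 2 - \<eta>) * M"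
proof -
  obtain C a k g where diag: "0 \<le> C" "0 < g" "diag_bound d (d - 1) C a k g" using diag_bound_ex by blast
  obtain C' a' k' g' where beck: "0 \<le> C'" "0 < g'" "beck_bound d C' a' k' g'"
    using beck_bound_ex[OF d] by blast
  define V where "V = 3 * (2 * d - 1) + 25 + 8 * d"
  \<comment> \<open>The ratio is \<open>5 = 1 + 4\<close>: then \<open>m c\<close> is
    \<open>5 * V\<close> plus four times the sum of the \<open>m j\<close> with
    \<open>1 \<le> j < c\<close>, as required by the growth of \<open>branches\<close>.\<close>
  define m where "m c = V * 5 ^ c" for c
  define X where "X = m d"
  \<comment> \<open>\<open>Y\<close> converts the gains \<open>g\<close> and \<open>g'\<close>, in
    powers of \<open>n + 1\<close>, into the required powers of
    \<open>z = (n + 1) powr (1 / Y)\<close>. It thereby determines \<open>\<eta>\<close>.\<close>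
  define Y where "Y = X + 8 + nat \<lceil>real (2 * a + 9) / g\<rceil> + nat \<lceil>real (X + 2 * a' + 3) / g'\<rceil>"
  define kk where "kk = k + 3 + 2 * d + k'"
  have m1: "(\<Sum>j\<in>{1..<c}. 8 + 4 * m j) + 3 * (2 * d - 1) + 25 \<le> m c" if c: "1 \<le> c" "c < d" for c
  proof -
    have "(\<Sum>j\<in>{1..<c}. 8 + 4 * m j) + 5 * V = 8 * (c - 1) + m c"
      using c(1) by (induction c rule: dec_induct) (auto simp: m_def)
    moreover have "8 * (c - 1) + 3 * (2 * d - 1) + 25 \<le> V" using c by (simp add: V_def)
    ultimately show ?thesis by linarith
  qed
  have m2: "5 * m c \<le> X" if "c < d" for c
  proof -
    have "5 * m c = V * 5 ^ Suc c" by (simp add: m_def)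
    also have "\<dots> \<le> V * 5 ^ d" using that by (intro mult_left_mono power_increasing) auto
    finally show ?thesis by (simp add: X_def m_def)
  qed
  have m3: "4 * m c \<le> Y" if "c < d" for c using m2[OF that] by (simp add: Y_def)
  have Yg: "real p \<le> real Y * g" if "nat \<lceil>real p / g\<rceil> \<le> Y" "0 < g" for p and g :: real
  proof -
    have "real p / g \<le> real (nat \<lceil>real p / g\<rceil>)" by (rule real_nat_ceiling_ge)
    also have "\<dots> \<le> real Y" using that(1) by (simp only: of_nat_le_iff)
    finally show ?thesis using that(2) by (simp add: field_simps)
  qed
  have "nat \<lceil>real (2 * a + 9) / g\<rceil> \<le> Y" "nat \<lceil>real (X + 2 * a' + 3) / g'\<rceil> \<le> Y" unfolding Y_def by linarith+
  then have G: "real (2 * a + 9) \<le> Y * g" "real (X + 2 * a' + 3) \<le> Y * g'"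
    using Yg diag(2) beck(2) by blast+
  obtain z1 :: real where z1: "1 \<le> z1" "\<And>z. z1 \<le> z \<Longrightarrow> z ^ (2 * (X + Y * (d + 1) * d) + Y * (kk + 5)) * 2 ^ (kk + 6) * exp (6 * z\<^sup>2 - z ^ 4 / 2) \<le> 1"
    using exp_beats_power by blast
  define z0 where "z0 = Max {16, C, C', 3400 * 4 ^ d * real d, z1}"
  have z0: "16 \<le> z0" "C \<le> z0" "C' \<le> z0" "3400 * 4 ^ d * real d \<le> z0" "z1 \<le> z0" by (auto simp: z0_def)
  have Y0: "0 < Y" by (simp add: Y_def)
  define \<eta> where "\<eta> = 1 / real Y"
  define e where "e = (real d - 1) / 2 - \<eta>"
  have e0: "0 \<le> e"
  proof -
    have "\<eta> \<le> 1" using Y0 by (simp add: \<eta>_def)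
    then show ?thesis using d by (simp add: e_def)
  qed
  have bound: "(\<Sum>r\<in>idx d n (\<lambda>_. UNIV). avg (digits d n) (\<lambda>w. \<bar>h r w\<bar>)) \<le> (z0 ^ (Y * d) + 2) * (real n + 1) powr e * M"
    if h: "hsys d n h" "\<And>w. \<bar>\<Sum>v\<in>levels d n. h v w\<bar> \<le> M" and M: "0 < M" for n h M
  proof (cases "z0 \<le> (real n + 1) powr \<eta>")
    case False
    have p: "1 \<le> (real n + 1) powr e" using e0 by (intro ge_one_powr_ge_zero) auto
    have "real n + 1 = ((real n + 1) powr \<eta>) ^ Y" using Y0 by (simp add: \<eta>_def powr_powr flip: powr_realpow)
    also have "\<dots> \<le> z0 ^ Y" using False by (intro power_mono) auto
    finally have "(real n + 1) ^ d \<le> (z0 ^ Y) ^ d" by (intro power_mono) auto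
    also have "\<dots> = z0 ^ (Y * d)" by (simp add: power_mult)
    also have "\<dots> \<le> z0 ^ (Y * d) + 2" by simp
    also have "\<dots> \<le> (z0 ^ (Y * d) + 2) * (real n + 1) powr e" using z0(1) mult_left_mono[OF p, of "z0 ^ (Y * d) + 2"] by simp
    finally have "(real n + 1) ^ d * M \<le> (z0 ^ (Y * d) + 2) * (real n + 1) powr e * M" using M by (intro mult_right_mono) auto
    then show ?thesis using mass_bound_small[OF _ h] d by fastforce
  next
    case True
    define z where "z = (real n + 1) powr \<eta>"
    have z: "z0 \<le> z" using True by (simp add: z_def)
    have zY: "z ^ Y = real n + 1" unfolding z_def using Y0 by (simp add: \<eta>_def powr_powr flip: powr_realpow)
    \<comment> \<open>Both sides are homogeneous in \<open>h\<close>, so \<open>M\<close> is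
      normalised to 1.\<close>
    define h' where "h' v w = h v w / M" for v w
    have h': "hsys d n h'" using h(1) unfolding hsys_def h'_def odd_at_def inv_at_def by simp
    have "(\<Sum>v\<in>levels d n. h' v w) = (\<Sum>v\<in>levels d n. h v w) / M" for w by (simp add: h'_def sum_divide_distrib)
    then have H': "\<bar>\<Sum>v\<in>levels d n. h' v w\<bar> \<le> 1" for w using h(2)[of w] M by simp
    have "(\<Sum>r\<in>idx d n (\<lambda>_. UNIV). avg (digits d n) (\<lambda>w. \<bar>h' r w\<bar>)) \<le> 2 * sqrt ((real n + 1) ^ (d - 1)) / z"
      by (rule mass_bound_large[OF d diag(3) beck(3) m1 m2 m3 _ G, where kk = kk])
        (use z z0 z1(2)[of z] zY diag(1) beck(1) h' H' in \<open>auto simp: Y_def kk_def\<close>)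
    also have "\<dots> = 2 * (real n + 1) powr e"
    proof -
      have "sqrt ((real n + 1) ^ (d - 1)) = (real n + 1) powr ((real d - 1) / 2)"
        using d by (simp add: powr_half_sqrt[symmetric] powr_powr of_nat_diff flip: powr_realpow)
      then show ?thesis by (simp add: e_def z_def powr_diff)
    qed
    also have "\<dots> \<le> (z0 ^ (Y * d) + 2) * (real n + 1) powr e" using z0(1) by (intro mult_right_mono) auto
    finally have "(\<Sum>r\<in>idx d n (\<lambda>_. UNIV). avg (digits d n) (\<lambda>w. \<bar>h' r w\<bar>)) \<le> (z0 ^ (Y * d) + 2) * (real n + 1) powr e" .
    moreover have "avg (digits d n) (\<lambda>w. \<bar>h' r w\<bar>) = 1 / M * avg (digits d n) (\<lambda>w. \<bar>h r w\<bar>)" for r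
      unfolding h'_def avg_cmult[symmetric] using M by (simp add: abs_divide)
    ultimately have "(1 / M) * (\<Sum>r\<in>idx d n (\<lambda>_. UNIV). avg (digits d n) (\<lambda>w. \<bar>h r w\<bar>)) \<le> (z0 ^ (Y * d) + 2) * (real n + 1) powr e"
      by (simp only: sum_distrib_left)
    then show ?thesis using M by (simp add: field_simps)
  qed
  show ?thesis
  proof (rule exI[of _ \<eta>], rule conjI)
    show "0 < \<eta>" using Y0 by (simp add: \<eta>_def)
    have "0 < z0 ^ (Y * d) + 2" using z0(1) by (simp add: add_pos_pos)
    then show "\<exists>C>0. \<forall>n h M. hsys d n h \<longrightarrow> (\<forall>w. \<bar>\<Sum>v\<in>levels d n. h v w\<bar> \<le> M) \<longrightarrow> 0 < M \<longrightarrow>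
      (\<Sum>r\<in>idx d n (\<lambda>_. UNIV). avg (digits d n) (\<lambda>w. \<bar>h r w\<bar>)) \<le> C * (real n + 1) powr ((real d - 1) / 2 - \<eta>) * M"
      unfolding e_def[symmetric] using bound by blast
  qed
qed

section \<open>Dyadic rectangles\<close>

definition dint :: "nat \<Rightarrow> nat \<Rightarrow> real set" where
  "dint m p = {real p / 2 ^ m ..< (real p + 1) / 2 ^ m}"

text \<open>Containment in the unit interval forces \<open>0 \<le> j\<close> and
  \<open>k \<le> 0\<close>, so natural numbers can replace the integers.\<close>

lemma dyadic_interval_unit:
  "dyadic_interval I \<and> I \<subseteq> {0..<1} \<longleftrightarrow> (\<exists>m p. p < 2 ^ m \<and> I = dint m p)"
proof
  assume "dyadic_interval I \<and> I \<subseteq> {0..<1}"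
  then obtain j k :: int where I: "I = {real_of_int j * 2 powi k ..< (real_of_int j + 1) * 2 powi k}" "I \<subseteq> {0..<1}"
    by (auto simp: dyadic_interval_def)
  have p: "0 < (2::real) powi k" by simp
  have "real_of_int j * 2 powi k < (real_of_int j + 1) * 2 powi k" using p by simp
  moreover have "I \<subseteq> {0..1}" using I(2) by auto
  ultimately have b: "0 \<le> real_of_int j * 2 powi k" "(real_of_int j + 1) * 2 powi k \<le> 1"
    unfolding I(1) atLeastLessThan_subseteq_atLeastAtMost_iff by auto
  have j: "0 \<le> j" using b(1) p by (simp add: zero_le_mult_iff)
  have k: "k \<le> 0"
  proof (rule ccontr)
    assume "\<not> k \<le> 0"
    then have "(2::real) powi 1 \<le> 2 powi k" by (intro power_int_increasing) auto
    moreover have "1 * (2::real) powi k \<le> (real_of_int j + 1) * 2 powi k" using j p by (intro mult_right_mono) auto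
    ultimately show False using b(2) by simp
  qed
  define m where "m = nat (- k)"
  have pk: "(2::real) powi k = 1 / 2 ^ m" using k by (simp add: m_def power_int_def inverse_eq_divide power_one_over)
  have "real_of_int j + 1 \<le> 2 ^ m" using b(2) by (simp add: pk)
  then have "real_of_int (j + 1) \<le> real_of_int (2 ^ m)" by simp
  then have "nat j < 2 ^ m" using j unfolding of_int_le_iff by (simp add: nat_less_iff)
  moreover have "I = dint m (nat j)" using I j by (simp add: dint_def pk)
  ultimately show "\<exists>m p. p < 2 ^ m \<and> I = dint m p" by blast
next
  assume "\<exists>m p. p < 2 ^ m \<and> I = dint m p"
  then obtain m p where I: "p < 2 ^ m" "I = dint m p" by blast
  have "I = {real_of_int (int p) * 2 powi (- int m) ..< (real_of_int (int p) + 1) * 2 powi (- int m)}"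
    by (simp add: I dint_def power_int_minus divide_inverse)
  then have "dyadic_interval I" unfolding dyadic_interval_def by blast
  moreover have "real p + 1 \<le> 2 ^ m" using I(1) by (metis Suc_eq_plus1 Suc_leI of_nat_Suc of_nat_le_iff of_nat_numeral of_nat_power add.commute)
  then have "(real p + 1) / 2 ^ m \<le> 1" by simp
  then have "I \<subseteq> {0..<1}" by (auto simp: I dint_def intro: order_trans[of 0 "real p / 2 ^ m"] less_le_trans)
  ultimately show "dyadic_interval I \<and> I \<subseteq> {0..<1}" by simp
qed

lemma dint_lt: "real p / 2 ^ m < (real p + 1) / 2 ^ m"
  by (simp add: divide_strict_right_mono)

lemma measure_dint: "measure lborel (dint m p) = 1 / 2 ^ m"
  using dint_lt[of p m] by (simp add: dint_def diff_divide_distrib[symmetric])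

lemma dint_children: "dint m p = dint (Suc m) (2 * p) \<union> dint (Suc m) (2 * p + 1)"
  "dint (Suc m) (2 * p) \<inter> dint (Suc m) (2 * p + 1) = {}"
  by (auto simp: dint_def field_simps)

lemma haar_dint: "haar (dint m p) x = of_bool (x \<in> dint (Suc m) (2 * p + 1)) - of_bool (x \<in> dint (Suc m) (2 * p))"
proof -
  have IS: "Inf (dint m p) = real p / 2 ^ m" "Sup (dint m p) = (real p + 1) / 2 ^ m"
    unfolding dint_def using dint_lt[of p m] by (simp_all add: cInf_atLeastLessThan cSup_atLeastLessThan)
  have "left_half (dint m p) = dint (Suc m) (2 * p)" "right_half (dint m p) = dint (Suc m) (2 * p + 1)"
    unfolding left_half_def right_half_def IS by (auto simp: dint_def field_simps)
  then show ?thesis by (simp add: haar_def indicator_def)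
qed

lemma dint_disjoint: "x \<in> dint m p \<Longrightarrow> x \<in> dint m p' \<Longrightarrow> p = p'"
proof -
  assume "x \<in> dint m p" "x \<in> dint m p'"
  then have "real p \<le> x * 2 ^ m" "x * 2 ^ m < real p + 1" "real p' \<le> x * 2 ^ m" "x * 2 ^ m < real p' + 1"
    by (auto simp: dint_def field_simps)
  then show ?thesis by linarith
qed

lemma dint_inj: "dint m p = dint m' p' \<Longrightarrow> m = m' \<and> p = p'"
proof -
  assume e: "dint m p = dint m' p'"
  then have "1 / (2::real) ^ m = 1 / 2 ^ m'" unfolding measure_dint[of m p, symmetric] measure_dint[of m' p', symmetric] by simp
  then have "m = m'" by simp
  moreover have "real p / 2 ^ m \<in> dint m p" using dint_lt[of p m] by (simp add: dint_def)
  ultimately show ?thesis using e dint_disjoint by metis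
qed

text \<open>Digit 0 is the most significant one. The first \<open>m\<close> digits select an
  interval of level \<open>m\<close>, and the digit with index \<open>m\<close> selects its half,
  hence the sign of the Haar function.\<close>

primrec dyadic_num :: "(nat \<Rightarrow> bool) \<Rightarrow> nat \<Rightarrow> nat" where
  "dyadic_num b 0 = 0"
| "dyadic_num b (Suc m) = 2 * dyadic_num b m + of_bool (b m)"

lemma dyadic_num_less: "dyadic_num b m < 2 ^ m"
  by (induction m) auto

lemma dyadic_num_cong: "(\<And>i. i < m \<Longrightarrow> b i = b' i) \<Longrightarrow> dyadic_num b m = dyadic_num b' m"
  by (induction m) auto

lemma dyadic_num_surj: "p < 2 ^ m \<Longrightarrow> \<exists>b. dyadic_num b m = p"
proof (induction m arbitrary: p)
  case (Suc m)
  then obtain b where b: "dyadic_num b m = p div 2" by (metis less_mult_imp_div_less power_Suc2)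
  have "dyadic_num (b(m := odd p)) m = dyadic_num b m" by (rule dyadic_num_cong) auto
  then have "dyadic_num (b(m := odd p)) (Suc m) = p" using b by (simp add: odd_two_times_div_two_succ)
  then show ?case by blast
qed simp

lemma dint_dyadic_num_Suc: "dint (Suc m) (dyadic_num b (Suc m)) \<subseteq> dint m (dyadic_num b m)"
  using dint_children(1)[of m "dyadic_num b m"] by auto

lemma dint_dyadic_num_mono: "m \<le> m' \<Longrightarrow> dint m' (dyadic_num b m') \<subseteq> dint m (dyadic_num b m)"
  by (induction m' rule: dec_induct) (use dint_dyadic_num_Suc in blast)+

lemma haar_dyadic_num: "x \<in> dint (Suc m) (dyadic_num b (Suc m)) \<Longrightarrow> haar (dint m (dyadic_num b m)) x = (if b m then 1 else - 1)"
  using dint_children(2)[of m "dyadic_num b m"] by (cases "b m") (auto simp: haar_dint)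

text \<open>The dyadic rectangle of side lengths \<open>2 powi - v j\<close> that contains the cell \<open>w\<close>.\<close>

definition drect :: "nat \<Rightarrow> (nat \<Rightarrow> nat) \<Rightarrow> (nat \<times> nat) set \<Rightarrow> nat \<Rightarrow> real set" where
  "drect d v w = (\<lambda>j\<in>{..<d}. dint (v j) (dyadic_num (\<lambda>i. (j, i) \<in> w) (v j)))"

lemma drect_in: "drect d v w \<in> dyadic_rectangles d"
  using dyadic_interval_unit dyadic_num_less by (fastforce simp: dyadic_rectangles_def drect_def)

lemma volume_drect: "rect_volume d (drect d v w) = 1 / 2 ^ (\<Sum>j<d. v j)"
  by (simp add: rect_volume_def drect_def measure_dint power_sum prod_dividef)

lemma drect_cong: "(\<And>j i. j < d \<Longrightarrow> i < v j \<Longrightarrow> (j, i) \<in> w \<longleftrightarrow> (j, i) \<in> w') \<Longrightarrow> drect d v w = drect d v w'"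
  unfolding drect_def by (intro restrict_ext arg_cong[where f = "dint _"] dyadic_num_cong) auto

lemma drect_level: "drect d v w = drect d v' w' \<Longrightarrow> j < d \<Longrightarrow> v j = v' j"
  unfolding drect_def by (drule fun_cong[of _ _ j]) (auto dest: dint_inj)

lemma drect_surj:
  assumes R: "R \<in> dyadic_rectangles d" and n: "1 / 2 ^ n \<le> rect_volume d R"
  obtains v w where "v \<in> levels d n" "w \<subseteq> digits d n" "R = drect d v w" "rect_volume d R = 1 / 2 ^ (\<Sum>j<d. v j)"
proof -
  have "\<exists>x. j < d \<longrightarrow> R j = dint (fst x) (dyadic_num (snd x) (fst x))" for j
  proof (cases "j < d")
    case True
    then obtain m p where mp: "p < 2 ^ m" "R j = dint m p"
      using R dyadic_interval_unit[of "R j"] by (auto simp: dyadic_rectangles_def)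
    obtain b where "dyadic_num b m = p" using dyadic_num_surj[OF mp(1)] by blast
    then show ?thesis using mp(2) by (intro exI[of _ "(m, b)"]) simp
  qed simp
  then have "\<forall>j. \<exists>x. j < d \<longrightarrow> R j = dint (fst x) (dyadic_num (snd x) (fst x))" by blast
  from choice[OF this] obtain c where c: "\<And>j. j < d \<Longrightarrow> R j = dint (fst (c j)) (dyadic_num (snd (c j)) (fst (c j)))"
    by blast
  define m where "m j = fst (c j)" for j
  define b where "b j = snd (c j)" for j
  have b: "R j = dint (m j) (dyadic_num (b j) (m j))" if "j < d" for j using c[OF that] by (simp add: m_def b_def)
  define v where "v j = (if j < d then m j else 0)" for j
  have V: "rect_volume d R = 1 / 2 ^ (\<Sum>j<d. v j)"
    by (simp add: rect_volume_def b measure_dint power_sum prod_dividef v_def)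
  then have "1 / (2::real) ^ n \<le> 1 / 2 ^ (\<Sum>j<d. v j)" using n by simp
  then have "(2::real) ^ (\<Sum>j<d. v j) \<le> 2 ^ n" by (simp add: field_simps)
  then have v: "v \<in> levels d n" by (simp add: levels_def v_def)
  define w where "w = {(j, i) \<in> digits d n. b j i}"
  have "R = drect d v w"
  proof
    fix j
    show "R j = drect d v w j"
    proof (cases "j < d")
      case True
      have "m j \<le> (\<Sum>j<d. v j)" using member_le_sum[of j "{..<d}" v] True by (simp add: v_def)
      then have "m j \<le> n" using v by (simp add: levels_def)
      then have nm: "dyadic_num (\<lambda>i. (j, i) \<in> w) (m j) = dyadic_num (b j) (m j)" using True by (intro dyadic_num_cong) (simp add: w_def digits_def)
      have vj: "v j = m j" using True by (simp add: v_def)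
      have "R j = dint (v j) (dyadic_num (\<lambda>i. (j, i) \<in> w) (v j))" unfolding vj nm by (rule b[OF True])
      then show ?thesis using True unfolding drect_def by simp
    next
      case False
      then have "R j = undefined" using R unfolding dyadic_rectangles_def by (intro PiE_arb[of R]) auto
      then show ?thesis using False unfolding drect_def by simp
    qed
  qed
  moreover have "w \<subseteq> digits d n" unfolding w_def by blast
  ultimately show ?thesis using v V by (intro that)
qed

section \<open>The Haar sum on cells\<close>

definition big_rects :: "nat \<Rightarrow> nat \<Rightarrow> (nat \<Rightarrow> real set) set" where
  "big_rects d n = {R \<in> dyadic_rectangles d. 1 / 2 ^ n \<le> rect_volume d R}"

lemma big_rects_eq: "big_rects d n = (\<Union>v\<in>levels d n. drect d v ` Pow (digits d n))"
proof (intro equalityI subsetI)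
  fix R assume "R \<in> big_rects d n"
  then obtain v w where "v \<in> levels d n" "w \<subseteq> digits d n" "R = drect d v w"
    using drect_surj[of R d n] unfolding big_rects_def by blast
  then show "R \<in> (\<Union>v\<in>levels d n. drect d v ` Pow (digits d n))" by auto
next
  fix R assume "R \<in> (\<Union>v\<in>levels d n. drect d v ` Pow (digits d n))"
  then obtain v w where v: "v \<in> levels d n" "R = drect d v w" by auto
  have "(2::real) ^ (\<Sum>j<d. v j) \<le> 2 ^ n" using v by (intro power_increasing) (auto simp: levels_def)
  then show "R \<in> big_rects d n" using v drect_in by (simp add: big_rects_def volume_drect field_simps)
qed

lemma finite_big_rects [simp]: "finite (big_rects d n)"
  by (simp add: big_rects_eq)

text \<open>The value on the cell \<open>w\<close> of the part of level \<open>v\<close>: in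
  coordinate \<open>j\<close> the sign is given by the first digit after those that determine the
  rectangle.\<close>

definition hcoef :: "nat \<Rightarrow> ((nat \<Rightarrow> real set) \<Rightarrow> real) \<Rightarrow> (nat \<Rightarrow> nat) \<Rightarrow> (nat \<times> nat) set \<Rightarrow> real" where
  "hcoef d \<alpha> v w = \<alpha> (drect d v w) * (\<Prod>j<d. if (j, v j) \<in> w then 1 else - 1)"

lemma abs_hcoef: "\<bar>hcoef d \<alpha> v w\<bar> = \<bar>\<alpha> (drect d v w)\<bar>"
proof -
  have "\<bar>\<Prod>j<d. if (j, v j) \<in> w then 1 else - 1 :: real\<bar> = 1" unfolding abs_prod by (intro prod.neutral) auto
  then show ?thesis by (simp add: hcoef_def abs_mult)
qed

lemma hsys_hcoef: "hsys d n (hcoef d \<alpha>)"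
  unfolding hsys_def
proof (intro ballI allI impI conjI)
  fix v j assume j: "j < d"
  have R: "drect d v (flip (j, i) w) = drect d v w" if "v j \<le> i" for i w
    using that by (intro drect_cong) (auto simp: flip_def)
  show "odd_at (j, v j) (hcoef d \<alpha> v)"
    unfolding odd_at_def
  proof
    fix w
    have "(\<Prod>k\<in>{..<d} - {j}. if (k, v k) \<in> flip (j, v j) w then 1 else - 1 :: real) =
      (\<Prod>k\<in>{..<d} - {j}. if (k, v k) \<in> w then 1 else - 1)" by (intro prod.cong) (auto simp: flip_def)
    moreover have "((j, v j) \<in> flip (j, v j) w) \<longleftrightarrow> (j, v j) \<notin> w" by (auto simp: flip_def)
    ultimately show "hcoef d \<alpha> v (flip (j, v j) w) = - hcoef d \<alpha> v w"
      using j R[of "v j" w] by (simp add: hcoef_def prod.remove[of "{..<d}" j])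
  qed
  fix i assume i: "v j < i"
  show "inv_at (j, i) (hcoef d \<alpha> v)"
    unfolding inv_at_def
  proof
    fix w
    have "(\<Prod>k<d. if (k, v k) \<in> flip (j, i) w then 1 else - 1 :: real) = (\<Prod>k<d. if (k, v k) \<in> w then 1 else - 1)"
      using i by (intro prod.cong) (auto simp: flip_def)
    then show "hcoef d \<alpha> v (flip (j, i) w) = hcoef d \<alpha> v w" using i R[of i w] by (simp add: hcoef_def)
  qed
qed

lemma haar_rect_zero: "j < d \<Longrightarrow> R j = dint m p \<Longrightarrow> x j \<notin> R j \<Longrightarrow> haar_rect d R x = 0"
proof -
  assume j: "j < d" and R: "R j = dint m p" "x j \<notin> R j"
  then have "haar (R j) (x j) = 0" using dint_children(1)[of m p] haar_dint[of m p "x j"] by simp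
  then show ?thesis using j by (auto simp: haar_rect_def)
qed

text \<open>Of all rectangles of level \<open>v\<close> only the one containing the cell
  contributes, and the cell is fine enough to lie in one half of each of its sides.\<close>

lemma haar_sum_cell:
  assumes x: "\<And>j. j < d \<Longrightarrow> x j \<in> dint (Suc n) (dyadic_num (\<lambda>i. (j, i) \<in> w) (Suc n))"
  shows "(\<Sum>R\<in>big_rects d n. \<alpha> R * haar_rect d R x) = (\<Sum>v\<in>levels d n. hcoef d \<alpha> v w)"
proof -
  have vn: "v j \<le> n" if "v \<in> levels d n" "j < d" for v j
    using member_le_sum[of j "{..<d}" v] that by (simp add: levels_def)
  have inj: "inj_on (\<lambda>v. drect d v w) (levels d n)"
  proof (rule inj_onI, rule ext)
    fix v v' j assume "v \<in> levels d n" "v' \<in> levels d n" "drect d v w = drect d v' w"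
    then show "v j = v' j" using drect_level[of d v w v' w j] by (cases "j < d") (auto simp: levels_def)
  qed
  have zero: "haar_rect d R x = 0" if R: "R \<in> big_rects d n - (\<lambda>v. drect d v w) ` levels d n" for R
  proof (rule ccontr)
    assume nz: "haar_rect d R x \<noteq> 0"
    obtain v w' where v: "v \<in> levels d n" "R = drect d v w'" using R by (auto simp: big_rects_eq)
    have "R = drect d v w"
    proof
      fix j
      show "R j = drect d v w j"
      proof (cases "j < d")
        case True
        have Rj: "R j = dint (v j) (dyadic_num (\<lambda>i. (j, i) \<in> w') (v j))" using v True by (simp add: drect_def)
        have "x j \<in> R j" using nz haar_rect_zero[of j d R _ _ x, OF True Rj] by blast
        moreover have "x j \<in> dint (v j) (dyadic_num (\<lambda>i. (j, i) \<in> w) (v j))"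
          using x[OF True] dint_dyadic_num_mono[of "v j" "Suc n" "\<lambda>i. (j, i) \<in> w"] vn[OF v(1) True] by auto
        ultimately have "dyadic_num (\<lambda>i. (j, i) \<in> w') (v j) = dyadic_num (\<lambda>i. (j, i) \<in> w) (v j)" unfolding Rj by (rule dint_disjoint)
        then show ?thesis using Rj True by (simp add: drect_def)
      qed (simp add: v(2) drect_def)
    qed
    then show False using R v(1) by auto
  qed
  have sub: "(\<lambda>v. drect d v w) ` levels d n \<subseteq> big_rects d n"
  proof
    fix R assume "R \<in> (\<lambda>v. drect d v w) ` levels d n"
    then obtain v where v: "v \<in> levels d n" "R = drect d v w" by auto
    have "drect d v w = drect d v (w \<inter> digits d n)"
      using vn[OF v(1)] by (intro drect_cong) (fastforce simp: digits_def)
    then show "R \<in> big_rects d n" using v by (auto simp: big_rects_eq)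
  qed
  have "(\<Sum>R\<in>big_rects d n. \<alpha> R * haar_rect d R x) = (\<Sum>R\<in>(\<lambda>v. drect d v w) ` levels d n. \<alpha> R * haar_rect d R x)"
    using sub zero by (intro sum.mono_neutral_right) auto
  also have "\<dots> = (\<Sum>v\<in>levels d n. \<alpha> (drect d v w) * haar_rect d (drect d v w) x)"
    by (simp add: sum.reindex[OF inj])
  also have "\<dots> = (\<Sum>v\<in>levels d n. hcoef d \<alpha> v w)"
  proof (intro sum.cong refl)
    fix v assume v: "v \<in> levels d n"
    have "haar (drect d v w j) (x j) = (if (j, v j) \<in> w then 1 else - 1)" if j: "j < d" for j
    proof -
      have "x j \<in> dint (Suc (v j)) (dyadic_num (\<lambda>i. (j, i) \<in> w) (Suc (v j)))"
        using x[OF j] dint_dyadic_num_mono[of "Suc (v j)" "Suc n" "\<lambda>i. (j, i) \<in> w"] vn[OF v j] by auto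
      from haar_dyadic_num[OF this] show ?thesis using j by (simp add: drect_def)
    qed
    then show "\<alpha> (drect d v w) * haar_rect d (drect d v w) x = hcoef d \<alpha> v w"
      by (simp add: haar_rect_def hcoef_def)
  qed
  finally show ?thesis .
qed

text \<open>A rectangle of volume \<open>1 / 2 ^ n\<close> is determined by \<open>n\<close> digits,
  so it contains at least the fraction \<open>1 / 2 ^ n\<close> of all cells.\<close>

lemma sum_le_avg:
  "(1 / 2 ^ n) * (\<Sum>R | R \<in> dyadic_rectangles d \<and> rect_volume d R = 1 / 2 ^ n. \<bar>\<alpha> R\<bar>)
    \<le> (\<Sum>r\<in>idx d n (\<lambda>_. UNIV). avg (digits d n) (\<lambda>w. \<bar>hcoef d \<alpha> r w\<bar>))"
proof -
  define S where "S = {R \<in> dyadic_rectangles d. rect_volume d R = 1 / 2 ^ n}"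
  define Sh where "Sh r = drect d r ` Pow (digits d n)" for r
  have finSh: "finite (Sh r)" for r by (simp add: Sh_def)
  have sub: "S \<subseteq> (\<Union>r\<in>idx d n (\<lambda>_. UNIV). Sh r)"
  proof
    fix R assume "R \<in> S"
    then have R: "R \<in> dyadic_rectangles d" "rect_volume d R = 1 / 2 ^ n" by (auto simp: S_def)
    then obtain v w where v: "v \<in> levels d n" "w \<subseteq> digits d n" "R = drect d v w" "rect_volume d R = 1 / 2 ^ (\<Sum>j<d. v j)"
      using drect_surj[of R d n] by auto
    then have "(\<Sum>j<d. v j) = n" using R by simp
    then have "v \<in> idx d n (\<lambda>_. UNIV)" using v by (simp add: idx_def levels_def)
    then show "R \<in> (\<Union>r\<in>idx d n (\<lambda>_. UNIV). Sh r)" using v by (auto simp: Sh_def)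
  qed
  have disj: "Sh r \<inter> Sh r' = {}" if "r \<in> idx d n (\<lambda>_. UNIV)" "r' \<in> idx d n (\<lambda>_. UNIV)" "r \<noteq> r'" for r r'
  proof (rule ccontr)
    assume "Sh r \<inter> Sh r' \<noteq> {}"
    then obtain w w' where "drect d r w = drect d r' w'" by (auto simp: Sh_def)
    then have "r j = r' j" for j using drect_level[of d r w r' w' j] that by (cases "j < d") (auto simp: idx_def)
    then show False using that by auto
  qed
  have one: "(\<Sum>R\<in>Sh r. \<bar>\<alpha> R\<bar>) / 2 ^ n \<le> avg (digits d n) (\<lambda>w. \<bar>hcoef d \<alpha> r w\<bar>)" if r: "r \<in> idx d n (\<lambda>_. UNIV)" for r
  proof -
    define P where "P = (SIGMA j:{..<d}. {..<r j})"
    have P: "P \<subseteq> digits d n" "card P = n" "finite P"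
    proof -
      show "P \<subseteq> digits d n" using idx_le[OF r] by (fastforce simp: P_def digits_def)
      show "card P = n" using r by (simp add: P_def idx_def)
      show "finite P" by (simp add: P_def)
    qed
    have freq: "1 / 2 ^ n \<le> avg (digits d n) (\<lambda>w. of_bool (drect d r w = R))" if R: "R \<in> Sh r" for R
    proof -
      obtain w0 where w0: "w0 \<subseteq> digits d n" "R = drect d r w0" using R by (auto simp: Sh_def)
      have "inj_on (\<lambda>u. u \<union> (w0 \<inter> P)) (Pow (digits d n - P))" by (auto simp: inj_on_def)
      then have "card ((\<lambda>u. u \<union> (w0 \<inter> P)) ` Pow (digits d n - P)) = 2 ^ (card (digits d n) - n)"
        using P by (simp add: card_image card_Pow card_Diff_subset)
      moreover have "(\<lambda>u. u \<union> (w0 \<inter> P)) ` Pow (digits d n - P) \<subseteq> {w \<in> Pow (digits d n). drect d r w = R}"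
      proof
        fix w assume "w \<in> (\<lambda>u. u \<union> (w0 \<inter> P)) ` Pow (digits d n - P)"
        then obtain u where u: "u \<subseteq> digits d n - P" "w = u \<union> (w0 \<inter> P)" by auto
        have "drect d r w = drect d r w0" using u by (intro drect_cong) (auto simp: P_def)
        then show "w \<in> {w \<in> Pow (digits d n). drect d r w = R}" using u w0 by auto
      qed
      ultimately have le: "2 ^ (card (digits d n) - n) \<le> card {w \<in> Pow (digits d n). drect d r w = R}"
        using card_mono[of "{w \<in> Pow (digits d n). drect d r w = R}" "(\<lambda>u. u \<union> (w0 \<inter> P)) ` Pow (digits d n - P)"] by simp
      have "n \<le> card (digits d n)" using P card_mono[OF _ P(1)] by simp
      then have "(1::real) / 2 ^ n = 2 ^ (card (digits d n) - n) / 2 ^ card (digits d n)"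
        by (simp add: power_diff)
      also have "\<dots> \<le> real (card {w \<in> Pow (digits d n). drect d r w = R}) / 2 ^ card (digits d n)"
        using le by (intro divide_right_mono) (auto simp flip: of_nat_le_iff)
      also have "\<dots> = avg (digits d n) (\<lambda>w. of_bool (drect d r w = R))"
        unfolding avg_def by (simp add: sum_of_bool_eq Int_def)
      finally show ?thesis .
    qed
    have "(\<Sum>R\<in>Sh r. \<bar>\<alpha> R\<bar>) / 2 ^ n = (\<Sum>R\<in>Sh r. \<bar>\<alpha> R\<bar> * (1 / 2 ^ n))" by (simp add: sum_divide_distrib)
    also have "\<dots> \<le> (\<Sum>R\<in>Sh r. \<bar>\<alpha> R\<bar> * avg (digits d n) (\<lambda>w. of_bool (drect d r w = R)))"
      using freq by (intro sum_mono mult_left_mono) auto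
    also have "\<dots> = avg (digits d n) (\<lambda>w. \<Sum>R\<in>Sh r. \<bar>\<alpha> R\<bar> * of_bool (drect d r w = R))"
      unfolding avg_sum avg_cmult ..
    also have "\<dots> = avg (digits d n) (\<lambda>w. \<bar>hcoef d \<alpha> r w\<bar>)"
    proof (rule avg_cong)
      fix w assume w: "w \<subseteq> digits d n"
      have "(\<Sum>R\<in>Sh r. \<bar>\<alpha> R\<bar> * of_bool (drect d r w = R)) = (\<Sum>R\<in>Sh r. if R = drect d r w then \<bar>\<alpha> (drect d r w)\<bar> else 0)"
        by (intro sum.cong) auto
      then show "(\<Sum>R\<in>Sh r. \<bar>\<alpha> R\<bar> * of_bool (drect d r w = R)) = \<bar>hcoef d \<alpha> r w\<bar>"
        using w finSh by (simp add: abs_hcoef Sh_def)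
    qed
    finally show ?thesis .
  qed
  have "(\<Sum>R\<in>S. \<bar>\<alpha> R\<bar>) \<le> (\<Sum>R\<in>(\<Union>r\<in>idx d n (\<lambda>_. UNIV). Sh r). \<bar>\<alpha> R\<bar>)"
    using sub finSh by (intro sum_mono2) auto
  also have "\<dots> = (\<Sum>r\<in>idx d n (\<lambda>_. UNIV). \<Sum>R\<in>Sh r. \<bar>\<alpha> R\<bar>)"
    using finSh disj by (intro sum.UNION_disjoint) auto
  finally have "(1 / 2 ^ n) * (\<Sum>R\<in>S. \<bar>\<alpha> R\<bar>) \<le> (\<Sum>r\<in>idx d n (\<lambda>_. UNIV). (\<Sum>R\<in>Sh r. \<bar>\<alpha> R\<bar>) / 2 ^ n)"
    unfolding sum_divide_distrib[symmetric] by (simp add: divide_right_mono)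
  also have "\<dots> \<le> (\<Sum>r\<in>idx d n (\<lambda>_. UNIV). avg (digits d n) (\<lambda>w. \<bar>hcoef d \<alpha> r w\<bar>))"
    using one by (rule sum_mono)
  finally show ?thesis unfolding S_def .
qed

section \<open>Measurability and the essential supremum\<close>

lemma measurable_haar_rect [measurable]:
  assumes R: "R \<in> dyadic_rectangles d"
  shows "haar_rect d R \<in> borel_measurable (unit_cube d)"
  unfolding haar_rect_def[abs_def]
proof (rule borel_measurable_prod)
  fix j assume j: "j \<in> {..<d}"
  then obtain m p where mp: "R j = dint m p"
    using R dyadic_interval_unit[of "R j"] by (auto simp: dyadic_rectangles_def)
  have "haar (R j) = (\<lambda>x. indicator (dint (Suc m) (2 * p + 1)) x - indicator (dint (Suc m) (2 * p)) x)"
    unfolding mp by (simp add: fun_eq_iff haar_dint indicator_def)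
  then have "haar (R j) \<in> borel_measurable borel" by (simp add: dint_def)
  moreover have "(\<lambda>x. x j) \<in> unit_cube d \<rightarrow>\<^sub>M restrict_space lborel {0..1}"
    unfolding unit_cube_def using j by (rule measurable_component_singleton)
  moreover have "(\<lambda>x. x) \<in> restrict_space lborel {0..1::real} \<rightarrow>\<^sub>M borel"
    by (rule measurable_restrict_space1) simp
  ultimately show "(\<lambda>x. haar (R j) (x j)) \<in> borel_measurable (unit_cube d)"
    using measurable_compose by blast
qed

text \<open>The bound \<open>B\<close> keeps the essential supremum finite;
  \<open>real_of_ereal\<close> would send an infinite one to 0.\<close>

lemma Linf_norm_ge:
  assumes f: "f \<in> borel_measurable M" and bounded: "\<And>x. \<bar>f x\<bar> \<le> B"
    and A: "emeasure M A \<noteq> 0" "A \<in> sets M" "\<And>x. x \<in> A \<Longrightarrow> f x = y"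
  shows "\<bar>y\<bar> \<le> Linf_norm M f"
proof -
  have [measurable]: "(\<lambda>x. ereal \<bar>f x\<bar>) \<in> borel_measurable M" using f by measurable
  have up: "esssup M (\<lambda>x. ereal \<bar>f x\<bar>) \<le> ereal B" using bounded by (intro esssup_I) auto
  have "\<exists>x\<in>A. ereal \<bar>f x\<bar> \<le> esssup M (\<lambda>x. ereal \<bar>f x\<bar>)"
  proof (rule ccontr)
    assume "\<not> ?thesis"
    then have "A \<subseteq> {x \<in> space M. ereal \<bar>f x\<bar> > esssup M (\<lambda>x. ereal \<bar>f x\<bar>)}"
      using sets.sets_into_space[OF A(2)] by (auto simp: not_le)
    then have "emeasure M A \<le> emeasure M {x \<in> space M. ereal \<bar>f x\<bar> > esssup M (\<lambda>x. ereal \<bar>f x\<bar>)}"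
      by (intro emeasure_mono) auto
    then show False using A(1) esssup_zero_measure[of M "\<lambda>x. ereal \<bar>f x\<bar>"] by simp
  qed
  then have lo: "ereal \<bar>y\<bar> \<le> esssup M (\<lambda>x. ereal \<bar>f x\<bar>)" using A(3) by auto
  then show ?thesis using up unfolding Linf_norm_def by (cases "esssup M (\<lambda>x. ereal \<bar>f x\<bar>)") auto
qed

lemma haar_le_1: "\<bar>haar I x\<bar> \<le> 1"
  by (auto simp: haar_def left_half_def right_half_def indicator_def)

lemma haar_rect_le_1: "\<bar>haar_rect d R x\<bar> \<le> 1"
  unfolding haar_rect_def abs_prod using haar_le_1 by (intro prod_le_1) auto

text \<open>The Haar sum is constant on the cell \<open>w\<close>, a set of positive measure, so its
  value there cannot exceed the essential supremum.\<close>

lemma sum_le_Linf_norm: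
  "\<bar>\<Sum>v\<in>levels d n. hcoef d \<alpha> v w\<bar> \<le> Linf_norm (unit_cube d) (\<lambda>x. \<Sum>R\<in>big_rects d n. \<alpha> R * haar_rect d R x)"
proof (rule Linf_norm_ge)
  define c where "c j = dint (Suc n) (dyadic_num (\<lambda>i. (j, i) \<in> w) (Suc n))" for j
  show "(\<lambda>x. \<Sum>R\<in>big_rects d n. \<alpha> R * haar_rect d R x) \<in> borel_measurable (unit_cube d)"
    by (intro borel_measurable_sum borel_measurable_times borel_measurable_const measurable_haar_rect) (simp add: big_rects_def)
  show "\<bar>\<Sum>R\<in>big_rects d n. \<alpha> R * haar_rect d R x\<bar> \<le> (\<Sum>R\<in>big_rects d n. \<bar>\<alpha> R\<bar>)" for x
  proof (rule order_trans[OF sum_abs sum_mono])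
    fix R show "\<bar>\<alpha> R * haar_rect d R x\<bar> \<le> \<bar>\<alpha> R\<bar>"
      using mult_left_mono[OF haar_rect_le_1[of d R x], of "\<bar>\<alpha> R\<bar>"] by (simp add: abs_mult)
  qed
  have c01: "c j \<subseteq> {0..1}" for j
  proof -
    have "c j \<subseteq> {0..<1}" unfolding c_def using dyadic_interval_unit dyadic_num_less by blast
    then show ?thesis by auto
  qed
  have cs: "c j \<in> sets (restrict_space lborel {0..1})" for j
    using c01[of j] by (auto simp: sets_restrict_space_iff c_def dint_def)
  have fin: "finite_measure (restrict_space lborel {0..1::real})"
    by (intro finite_measureI) (simp add: space_restrict_space emeasure_restrict_space)
  interpret P: product_sigma_finite "\<lambda>_::nat. restrict_space lborel {0..1::real}"
    by (rule product_sigma_finite.intro) (rule finite_measure.axioms(1)[OF fin])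
  have "emeasure (unit_cube d) (PiE {..<d} c) = (\<Prod>j<d. emeasure (restrict_space lborel {0..1}) (c j))"
    unfolding unit_cube_def by (rule P.emeasure_PiM) (use cs in auto)
  also have "\<dots> = (\<Prod>j<d. emeasure lborel (c j))"
    using c01 by (intro prod.cong refl emeasure_restrict_space) auto
  also have "\<dots> \<noteq> 0"
  proof -
    have "emeasure lborel (c j) \<noteq> 0" for j
      using dint_lt[of "dyadic_num (\<lambda>i. (j, i) \<in> w) (Suc n)" "Suc n"] unfolding c_def dint_def by (simp del: dyadic_num.simps)
    then show ?thesis by simp
  qed
  finally show "emeasure (unit_cube d) (PiE {..<d} c) \<noteq> 0" .
  show "PiE {..<d} c \<in> sets (unit_cube d)"
    unfolding unit_cube_def by (rule sets_PiM_I_finite[OF finite_lessThan cs])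
  fix x assume x: "x \<in> PiE {..<d} c"
  show "(\<Sum>R\<in>big_rects d n. \<alpha> R * haar_rect d R x) = (\<Sum>v\<in>levels d n. hcoef d \<alpha> v w)"
  proof (rule haar_sum_cell)
    fix j assume "j < d"
    then have "x j \<in> c j" by (intro PiE_mem[OF x]) simp
    then show "x j \<in> dint (Suc n) (dyadic_num (\<lambda>i. (j, i) \<in> w) (Suc n))" unfolding c_def .
  qed
qed

theorem theorem1p5:
  fixes d :: nat
  assumes "d \<ge> 3"
  shows "\<exists>\<eta>>0. \<exists>C>0. \<forall>n :: nat. n \<ge> 1 \<longrightarrow> (\<forall>\<alpha> :: (nat \<Rightarrow> real set) \<Rightarrow> real.
    (1 / 2 ^ n) * (\<Sum>R | R \<in> dyadic_rectangles d \<and> rect_volume d R = 1 / 2 ^ n. \<bar>\<alpha> R\<bar>)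
      \<le> C * real n powr ((real d - 1) / 2 - \<eta>) *
        Linf_norm (unit_cube d)
          (\<lambda>x. \<Sum>R | R \<in> dyadic_rectangles d \<and> rect_volume d R \<ge> 1 / 2 ^ n. \<alpha> R * haar_rect d R x))"
proof -
  obtain \<eta> C where \<eta>: "0 < \<eta>" "0 < C" and mass: "\<And>n h M. hsys d n h \<Longrightarrow> (\<And>w. \<bar>\<Sum>v\<in>levels d n. h v w\<bar> \<le> M) \<Longrightarrow> 0 < M \<Longrightarrow>
      (\<Sum>r\<in>idx d n (\<lambda>_. UNIV). avg (digits d n) (\<lambda>w. \<bar>h r w\<bar>)) \<le> C * (real n + 1) powr ((real d - 1) / 2 - \<eta>) * M"
    using mass_bound[OF assms] by blast
  define e where "e = (real d - 1) / 2 - \<eta>"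
  have main: "(1 / 2 ^ n) * (\<Sum>R | R \<in> dyadic_rectangles d \<and> rect_volume d R = 1 / 2 ^ n. \<bar>\<alpha> R\<bar>)
      \<le> C * 2 powr \<bar>e\<bar> * real n powr e * Linf_norm (unit_cube d) (\<lambda>x. \<Sum>R\<in>big_rects d n. \<alpha> R * haar_rect d R x)"
    if n: "1 \<le> n" for n \<alpha>
  \<comment> \<open>The norm may be 0, while \<open>mass\<close> asks for a positive bound; hence
    the detour through \<open>N + \<epsilon> / P\<close>.\<close>
  proof (rule field_le_epsilon)
    fix \<epsilon> :: real assume \<epsilon>: "0 < \<epsilon>"
    define N where "N = Linf_norm (unit_cube d) (\<lambda>x. \<Sum>R\<in>big_rects d n. \<alpha> R * haar_rect d R x)"
    define P where "P = C * 2 powr \<bar>e\<bar> * real n powr e"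
    have P: "0 < P" using \<eta> n by (simp add: P_def)
    have N: "\<bar>\<Sum>v\<in>levels d n. hcoef d \<alpha> v w\<bar> \<le> N" for w unfolding N_def by (rule sum_le_Linf_norm)
    have pw: "(real n + 1) powr e \<le> 2 powr \<bar>e\<bar> * real n powr e"
    proof (cases "0 \<le> e")
      case True
      have "(real n + 1) powr e \<le> (2 * real n) powr e" using n True by (intro powr_mono2) auto
      then show ?thesis using True by (simp add: powr_mult)
    next
      case False
      have "(real n + 1) powr e \<le> real n powr e" using n False by (intro powr_mono2') auto
      moreover have "1 * real n powr e \<le> 2 powr \<bar>e\<bar> * real n powr e" by (intro mult_right_mono ge_one_powr_ge_zero) auto
      ultimately show ?thesis by simp
    qed
    have "(1 / 2 ^ n) * (\<Sum>R | R \<in> dyadic_rectangles d \<and> rect_volume d R = 1 / 2 ^ n. \<bar>\<alpha> R\<bar>)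
      \<le> (\<Sum>r\<in>idx d n (\<lambda>_. UNIV). avg (digits d n) (\<lambda>w. \<bar>hcoef d \<alpha> r w\<bar>))" by (rule sum_le_avg)
    also have "\<dots> \<le> C * (real n + 1) powr e * (N + \<epsilon> / P)"
      unfolding e_def
    proof (rule mass)
      show "hsys d n (hcoef d \<alpha>)" by (rule hsys_hcoef)
      show "\<bar>\<Sum>v\<in>levels d n. hcoef d \<alpha> v w\<bar> \<le> N + \<epsilon> / P" for w
        using N[of w] \<epsilon> P divide_pos_pos[of \<epsilon> P] by linarith
      show "0 < N + \<epsilon> / P" using N[of "{}"] \<epsilon> P divide_pos_pos[of \<epsilon> P] by linarith
    qed
    also have "\<dots> \<le> C * (2 powr \<bar>e\<bar> * real n powr e) * (N + \<epsilon> / P)"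
      using N[of "{}"] \<epsilon> P divide_pos_pos[of \<epsilon> P] \<eta>(2) by (intro mult_right_mono mult_left_mono pw) linarith+
    also have "\<dots> = P * N + \<epsilon>" using P by (simp add: P_def[symmetric] mult.assoc[symmetric] distrib_left)
    finally show "(1 / 2 ^ n) * (\<Sum>R | R \<in> dyadic_rectangles d \<and> rect_volume d R = 1 / 2 ^ n. \<bar>\<alpha> R\<bar>)
      \<le> C * 2 powr \<bar>e\<bar> * real n powr e * Linf_norm (unit_cube d) (\<lambda>x. \<Sum>R\<in>big_rects d n. \<alpha> R * haar_rect d R x) + \<epsilon>"
      by (simp add: P_def N_def)
  qed
  have "0 < C * 2 powr \<bar>e\<bar>" using \<eta> by simp
  show ?thesis
  proof (rule exI[of _ \<eta>], intro conjI \<eta>(1), rule exI[of _ "C * 2 powr \<bar>e\<bar>"], intro conjI allI impI)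
    show "0 < C * 2 powr \<bar>e\<bar>" by fact
    fix n :: nat and \<alpha> assume "1 \<le> n"
    from main[OF this, of \<alpha>]
    show "(1 / 2 ^ n) * (\<Sum>R | R \<in> dyadic_rectangles d \<and> rect_volume d R = 1 / 2 ^ n. \<bar>\<alpha> R\<bar>)
      \<le> C * 2 powr \<bar>e\<bar> * real n powr ((real d - 1) / 2 - \<eta>) *
        Linf_norm (unit_cube d) (\<lambda>x. \<Sum>R | R \<in> dyadic_rectangles d \<and> rect_volume d R \<ge> 1 / 2 ^ n. \<alpha> R * haar_rect d R x)"
      unfolding big_rects_def e_def .
  qed
qed

end
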